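(* Let $n\ge1$, $x,y>0$, and let $\alpha$, $\hat v$, $\sigma$, the constrained set $\mathcal C$, its residual gauge action, the two-form $[Symp]$ and the functions $\Phi_\nu$ be as in the context. Then: (1) Modulo the gauge action, an element of $\mathcal C$ may be brought to the form $$g=\begin{pmatrix}\rho\Gamma&\rho\Sigma\\ \Sigma&\Gamma\end{pmatrix}\begin{pmatrix}x\mathbf I_n&\omega\\0&x^{-1}\mathbf I_n\end{pmatrix},\qquad \omega=\Sigma^{-1}(\Omega-x^{-1}\Gamma),\qquad \Omega=\Lambda T,$$ where $\Gamma=\cosh\Delta$, $\Sigma=\sinh\Delta=\mathrm{diag}(\Sigma_1,\dots,\Sigma_n)$, $\Lambda=\mathrm{diag}\bigl((y^2+x^2\Sigma_i^2)^{1/2}\bigr)$, $\rho$ is unitary, and $T\in U(n)$ satisfies $$T^\dagger\Sigma^2T=\Sigma\rho^\dagger\sigma\sigma^\dagger\rho\Sigma=\alpha^2\Sigma^2+vv^\dagger,\qquad v:=\Sigma\rho^\dagger\hat v .$$ Using the freedom to multiply $\rho$ on the right by diagonal unitary matrices, one may take every component $v_i$ real and non-negative, and then $$v_k^2=\Bigl(\prod_{j\ne k}(\alpha^2\Sigma_j^2-\alpha^2\Sigma_k^2)\Bigr)^{-1}\prod_{i=1}^n(\Sigma_i^2-\alpha^2\Sigma_k^2),$$ and $T=P\tilde T$ with $P=\exp(ip)$, $p=\mathrm{diag}(p_1,\dots,p_n)$ real, and $\tilde T\in O(n)$ the real matrix with $\tilde T^{T}=(\tilde{\mathbf t}_1,\dots,\tilde{\mathbf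 t}_n)$, $$\tilde{\mathbf t}_i=\bigl[v^T(\Sigma_i^2\mathbf I_n-\alpha^2\Sigma^2)^{-2}v\bigr]^{-1/2}(\Sigma_i^2\mathbf I_n-\alpha^2\Sigma^2)^{-1}v .$$ (2) In the local coordinates $(\Sigma_i,p_i)$, or $(q_i,p_i)$ with $\Sigma_i=e^{q_i}$, the symplectic structure on the reduced space is $$[Symp]=2\sum_{i=1}^n dp_i\wedge\Sigma_i^{-1}d\Sigma_i=2\sum_{i=1}^n dp_i\wedge dq_i ,$$ so that $(q,p)$ are canonical coordinates (up to the constant factor $2$). (3) The functions $\Phi_\nu$, $\nu=1,2,\dots$, descend to the reduced space, where they are in involution with one another, and the simplest of them is $$\Phi_1=\tfrac12(x^{-2}+y^2)\sum_{i=1}^ne^{-2q_i}-\sum_{i=1}^n(\cos p_i)\Bigl[1+\Bigl(1+\frac{y^2}{x^2}\Bigr)e^{-2q_i}+\frac{y^2}{x^2}e^{-4q_i}\Bigr]^{1/2}\prod_{k\ne i}\Bigl[1-\frac{(\alpha-\alpha^{-1})^2}{4\sinh^2(q_i-q_k)}\Bigr]^{1/2}.$$ Here the $q_k$ are restricted by a condition of the form $q_1>q_2+s,\ q_2>q_3+s,\dots$ with a suitable $s>0$, so that the arguments of all the square roots in the product are positive.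
   Context: $G=SL(2n,\mathbb C)$; $I_{n,n}=\mathrm{diag}(\mathbf I_n,-\mathbf I_n)$; $K=SU(n,n)=\{g\in G:g^\dagger I_{n,n}g=I_{n,n}\}$; $K_+=K\cap SU(2n)$, the block-diagonal subgroup. $B$ is the group of upper triangular matrices in $G$ with real positive diagonal entries, and $B_n$ the corresponding group in $GL(n,\mathbb C)$. $\langle X,Y\rangle=\mathrm{Im}\,\mathrm{tr}(XY)$. $G$ carries the Heisenberg double Poisson structure of $SU(n,n)$. One restricts to the symplectic leaf of elements which can be written $g=k_Lb_R=b_Lk_R$ with $k_L,k_R\in K$, $b_L,b_R\in B$, with symplectic form $$[Symp]=\langle db_Lb_L^{-1}\overset{\wedge}{,}dk_Lk_L^{-1}\rangle+\langle b_R^{-1}db_R\overset{\wedge}{,}k_R^{-1}dk_R\rangle ;$$ the same symbol denotes the form induced on the reduced space. It is also required that $k_L$ be regular, i.e. $$k_L=\begin{pmatrix}\rho&0\\0&\tau\end{pmatrix}\begin{pmatrix}\cosh\Delta&\sinh\Delta\\ \sinh\Delta&\cosh\Delta\end{pmatrix}\begin{pmatrix}k&0\\0&l\end{pmatrix},\quad \rho,\tau,k,l\in U(n),\quad \Delta=\mathrm{diag}(\Delta_1,\dots,\Delta_n),\ \Delta_1>\dots>\Delta_n,$$ with $\Delta$ in the interior of a fixed Weyl chamber. Constraints: fix $\alpha\in\mathbb R\setminus\{0,\pm1\}$, $\hat v\in\mathbb C^n$ and $\sigma\in B_n$ with $\det\sigma=1$ and $\sigma\sigma^\dagger=\alpha^2\mathbf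 I_n+\epsilon\hat v\hat v^\dagger$, where $\epsilon=+1$ if $\alpha^2<1$ and $\epsilon=-1$ if $\alpha^2>1$. As the resulting reduced symplectic form and Hamiltonian are invariant under $\alpha\mapsto\alpha^{-1}$, it is assumed that $\alpha^2<1$ and $\epsilon=1$. $\mathcal C$ is the set of such $g$ for which $$b_R=\begin{pmatrix}x\mathbf I_n&\omega\\0&x^{-1}\mathbf I_n\end{pmatrix},\qquad b_L=\begin{pmatrix}y^{-1}\sigma&y^{-1}\nu\\0&y\mathbf I_n\end{pmatrix}$$ with $\omega,\nu\in gl(n,\mathbb C)$ undetermined. The gauge action is right multiplication by $K_+$ and left multiplication by the block-diagonal elements $\mathrm{diag}(R,r)\in K_+$ with $R^\dagger\sigma\sigma^\dagger R=\sigma\sigma^\dagger$; the reduced space is the quotient of $\mathcal C$ by this action. $\Phi_\nu(g)=-\frac1{2\nu}\mathrm{tr}\bigl(gI_{n,n}g^\dagger I_{n,n}\bigr)^\nu$ for $\nu=1,2,\dots$.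
   Formalization: For n=1, where det g=1 forces ρ=1, v̂ may be replaced by a phase multiple; for n≥2 the diagonal phases of ρ are combined with a left gauge factor; T=PT̃, the coordinates and the involution are stated for q_i>q_{i+1}+s, since T̃ is undefined on the boundary. *)

theory Defs
  imports "HOL-Analysis.Analysis"
begin

section \<open>Matrices in block form\<close>

text \<open>
  The index type \<open>'n :: {finite, linorder}\<close> plays the role of \<open>{1 < \<dots> < n}\<close>, and \<open>'n + 'n\<close> that of
  \<open>{1 < \<dots> < 2n}\<close>, where \<open>Inl\<close> indexes the first half and \<open>Inr\<close> the second half.
\<close>

type_synonym 'n rvec = "real ^ 'n"
type_synonym 'n cvec = "complex ^ 'n"
type_synonym 'n cmat = "complex ^ 'n ^ 'n"
type_synonym 'n bmat = "complex ^ ('n + 'n) ^ ('n + 'n)"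

definition ctrans :: "complex ^ 'n ^ 'm \<Rightarrow> complex ^ 'm ^ 'n" ("(_\<^sup>\<dagger>)" [1000] 999)
  where "A\<^sup>\<dagger> = (\<chi> i j. cnj (A $ j $ i))"

definition dmat :: "'a::zero ^ 'n \<Rightarrow> 'a ^ 'n ^ 'n"
  where "dmat d = (\<chi> i j. if i = j then d $ i else 0)"

definition cvec :: "real ^ 'n \<Rightarrow> complex ^ 'n"
  where "cvec v = (\<chi> i. complex_of_real (v $ i))"

definition outer :: "complex ^ 'n \<Rightarrow> 'n cmat"
  where "outer v = (\<chi> i j. v $ i * cnj (v $ j))"

definition smat :: "real \<Rightarrow> ('n::finite) cmat"
  where "smat c = mat (complex_of_real c)"

definition blk :: "('n::finite) cmat \<Rightarrow> 'n cmat \<Rightarrow> 'n cmat \<Rightarrow> 'n cmat \<Rightarrow> 'n bmat"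
  where "blk A B C D = (\<chi> i j. case i of
      Inl a \<Rightarrow> (case j of Inl b \<Rightarrow> A $ a $ b | Inr b \<Rightarrow> B $ a $ b)
    | Inr a \<Rightarrow> (case j of Inl b \<Rightarrow> C $ a $ b | Inr b \<Rightarrow> D $ a $ b))"

definition matpow :: "'n cmat \<Rightarrow> nat \<Rightarrow> ('n::finite) cmat"
  where "matpow A m = (((**) A) ^^ m) (mat 1)"

definition unitary :: "('n::finite) cmat \<Rightarrow> bool"
  where "unitary U \<longleftrightarrow> U\<^sup>\<dagger> ** U = mat 1"

section \<open>The groups\<close>

definition Inn :: "('n::finite) bmat"
  where "Inn = blk (mat 1) 0 0 (- mat 1)"

definition SUnn :: "('n::finite) bmat set"
  where "SUnn = {g. det g = 1 \<and> g\<^sup>\<dagger> ** Inn ** g = Inn}"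

definition K_plus :: "('n::finite) bmat set"
  where "K_plus = SUnn \<inter> {g. det g = 1 \<and> unitary g}"

fun block_less :: "'n::linorder + 'n \<Rightarrow> 'n + 'n \<Rightarrow> bool" where
  "block_less (Inl a) (Inl b) = (a < b)"
| "block_less (Inl a) (Inr b) = True"
| "block_less (Inr a) (Inl b) = False"
| "block_less (Inr a) (Inr b) = (a < b)"

definition upper_pos :: "('n::finite \<Rightarrow> 'n \<Rightarrow> bool) \<Rightarrow> 'n cmat \<Rightarrow> bool"
  where "upper_pos lt A \<longleftrightarrow>
    (\<forall>i. A $ i $ i \<in> \<real> \<and> 0 < Re (A $ i $ i)) \<and> (\<forall>i j. lt j i \<longrightarrow> A $ i $ j = 0)"

definition Bgrp :: "('n::{finite,linorder}) bmat set"
  where "Bgrp = {b. det b = 1 \<and> upper_pos block_less b}"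

definition B_n :: "('n::{finite,linorder}) cmat set"
  where "B_n = {b. upper_pos (<) b}"

section \<open>The symplectic leaf and its two-form\<close>

definition leaf :: "('n::{finite,linorder}) bmat set"
  where "leaf = {g. det g = 1 \<and> (\<exists>k\<in>SUnn. \<exists>b\<in>Bgrp. g = k ** b) \<and> (\<exists>b\<in>Bgrp. \<exists>k\<in>SUnn. g = b ** k)}"

text \<open>
  The four factors are unique on the leaf because \<open>SUnn \<inter> Bgrp\<close> is trivial.
\<close>

definition k_L :: "('n::{finite,linorder}) bmat \<Rightarrow> 'n bmat"
  where "k_L g = (THE k. k \<in> SUnn \<and> (\<exists>b\<in>Bgrp. g = k ** b))"
definition b_R :: "('n::{finite,linorder}) bmat \<Rightarrow> 'n bmat"
  where "b_R g = (THE b. b \<in> Bgrp \<and> (\<exists>k\<in>SUnn. g = k ** b))"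
definition b_L :: "('n::{finite,linorder}) bmat \<Rightarrow> 'n bmat"
  where "b_L g = (THE b. b \<in> Bgrp \<and> (\<exists>k\<in>SUnn. g = b ** k))"
definition k_R :: "('n::{finite,linorder}) bmat \<Rightarrow> 'n bmat"
  where "k_R g = (THE k. k \<in> SUnn \<and> (\<exists>b\<in>Bgrp. g = b ** k))"

definition pairing :: "'n cmat \<Rightarrow> ('n::finite) cmat \<Rightarrow> real"
  where "pairing X Y = Im (trace (X ** Y))"

definition wedge :: "('a \<Rightarrow> real) \<Rightarrow> ('a \<Rightarrow> real) \<Rightarrow> 'a \<Rightarrow> 'a \<Rightarrow> real"
  where "wedge \<alpha> \<beta> X Y = \<alpha> X * \<beta> Y - \<alpha> Y * \<beta> X"

definition pairing_wedge ::
    "('a \<Rightarrow> ('n::finite) cmat) \<Rightarrow> ('a \<Rightarrow> 'n cmat) \<Rightarrow> 'a \<Rightarrow> 'a \<Rightarrow> real"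
  where "pairing_wedge \<alpha> \<beta> X Y = pairing (\<alpha> X) (\<beta> Y) - pairing (\<alpha> Y) (\<beta> X)"

text \<open>
  \<open>pull_symp F a X Y\<close> is the value at \<open>a\<close>, on the tangent vectors \<open>X\<close> and \<open>Y\<close>, of the pull-back of
  \<open>[Symp]\<close> along a map \<open>F\<close> into the leaf.  A two-form is determined by its pull-backs, so the form
  itself is handled through them and no tangent spaces of the leaf are needed.
\<close>

definition pull_symp ::
    "('a::real_normed_vector \<Rightarrow> ('n::{finite,linorder}) bmat) \<Rightarrow> 'a \<Rightarrow> 'a \<Rightarrow> 'a \<Rightarrow> real"
  where "pull_symp F a X Y =
    (let d = (\<lambda>f. frechet_derivative (\<lambda>u. f (F u)) (at a)) in
      pairing_wedge (\<lambda>Z. d b_L Z ** matrix_inv (b_L (F a))) (\<lambda>Z. d k_L Z ** matrix_inv (k_L (F a))) X Y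
    + pairing_wedge (\<lambda>Z. matrix_inv (b_R (F a)) ** d b_R Z) (\<lambda>Z. matrix_inv (k_R (F a)) ** d k_R Z) X Y)"

text \<open>
  Poisson bracket of a non-degenerate two-form \<open>w\<close>, with Hamiltonian vector fields given by
  \<open>w X\<^sub>f = df\<close>.
\<close>

definition hamiltonian_vector :: "('a \<Rightarrow> 'a \<Rightarrow> real) \<Rightarrow> ('a \<Rightarrow> real) \<Rightarrow> 'a"
  where "hamiltonian_vector w \<theta> = (THE X. \<forall>Y. w X Y = \<theta> Y)"

definition poisson_bracket ::
    "('a::real_normed_vector \<Rightarrow> 'a \<Rightarrow> 'a \<Rightarrow> real) \<Rightarrow> ('a \<Rightarrow> real) \<Rightarrow> ('a \<Rightarrow> real) \<Rightarrow> 'a \<Rightarrow> real"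
  where "poisson_bracket w f h a =
    w a (hamiltonian_vector (w a) (frechet_derivative f (at a)))
        (hamiltonian_vector (w a) (frechet_derivative h (at a)))"

section \<open>Constraints, gauge action, normal form\<close>

text \<open>
  The restricted root system of \<open>SU(n,n)\<close> is of type \<open>C\<close>, so the interior of the Weyl chamber with
  decreasing entries is \<open>\<Delta>\<^sub>1 > \<dots> > \<Delta>\<^sub>n > 0\<close>.
\<close>

definition chamber :: "('n::{finite,linorder}) rvec set"
  where "chamber = {\<Delta>. (\<forall>i j. i < j \<longrightarrow> \<Delta> $ j < \<Delta> $ i) \<and> (\<forall>i. 0 < \<Delta> $ i)}"

definition Cosh :: "('n::finite) rvec \<Rightarrow> 'n cmat"
  where "Cosh \<Delta> = dmat (cvec (\<chi> i. cosh (\<Delta> $ i)))"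

definition Sinh :: "('n::finite) rvec \<Rightarrow> 'n cmat"
  where "Sinh \<Delta> = dmat (cvec (\<chi> i. sinh (\<Delta> $ i)))"

definition regular :: "('n::{finite,linorder}) bmat \<Rightarrow> bool"
  where "regular g \<longleftrightarrow> (\<exists>\<rho> \<tau> k l \<Delta>. unitary \<rho> \<and> unitary \<tau> \<and> unitary k \<and> unitary l \<and> \<Delta> \<in> chamber \<and>
    g = blk \<rho> 0 0 \<tau> ** blk (Cosh \<Delta>) (Sinh \<Delta>) (Sinh \<Delta>) (Cosh \<Delta>) ** blk k 0 0 l)"

definition constrained :: "'n cmat \<Rightarrow> real \<Rightarrow> real \<Rightarrow> ('n::{finite,linorder}) bmat set"
  where "constrained \<sigma> x y = {g \<in> leaf. regular (k_L g) \<and>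
    (\<exists>\<omega>. b_R g = blk (smat x) \<omega> 0 (smat (1 / x))) \<and>
    (\<exists>\<nu>. b_L g = blk ((1 / y) *\<^sub>R \<sigma>) ((1 / y) *\<^sub>R \<nu>) 0 (smat y))}"

definition gauge_rel :: "'n cmat \<Rightarrow> real \<Rightarrow> real \<Rightarrow> (('n::{finite,linorder}) bmat \<times> 'n bmat) set"
  where "gauge_rel \<sigma> x y = {(g, h). g \<in> constrained \<sigma> x y \<and>
    (\<exists>R r. blk R 0 0 r \<in> K_plus \<and> R\<^sup>\<dagger> ** \<sigma> ** \<sigma>\<^sup>\<dagger> ** R = \<sigma> ** \<sigma>\<^sup>\<dagger> \<and>
      (\<exists>k\<in>K_plus. h = blk R 0 0 r ** g ** k))}"

definition reduced_space :: "'n cmat \<Rightarrow> real \<Rightarrow> real \<Rightarrow> ('n::{finite,linorder}) bmat set set"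
  where "reduced_space \<sigma> x y = constrained \<sigma> x y // gauge_rel \<sigma> x y"

definition Lam :: "real \<Rightarrow> real \<Rightarrow> ('n::finite) rvec \<Rightarrow> 'n cmat"
  where "Lam x y \<Delta> = dmat (cvec (\<chi> i. sqrt (y\<^sup>2 + x\<^sup>2 * (sinh (\<Delta> $ i))\<^sup>2)))"

definition normal_form :: "real \<Rightarrow> real \<Rightarrow> 'n cmat \<Rightarrow> 'n rvec \<Rightarrow> 'n cmat \<Rightarrow> ('n::finite) bmat"
  where "normal_form x y \<rho> \<Delta> T =
    (let \<Gamma> = Cosh \<Delta>; S = Sinh \<Delta>; \<Omega> = Lam x y \<Delta> ** T;
         \<omega> = matrix_inv S ** (\<Omega> - (1 / x) *\<^sub>R \<Gamma>)
     in blk (\<rho> ** \<Gamma>) (\<rho> ** S) S \<Gamma> ** blk (smat x) \<omega> 0 (smat (1 / x)))"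

definition normal_data :: "('n::{finite,linorder}) cmat \<Rightarrow> 'n cmat \<Rightarrow> 'n rvec \<Rightarrow> 'n cmat \<Rightarrow> bool"
  where "normal_data \<sigma> \<rho> \<Delta> T \<longleftrightarrow> unitary \<rho> \<and> \<Delta> \<in> chamber \<and>
    unitary T \<and>
    T\<^sup>\<dagger> ** (Sinh \<Delta> ** Sinh \<Delta>) ** T = Sinh \<Delta> ** \<rho>\<^sup>\<dagger> ** \<sigma> ** \<sigma>\<^sup>\<dagger> ** \<rho> ** Sinh \<Delta>"

text \<open>
  The matrix \<open>\<sigma>\<close> determines \<open>v\<close> below only up to a phase.  For \<open>n \<ge> 2\<close> that phase is absorbed by the
  residual gauge action.  For \<open>n = 1\<close> the condition \<open>det g = 1\<close> forces \<open>\<rho> = 1\<close> in the normal form, so the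
  phase has to be adjusted by hand.
\<close>

definition rephased :: "('n::finite) cvec \<Rightarrow> 'n cvec \<Rightarrow> bool"
  where "rephased v w \<longleftrightarrow> (\<exists>c. cmod c = 1 \<and> (CARD('n) \<noteq> 1 \<longrightarrow> c = 1) \<and> w = c *s v)"

text \<open>
  Row \<open>i\<close> of \<open>T_tilde \<alpha> S v\<close> is the normalised vector \<open>(S\<^sub>i\<^sup>2 I - \<alpha>\<^sup>2 S\<^sup>2)\<^sup>-\<^sup>1 v\<close>.
\<close>

definition T_tilde :: "real \<Rightarrow> ('n::finite) rvec \<Rightarrow> 'n rvec \<Rightarrow> 'n rvec ^ 'n"
  where "T_tilde \<alpha> S v = (\<chi> i.
    let N = matrix_inv (mat ((S $ i)\<^sup>2) - \<alpha>\<^sup>2 *\<^sub>R (dmat S ** dmat S))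
    in (1 / sqrt (v \<bullet> ((N ** N) *v v))) *\<^sub>R (N *v v))"

definition exp_i :: "('n::finite) rvec \<Rightarrow> 'n cmat"
  where "exp_i p = dmat (\<chi> i. exp (\<i> * complex_of_real (p $ i)))"

section \<open>Coordinates on the reduced space\<close>

text \<open>
  Since \<open>(\<alpha> - \<alpha>\<^sup>-\<^sup>1)\<^sup>2 / 4 = sinh\<^sup>2 (ln \<bar>\<alpha>\<bar>)\<close>, the square roots in the Hamiltonian have, for
  decreasing \<open>q\<close>, positive arguments exactly when the \<open>q\<^sub>i\<close> are more than \<open>- ln \<bar>\<alpha>\<bar>\<close> apart.
\<close>

definition gap :: "real \<Rightarrow> real"
  where "gap \<alpha> = - ln \<bar>\<alpha>\<bar>"

definition region :: "real \<Rightarrow> ('n::{finite,linorder}) rvec set"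
  where "region \<alpha> = {q. \<forall>i j. i < j \<longrightarrow> q $ i > q $ j + gap \<alpha>}"

definition coords ::
    "real \<Rightarrow> 'n cvec \<Rightarrow> 'n cmat \<Rightarrow> real \<Rightarrow> real \<Rightarrow> ('n::{finite,linorder}) bmat \<Rightarrow>
     'n rvec \<Rightarrow> 'n rvec \<Rightarrow> bool"
  where "coords \<alpha> vh \<sigma> x y g q p \<longleftrightarrow> q \<in> region \<alpha> \<and>
    (let \<Delta> = (\<chi> i. arsinh (exp (q $ i))) in
     \<exists>\<rho> w v. unitary \<rho> \<and> rephased vh w \<and> (\<forall>i. 0 \<le> v $ i) \<and> cvec v = Sinh \<Delta> *v (\<rho>\<^sup>\<dagger> *v w) \<and>
       (g, normal_form x y \<rho> \<Delta> (exp_i p ** map_matrix complex_of_real (T_tilde \<alpha> (\<chi> i. exp (q $ i)) v)))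
         \<in> gauge_rel \<sigma> x y)"

definition local_section ::
    "real \<Rightarrow> 'n cvec \<Rightarrow> 'n cmat \<Rightarrow> real \<Rightarrow> real \<Rightarrow> ('n rvec \<times> 'n rvec) set \<Rightarrow>
     ('n rvec \<times> 'n rvec \<Rightarrow> ('n::{finite,linorder}) bmat) \<Rightarrow> bool"
  where "local_section \<alpha> vh \<sigma> x y U S \<longleftrightarrow> open U \<and> S differentiable_on U \<and>
    (\<forall>(q, p)\<in>U. coords \<alpha> vh \<sigma> x y (S (q, p)) q p)"

section \<open>The Hamiltonians\<close>

definition Phi :: "nat \<Rightarrow> ('n::finite) bmat \<Rightarrow> real"
  where "Phi m g = - (1 / (2 * real m)) * Re (trace (matpow (g ** Inn ** g\<^sup>\<dagger> ** Inn) m))"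

text \<open>The trace in the definition of \<open>Phi\<close> is real, so that taking the real part loses nothing.\<close>

lemma ctrans_mult: "(A ** B)\<^sup>\<dagger> = B\<^sup>\<dagger> ** A\<^sup>\<dagger>"
  by (simp add: ctrans_def matrix_matrix_mult_def vec_eq_iff mult.commute)

lemma ctrans_ctrans [simp]: "(A\<^sup>\<dagger>)\<^sup>\<dagger> = A"
  by (simp add: ctrans_def vec_eq_iff)

lemma ctrans_Inn [simp]: "Inn\<^sup>\<dagger> = (Inn :: ('n::finite) bmat)"
  by (auto simp: ctrans_def Inn_def blk_def vec_eq_iff mat_def split: sum.splits)

lemma matpow_Suc_right: "matpow A (Suc m) = matpow A m ** A"
  by (induction m) (simp_all add: matpow_def matrix_mul_assoc)

lemma ctrans_matpow: "(matpow A m)\<^sup>\<dagger> = matpow (A\<^sup>\<dagger>) m"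
proof (induction m)
  case 0
  show ?case by (simp add: matpow_def ctrans_def mat_def vec_eq_iff)
next
  case (Suc m)
  have "(matpow A (Suc m))\<^sup>\<dagger> = (A ** matpow A m)\<^sup>\<dagger>" by (simp add: matpow_def)
  then show ?case by (simp add: ctrans_mult Suc matpow_Suc_right)
qed

lemma trace_matpow_comm:
  fixes A B :: "('n::finite) cmat"
  shows "trace (matpow (A ** B) m) = trace (matpow (B ** A) m)"
proof (cases m)
  case (Suc k)
  have "A ** matpow (B ** A) k = matpow (A ** B) k ** A" for k
    by (induction k) (simp_all add: matpow_def flip: matrix_mul_assoc)
  then have "trace (matpow (A ** B) m) = trace (A ** (matpow (B ** A) k ** B))"
    by (simp add: Suc matpow_Suc_right matrix_mul_assoc)
  also have "\<dots> = trace (matpow (B ** A) m)"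
    by (subst trace_mul_sym) (simp add: Suc matpow_Suc_right flip: matrix_mul_assoc)
  finally show ?thesis .
qed (simp add: matpow_def)

lemma of_real_Phi:
  "complex_of_real (Phi m g) = - (1 / (2 * of_nat m)) * trace (matpow (g ** Inn ** g\<^sup>\<dagger> ** Inn) m)"
proof -
  let ?H = "g ** Inn ** g\<^sup>\<dagger>"
  have "cnj (trace (matpow (?H ** Inn) m)) = trace ((matpow (?H ** Inn) m)\<^sup>\<dagger>)"
    by (simp add: trace_def ctrans_def)
  also have "\<dots> = trace (matpow (Inn ** ?H) m)"
    by (simp add: ctrans_matpow ctrans_mult matrix_mul_assoc)
  also have "\<dots> = trace (matpow (?H ** Inn) m)" by (rule trace_matpow_comm)
  finally have "trace (matpow (?H ** Inn) m) \<in> \<real>"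
    by (simp add: Reals_cnj_iff)
  then show ?thesis by (auto simp: Phi_def elim!: Reals_cases)
qed

end

(*
The Cartan decomposition of k_L together with the constraints leaves (rho, Delta, T).  Both T^H S^2 T and
S rho^H sigma sigma^H rho S are alpha^2 S^2 plus the rank-one matrix v v^H, so equality of characteristic
polynomials is a secular equation.  It gives v_k^2, the interlacing condition on S, and T up to the phases p.

Two-form: with gamma = dg g^-1 it equals <lambda ^ gamma> + <beta ^ g^-1 gamma g>, where lambda and beta are the
nilpotent parts of the Maurer-Cartan forms of b_L and b_R.  In this shape it is invariant under point dependent
gauge transformations, so it may be evaluated on a section whose frame rho is a constant times a real reflection;
there all terms but dp ^ dq are imaginary parts of traces of real matrices.  Along an arbitrary map the gauge
transformation to the section is differentiable, because it is read off from spectral projections of a Hermitian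
matrix with simple spectrum.

Involution: the flow of Phi_m multiplies g from the left by a curve in SU(n,n) commuting with J = g I g^H I.
It preserves b_L, b_R and J, hence all Phi_k, and its velocity (i/2) J^m, up to a scalar, is the Hamiltonian
vector field of Phi_m.
*)
theory Submission
  imports Defs
begin

text \<open>Three obstacles shape the proof. The form is known only through pull-backs along maps
  that are differentiable but not C^1, so eigenvalues must be differentiated without the implicit
  function theorem, and pointwise gauge choices enter only through products that do not depend on
  their phases. Interlacing holds only weakly: where q_i exceeds the next q by exactly the gap, v_i
  vanishes and the formula for T degenerates, so (q, p) are coordinates on the open region only.
  Finally, det g = 1 imposes one determinant condition on each side of the gauge action: every
  normalisation by phases must be balanced, by a scalar phase or by a unitary fixing the given
  vector. For n = 1 no such unitary is available, hence the phase in \<open>rephased\<close>. The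
  reflection in the frame costs a factor -1 in det \<rho>, which its constant part repays. In the
  involution argument the flow has to stay in the constrained set; regularity of k_L is a spectral
  condition on its lower left block and persists for small times.\<close>

notation ctrans ("(_\<^sup>H)" [1000] 999)
lemmas mm_assoc = matrix_mul_assoc

subsection \<open>Matrix algebra\<close>

lemma matrix_mult_nth: "(A**B)$i$j = (\<Sum>k\<in>UNIV. A$i$k * B$k$j)"
 by (simp add: matrix_matrix_mult_def)

lemma matrix_add_rdistrib: "(A + B)**C = A**C + B**(C :: 'a::semiring_1 ^ 'n ^ 'm)"
 by (simp add: matrix_matrix_mult_def vec_eq_iff sum.distrib distrib_right)

lemma matrix_uminus_left: "(- A)**B = - (A**(B :: 'a::ring_1 ^ 'n ^ 'm))"
 by (simp add: matrix_matrix_mult_def vec_eq_iff sum_negf)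

lemma matrix_uminus_right: "A**(- B) = - (A**(B :: 'a::ring_1 ^ 'n ^ 'm))"
 by (simp add: matrix_matrix_mult_def vec_eq_iff sum_negf)

lemma matrix_diff_ldistrib: "A**(B - C) = A**B - A**(C :: 'a::ring_1 ^ 'n ^ 'm)"
 by (simp add: matrix_matrix_mult_def vec_eq_iff sum_subtractf right_diff_distrib)

lemma matrix_diff_rdistrib: "(A - B)**C = A**C - B**(C :: 'a::ring_1 ^ 'n ^ 'm)"
 by (simp add: matrix_matrix_mult_def vec_eq_iff sum_subtractf left_diff_distrib)

lemma matrix_scaleR_left: "(c *\<^sub>R A)**B = c *\<^sub>R (A**(B :: 'a::real_algebra_1 ^ 'n ^ 'm))"
 by (simp add: matrix_matrix_mult_def vec_eq_iff scaleR_sum_right)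

lemma matrix_scaleR_right: "A**(c *\<^sub>R B) = c *\<^sub>R (A**(B :: 'a::real_algebra_1 ^ 'n ^ 'm))"
 by (simp add: matrix_matrix_mult_def vec_eq_iff scaleR_sum_right)

lemmas mm_ring = matrix_add_ldistrib matrix_add_rdistrib matrix_uminus_left
 matrix_uminus_right matrix_diff_ldistrib matrix_diff_rdistrib matrix_scaleR_left
 matrix_scaleR_right mm_assoc

lemma smat_eq: "smat c = c *\<^sub>R (mat 1 :: 'n::finite cmat)"
 by (simp add: smat_def mat_def vec_eq_iff complex_eq_iff)

lemma ctrans_nth [simp]: "A\<^sup>H$i$j = cnj (A$j$i)"
 by (simp add: ctrans_def)

lemma ctrans_add: "(A + B)\<^sup>H = A\<^sup>H + B\<^sup>H"
 by (simp add: vec_eq_iff)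
lemma ctrans_diff: "(A - B)\<^sup>H = A\<^sup>H - B\<^sup>H"
 by (simp add: vec_eq_iff)
lemma ctrans_uminus: "(- A)\<^sup>H = - (A\<^sup>H)"
 by (simp add: vec_eq_iff)
lemma ctrans_scaleR: "(c *\<^sub>R A)\<^sup>H = c *\<^sub>R (A\<^sup>H)"
 by (simp add: vec_eq_iff)
lemma ctrans_zero [simp]: "(0 :: complex ^ 'n ^ 'm)\<^sup>H = 0"
 by (simp add: vec_eq_iff)
lemma ctrans_mat [simp]: "(mat c :: 'n::finite cmat)\<^sup>H = mat (cnj c)"
 by (simp add: vec_eq_iff mat_def)
lemma ctrans_eq_iff [simp]: "A\<^sup>H = B\<^sup>H \<longleftrightarrow> A = B"
 by (metis ctrans_ctrans)

lemmas ctrans_simps = ctrans_add ctrans_diff ctrans_uminus ctrans_scaleR ctrans_mult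

lemma det_ctrans: "det (A\<^sup>H) = cnj (det (A :: 'n::finite cmat))"
proof -
 have "det (A\<^sup>H) = det (\<chi> i j. cnj (A$i$j))"
  using det_transpose[of "\<chi> i j. cnj (A$i$j)"]
  by (simp add: Finite_Cartesian_Product.transpose_def ctrans_def)
 also have "... = cnj (det A)"
  by (simp add: det_def of_int_def)
 finally show ?thesis .
qed

lemma trace_scaleR: "trace (c *\<^sub>R (A :: 'n::finite cmat)) = c *\<^sub>R trace A"
 by (simp add: trace_def scaleR_sum_right)
lemma trace_uminus: "trace (- (A :: 'n::finite cmat)) = - trace A"
 by (simp add: trace_def sum_negf)
lemma trace_ctrans: "trace (A\<^sup>H) = cnj (trace A)"
 by (simp add: trace_def)

lemma matrix_inv_eqI:
 fixes A B :: "'a::field ^ 'n ^ 'n"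
 assumes "A**B = mat 1" shows "matrix_inv A = B"
proof -
 have BA: "B**A = mat 1" using assms matrix_left_right_inverse by blast
 have "A**matrix_inv A = mat 1 & matrix_inv A**A = mat 1"
  unfolding matrix_inv_def by (rule someI[of _ B]) (simp add: assms BA)
 then have "B**(A**matrix_inv A) = B" by simp
 then show ?thesis by (simp add: mm_assoc BA)
qed

lemma matrix_inv_works:
 fixes A :: "'a::field ^ 'n ^ 'n"
 assumes "det A ~= 0" shows "A**matrix_inv A = mat 1" "matrix_inv A**A = mat 1"
proof -
 obtain B where "A**B = mat 1" using assms by (meson invertible_def invertible_det_nz)
 then show "A**matrix_inv A = mat 1" "matrix_inv A**A = mat 1"
  using matrix_inv_eqI matrix_left_right_inverse by metis+
qed

lemma matrix_mult_cancel_left: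
 fixes A B C :: "'a::field ^ 'n ^ 'n"
 assumes "det A ~= 0" "A**B = A**C" shows "B = C"
 by (metis assms matrix_inv_works(2) mm_assoc matrix_mul_lid)

lemma matrix_mult_cancel_right:
 fixes A B C :: "'a::field ^ 'n ^ 'n"
 assumes "det A ~= 0" "B**A = C**A" shows "B = C"
 by (metis assms matrix_inv_works(1) mm_assoc matrix_mul_rid)

lemma unitaryD: "unitary U ==> U\<^sup>H**U = mat 1" "unitary U ==> U**U\<^sup>H = mat 1"
 unfolding unitary_def using matrix_left_right_inverse by blast+

lemma unitary_ctrans [simp]: "unitary (U\<^sup>H) \<longleftrightarrow> unitary U"
 unfolding unitary_def using matrix_left_right_inverse by force

lemma unitary_mult: "unitary U ==> unitary V ==> unitary (U**V)"
proof -
 assume "unitary U" "unitary V"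
 have "(U**V)\<^sup>H**(U**V) = V\<^sup>H**(U\<^sup>H**U)**V" by (simp add: ctrans_mult mm_assoc)
 then show ?thesis using \<open>unitary U\<close> \<open>unitary V\<close> by (simp add: unitary_def)
qed

lemma unitary_one [simp]: "unitary (mat 1)"
 by (simp add: unitary_def)

lemma mat_mult_left: "mat c**A = (\<chi> i j. c * A$i$j)"
 by (simp add: matrix_matrix_mult_def mat_def vec_eq_iff if_distrib [of "%x. x * _"] cong: if_cong)
lemma mat_mult_right: "A**mat c = (\<chi> i j. A$i$j * c)"
 by (simp add: matrix_matrix_mult_def mat_def vec_eq_iff if_distrib [of "%x. _ * x"] cong: if_cong)
lemma mat_mult_commute: "A**mat c = mat (c :: complex)**(A :: 'n::finite cmat)"
 by (simp add: mat_mult_left mat_mult_right mult.commute)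
lemma mat_mult_mat: "mat c**mat d = (mat (c * d) :: 'n::finite cmat)"
 by (simp add: mat_mult_left) (simp add: mat_def vec_eq_iff)
lemma det_mat: "det (mat c :: 'n::finite cmat) = c ^ CARD('n)"
 by (subst det_diagonal) (simp_all add: mat_def)

lemma unitary_mat: "cmod c = 1 ==> unitary (mat c)"
 unfolding unitary_def by (simp add: mat_mult_mat complex_norm_square[symmetric] mult.commute)

lemma unitary_det: "unitary U ==> cmod (det U) = 1"
proof -
 assume "unitary U"
 then have "cnj (det U) * det U = 1" by (metis det_I det_ctrans det_mul unitary_def)
 then have "cmod (det U) ^ 2 = 1"
  by (metis complex_mod_cnj norm_mult norm_one power2_eq_square)
 then show ?thesis by (simp add: power2_eq_1_iff) (metis norm_ge_zero neg_0_le_iff_le not_one_le_zero)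
qed

subsection \<open>Diagonal matrices\<close>

lemma dmat_nth [simp]: "dmat d$i$j = (if i = j then d$i else 0)"
 by (simp add: dmat_def)

lemma dmat_mult_left: "dmat d**A = (\<chi> i j. d$i * A$i$j)" for A :: "'a::semiring_1 ^ 'm ^ 'n"
 by (simp add: matrix_matrix_mult_def vec_eq_iff if_distrib [of "%x. x * _"] cong: if_cong)
lemma dmat_mult_right: "A**dmat d = (\<chi> i j. A$i$j * d$j)" for A :: "'a::semiring_1 ^ 'n ^ 'm"
 by (simp add: matrix_matrix_mult_def vec_eq_iff if_distrib [of "%x. _ * x"] cong: if_cong)
lemma dmat_mult_dmat: "dmat d**dmat e = dmat (d * e)" for d :: "'a::semiring_1 ^ 'n"
 by (simp add: dmat_mult_left vec_eq_iff)
lemma dmat_mult_commute: "dmat d**dmat e = dmat e**dmat d" for d :: "'a::comm_semiring_1 ^ 'n"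
 by (simp add: dmat_mult_dmat mult.commute)
lemma dmat_one: "dmat (\<chi> i. 1) = mat 1"
 by (simp add: vec_eq_iff mat_def)
lemma dmat_vector: "dmat d *v u = d * u" for d :: "'a::semiring_1 ^ 'n"
 by (simp add: matrix_vector_mult_def vec_eq_iff if_distrib [of "%x. x * _"] cong: if_cong)
lemma ctrans_dmat: "(dmat d)\<^sup>H = dmat (\<chi> i. cnj (d$i))"
 by (simp add: vec_eq_iff)
lemma ctrans_dmat_cvec [simp]: "(dmat (cvec d))\<^sup>H = dmat (cvec d)"
 by (simp add: vec_eq_iff cvec_def)
lemma det_dmat: "det (dmat d) = (\<Prod>i\<in>UNIV. d$i)" for d :: "'a::comm_ring_1 ^ 'n"
 by (subst det_diagonal) auto
lemma cvec_nth [simp]: "cvec v$i = complex_of_real (v$i)"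
 by (simp add: cvec_def)
lemma matrix_inv_dmat:
 fixes d :: "'a::field ^ 'n"
 assumes "!!i. d$i ~= 0" shows "matrix_inv (dmat d) = dmat (\<chi> i. inverse (d$i))"
 by (rule matrix_inv_eqI) (use assms in \<open>simp add: dmat_mult_dmat vec_eq_iff mat_def\<close>)
lemma unitary_dmat: "unitary (dmat m) \<longleftrightarrow> (\<forall>i. cmod (m$i) = 1)"
proof -
 have "cnj z * z = 1 \<longleftrightarrow> cmod z = 1" for z
  by (metis complex_norm_square mult.commute norm_ge_zero norm_one of_real_1 of_real_eq_iff one_power2 power2_eq_iff_nonneg zero_le_one)
 then show ?thesis
  unfolding unitary_def ctrans_dmat dmat_mult_dmat by (auto simp: vec_eq_iff mat_def)
qed

subsection \<open>Block matrices\<close>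

lemma blk_nth [simp]:
 "blk A B C D$Inl a$Inl b = A$a$b" "blk A B C D$Inl a$Inr b = B$a$b"
 "blk A B C D$Inr a$Inl b = C$a$b" "blk A B C D$Inr a$Inr b = D$a$b"
 by (simp_all add: blk_def)

lemma vec_eq_sum_iff: "(M :: 'a ^ ('m::finite + 'n::finite)) = N \<longleftrightarrow> (\<forall>i. M$Inl i = N$Inl i) & (\<forall>i. M$Inr i = N$Inr i)"
 by (metis (no_types) obj_sumE vec_eq_iff)

lemma blk_eq_iff: "blk A B C D = blk A' B' C' D' \<longleftrightarrow> A = A' & B = B' & C = C' & D = D'"
 by (auto simp: vec_eq_sum_iff vec_eq_iff)

definition blk11 :: "('n::finite) bmat => 'n cmat" where "blk11 M = (\<chi> i j. M$Inl i$Inl j)"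
definition blk12 :: "('n::finite) bmat => 'n cmat" where "blk12 M = (\<chi> i j. M$Inl i$Inr j)"
definition blk21 :: "('n::finite) bmat => 'n cmat" where "blk21 M = (\<chi> i j. M$Inr i$Inl j)"
definition blk22 :: "('n::finite) bmat => 'n cmat" where "blk22 M = (\<chi> i j. M$Inr i$Inr j)"

lemma blk_parts [simp]: "blk11 (blk A B C D) = A" "blk12 (blk A B C D) = B"
 "blk21 (blk A B C D) = C" "blk22 (blk A B C D) = D"
 by (simp_all add: blk11_def blk12_def blk21_def blk22_def vec_eq_iff)

lemma blk_collapse [simp]: "blk (blk11 M) (blk12 M) (blk21 M) (blk22 M) = M"
 by (simp add: vec_eq_sum_iff blk11_def blk12_def blk21_def blk22_def)

lemma blk_cases: obtains A B C D where "M = blk A B C D"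
 by (metis blk_collapse)

lemma sum_UNIV_Plus: "(\<Sum>k\<in>UNIV. f k) = (\<Sum>k\<in>UNIV. f (Inl k)) + (\<Sum>k\<in>UNIV. f (Inr k))"
 for f :: "'m::finite + 'n::finite => 'a::comm_monoid_add"
 unfolding UNIV_Plus_UNIV[symmetric] by (subst sum.Plus) auto

lemma blk_mult: "blk A B C D**blk A' B' C' D' =
  blk (A**A' + B**C') (A**B' + B**D') (C**A' + D**C') (C**B' + D**D')"
 by (simp add: vec_eq_sum_iff vec_eq_iff matrix_mult_nth sum_UNIV_Plus)
lemma blk_add: "blk A B C D + blk A' B' C' D' = blk (A + A') (B + B') (C + C') (D + D')"
 by (simp add: vec_eq_sum_iff vec_eq_iff)
lemma blk_diff: "blk A B C D - blk A' B' C' D' = blk (A - A') (B - B') (C - C') (D - D')"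
 by (simp add: vec_eq_sum_iff vec_eq_iff)
lemma blk_uminus: "- blk A B C D = blk (- A) (- B) (- C) (- D)"
 by (simp add: vec_eq_sum_iff vec_eq_iff)
lemma blk_scaleR: "c *\<^sub>R blk A B C D = blk (c *\<^sub>R A) (c *\<^sub>R B) (c *\<^sub>R C) (c *\<^sub>R D)"
 by (simp add: vec_eq_sum_iff vec_eq_iff)
lemma ctrans_blk: "(blk A B C D)\<^sup>H = blk (A\<^sup>H) (C\<^sup>H) (B\<^sup>H) (D\<^sup>H)"
 by (simp add: vec_eq_sum_iff vec_eq_iff)
lemma blk_mat: "blk (mat c) 0 0 (mat c) = mat c"
 by (simp add: vec_eq_sum_iff vec_eq_iff mat_def)
lemma blk_zero: "blk 0 0 0 0 = 0"
 by (simp add: vec_eq_sum_iff vec_eq_iff)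
lemma mat_eq_blk: "(mat c :: ('n::finite) bmat) = blk (mat c) 0 0 (mat c)"
 by (simp add: blk_mat)
lemma trace_blk: "trace (blk A B C D) = trace A + trace D"
 by (simp add: trace_def sum_UNIV_Plus)

lemmas blk_simps = blk_mult blk_add blk_diff blk_uminus blk_scaleR ctrans_blk

subsection \<open>Determinants\<close>

text \<open>A permutation that moves an index outside the range meets a zero entry there, so only
  permutations of the range survive in the Leibniz sum; they are transported along \<open>f\<close>
  with their signs. Applied to \<open>Inl\<close> and \<open>Inr\<close>, this gives block
  determinants over the sum index type.\<close>

lemma det_identity_outside_range:
 fixes M :: "'a::comm_ring_1 ^ 'm ^ 'm" and f :: "'n::finite => 'm"
 assumes f: "inj f"
  and M: "!!i j. i \<notin> range f ==> M$i$j = (if i = j then 1 else 0)"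
 shows "det M = det (\<chi> i j. M$f i$f j :: 'a ^ 'n ^ 'n)"
proof -
 let ?t = "%p. of_int (sign p) * (\<Prod>i\<in>UNIV. M$i$p i)"
 have zero: "?t p = 0" if p: "p permutes UNIV" "\<not> p permutes range f" for p
 proof -
  obtain i where "i \<notin> range f" "p i ~= i"
   using p permutes_superset[OF p(1), of "range f"] by blast
  then have "(\<Prod>i\<in>UNIV. M$i$p i) = 0"
   by (intro prod_zero bexI[of _ i]) (auto simp: M)
  then show ?thesis by simp
 qed
 have bij: "bij_betw f UNIV (range f)" using f by (simp add: bij_betw_def)
 have "det M = sum ?t {p. p permutes range f}"
  unfolding det_def
  by (rule sum.mono_neutral_right) (use zero in \<open>auto intro: permutes_subset\<close>)
 also have "... = (\<Sum>p | p permutes (UNIV :: 'n set). of_int (sign p) * (\<Prod>i\<in>UNIV. M$f i$f (p i)))"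
 proof (rule sum.reindex_bij_witness[where i = "map_permutation UNIV f" and j = "map_permutation (range f) (inv f)"])
  fix p assume "p \<in> {p. p permutes range f}"
  then have p: "p permutes range f" by simp
  have invb: "bij_betw (inv f) (range f) UNIV" using bij bij_betw_inv_into by blast
  have q: "map_permutation (range f) (inv f) p permutes UNIV"
   by (rule map_permutation_permutes[OF invb p])
  show "map_permutation UNIV f (map_permutation (range f) (inv f) p) = p"
   by (rule map_permutation_compose_inv[OF invb p]) (auto simp: f_inv_into_f)
  let ?q = "map_permutation (range f) (inv f) p"
  show "?q \<in> {p. p permutes UNIV}" using q by simp
  have s: "sign ?q = sign p"
   by (rule sign_map_permutation[OF _ p]) (use invb in \<open>auto simp: bij_betw_def\<close>)
  have app: "f (?q i) = p (f i)" for i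
  proof -
   have "?q (inv f (f i)) = inv f (p (f i))"
    by (rule map_permutation_apply) (use invb in \<open>auto simp: bij_betw_def\<close>)
   moreover have "p (f i) \<in> range f" using p by (simp add: permutes_in_image)
   ultimately show ?thesis using f by (simp add: f_inv_into_f)
  qed
  have "(\<Prod>i\<in>UNIV. M$i$p i) = (\<Prod>i\<in>range f. M$i$p i)"
   by (rule prod.mono_neutral_right) (use p in \<open>auto simp: M permutes_def\<close>)
  also have "... = (\<Prod>i\<in>UNIV. M$f i$p (f i))"
   by (simp add: prod.reindex f)
  finally show "of_int (sign ?q) * (\<Prod>i\<in>UNIV. M$f i$f (?q i)) = ?t p"
   by (simp add: s app)
 next
  fix q assume "q \<in> {p. p permutes (UNIV :: 'n set)}"
  then have q: "q permutes (UNIV :: 'n set)" by simp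
  show "map_permutation UNIV f q \<in> {p. p permutes range f}"
   using map_permutation_permutes[OF bij q] by simp
  show "map_permutation (range f) (inv f) (map_permutation UNIV f q) = q"
   by (rule map_permutation_compose_inv[OF bij q]) (simp add: f)
 qed
 also have "... = det (\<chi> i j. M$f i$f j :: 'a ^ 'n ^ 'n)"
  by (simp add: det_def)
 finally show ?thesis .
qed

lemma det_blk_one_right: "det (blk A B 0 (mat 1)) = det A"
proof -
 have "det (blk A B 0 (mat 1)) = det (\<chi> i j. blk A B 0 (mat 1)$Inl i$Inl j)"
 proof (rule det_identity_outside_range)
  fix i j :: "'a + 'a" assume "i \<notin> range Inl"
  then obtain a where "i = Inr a" by (cases i) auto
  then show "blk A B 0 (mat 1)$i$j = (if i = j then 1 else 0)"
   by (cases j) (auto simp: mat_def)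
 qed auto
 then show ?thesis by (simp cong: Cart_lambda_cong)
qed

lemma det_blk_one_left: "det (blk (mat 1) 0 C D) = det D"
proof -
 have "det (blk (mat 1) 0 C D) = det (\<chi> i j. blk (mat 1) 0 C D$Inr i$Inr j)"
 proof (rule det_identity_outside_range)
  fix i j :: "'a + 'a" assume "i \<notin> range Inr"
  then obtain a where "i = Inl a" by (cases i) auto
  then show "blk (mat 1) 0 C D$i$j = (if i = j then 1 else 0)"
   by (cases j) (auto simp: mat_def)
 qed auto
 then show ?thesis by (simp cong: Cart_lambda_cong)
qed

lemma det_blk_upper: "det (blk A B 0 D) = det A * det D"
proof -
 have "blk A B 0 D = blk (mat 1) 0 0 D**blk A B 0 (mat 1)"
  by (simp add: blk_mult)
 then show ?thesis by (simp add: det_mul det_blk_one_right det_blk_one_left)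
qed

lemma det_blk_lower: "det (blk A 0 C D) = det A * det D"
proof -
 have "det ((blk A 0 C D)\<^sup>H) = cnj (det A * det D)"
  by (simp add: ctrans_blk det_blk_upper det_ctrans)
 then show ?thesis by (simp add: det_ctrans del: complex_cnj_mult)
qed

text \<open>Two triangular factorisations of the block matrix with entries 1, -U, V, 1: clearing the
  lower left block leaves 1 + VU, clearing the upper right block leaves 1 + UV.\<close>

lemma sylvester_det: "det (mat 1 + U**V) = det (mat 1 + V**(U :: 'n::finite cmat))"
proof -
 have "blk (mat 1) 0 V (mat 1)**blk (mat 1) (- U) 0 (mat 1 + V**U) = blk (mat 1) (- U) V (mat 1)"
  by (simp add: blk_mult mm_ring)
 moreover have "blk (mat 1) (- U) 0 (mat 1)**blk (mat 1 + U**V) 0 V (mat 1) = blk (mat 1) (- U) V (mat 1)"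
  by (simp add: blk_mult mm_ring)
 ultimately have "det (blk (mat 1) 0 V (mat 1)) * det (blk (mat 1) (- U) 0 (mat 1 + V**U))
   = det (blk (mat 1) (- U) 0 (mat 1)) * det (blk (mat 1 + U**V) 0 V (mat 1))"
  by (simp only: det_mul[symmetric])
 then show ?thesis by (simp add: det_blk_upper det_blk_lower)
qed

lemma det_rank_one_update: "det (mat 1 + (\<chi> i j. u$i * w$j)) = 1 + (\<Sum>i\<in>UNIV. w$i * u$i)"
 for u w :: "('n::finite) cvec"
proof -
 fix a :: 'n
 \<comment> \<open>Padding \<open>u\<close> to a column and \<open>w\<close> to a row keeps all
   matrices square; then \<open>V**U\<close> has at most one non-zero entry, at (a, a).\<close>
 define U :: "'n cmat" where "U = (\<chi> i j. if j = a then u$i else 0)"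
 define V :: "'n cmat" where "V = (\<chi> i j. if i = a then w$j else 0)"
 have "U**V = (\<chi> i j. u$i * w$j)"
  by (simp add: U_def V_def vec_eq_iff matrix_mult_nth if_distrib [of "%x. x * _"] cong: if_cong)
 moreover have "mat 1 + V**U = dmat (\<chi> i. if i = a then 1 + (\<Sum>i\<in>UNIV. w$i * u$i) else 1)"
  by (auto simp: U_def V_def vec_eq_iff matrix_mult_nth mat_def)
 ultimately show ?thesis
  using sylvester_det[of U V] by (simp add: det_dmat)
qed

text \<open>Source of the secular equation and, for a scalar diagonal, of the length of
  \<open>vh\<close>.\<close>

lemma det_diagonal_plus_rank_one:
 fixes d u w :: "('n::finite) cvec"
 assumes d: "!!i. d$i ~= 0"
 shows "det (dmat d + (\<chi> i j. u$i * w$j))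
  = (\<Prod>i\<in>UNIV. d$i) * (1 + (\<Sum>i\<in>UNIV. w$i * u$i / d$i))"
proof -
 have "dmat d + (\<chi> i j. u$i * w$j) = dmat d**(mat 1 + (\<chi> i j. (u$i / d$i) * w$j))"
  by (auto simp: dmat_mult_left vec_eq_iff mat_def d algebra_simps)
 then show ?thesis
  using det_rank_one_update[of "\<chi> i. u$i / d$i" w] by (simp add: det_mul det_dmat)
qed

lemma outer_mult_vec: "A**outer v **A\<^sup>H = outer (A *v v)"
 by (simp add: vec_eq_iff matrix_mult_nth outer_def matrix_vector_mult_def sum_distrib_left
   sum_distrib_right ac_simps)

lemma outer_smult: "cmod c = 1 ==> outer (c *s v) = outer v"
proof -
 assume "cmod c = 1"
 then have "c * cnj c = 1" by (simp add: complex_norm_square[symmetric])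
 then have "(c * a) * (cnj c * b) = a * b" for a b
  by (metis mult.commute mult.left_commute mult.right_neutral)
 note e = this
 show ?thesis unfolding outer_def by (simp only: vector_smult_component complex_cnj_mult e)
qed

subsection \<open>The indefinite unitary group\<close>

text \<open>U(n,n). The determinant condition of \<open>SUnn\<close> is kept apart, because matrices
  such as Cayley transforms are first seen to be pseudo-unitary and only then normalised.\<close>

definition Unn :: "('n::finite) bmat => bool"
 where "Unn g \<longleftrightarrow> g\<^sup>H**Inn**g = Inn"

lemma SUnn_iff: "g \<in> SUnn \<longleftrightarrow> Unn g & det g = 1"
 by (auto simp: SUnn_def Unn_def)

lemma Inn_Inn [simp]: "Inn**Inn = (mat 1 :: ('n::finite) bmat)"
 by (simp add: Inn_def blk_mult mm_ring blk_mat)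

lemma Unn_left: "Unn g ==> (Inn**g\<^sup>H**Inn)**g = mat 1"
 by (metis Inn_Inn Unn_def mm_assoc)

lemma Unn_right: "Unn g ==> g**(Inn**g\<^sup>H**Inn) = mat 1"
 using Unn_left matrix_left_right_inverse by blast

lemma Unn_inv: "Unn g ==> matrix_inv g = Inn**g\<^sup>H**Inn"
 by (rule matrix_inv_eqI) (rule Unn_right)

lemma Unn_flip: "Unn g ==> g**Inn**g\<^sup>H = Inn"
proof -
 assume "Unn g"
 then have "g**(Inn**g\<^sup>H**Inn)**Inn = Inn" by (simp add: Unn_right)
 then show ?thesis by (simp flip: mm_assoc)
qed

lemma Unn_iff_flip: "Unn g \<longleftrightarrow> g**Inn**g\<^sup>H = Inn"
proof
 assume "g**Inn**g\<^sup>H = Inn"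
 then have "g**(Inn**g\<^sup>H**Inn) = mat 1" by (metis Inn_Inn mm_assoc)
 then have "(Inn**g\<^sup>H**Inn)**g = mat 1" using matrix_left_right_inverse by blast
 then have "Inn**((Inn**g\<^sup>H**Inn)**g) = Inn" by simp
 then show "Unn g" unfolding Unn_def by (simp add: mm_assoc)
qed (rule Unn_flip)

lemma Unn_ctrans: "Unn (g\<^sup>H) \<longleftrightarrow> Unn g"
 by (metis Unn_def Unn_iff_flip ctrans_ctrans)

lemma Unn_mult: "Unn g ==> Unn h ==> Unn (g**h)"
proof -
 assume "Unn g" "Unn h"
 then have "h\<^sup>H**(g\<^sup>H**Inn**g)**h = Inn" by (simp add: Unn_def)
 then show ?thesis by (simp add: Unn_def ctrans_mult mm_assoc)
qed

lemma Unn_matrix_inv: "Unn g ==> Unn (matrix_inv g)"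
proof -
 assume g: "Unn g"
 have I: "Unn (Inn :: 'a bmat)" by (simp add: Unn_def)
 show ?thesis unfolding Unn_inv[OF g] by (intro Unn_mult I) (simp add: Unn_ctrans g)
qed

lemma det_matrix_inv: "det g = 1 ==> det (matrix_inv g) = 1" for g :: "'a::field ^ 'n ^ 'n"
 by (metis det_I det_mul matrix_inv_works(1) mult_1 one_neq_zero)

lemma SUnn_mult: "g \<in> SUnn ==> h \<in> SUnn ==> g**h \<in> SUnn"
 by (simp add: SUnn_iff Unn_mult det_mul)

lemma Unn_blk_diag: "unitary a ==> unitary d ==> Unn (blk a 0 0 d)"
 by (simp add: Unn_def Inn_def blk_simps unitary_def mm_ring)

lemma K_plus_iff: "g \<in> K_plus \<longleftrightarrow>
  (\<exists>a d. g = blk a 0 0 d & unitary a & unitary d & det a * det d = 1)"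
proof
 assume "g \<in> K_plus"
 then have g: "Unn g" "det g = 1" "unitary g" by (auto simp: K_plus_def SUnn_iff)
 \<comment> \<open>Unitary and pseudo-unitary together mean commuting with \<open>Inn\<close>, and
   only block diagonal matrices do.\<close>
 have "g**(g\<^sup>H**Inn**g) = g**Inn" using g by (simp add: Unn_def)
 then have comm: "Inn**g = g**Inn" using unitaryD(2)[OF g(3)] by (simp add: mm_assoc)
 obtain a b c d where abcd: "g = blk a b c d" by (rule blk_cases)
 have "b = - b" "c = - c"
  using comm by (auto simp: abcd Inn_def blk_mult mm_ring blk_eq_iff)
 then have bc: "b = 0" "c = 0"
  by (simp_all add: vec_eq_iff complex_eq_iff)
 then have "unitary a" "unitary d"
  using g(3) by (simp_all add: abcd unitary_def blk_simps mat_eq_blk blk_eq_iff)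
 then show "\<exists>a d. g = blk a 0 0 d & unitary a & unitary d & det a * det d = 1"
  using abcd bc g(2) by (auto simp: det_blk_upper)
next
 assume "\<exists>a d. g = blk a 0 0 d & unitary a & unitary d & det a * det d = 1"
 then obtain a d where g: "g = blk a 0 0 d" "unitary a" "unitary d" "det a * det d = 1" by blast
 have "unitary g" using g by (simp add: unitary_def blk_simps blk_mat)
 then show "g \<in> K_plus" using g by (simp add: K_plus_def SUnn_iff Unn_blk_diag det_blk_upper)
qed

lemma blk_K_plus_iff: "blk a 0 0 d \<in> K_plus \<longleftrightarrow> unitary a & unitary d & det a * det d = 1"
 by (auto simp: K_plus_iff blk_eq_iff)

lemma Bex_K_plus_iff: "(\<exists>k\<in>K_plus. P k) \<longleftrightarrow>
  (\<exists>a d. unitary a & unitary d & det a * det d = 1 & P (blk a 0 0 d))"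
 unfolding Bex_def K_plus_iff by blast

subsection \<open>Triangular matrices and uniqueness of factorization\<close>

text \<open>The sum index type is ordered only through the predicate \<open>block_less\<close>, so
  the algebra of triangular matrices takes the order as a parameter.\<close>

locale finite_strict_order =
 fixes lt :: "'n::finite => 'n => bool"
 assumes irrefl: "\<not> lt i i" and trans: "lt i j ==> lt j k ==> lt i k"
  and total: "i ~= j ==> lt i j \<or> lt j i"
begin

lemma upper_pos_mult:
 assumes A: "upper_pos lt A" and B: "upper_pos lt B" shows "upper_pos lt (A**B)"
proof -
 have z: "A$i$k * B$k$j = 0" if "lt j i \<or> i = j & k ~= i" for i j k
  using that A B total[of k i] trans[of k i j] trans[of j i k] irrefl unfolding upper_pos_def
  by (metis mult_eq_0_iff local.trans local.total)
 have d: "(A**B)$i$i = A$i$i * B$i$i" for i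
  unfolding matrix_mult_nth by (subst sum.remove[of _ i]) (auto intro!: sum.neutral z)
 have "(A**B)$i$j = 0" if "lt j i" for i j
  unfolding matrix_mult_nth using that by (intro sum.neutral ballI z) simp
 moreover have "(A**B)$i$i \<in> \<real> & 0 < Re ((A**B)$i$i)" for i
 proof -
  obtain a b where "A$i$i = complex_of_real a" "0 < a" "B$i$i = complex_of_real b" "0 < b"
   using A B unfolding upper_pos_def by (metis Re_complex_of_real Reals_cases)
  then show ?thesis unfolding d by (simp flip: of_real_mult)
 qed
 ultimately show ?thesis unfolding upper_pos_def by blast
qed

lemma upper_pos_inverse:
 assumes A: "upper_pos lt A" and AB: "A**B = mat 1" shows "upper_pos lt B"
proof -
 \<comment> \<open>Back substitution from the last row: the number of indices above \<open>i\<close>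
   is the induction measure.\<close>
 have card_less: "card {m. lt k m} < card {m. lt i m}" if "lt i k" for i k
 proof (rule psubset_card_mono)
  have "{m. lt k m} \<subseteq> {m. lt i m}" "k \<in> {m. lt i m}" "k \<notin> {m. lt k m}"
   using that trans irrefl by auto
  then show "{m. lt k m} \<subset> {m. lt i m}" by blast
 qed simp
 have low: "lt j i ==> B$i$j = 0" for i j
 proof (induction i rule: measure_induct_rule[where f = "%i. card {m. lt i m}"])
  case (less i)
  have "A$i$k * B$k$j = 0" if "k ~= i" for k
   using that A less card_less[of i k] total[of k i] trans[of j i k] unfolding upper_pos_def by auto
  then have "(\<Sum>k\<in>UNIV - {i}. A$i$k * B$k$j) = 0" by (intro sum.neutral) blast
  then have "(A**B)$i$j = A$i$i * B$i$j"
   unfolding matrix_mult_nth by (subst sum.remove[of _ i]) simp_all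
  moreover have "i ~= j" using less(2) irrefl by blast
  ultimately have "A$i$i * B$i$j = 0" unfolding AB by (simp add: mat_def)
  moreover have "A$i$i ~= 0" using A unfolding upper_pos_def by (metis less_irrefl zero_complex.sel(1))
  ultimately show ?case by simp
 qed
 have diag: "A$i$i * B$i$i = 1" for i
 proof -
  have "A$i$k * B$k$i = 0" if "k ~= i" for k
   using that A low total[of k i] unfolding upper_pos_def by auto
  then have "(\<Sum>k\<in>UNIV - {i}. A$i$k * B$k$i) = 0" by (intro sum.neutral) blast
  then have "(A**B)$i$i = A$i$i * B$i$i"
   unfolding matrix_mult_nth by (subst sum.remove[of _ i]) simp_all
  then show ?thesis using AB by (simp add: mat_def)
 qed
 have "B$i$i \<in> \<real> & 0 < Re (B$i$i)" for i
 proof -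
  obtain a where a: "A$i$i = complex_of_real a" "0 < a"
   using A unfolding upper_pos_def by (metis Re_complex_of_real Reals_cases)
  then have "B$i$i = complex_of_real (1 / a)" using diag[of i] by (auto simp: field_simps)
  then show ?thesis using a by simp
 qed
 then show ?thesis using low unfolding upper_pos_def by blast
qed

end

interpretation block_less: finite_strict_order block_less
proof
 fix i j k :: "'a + 'a"
 show "\<not> block_less i i" by (cases i) auto
 show "block_less i j ==> block_less j k ==> block_less i k" by (cases i; cases j; cases k) auto
 show "i ~= j ==> block_less i j \<or> block_less j i" by (cases i; cases j) auto
qed

lemma Bgrp_mult: "a \<in> Bgrp ==> b \<in> Bgrp ==> a**b \<in> Bgrp"
 by (simp add: Bgrp_def det_mul block_less.upper_pos_mult)

lemma Bgrp_inv: "a \<in> Bgrp ==> matrix_inv a \<in> Bgrp"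
 using block_less.upper_pos_inverse[of a "matrix_inv a"]
 by (simp add: Bgrp_def det_matrix_inv matrix_inv_works)

lemma Inn_nth: "Inn$i$j = (if i = j then (case i of Inl _ => 1 | Inr _ => - 1) else 0)"
 by (cases i; cases j) (auto simp: Inn_def mat_def)

lemma Inn_sandwich_nth: "(Inn**A**Inn)$i$j = Inn$i$i * A$i$j * Inn$j$j"
proof -
 have I: "Inn = dmat (\<chi> i. Inn$i$i)" by (simp add: vec_eq_iff Inn_nth)
 show ?thesis by (subst I, subst (2) I) (simp add: dmat_mult_left dmat_mult_right)
qed

text \<open>The inverse \<open>Inn**u\<^sup>H**Inn\<close> is lower triangular because u is upper
  triangular, and upper triangular because it lies in the group. So u is diagonal, with positive
  entries of modulus one. The four factors defined by \<open>THE\<close> owe their existence to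
  this.\<close>

lemma Unn_Bgrp_trivial:
 assumes "Unn u" "u \<in> Bgrp" shows "u = mat 1"
proof -
 have inv: "matrix_inv u = Inn**u\<^sup>H**Inn" by (rule Unn_inv[OF assms(1)])
 have nz: "Inn$i$i ~= (0 :: complex)" for i :: "'a + 'a" by (cases i) (auto simp: Inn_nth)
 have u: "upper_pos block_less u" and ui: "upper_pos block_less (matrix_inv u)"
  using assms(2) Bgrp_inv[OF assms(2)] by (auto simp: Bgrp_def)
 have "u$j$i = 0" if "block_less j i" for i j
  using ui that nz unfolding upper_pos_def inv Inn_sandwich_nth by auto
 then have off: "u$i$j = 0" if "i ~= j" for i j
  using that u block_less.total unfolding upper_pos_def by blast
 have ud: "u = dmat (\<chi> i. u$i$i)" using off by (simp add: vec_eq_iff)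
 have "u$i$i = 1" for i
 proof -
  obtain a where a: "u$i$i = complex_of_real a" "0 < a"
   using u unfolding upper_pos_def by (metis Re_complex_of_real Reals_cases)
  have "(u\<^sup>H**Inn**u)$i$i = cnj (u$i$i) * Inn$i$i * u$i$i"
   by (subst (1 2) ud) (simp add: ctrans_dmat dmat_mult_left dmat_mult_right)
  then have "a * a = 1"
   using assms(1) nz[of i] unfolding Unn_def a(1)
   by (simp add: mult.commute mult.left_commute) (metis of_real_eq_1_iff of_real_mult)
  then have "a = 1" using a(2) square_eq_1_iff by fastforce
  then show ?thesis using a by simp
 qed
 then show ?thesis using off by (simp add: vec_eq_iff mat_def)
qed

lemma factor_KB_unique:
 assumes "k1 \<in> SUnn" "k2 \<in> SUnn" "b1 \<in> Bgrp" "b2 \<in> Bgrp" "k1**b1 = k2**b2"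
 shows "k1 = k2 & b1 = b2"
proof -
 have d: "det k1 ~= 0" "det k2 ~= 0" "det b2 ~= 0" using assms by (auto simp: SUnn_iff Bgrp_def)
 let ?u = "matrix_inv k2**k1"
 have "?u**b1 = b2" using assms(5) d by (metis matrix_inv_works(2) mm_assoc matrix_mul_lid)
 then have "?u = b2**matrix_inv b1"
  by (metis (mono_tags, lifting) Bgrp_def assms(3) matrix_inv_works(1) mm_assoc
    matrix_mul_rid mem_Collect_eq zero_neq_one)
 then have "?u \<in> Bgrp" using assms by (simp add: Bgrp_mult Bgrp_inv)
 moreover have "Unn ?u" using assms by (simp add: SUnn_iff Unn_mult Unn_matrix_inv)
 ultimately have u: "?u = mat 1" by (simp add: Unn_Bgrp_trivial)
 then have "b1 = b2" using \<open>?u ** b1 = b2\<close> by simp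
 moreover have "k1 = k2" using u d by (metis matrix_inv_works(1) mm_assoc matrix_mul_lid matrix_mul_rid)
 ultimately show ?thesis by simp
qed

lemma factor_BK_unique:
 assumes "k1 \<in> SUnn" "k2 \<in> SUnn" "b1 \<in> Bgrp" "b2 \<in> Bgrp" "b1**k1 = b2**k2"
 shows "k1 = k2 & b1 = b2"
proof -
 have d: "det k1 ~= 0" "det k2 ~= 0" "det b1 ~= 0" "det b2 ~= 0" using assms by (auto simp: SUnn_iff Bgrp_def)
 let ?u = "matrix_inv b2**b1"
 have "?u**k1 = k2" using assms(5) d by (metis matrix_inv_works(2) mm_assoc matrix_mul_lid)
 then have "?u = k2**matrix_inv k1"
  using d by (metis matrix_inv_works(1) mm_assoc matrix_mul_rid)
 then have "Unn ?u" using assms by (simp add: SUnn_iff Unn_mult Unn_matrix_inv)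
 moreover have "?u \<in> Bgrp" using assms by (simp add: Bgrp_mult Bgrp_inv)
 ultimately have u: "?u = mat 1" by (simp add: Unn_Bgrp_trivial)
 then have "k1 = k2" using \<open>?u ** k1 = k2\<close> by simp
 moreover have "b1 = b2" using u d by (metis matrix_inv_works(1) mm_assoc matrix_mul_lid matrix_mul_rid)
 ultimately show ?thesis by simp
qed

lemma factors_eq:
 assumes "k \<in> SUnn" "b \<in> Bgrp" "g = k**b"
 shows "k_L g = k" "b_R g = b"
 unfolding k_L_def b_R_def using assms factor_KB_unique by (intro the_equality; blast)+

lemma factors_eq':
 assumes "k \<in> SUnn" "b \<in> Bgrp" "g = b**k"
 shows "k_R g = k" "b_L g = b"
 unfolding k_R_def b_L_def using assms factor_BK_unique by (intro the_equality; blast)+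

lemma leafD:
 assumes "g \<in> leaf"
 shows "det g = 1" "k_L g \<in> SUnn" "b_R g \<in> Bgrp" "k_R g \<in> SUnn" "b_L g \<in> Bgrp"
  "g = k_L g**b_R g" "g = b_L g**k_R g"
proof -
 obtain k b where "k \<in> SUnn" "b \<in> Bgrp" "g = k**b" using assms by (auto simp: leaf_def)
 then show "k_L g \<in> SUnn" "b_R g \<in> Bgrp" "g = k_L g**b_R g" using factors_eq by metis+
 obtain k b where "k \<in> SUnn" "b \<in> Bgrp" "g = b**k" using assms by (auto simp: leaf_def)
 then show "k_R g \<in> SUnn" "b_L g \<in> Bgrp" "g = b_L g**k_R g" using factors_eq' by metis+
 show "det g = 1" using assms by (simp add: leaf_def)
qed

subsection \<open>The constrained set and the gauge action\<close>

locale reduction =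
 fixes x y \<alpha> :: real and vh :: "('n::{finite,linorder}) cvec" and \<sigma> :: "'n cmat"
 assumes x_pos: "0 < x" and y_pos: "0 < y"
  and alpha: "\<alpha> \<notin> {0, 1, -1}" "\<alpha>^2 < 1"
  and sigma_B: "\<sigma> \<in> B_n" and det_sigma: "det \<sigma> = 1"
  and sigma_outer: "\<sigma>**\<sigma>\<^sup>H = smat (\<alpha>^2) + outer vh"
begin

definition bR :: "'n cmat => 'n bmat"
 where "bR \<omega> = blk (smat x) \<omega> 0 (smat (1 / x))"

definition bL :: "'n cmat => 'n bmat"
 where "bL \<nu> = blk ((1 / y) *\<^sub>R \<sigma>) ((1 / y) *\<^sub>R \<nu>) 0 (smat y)"

abbreviation C where "C \<equiv> constrained \<sigma> x y"
abbreviation G where "G \<equiv> gauge_rel \<sigma> x y"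

lemma det_smat: "det (smat c :: 'n cmat) = complex_of_real c ^ CARD('n)"
 by (simp add: smat_def det_mat)

lemma det_bR [simp]: "det (bR \<omega>) = 1"
 using x_pos by (simp add: bR_def det_blk_upper det_smat power_one_over)

lemma det_bL [simp]: "det (bL \<nu>) = 1"
proof -
 have "(1 / y) *\<^sub>R \<sigma> = smat (1 / y)**\<sigma>" by (simp add: smat_eq mm_ring)
 then show ?thesis
  using y_pos by (simp add: bL_def det_blk_upper det_smat det_mul det_sigma power_one_over)
qed

lemma bR_Bgrp: "bR \<omega> \<in> Bgrp"
proof -
 have "upper_pos block_less (bR \<omega>)"
  unfolding upper_pos_def
 proof (intro conjI allI impI)
  fix i j :: "'n + 'n"
  show "bR \<omega>$i$i \<in> \<real>" "0 < Re (bR \<omega>$i$i)"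
   using x_pos by (cases i; simp add: bR_def smat_def mat_def)+
  show "block_less j i ==> bR \<omega>$i$j = 0"
   by (cases i; cases j) (auto simp: bR_def smat_def mat_def)
 qed
 then show ?thesis by (simp add: Bgrp_def)
qed

lemma bL_Bgrp: "bL \<nu> \<in> Bgrp"
proof -
 have "upper_pos block_less (bL \<nu>)"
  unfolding upper_pos_def
 proof (intro conjI allI impI)
  fix i j :: "'n + 'n"
  show "bL \<nu>$i$i \<in> \<real>"
   using sigma_B by (cases i) (auto simp: bL_def smat_def mat_def B_n_def upper_pos_def complex_is_Real_iff)
  show "0 < Re (bL \<nu>$i$i)"
   using y_pos sigma_B by (cases i) (auto simp: bL_def smat_def mat_def B_n_def upper_pos_def)
  show "block_less j i ==> bL \<nu>$i$j = 0"
   using sigma_B by (cases i; cases j) (auto simp: bL_def smat_def mat_def B_n_def upper_pos_def)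
 qed
 then show ?thesis by (simp add: Bgrp_def)
qed

lemma constrainedI:
 assumes "k \<in> SUnn" "regular k" "kR \<in> SUnn" "g = k**bR \<omega>" "g = bL \<nu>**kR"
 shows "g \<in> C" "k_L g = k" "b_R g = bR \<omega>" "k_R g = kR" "b_L g = bL \<nu>"
proof -
 show e: "k_L g = k" "b_R g = bR \<omega>" using factors_eq[OF assms(1) bR_Bgrp assms(4)] .
 show e': "k_R g = kR" "b_L g = bL \<nu>" using factors_eq'[OF assms(3) bL_Bgrp assms(5)] .
 have "det g = 1" using assms by (simp add: det_mul SUnn_iff)
 then have "g \<in> leaf" unfolding leaf_def using assms bR_Bgrp bL_Bgrp by blast
 then show "g \<in> C" unfolding constrained_def using assms(2) e e' by (auto simp: bR_def bL_def)
qed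

lemma constrainedE:
 assumes "g \<in> C"
 obtains k \<omega> \<nu> kR where "k \<in> SUnn" "regular k" "kR \<in> SUnn" "g = k**bR \<omega>" "g = bL \<nu>**kR"
  "k_L g = k" "b_R g = bR \<omega>" "k_R g = kR" "b_L g = bL \<nu>"
proof -
 obtain \<omega> \<nu> where g: "g \<in> leaf" "regular (k_L g)" "b_R g = bR \<omega>" "b_L g = bL \<nu>"
  using assms by (auto simp: constrained_def bR_def bL_def)
 show ?thesis using leafD[OF g(1)] g that by metis
qed

text \<open>The factor k_R has no convenient formula and need not be exhibited: equality of the two
  metrics is exactly pseudo-unitarity of \<open>matrix_inv (bL \<nu>)**g\<close>.\<close>

lemma constrainedI_metric:
 assumes k: "k \<in> SUnn" "regular k" and g: "g = k**bR \<omega>"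
  and J: "g**Inn**g\<^sup>H = bL \<nu>**Inn**(bL \<nu>)\<^sup>H"
 shows "g \<in> C" "k_L g = k" "b_R g = bR \<omega>" "b_L g = bL \<nu>"
proof -
 let ?bi = "matrix_inv (bL \<nu>)" let ?kR = "?bi**g"
 have bi: "?bi**bL \<nu> = mat 1" "bL \<nu>**?bi = mat 1" by (simp_all add: matrix_inv_works)
 have "?kR**Inn**?kR\<^sup>H = ?bi**(g**Inn**g\<^sup>H)**?bi\<^sup>H"
  by (simp add: ctrans_mult mm_assoc)
 also have "... = (?bi**bL \<nu>)**Inn**(?bi**bL \<nu>)\<^sup>H"
  unfolding J by (simp add: ctrans_mult mm_assoc)
 finally have "Unn ?kR" by (simp add: bi Unn_iff_flip)
 moreover have "det ?kR = 1" using k by (simp add: det_mul det_matrix_inv SUnn_iff g)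
 ultimately have kR: "?kR \<in> SUnn" by (simp add: SUnn_iff)
 have "g = bL \<nu>**?kR" by (simp add: bi mm_assoc)
 from constrainedI[OF k kR g this]
 show "g \<in> C" "k_L g = k" "b_R g = bR \<omega>" "b_L g = bL \<nu>" by auto
qed

lemma constrained_metric:
 assumes "g \<in> C" "b_L g = bL \<nu>" shows "g**Inn**g\<^sup>H = bL \<nu>**Inn**(bL \<nu>)\<^sup>H"
proof -
 have g: "Unn (k_R g)" "g = bL \<nu>**k_R g"
  using assms leafD[of g] by (auto simp: constrained_def SUnn_iff)
 have "(bL \<nu>**k_R g)**Inn**(bL \<nu>**k_R g)\<^sup>H = bL \<nu>**(k_R g**Inn**(k_R g)\<^sup>H)**(bL \<nu>)\<^sup>H"
  by (simp add: ctrans_mult mm_assoc)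
 then show ?thesis using g by (simp add: Unn_flip)
qed

section \<open>The residual gauge group and its action on the four factors\<close>

definition Rt :: "'n cmat => 'n cmat"
 where "Rt R = matrix_inv \<sigma>**R**\<sigma>"

lemma sigma_inv: "\<sigma>**matrix_inv \<sigma> = mat 1" "matrix_inv \<sigma>**\<sigma> = mat 1"
 by (simp_all add: matrix_inv_works det_sigma)

lemma sigma_Rt: "\<sigma>**Rt R = R**\<sigma>"
 by (simp add: Rt_def mm_assoc sigma_inv)

definition stab :: "'n cmat => bool"
 where "stab R \<longleftrightarrow> unitary R & R\<^sup>H**\<sigma>**\<sigma>\<^sup>H**R = \<sigma>**\<sigma>\<^sup>H"

lemma stab_iff_commute: "stab R \<longleftrightarrow> unitary R & \<sigma>**\<sigma>\<^sup>H**R = R**\<sigma>**\<sigma>\<^sup>H"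
proof -
 have "R\<^sup>H**\<sigma>**\<sigma>\<^sup>H**R = \<sigma>**\<sigma>\<^sup>H \<longleftrightarrow> \<sigma>**\<sigma>\<^sup>H**R = R**\<sigma>**\<sigma>\<^sup>H" if R: "unitary R"
  by (metis R mm_assoc matrix_mul_lid unitaryD)
 then show ?thesis by (auto simp: stab_def)
qed

lemma stab_mult: "stab R ==> stab R' ==> stab (R**R')"
 unfolding stab_iff_commute by (metis mm_assoc unitary_mult)

lemma stab_ctrans: "stab R ==> stab (R\<^sup>H)"
 unfolding stab_iff_commute by (metis mm_assoc matrix_mul_lid matrix_mul_rid unitaryD unitary_ctrans)

lemma stab_mat: "cmod c = 1 ==> stab (mat c)"
 unfolding stab_iff_commute by (simp add: unitary_mat mat_mult_commute mm_assoc)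

lemma stab_outer: "stab R \<longleftrightarrow> unitary R & R\<^sup>H**outer vh**R = outer vh"
 unfolding stab_def mm_assoc[symmetric, of "R\<^sup>H" \<sigma>] sigma_outer
 by (auto simp: mm_ring smat_eq unitaryD)

text \<open>Commuting with \<sigma>\<sigma>^H is what keeps R unitary after it has been carried past
  \<sigma>; this is the origin of the stabiliser condition in the gauge action.\<close>

lemma unitary_Rt: assumes "stab R" shows "unitary (Rt R)"
proof -
 let ?s = "matrix_inv \<sigma>"
 have R: "unitary R" "\<sigma>**\<sigma>\<^sup>H**R = R**\<sigma>**\<sigma>\<^sup>H" using assms by (auto simp: stab_iff_commute)
 have "Rt R**(Rt R)\<^sup>H = ?s**(R**\<sigma>**\<sigma>\<^sup>H)**R\<^sup>H**?s\<^sup>H"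
  by (simp add: Rt_def ctrans_mult mm_assoc)
 also have "... = ?s**\<sigma>**\<sigma>\<^sup>H**(R**R\<^sup>H)**?s\<^sup>H"
  by (simp add: R(2)[symmetric] mm_assoc)
 also have "... = (?s**\<sigma>)**(?s**\<sigma>)\<^sup>H"
  by (simp add: unitaryD[OF R(1)] ctrans_mult mm_assoc)
 finally have "Rt R**(Rt R)\<^sup>H = mat 1" by (simp add: sigma_inv)
 then show ?thesis by (metis ctrans_ctrans unitary_ctrans unitary_def)
qed

lemma bL_gauge: "unitary r ==> blk R 0 0 r**bL \<nu> = bL (R**\<nu>**r\<^sup>H)**blk (Rt R) 0 0 r"
 by (simp add: bL_def blk_mult smat_eq mm_ring sigma_Rt)
   (simp add: mm_assoc[symmetric] unitaryD)

lemma bR_gauge: "unitary k1 ==> bR \<omega>**blk k1 0 0 k2 = blk k1 0 0 k2**bR (k1\<^sup>H**\<omega>**k2)"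
 if "unitary k2"
 by (simp add: bR_def blk_mult smat_eq mm_ring unitaryD)

lemma regular_gauge:
 assumes "regular k" "unitary R" "unitary r" "unitary k1" "unitary k2"
 shows "regular (blk R 0 0 r**k**blk k1 0 0 k2)"
proof -
 obtain \<rho> \<tau> a b Delta where h: "unitary \<rho>" "unitary \<tau>" "unitary a" "unitary b" "Delta \<in> chamber"
  "k = blk \<rho> 0 0 \<tau>**blk (Cosh Delta) (Sinh Delta) (Sinh Delta) (Cosh Delta)**blk a 0 0 b"
  using assms(1) by (auto simp: regular_def)
 have "blk R 0 0 r**k**blk k1 0 0 k2 = blk (R**\<rho>) 0 0 (r**\<tau>) **
   blk (Cosh Delta) (Sinh Delta) (Sinh Delta) (Cosh Delta)**blk (a**k1) 0 0 (b**k2)"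
  by (simp add: h(6) blk_mult mm_assoc)
 then show ?thesis unfolding regular_def using h assms unitary_mult by metis
qed

text \<open>Block diagonal factors pass through \<open>bL\<close> and \<open>bR\<close> changing
  only the corners, so all four factors of the transformed element are explicit. Closure of the
  constrained set under the gauge action and the uniqueness of normal forms rest on this.\<close>

lemma gauge_step:
 assumes g: "k \<in> SUnn" "regular k" "kR \<in> SUnn" "g = k**bR \<omega>" "g = bL \<nu>**kR"
  and R: "stab R" "unitary r" "det R * det r = 1"
  and K: "unitary k1" "unitary k2" "det k1 * det k2 = 1"
  and h: "h = blk R 0 0 r**g**blk k1 0 0 k2"
 shows "h \<in> C" "k_L h = blk R 0 0 r**k**blk k1 0 0 k2" "b_R h = bR (k1\<^sup>H**\<omega>**k2)"
  "b_L h = bL (R**\<nu>**r\<^sup>H)" "k_R h = blk (Rt R) 0 0 r**kR**blk k1 0 0 k2"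
proof -
 have uR: "unitary R" using R by (simp add: stab_def)
 have dRt: "det (Rt R) = det R"
  using det_matrix_inv[OF det_sigma] by (simp add: Rt_def det_mul det_sigma)
 have S: "blk R 0 0 r \<in> SUnn" "blk k1 0 0 k2 \<in> SUnn" "blk (Rt R) 0 0 r \<in> SUnn"
  using R K uR by (simp_all add: SUnn_iff det_blk_upper Unn_blk_diag unitary_Rt dRt)
 have 1: "h = (blk R 0 0 r**k**blk k1 0 0 k2)**bR (k1\<^sup>H**\<omega>**k2)"
  unfolding h g(4) mm_assoc[symmetric] bR_gauge[OF K(2,1)] ..
 have "h = (blk R 0 0 r**bL \<nu>)**kR**blk k1 0 0 k2"
  unfolding h by (subst g(5)) (simp add: mm_assoc)
 then have 2: "h = bL (R**\<nu>**r\<^sup>H)**(blk (Rt R) 0 0 r**kR**blk k1 0 0 k2)"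
  unfolding bL_gauge[OF R(2)] by (simp add: mm_assoc)
 note c = constrainedI[OF _ _ _ 1 2]
 show "h \<in> C" "k_L h = blk R 0 0 r**k**blk k1 0 0 k2" "b_R h = bR (k1\<^sup>H**\<omega>**k2)"
  "b_L h = bL (R**\<nu>**r\<^sup>H)" "k_R h = blk (Rt R) 0 0 r**kR**blk k1 0 0 k2"
  by (intro c SUnn_mult S g regular_gauge R K uR)+
qed

lemma gauge_rel_iff: "(g, h) \<in> G \<longleftrightarrow> g \<in> C & (\<exists>R r k1 k2. stab R & unitary r & det R * det r = 1 &
  unitary k1 & unitary k2 & det k1 * det k2 = 1 & h = blk R 0 0 r**g**blk k1 0 0 k2)"
 unfolding gauge_rel_def stab_def Bex_K_plus_iff blk_K_plus_iff by auto

lemma gauge_relI: "g \<in> C ==> stab R ==> unitary r ==> det R * det r = 1 ==> unitary k1 ==> unitary k2 ==>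
  det k1 * det k2 = 1 ==> h = blk R 0 0 r**g**blk k1 0 0 k2 ==> (g, h) \<in> G"
 unfolding gauge_rel_iff by blast

lemma gauge_rel_in_C: "(g, h) \<in> G ==> g \<in> C & h \<in> C"
proof
 assume gh: "(g, h) \<in> G"
 then show g: "g \<in> C" by (simp add: gauge_rel_iff)
 obtain R r k1 k2 where *: "stab R" "unitary r" "det R * det r = 1" "unitary k1" "unitary k2"
  "det k1 * det k2 = 1" "h = blk R 0 0 r**g**blk k1 0 0 k2" using gh by (auto simp: gauge_rel_iff)
 obtain k \<omega> \<nu> kR where "k \<in> SUnn" "regular k" "kR \<in> SUnn" "g = k**bR \<omega>" "g = bL \<nu>**kR"
  using g by (rule constrainedE)
 from gauge_step(1)[OF this *] show "h \<in> C" .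
qed

lemma det_ctrans_mult_one: "det R * det r = 1 ==> det (R\<^sup>H) * det (r\<^sup>H) = 1" for R r :: "'n cmat"
 by (metis complex_cnj_mult complex_cnj_one det_ctrans)

lemma equiv_gauge: "equiv C G"
proof (rule equivI)
 show "G \<subseteq> C \<times> C" using gauge_rel_in_C by auto
 show "refl_on C G"
  by (auto simp: refl_on_def blk_mat intro!: gauge_relI[where R = "mat 1" and r = "mat 1" and ?k1.0 = "mat 1" and ?k2.0 = "mat 1"] stab_mat)
 show "sym G"
 proof (rule symI)
  fix g h assume gh: "(g, h) \<in> G"
  then obtain R r k1 k2 where *: "stab R" "unitary r" "det R * det r = 1" "unitary k1" "unitary k2"
   "det k1 * det k2 = 1" "h = blk R 0 0 r**g**blk k1 0 0 k2" by (auto simp: gauge_rel_iff)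
  have "unitary R" using * by (simp add: stab_def)
  have "blk (R\<^sup>H) 0 0 (r\<^sup>H)**h**blk (k1\<^sup>H) 0 0 (k2\<^sup>H)
   = (blk (R\<^sup>H) 0 0 (r\<^sup>H)**blk R 0 0 r)**g**(blk k1 0 0 k2**blk (k1\<^sup>H) 0 0 (k2\<^sup>H))"
   unfolding * by (simp add: mm_assoc)
  also have "... = g" using * \<open>unitary R\<close> by (simp add: blk_mult unitaryD blk_mat)
  finally show "(h, g) \<in> G"
   using gauge_rel_in_C[OF gh] * by (intro gauge_relI[where R = "R\<^sup>H" and r = "r\<^sup>H" and ?k1.0 = "k1\<^sup>H" and ?k2.0 = "k2\<^sup>H"])
     (auto simp: stab_ctrans det_ctrans_mult_one)
 qed
 show "trans G"
 proof (rule transI)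
  fix g h h' assume gh: "(g, h) \<in> G" "(h, h') \<in> G"
  obtain R r k1 k2 where *: "stab R" "unitary r" "det R * det r = 1" "unitary k1" "unitary k2"
   "det k1 * det k2 = 1" "h = blk R 0 0 r**g**blk k1 0 0 k2" using gh(1) by (auto simp: gauge_rel_iff)
  obtain R' r' k1' k2' where **: "stab R'" "unitary r'" "det R' * det r' = 1" "unitary k1'" "unitary k2'"
   "det k1' * det k2' = 1" "h' = blk R' 0 0 r'**h**blk k1' 0 0 k2'" using gh(2) by (auto simp: gauge_rel_iff)
  have "h' = (blk R' 0 0 r'**blk R 0 0 r)**g**(blk k1 0 0 k2**blk k1' 0 0 k2')"
   unfolding ** * by (simp only: mm_assoc)
  then have h': "h' = blk (R'**R) 0 0 (r'**r)**g**blk (k1**k1') 0 0 (k2**k2')"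
   by (simp add: blk_mult)
  have "det (R'**R) * det (r'**r) = (det R' * det r') * (det R * det r)"
   "det (k1**k1') * det (k2**k2') = (det k1 * det k2) * (det k1' * det k2')"
   by (simp_all add: det_mul)
  then show "(g, h') \<in> G"
   using gauge_rel_in_C gh * ** h' stab_mult unitary_mult
   by (intro gauge_relI[OF _ _ _ _ _ _ _ h']) auto
 qed
qed

lemma gauge_sym: "(g, h) \<in> G ==> (h, g) \<in> G"
 using equiv_gauge by (auto simp: equiv_def dest: symD)
lemma gauge_trans: "(g, h) \<in> G ==> (h, k) \<in> G ==> (g, k) \<in> G"
 using equiv_gauge by (auto simp: equiv_def dest: transD)

end

subsection \<open>The normal form\<close>

definition Hyp :: "('n::{finite,linorder}) rvec => 'n bmat"
 where "Hyp Delta = blk (Cosh Delta) (Sinh Delta) (Sinh Delta) (Cosh Delta)"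

definition SinhI :: "('n::{finite,linorder}) rvec => 'n cmat"
 where "SinhI Delta = dmat (cvec (\<chi> i. inverse (sinh (Delta$i))))"

definition CoshI :: "('n::{finite,linorder}) rvec => 'n cmat"
 where "CoshI Delta = dmat (cvec (\<chi> i. inverse (cosh (Delta$i))))"

lemma ctrans_Cosh [simp]: "(Cosh Delta)\<^sup>H = Cosh Delta" "(Sinh Delta)\<^sup>H = Sinh Delta"
 "(SinhI Delta)\<^sup>H = SinhI Delta" "(CoshI Delta)\<^sup>H = CoshI Delta"
 by (simp_all add: Cosh_def Sinh_def SinhI_def CoshI_def)

lemma Sinh_Cosh_commute: "Sinh Delta**Cosh Delta = Cosh Delta**Sinh Delta"
 by (simp add: Cosh_def Sinh_def dmat_mult_commute)
lemma SinhI_Cosh_commute: "SinhI Delta**Cosh Delta = Cosh Delta**SinhI Delta"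
 by (simp add: Cosh_def SinhI_def dmat_mult_commute)
lemma Cosh_square: "Cosh Delta**Cosh Delta = Sinh Delta**Sinh Delta + mat 1"
proof -
 have "complex_of_real (cosh t) * of_real (cosh t) = of_real (sinh t) * of_real (sinh t) + 1" for t
  by (metis cosh_square_eq of_real_1 of_real_add of_real_mult power2_eq_square)
 then show ?thesis by (simp add: Cosh_def Sinh_def dmat_mult_dmat vec_eq_iff mat_def)
qed
lemma Cosh_CoshI: "Cosh Delta**CoshI Delta = mat 1" "CoshI Delta**Cosh Delta = mat 1"
 by (simp_all add: Cosh_def CoshI_def dmat_mult_dmat vec_eq_iff mat_def less_imp_neq[OF cosh_real_pos, symmetric])

lemma chamber_pos: "Delta \<in> chamber ==> 0 < sinh (Delta$i)"
 by (simp add: chamber_def)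
lemma chamber_strict: "Delta \<in> chamber ==> i < j ==> sinh (Delta$j) < sinh (Delta$i)"
 by (simp add: chamber_def)
lemma chamber_sinh_neq: "Delta \<in> chamber ==> i ~= j ==> (sinh (Delta$i))\<^sup>2 ~= (sinh (Delta$j))^2"
proof -
 assume Delta: "Delta \<in> chamber" and "i ~= j"
 then have "sinh (Delta$i) ~= sinh (Delta$j)"
  using chamber_strict[OF Delta, of i j] chamber_strict[OF Delta, of j i] by (metis less_irrefl neq_iff)
 then show ?thesis using chamber_pos[OF Delta] by (metis less_imp_le power2_eq_iff_nonneg)
qed

lemma Sinh_SinhI:
 assumes "Delta \<in> chamber" shows "Sinh Delta**SinhI Delta = mat 1" "SinhI Delta**Sinh Delta = mat 1"
  "matrix_inv (Sinh Delta) = SinhI Delta"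
proof -
 have nz: "Delta$i ~= 0" for i using chamber_pos[OF assms, of i] by auto
 show "Sinh Delta**SinhI Delta = mat 1"
  by (simp add: Sinh_def SinhI_def dmat_mult_dmat vec_eq_iff mat_def nz)
 then show "SinhI Delta**Sinh Delta = mat 1" "matrix_inv (Sinh Delta) = SinhI Delta"
  using matrix_left_right_inverse matrix_inv_eqI by blast+
qed

text \<open>Block elimination: the Schur complement of \<open>Cosh Delta\<close> is cosh -
  sinh^2/cosh = 1/cosh, and the two determinants cancel.\<close>

lemma det_Hyp: "det (Hyp Delta) = 1"
proof -
 have "Sinh Delta**CoshI Delta**Sinh Delta + CoshI Delta = Cosh Delta"
 proof -
  have "Sinh Delta**CoshI Delta = CoshI Delta**Sinh Delta" by (simp add: Sinh_def CoshI_def dmat_mult_commute)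
  then have "Sinh Delta**CoshI Delta**Sinh Delta + CoshI Delta = CoshI Delta**(Sinh Delta**Sinh Delta + mat 1)"
   by (simp add: mm_ring)
  also have "... = (CoshI Delta**Cosh Delta)**Cosh Delta" by (simp add: Cosh_square[symmetric] mm_assoc)
  finally show ?thesis by (simp add: Cosh_CoshI)
 qed
 moreover have "Sinh Delta**CoshI Delta**Cosh Delta = Sinh Delta"
  by (metis Cosh_CoshI(2) mm_assoc matrix_mul_rid)
 ultimately have "Hyp Delta = blk (mat 1) 0 (Sinh Delta**CoshI Delta) (mat 1)**blk (Cosh Delta) (Sinh Delta) 0 (CoshI Delta)"
  by (simp add: Hyp_def blk_mult)
 then have "det (Hyp Delta) = det (Cosh Delta) * det (CoshI Delta)"
  by (simp add: det_mul det_blk_upper det_blk_lower)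
 then show ?thesis by (metis Cosh_CoshI(1) det_I det_mul)
qed

lemma Unn_Hyp: "Unn (Hyp Delta)"
 unfolding Unn_def Hyp_def Inn_def
 by (simp add: blk_simps mm_ring Cosh_square Sinh_Cosh_commute)

lemma regular_Hyp: "unitary \<rho> ==> unitary \<tau> ==> unitary k ==> unitary l ==> Delta \<in> chamber ==>
  regular (blk \<rho> 0 0 \<tau>**Hyp Delta**blk k 0 0 l)"
 unfolding regular_def Hyp_def by blast

lemma regularE:
 assumes "regular g"
 obtains \<rho> \<tau> k l Delta where "unitary \<rho>" "unitary \<tau>" "unitary k" "unitary l" "Delta \<in> chamber"
  "g = blk \<rho> 0 0 \<tau>**Hyp Delta**blk k 0 0 l"
 using assms unfolding regular_def Hyp_def by blast

context reduction begin

text \<open>\<open>kN\<close>, \<open>wN\<close> and \<open>nN\<close> are k_L, \<omega> and \<nu>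
  of a normal form; in the Cartan decomposition of k_L all unitary factors except \<rho> have been
  gauged to 1.\<close>

abbreviation kN :: "'n cmat => 'n rvec => 'n bmat"
 where "kN \<rho> Delta \<equiv> blk \<rho> 0 0 (mat 1)**Hyp Delta"

abbreviation wN :: "'n rvec => 'n cmat => 'n cmat"
 where "wN Delta T \<equiv> SinhI Delta**(Lam x y Delta**T - (1 / x) *\<^sub>R Cosh Delta)"

abbreviation nN :: "'n cmat => 'n rvec => 'n cmat => 'n cmat"
 where "nN \<rho> Delta T \<equiv> \<rho>**SinhI Delta**(y^2 *\<^sub>R Cosh Delta - (1 / x) *\<^sub>R (Lam x y Delta**T)\<^sup>H)"

abbreviation NF where "NF \<equiv> normal_form x y"

lemma normal_form_eq: "Delta \<in> chamber ==> NF \<rho> Delta T = kN \<rho> Delta**bR (wN Delta T)"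
 by (simp add: normal_form_def Let_def Sinh_SinhI bR_def Hyp_def blk_mult mm_assoc)

lemma kN_SUnn: "unitary \<rho> ==> kN \<rho> Delta \<in> SUnn \<longleftrightarrow> det \<rho> = 1"
 by (simp add: SUnn_iff det_mul det_Hyp det_blk_upper Unn_mult Unn_Hyp Unn_blk_diag)

lemma kN_regular: "unitary \<rho> ==> Delta \<in> chamber ==> regular (kN \<rho> Delta)"
 using regular_Hyp[of \<rho> "mat 1" "mat 1" "mat 1" Delta] by (simp add: blk_mat)

text \<open>
 \<open>g I g\<^sup>H = b\<^sub>L I b\<^sub>L\<^sup>H\<close> written out in blocks: the lower right block forces the modulus of
 \<open>\<Omega> = S\<omega> + \<Gamma>/x\<close>, the off-diagonal block determines \<open>\<nu>\<close>, and the upper left block becomes the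
 constraint on \<open>\<sigma>\<sigma>\<^sup>H\<close>.
\<close>

lemma metric_normal_form:
 fixes \<Omega> \<nu> :: "'n cmat"
 assumes D: "Delta \<in> chamber" and \<rho>: "unitary \<rho>"
 defines "S \<equiv> Sinh Delta" and "\<Gamma> \<equiv> Cosh Delta" and "Si \<equiv> SinhI Delta"
 defines "g \<equiv> kN \<rho> Delta**bR (Si**(\<Omega> - (1 / x) *\<^sub>R \<Gamma>))"
 shows "g**Inn**g\<^sup>H = bL \<nu>**Inn**(bL \<nu>)\<^sup>H \<longleftrightarrow>
  \<Omega>**\<Omega>\<^sup>H = y^2 *\<^sub>R mat 1 + x^2 *\<^sub>R (S**S) &
  \<nu> = \<rho>**Si**(y^2 *\<^sub>R \<Gamma> - (1 / x) *\<^sub>R \<Omega>\<^sup>H) &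
  \<sigma>**\<sigma>\<^sup>H = (1 / x^2) *\<^sub>R (\<rho>**Si**(\<Omega>\<^sup>H**\<Omega> - y\<^sup>2 *\<^sub>R mat 1)**Si**\<rho>\<^sup>H)"
proof -
 have SS: "S**Si = mat 1" "Si**S = mat 1" using Sinh_SinhI[OF D] by (simp_all add: S_def Si_def)
 have GG: "\<Gamma>**\<Gamma> = S**S + mat 1" by (simp add: \<Gamma>_def S_def Cosh_square)
 have SG: "S**\<Gamma> = \<Gamma>**S" by (simp add: \<Gamma>_def S_def Sinh_Cosh_commute)
 have SiG: "Si**\<Gamma> = \<Gamma>**Si" by (simp add: \<Gamma>_def Si_def SinhI_Cosh_commute)
 have ct: "S\<^sup>H = S" "\<Gamma>\<^sup>H = \<Gamma>" "Si\<^sup>H = Si" by (simp_all add: S_def \<Gamma>_def Si_def)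
 \<comment> \<open>Upper right block of g without its factor \<rho>; cosh^2 = sinh^2 + 1 has removed
   the square of cosh.\<close>
 define W where "W = \<Gamma>**Si**\<Omega> - (1 / x) *\<^sub>R Si"
 have W: "\<Gamma>**(Si**(\<Omega> - (1 / x) *\<^sub>R \<Gamma>)) + (1 / x) *\<^sub>R S = W"
 proof -
  have "\<Gamma>**Si**\<Gamma> = Si**(\<Gamma>**\<Gamma>)" by (simp add: SiG[symmetric] mm_assoc)
  also have "... = S + Si" by (simp add: GG mm_ring SS)
  finally show ?thesis by (simp add: W_def mm_ring algebra_simps)
 qed
 have W2: "S**(Si**(\<Omega> - (1 / x) *\<^sub>R \<Gamma>)) + (1 / x) *\<^sub>R \<Gamma> = \<Omega>"
  by (simp add: mm_assoc SS)
 have g: "g = blk (x *\<^sub>R (\<rho>**\<Gamma>)) (\<rho>**W) (x *\<^sub>R S) \<Omega>"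
  unfolding g_def Hyp_def bR_def blk_mult smat_eq S_def[symmetric] \<Gamma>_def[symmetric]
  using W W2 by (simp add: matrix_scaleR_left matrix_scaleR_right mm_assoc[symmetric] matrix_add_ldistrib[symmetric])
   (metis matrix_add_ldistrib matrix_scaleR_right)
 have l: "g**Inn**g\<^sup>H = blk (x^2 *\<^sub>R (\<rho>**\<Gamma>**\<Gamma>**\<rho>\<^sup>H) - \<rho>**W**W\<^sup>H**\<rho>\<^sup>H)
   (x^2 *\<^sub>R (\<rho>**\<Gamma>**S) - \<rho>**W**\<Omega>\<^sup>H)
   ((x^2 *\<^sub>R (\<rho>**\<Gamma>**S) - \<rho>**W**\<Omega>\<^sup>H)\<^sup>H) (x^2 *\<^sub>R (S**S) - \<Omega>**\<Omega>\<^sup>H)"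
  unfolding g Inn_def by (simp add: blk_simps ctrans_simps mm_ring ct power2_eq_square blk_eq_iff)
 have r: "bL \<nu>**Inn**(bL \<nu>)\<^sup>H = blk ((1 / y^2) *\<^sub>R (\<sigma>**\<sigma>\<^sup>H - \<nu>**\<nu>\<^sup>H)) (- \<nu>) ((- \<nu>)\<^sup>H) (- (y^2 *\<^sub>R mat 1))"
  unfolding bL_def Inn_def using y_pos
  by (simp add: blk_simps ctrans_simps mm_ring smat_eq power2_eq_square blk_eq_iff algebra_simps)
 have x1: "x * (1 / x) = 1" "x^2 * (1 / x^2) = 1" "y^2 * (1 / y^2) = 1" using x_pos y_pos by auto
 \<comment> \<open>Given the modulus of \<Omega>, the off-diagonal block can be solved for \<nu>.
   After substitution, y^2 times the upper left block plus \<nu>\<nu>^H loses every term in cosh and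
   depends on \<Omega>^H \<Omega> only.\<close>
 have main: "(x^2 *\<^sub>R (\<rho>**\<Gamma>**S) - \<rho>**W**\<Omega>\<^sup>H = - \<nu>) \<longleftrightarrow> \<nu> = \<rho>**Si**(y^2 *\<^sub>R \<Gamma> - (1 / x) *\<^sub>R \<Omega>\<^sup>H)"
  "\<nu> = \<rho>**Si**(y^2 *\<^sub>R \<Gamma> - (1 / x) *\<^sub>R \<Omega>\<^sup>H) ==>
   (x^2 *\<^sub>R (\<rho>**\<Gamma>**\<Gamma>**\<rho>\<^sup>H) - \<rho>**W**W\<^sup>H**\<rho>\<^sup>H = (1 / y^2) *\<^sub>R (\<sigma>**\<sigma>\<^sup>H - \<nu>**\<nu>\<^sup>H)) \<longleftrightarrow>
   \<sigma>**\<sigma>\<^sup>H = (1 / x^2) *\<^sub>R (\<rho>**Si**(\<Omega>\<^sup>H**\<Omega> - y\<^sup>2 *\<^sub>R mat 1)**Si**\<rho>\<^sup>H)"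
  if O: "\<Omega>**\<Omega>\<^sup>H = y^2 *\<^sub>R mat 1 + x^2 *\<^sub>R (S**S)"
 proof -
  have O': "A**\<Omega>**\<Omega>\<^sup>H = y^2 *\<^sub>R A + x^2 *\<^sub>R (A**S**S)" for A :: "'n cmat"
   unfolding mm_assoc[symmetric] O by (simp add: mm_ring)
  have a: "A**Si**S = A" "A**S**Si = A" for A :: "'n cmat"
   by (simp_all add: mm_assoc[symmetric] SS)
  have b: "A**Si**\<Gamma> = A**\<Gamma>**Si" "A**S**\<Gamma> = A**\<Gamma>**S" for A :: "'n cmat"
   by (simp_all add: mm_assoc[symmetric] SiG SG)
  have "\<rho>**W**\<Omega>\<^sup>H - x\<^sup>2 *\<^sub>R (\<rho>**\<Gamma>**S) = \<rho>**Si**(y^2 *\<^sub>R \<Gamma> - (1 / x) *\<^sub>R \<Omega>\<^sup>H)"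
   by (simp add: W_def mm_ring O' a b)
  then show "(x^2 *\<^sub>R (\<rho>**\<Gamma>**S) - \<rho>**W**\<Omega>\<^sup>H = - \<nu>) \<longleftrightarrow> \<nu> = \<rho>**Si**(y^2 *\<^sub>R \<Gamma> - (1 / x) *\<^sub>R \<Omega>\<^sup>H)"
   by (auto simp: algebra_simps)
  assume \<nu>: "\<nu> = \<rho>**Si**(y^2 *\<^sub>R \<Gamma> - (1 / x) *\<^sub>R \<Omega>\<^sup>H)"
  let ?L = "x^2 *\<^sub>R (\<rho>**\<Gamma>**\<Gamma>**\<rho>\<^sup>H) - \<rho>**W**W\<^sup>H**\<rho>\<^sup>H"
  let ?Z = "(1 / x^2) *\<^sub>R (\<rho>**Si**(\<Omega>\<^sup>H**\<Omega> - y\<^sup>2 *\<^sub>R mat 1)**Si**\<rho>\<^sup>H)"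
  have "y^2 *\<^sub>R ?L + \<nu>**\<nu>\<^sup>H = ?Z"
   unfolding \<nu> W_def
   by (simp add: ctrans_simps mm_ring ct O' a b scaleR_diff_right scaleR_add_right)
     (simp add: algebra_simps power2_eq_square)
  moreover have "A = (1 / y^2) *\<^sub>R B \<longleftrightarrow> y\<^sup>2 *\<^sub>R A = B" for A B :: "'n cmat"
   using y_pos by auto
  ultimately show "?L = (1 / y^2) *\<^sub>R (\<sigma>**\<sigma>\<^sup>H - \<nu>**\<nu>\<^sup>H) \<longleftrightarrow> \<sigma>**\<sigma>\<^sup>H = ?Z"
   by (metis add_diff_cancel_right' diff_add_cancel)
 qed
 have 22: "x^2 *\<^sub>R (S**S) - \<Omega>**\<Omega>\<^sup>H = - (y^2 *\<^sub>R mat 1) \<longleftrightarrow> \<Omega>**\<Omega>\<^sup>H = y^2 *\<^sub>R mat 1 + x^2 *\<^sub>R (S**S)"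
 proof -
  have "a - b = - c \<longleftrightarrow> b = c + a" for a b c :: "'n cmat" by (auto simp: algebra_simps)
  then show ?thesis by this
 qed
 show ?thesis unfolding l r blk_eq_iff ctrans_eq_iff 22 using main by blast
qed

lemma Lam_props:
 "(Lam x y Delta)\<^sup>H = Lam x y Delta" "Lam x y Delta**Lam x y Delta = y^2 *\<^sub>R mat 1 + x^2 *\<^sub>R (Sinh Delta**Sinh Delta)"
 "det (Lam x y Delta) ~= 0"
proof -
 have p: "0 < y^2 + x^2 * (sinh (Delta$i))^2" for i using y_pos by (simp add: add_pos_nonneg)
 have e: "complex_of_real (sqrt (y^2 + x^2 * (sinh (Delta$i))^2)) * complex_of_real (sqrt (y^2 + x^2 * (sinh (Delta$i))^2))
   = of_real (y^2 + x^2 * (sinh (Delta$i))^2)" for i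
  using p[of i] by (simp flip: of_real_mult del: of_real_add)
 show "(Lam x y Delta)\<^sup>H = Lam x y Delta" by (simp add: Lam_def)
 show "Lam x y Delta**Lam x y Delta = y^2 *\<^sub>R mat 1 + x^2 *\<^sub>R (Sinh Delta**Sinh Delta)"
  by (simp add: Lam_def Sinh_def dmat_mult_dmat vec_eq_iff mat_def e)
    (simp add: scaleR_conv_of_real power2_eq_square)
 show "det (Lam x y Delta) ~= 0" using p by (simp add: Lam_def det_dmat less_imp_neq[symmetric])
qed

text \<open>With \<open>\<Omega> = \<Lambda>T\<close> the modulus condition says that \<open>T\<close> is unitary.\<close>

lemma normal_data_iff_metric:
 assumes D: "Delta \<in> chamber" and \<rho>: "unitary \<rho>"
 shows "NF \<rho> Delta T**Inn**(NF \<rho> Delta T)\<^sup>H = bL \<nu>**Inn**(bL \<nu>)\<^sup>H \<longleftrightarrow>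
  normal_data \<sigma> \<rho> Delta T & \<nu> = nN \<rho> Delta T"
proof -
 let ?S = "Sinh Delta" and ?L = "Lam x y Delta" and ?Si = "SinhI Delta"
 let ?W = "?L**T"
 have 1: "?W**?W\<^sup>H = y^2 *\<^sub>R mat 1 + x^2 *\<^sub>R (?S**?S) \<longleftrightarrow> unitary T"
 proof -
  have "?W**?W\<^sup>H = ?L**(T**T\<^sup>H)**?L" by (simp add: ctrans_mult Lam_props mm_assoc)
  moreover have "?L**(T**T\<^sup>H)**?L = ?L**mat 1**?L \<longleftrightarrow> T**T\<^sup>H = mat 1"
   using matrix_mult_cancel_left[OF Lam_props(3)] matrix_mult_cancel_right[OF Lam_props(3)] by metis
  ultimately have "?W**?W\<^sup>H = ?L**?L \<longleftrightarrow> T**T\<^sup>H = mat 1" by simp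
  then show ?thesis unfolding Lam_props unitary_def using matrix_left_right_inverse by metis
 qed
 have 2: "\<sigma>**\<sigma>\<^sup>H = (1 / x^2) *\<^sub>R (\<rho>**?Si**(?W\<^sup>H**?W - y\<^sup>2 *\<^sub>R mat 1)**?Si**\<rho>\<^sup>H) \<longleftrightarrow>
   T\<^sup>H**(?S**?S)**T = ?S**\<rho>\<^sup>H**\<sigma>**\<sigma>\<^sup>H**\<rho>**?S" if T: "unitary T"
 proof -
  let ?M = "T\<^sup>H**(?S**?S)**T"
  have "?W\<^sup>H**?W = T\<^sup>H**(?L**?L)**T" by (simp add: ctrans_mult Lam_props(1) mm_assoc)
  also have "... - y\<^sup>2 *\<^sub>R mat 1 = x^2 *\<^sub>R ?M"
   unfolding Lam_props by (simp add: mm_ring unitaryD[OF T])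
  finally have "(1 / x^2) *\<^sub>R (\<rho>**?Si**(?W\<^sup>H**?W - y\<^sup>2 *\<^sub>R mat 1)**?Si**\<rho>\<^sup>H) = \<rho>**?Si**?M**?Si**\<rho>\<^sup>H"
   using x_pos by (simp add: matrix_scaleR_left matrix_scaleR_right)
  moreover have "\<sigma>**\<sigma>\<^sup>H = \<rho>**?Si**?M**?Si**\<rho>\<^sup>H \<longleftrightarrow> ?S**\<rho>\<^sup>H**(\<sigma>**\<sigma>\<^sup>H)**\<rho>**?S = ?M"
  proof
   assume e: "\<sigma>**\<sigma>\<^sup>H = \<rho>**?Si**?M**?Si**\<rho>\<^sup>H"
   have "?S**\<rho>\<^sup>H**(\<sigma>**\<sigma>\<^sup>H)**\<rho>**?S = ?S**(\<rho>\<^sup>H**\<rho>)**?Si**?M**?Si**(\<rho>\<^sup>H**\<rho>)**?S"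
    unfolding e by (simp only: mm_assoc)
   also have "... = (?S**?Si)**?M**(?Si**?S)"
    unfolding unitaryD[OF \<rho>] by (simp only: mm_assoc matrix_mul_rid matrix_mul_lid)
   finally show "?S**\<rho>\<^sup>H**(\<sigma>**\<sigma>\<^sup>H)**\<rho>**?S = ?M" by (simp add: Sinh_SinhI[OF D])
  next
   assume e: "?S**\<rho>\<^sup>H**(\<sigma>**\<sigma>\<^sup>H)**\<rho>**?S = ?M"
   have "\<rho>**?Si**?M**?Si**\<rho>\<^sup>H = \<rho>**(?Si**?S)**\<rho>\<^sup>H**(\<sigma>**\<sigma>\<^sup>H)**\<rho>**(?S**?Si)**\<rho>\<^sup>H"
    unfolding e[symmetric] by (simp only: mm_assoc)
   also have "... = (\<rho>**\<rho>\<^sup>H)**(\<sigma>**\<sigma>\<^sup>H)**(\<rho>**\<rho>\<^sup>H)"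
    unfolding Sinh_SinhI[OF D] by (simp only: mm_assoc matrix_mul_rid matrix_mul_lid)
   finally show "\<sigma>**\<sigma>\<^sup>H = \<rho>**?Si**?M**?Si**\<rho>\<^sup>H" by (simp add: unitaryD[OF \<rho>])
  qed
  ultimately show ?thesis by (auto simp: mm_assoc)
 qed
 show ?thesis
  unfolding normal_form_eq[OF D] metric_normal_form[OF D \<rho>] 1 normal_data_def
  using 2 D \<rho> by blast
qed

lemma normal_form_constrained:
 assumes "normal_data \<sigma> \<rho> Delta T" "det \<rho> = 1"
 shows "NF \<rho> Delta T \<in> C" "k_L (NF \<rho> Delta T) = kN \<rho> Delta" "b_R (NF \<rho> Delta T) = bR (wN Delta T)"
  "b_L (NF \<rho> Delta T) = bL (nN \<rho> Delta T)"
proof -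
 have D: "Delta \<in> chamber" "unitary \<rho>" using assms by (auto simp: normal_data_def)
 note * = constrainedI_metric[OF _ kN_regular[OF D(2,1)] normal_form_eq[OF D(1)]]
 have k: "kN \<rho> Delta \<in> SUnn" using kN_SUnn D assms by simp
 have m: "NF \<rho> Delta T**Inn**(NF \<rho> Delta T)\<^sup>H = bL (nN \<rho> Delta T)**Inn**(bL (nN \<rho> Delta T))\<^sup>H"
  using normal_data_iff_metric[OF D] assms by blast
 show "NF \<rho> Delta T \<in> C" "k_L (NF \<rho> Delta T) = kN \<rho> Delta" "b_R (NF \<rho> Delta T) = bR (wN Delta T)"
  "b_L (NF \<rho> Delta T) = bL (nN \<rho> Delta T)"
  using *[OF k m] .
qed

lemma normal_form_constrainedD:
 assumes "NF \<rho> Delta T \<in> C" "unitary \<rho>" "Delta \<in> chamber"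
 shows "normal_data \<sigma> \<rho> Delta T" "det \<rho> = 1"
proof -
 obtain \<nu> where \<nu>: "b_L (NF \<rho> Delta T) = bL \<nu>" using assms(1) by (auto elim: constrainedE)
 show "normal_data \<sigma> \<rho> Delta T"
  using normal_data_iff_metric[OF assms(3,2)] constrained_metric[OF assms(1) \<nu>] by blast
 have "det (NF \<rho> Delta T) = 1" using assms(1) by (simp add: constrained_def leaf_def)
 then show "det \<rho> = 1"
  by (simp add: normal_form_eq[OF assms(3)] det_mul det_Hyp det_blk_upper)
qed

lemma exists_root: "cmod z = 1 ==> 0 < m ==> \<exists>c. c ^ m = z & cmod c = 1"
proof -
 assume z: "cmod z = 1" and m: "0 < m"
 then obtain t where t: "z = cis t" by (metis rcis_cmod_Arg rcis_def of_real_1 mult_1)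
 have "cis (t / m) ^ m = z" using m by (simp add: Complex.DeMoivre t)
 then show ?thesis by (intro exI[of _ "cis (t / m)"]) simp
qed

lemma exists_normal_form:
 assumes g: "g \<in> C" shows "\<exists>\<rho> Delta T. normal_data \<sigma> \<rho> Delta T & (g, NF \<rho> Delta T) \<in> G"
proof -
 obtain K \<omega> \<nu> kR where gf: "K \<in> SUnn" "regular K" "kR \<in> SUnn" "g = K**bR \<omega>" "g = bL \<nu>**kR"
  using g by (rule constrainedE)
 obtain \<rho> \<tau> k l Delta where u: "unitary \<rho>" "unitary \<tau>" "unitary k" "unitary l" "Delta \<in> chamber"
  "K = blk \<rho> 0 0 \<tau>**Hyp Delta**blk k 0 0 l" using gf(2) by (rule regularE)
 have "det K = 1" using gf by (simp add: SUnn_iff)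
 then have dets: "det \<rho> * det \<tau> * (det k * det l) = 1"
  by (simp add: u(6) det_mul det_blk_upper det_Hyp)
 \<comment> \<open>Undoing k and l on the right produces the determinant conj(det k det l); a common
   phase c contributes c^(2n) and restores 1. Being scalar, it commutes through to the left.\<close>
 obtain c where c: "c ^ (2 * CARD('n)) = det k * det l" "cmod c = 1"
  using exists_root[of "det k * det l" "2 * CARD('n)"] u by (auto simp: norm_mult unitary_det)
 \<comment> \<open>The lower left factor now carries conj(c) and undoes \<tau>; the scalar d, which
   lies in the stabiliser, balances the determinant on that side.\<close>
 obtain d where d: "d ^ CARD('n) = c ^ CARD('n) * det \<tau>" "cmod d = 1"
  using exists_root[of "c ^ CARD('n) * det \<tau>" "CARD('n)"] u c by (auto simp: norm_mult norm_power unitary_det)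
 let ?r = "mat (cnj c)**\<tau>\<^sup>H" and ?R = "mat d :: 'n cmat" and ?k1 = "k\<^sup>H**mat c" and ?k2 = "l\<^sup>H**mat c"
 have cc: "cnj c * c = 1" "c * cnj c = 1" using c(2) by (simp_all add: complex_norm_square[symmetric] mult.commute)
 have ud: "cnj (det U) * det U = 1" if "unitary U" for U :: "'n cmat"
  by (metis det_I det_ctrans det_mul that unitary_def)
 have "det ?R * det ?r = (cnj c ^ CARD('n) * c ^ CARD('n)) * (cnj (det \<tau>) * det \<tau>)"
  by (simp add: det_mul det_mat det_ctrans d algebra_simps)
 then have d1: "det ?R * det ?r = 1" by (simp add: ud u power_mult_distrib[symmetric] cc)
 have "det ?k1 * det ?k2 = (cnj (det k) * det k) * (cnj (det l) * det l)"
  using c(1) by (simp add: det_mul det_mat det_ctrans power_mult power2_eq_square algebra_simps power_mult_distrib)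
 then have d2: "det ?k1 * det ?k2 = 1" by (simp add: ud u)
 let ?\<rho> = "mat (d * c)**\<rho>" and ?h = "blk ?R 0 0 ?r**g**blk ?k1 0 0 ?k2"
 have us: "unitary ?\<rho>" "unitary ?r" "unitary ?k1" "unitary ?k2" "stab ?R"
  using u c d by (auto intro!: unitary_mult unitary_mat stab_mat simp: norm_mult)
 have "blk ?R 0 0 ?r**K**blk ?k1 0 0 ?k2 = blk (?R**\<rho>) 0 0 (?r**\<tau>)**Hyp Delta**blk (k**?k1) 0 0 (l**?k2)"
  by (simp add: u(6) blk_mult Hyp_def mm_assoc)
 also have "... = blk (?R**\<rho>) 0 0 (mat (cnj c))**Hyp Delta**mat c"
  by (simp add: mm_assoc unitaryD u blk_mat) (simp add: mm_assoc[symmetric] unitaryD u)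
 also have "... = kN ?\<rho> Delta"
  unfolding mat_mult_commute unfolding mat_eq_blk
  by (simp add: mm_assoc blk_mult mat_mult_mat cc mult.commute)
 finally have K: "blk ?R 0 0 ?r**K**blk ?k1 0 0 ?k2 = kN ?\<rho> Delta" .
 note st = gauge_step[OF gf us(5,2) d1 us(3,4) d2 refl]
 define \<omega>' where "\<omega>' = ?k1\<^sup>H**\<omega>**?k2"
 \<comment> \<open>\<open>T\<close> is the solution of \<open>wN Delta T = \<omega>'\<close>; its
   unitarity comes afterwards, from membership in the constrained set.\<close>
 define T where "T = matrix_inv (Lam x y Delta)**(Sinh Delta**\<omega>' + (1 / x) *\<^sub>R Cosh Delta)"
 have "wN Delta T = \<omega>'"
  unfolding T_def by (simp add: mm_assoc matrix_inv_works Lam_props Sinh_SinhI[OF u(5)])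
 then have h: "?h = NF ?\<rho> Delta T"
  using leafD(6)[of ?h] st(1) unfolding st K normal_form_eq[OF u(5)] \<omega>'_def[symmetric]
  by (simp add: constrained_def)
 have "(g, ?h) \<in> G" by (rule gauge_relI[OF g us(5,2) d1 us(3,4) d2 refl])
 moreover have "normal_data \<sigma> ?\<rho> Delta T" using normal_form_constrainedD(1)[of ?\<rho> Delta T] st(1) us u unfolding h by blast
 ultimately show ?thesis unfolding h by blast
qed

lemma sinh_sigma_outer:
 assumes "unitary \<rho>"
 shows "Sinh Delta**\<rho>\<^sup>H**\<sigma>**\<sigma>\<^sup>H**\<rho>**Sinh Delta
  = \<alpha>^2 *\<^sub>R (Sinh Delta**Sinh Delta) + outer (Sinh Delta *v (\<rho>\<^sup>H *v vh))"
proof -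
 let ?A = "Sinh Delta**\<rho>\<^sup>H"
 have "Sinh Delta**\<rho>\<^sup>H**\<sigma>**\<sigma>\<^sup>H**\<rho>**Sinh Delta = ?A**(\<sigma>**\<sigma>\<^sup>H)**?A\<^sup>H"
  by (simp add: ctrans_mult mm_assoc)
 also have "... = \<alpha>^2 *\<^sub>R (?A**?A\<^sup>H) + ?A**outer vh**?A\<^sup>H"
  by (simp add: sigma_outer smat_eq mm_ring)
 also have "?A**?A\<^sup>H = Sinh Delta**(\<rho>\<^sup>H**\<rho>)**Sinh Delta" by (simp add: ctrans_mult mm_assoc)
 finally show ?thesis by (simp add: unitaryD[OF assms] outer_mult_vec matrix_vector_mul_assoc)
qed

end

subsection \<open>Rank-one perturbations of diagonal matrices\<close>

text \<open>Characteristic polynomials are compared after division by the m_k - t, hence only off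
  finitely many t; continuity supplies the missing values.\<close>

lemma isCont_eq_zero_off_finite:
 fixes f :: "real => real"
 assumes "isCont f t" "finite A" "!!s. s \<notin> A ==> f s = 0"
 shows "f t = 0"
proof -
 have "open (- (A - {t}))" using assms(2) by (intro open_Compl finite_imp_closed) auto
 then have "\<forall>\<^sub>F s in at t. s \<in> - (A - {t})" by (rule eventually_at_in_open') auto
 moreover have "\<forall>\<^sub>F s in at t. s ~= t" by (simp add: eventually_at_filter)
 ultimately have "\<forall>\<^sub>F s in at t. f s = 0"
  by eventually_elim (use assms(3) in auto)
 then have "(f \<longlongrightarrow> 0) (at t)" by (simp add: tendsto_eventually)
 then show ?thesis using assms(1) tendsto_unique[of "at t" f "f t" 0] by (simp add: isCont_def)
qed

text \<open>For u_k = v_k^2 this says that diag(l) and diag(m) + v v^T have the same characteristic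
  polynomial. Without denominators it may be evaluated at the m_k as well.\<close>

definition secular :: "('n::finite => real) => ('n => real) => ('n => real) => bool"
 where "secular l m u \<longleftrightarrow> (\<forall>t. (\<Prod>i\<in>UNIV. l i - t) =
  (\<Prod>k\<in>UNIV. m k - t) + (\<Sum>k\<in>UNIV. u k * (\<Prod>j\<in>UNIV - {k}. m j - t)))"

lemma prod_remove_UNIV: "(\<Prod>i\<in>UNIV. f i) = f k * (\<Prod>i\<in>UNIV - {k}. f i)" for f :: "'n::finite => 'a::comm_monoid_mult"
 by (rule prod.remove) auto

lemma sum_remove_UNIV: "(\<Sum>i\<in>UNIV. f i) = f k + (\<Sum>i\<in>UNIV - {k}. f i)" for f :: "'n::finite => 'a::comm_monoid_add"
 by (rule sum.remove) auto

text \<open>At t = m_k only the k-th summand on the right survives.\<close>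

lemma secularD:
 assumes "secular l m u"
 shows "u k * (\<Prod>j\<in>UNIV - {k}. m j - m k) = (\<Prod>i\<in>UNIV. l i - m k)"
proof -
 have "(\<Sum>i\<in>UNIV - {k}. u i * (\<Prod>j\<in>UNIV - {i}. m j - m k)) = 0"
  by (intro sum.neutral ballI) (auto intro!: prod_zero)
 moreover have "(\<Prod>i\<in>UNIV. m i - m k) = 0" by (rule prod_zero) auto
 ultimately show ?thesis
  using assms[unfolded secular_def, rule_format, of "m k"] by (simp add: sum_remove_UNIV[of _ k])
qed

text \<open>Lagrange interpolation: both sides have leading coefficient (-1)^n, so their difference
  has degree below n, and it vanishes at the n distinct points m_k.\<close>

lemma secularI:
 assumes m: "inj m" and u: "!!k. u k * (\<Prod>j\<in>UNIV - {k}. m j - m k) = (\<Prod>i\<in>UNIV. l i - m k)"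
 shows "secular l m (u :: 'n::finite => real)"
proof -
 let ?n = "CARD('n)"
 define L where "L = (\<Prod>i\<in>UNIV. [:l i, -1:])"
 define M where "M = (\<Prod>i\<in>UNIV. [:m i, -1:])"
 define U where "U = (\<Sum>k\<in>UNIV. smult (u k) (\<Prod>j\<in>UNIV - {k}. [:m j, -1:]))"
 define P where "P = L - M - U"
 have deg: "degree (\<Prod>i\<in>A. [:f i, -1:]) \<le> card A" "coeff (\<Prod>i\<in>A. [:f i, -1:]) (card A) = (-1) ^ card A"
  for f :: "'n => real" and A
 proof -
  have "degree (\<Prod>i\<in>A. [:f i, -1:]) = card A" by (subst degree_prod_eq_sum_degree) auto
  moreover have "lead_coeff (\<Prod>i\<in>A. [:f i, -1:]) = (-1) ^ card A" by (simp add: lead_coeff_prod)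
  ultimately show "degree (\<Prod>i\<in>A. [:f i, -1:]) \<le> card A" "coeff (\<Prod>i\<in>A. [:f i, -1:]) (card A) = (-1) ^ card A"
   by auto
 qed
 have n0: "0 < ?n" by simp
 have dU: "degree U < ?n"
 proof -
  have "degree (smult (u k) (\<Prod>j\<in>UNIV - {k}. [:m j, -1:])) \<le> ?n - 1" for k
   using deg(1)[of m "UNIV - {k}"] by (metis card_Diff_singleton degree_smult_le iso_tuple_UNIV_I le_trans)
  then have "degree U \<le> ?n - 1" unfolding U_def by (intro degree_sum_le) auto
  then show ?thesis using n0 by linarith
 qed
 have "degree P \<le> ?n"
  unfolding P_def L_def M_def using dU deg(1)[of l UNIV] deg(1)[of m UNIV]
  by (intro degree_diff_le) auto
 moreover have "coeff P ?n = 0"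
  using deg(2)[of l UNIV] deg(2)[of m UNIV] dU by (simp add: P_def L_def M_def coeff_eq_0)
 ultimately have "P = 0 \<or> degree P < ?n"
  by (metis le_neq_implies_less leading_coeff_0_iff)
 moreover have roots: "poly P (m k) = 0" for k
 proof -
  have "(\<Sum>i\<in>UNIV - {k}. u i * (\<Prod>j\<in>UNIV - {i}. m j - m k)) = 0"
   by (intro sum.neutral ballI) (auto intro!: prod_zero)
  moreover have "(\<Prod>i\<in>UNIV. m i - m k) = 0" by (rule prod_zero) auto
  ultimately show ?thesis
   by (simp add: P_def L_def M_def U_def poly_prod poly_sum u[symmetric] sum_remove_UNIV[of _ k])
 qed
 moreover have "?n \<le> card {t. poly P t = 0}" if "P ~= 0"
 proof -
  have "card (range m) = ?n" using m by (simp add: card_image)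
  moreover have "range m \<subseteq> {t. poly P t = 0}" using roots by auto
  ultimately show ?thesis using card_mono[OF poly_roots_finite[OF that]] by metis
 qed
 ultimately have "P = 0" using card_poly_roots_bound[of P] by force
 then have "poly L t = poly M t + poly U t" for t
  by (metis P_def add.commute diff_add_cancel eq_iff_diff_eq_0 poly_add)
 then show ?thesis
  unfolding secular_def by (simp add: L_def M_def U_def poly_prod poly_sum)
qed

lemma secular_factor:
 assumes "secular l m u" "!!k. m k ~= t"
 shows "(\<Prod>i\<in>UNIV. l i - t) = (\<Prod>k\<in>UNIV. m k - t) * (1 + (\<Sum>k\<in>UNIV. u k / (m k - t)))"
proof -
 have "u k * (\<Prod>j\<in>UNIV - {k}. m j - t) = (\<Prod>j\<in>UNIV. m j - t) * (u k / (m k - t))" for k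
  using assms(2)[of k] by (simp add: prod_remove_UNIV[of _ k])
 then show ?thesis
  using assms(1) by (simp add: secular_def distrib_left sum_distrib_left)
qed

lemma secular_equation:
 assumes "secular l m u" "!!k. l i ~= m k"
 shows "1 + (\<Sum>k\<in>UNIV. u k / (m k - l i)) = 0"
proof -
 have "(\<Prod>j\<in>UNIV. l j - l i) = 0" by (rule prod_zero) auto
 moreover have "(\<Prod>k\<in>UNIV. m k - l i) ~= 0" using not_sym[OF assms(2)] by simp
 ultimately show ?thesis
  using secular_factor[OF assms(1), of "l i"] assms(2) by (metis mult_eq_0_iff)
qed

lemma secular_sum:
 assumes "secular l m u" "!!k. l i ~= m k"
 shows "(\<Sum>k\<in>UNIV. u k / (l i - m k)) = 1"
proof -
 have "u k / (m k - l i) = - (u k / (l i - m k))" for k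
  by (metis minus_diff_eq minus_divide_right)
 then show ?thesis using secular_equation[OF assms] by (simp add: sum_negf)
qed

text \<open>This is the derivative of the characteristic polynomial at the eigenvalue \<open>l i\<close>.\<close>

lemma secular_sum_square:
 assumes s: "secular l m u" and n: "!!k. l i ~= m k"
 shows "(\<Sum>k\<in>UNIV. u k / (l i - m k)^2) * (\<Prod>k\<in>UNIV. m k - l i) = - (\<Prod>j\<in>UNIV - {i}. l j - l i)"
proof -
 \<comment> \<open>The secular identity divided by l_i - t: it vanishes off l_i and the m_k, and its
   value at l_i, reached by continuity, is the claim.\<close>
 define f where "f t = (\<Sum>k\<in>UNIV. u k / ((m k - t) * (m k - l i))) * (\<Prod>k\<in>UNIV. m k - t) + (\<Prod>j\<in>UNIV - {i}. l j - t)" for t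
 have n': "m k ~= l i" for k using n[of k] by simp
 have "f (l i) = 0"
 proof (rule isCont_eq_zero_off_finite[where f = f and t = "l i" and A = "insert (l i) (range m)"])
  show "isCont f (l i)" unfolding f_def using n' by (intro continuous_intros) auto
  show "finite (insert (l i) (range m))" by simp
  fix t assume t: "t \<notin> insert (l i) (range m)"
  then have mt: "m k ~= t" for k by auto
  have "1 + (\<Sum>k\<in>UNIV. u k / (m k - l i)) = 0"
   by (rule secular_equation[OF s n])
  then have "1 + (\<Sum>k\<in>UNIV. u k / (m k - t)) = (\<Sum>k\<in>UNIV. u k / (m k - t)) - (\<Sum>k\<in>UNIV. u k / (m k - l i))"
   by linarith
  then have "(\<Prod>j\<in>UNIV. l j - t) = (\<Prod>k\<in>UNIV. m k - t) * ((\<Sum>k\<in>UNIV. u k / (m k - t)) - (\<Sum>k\<in>UNIV. u k / (m k - l i)))"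
   using secular_factor[OF s mt] by simp
  also have "(\<Sum>k\<in>UNIV. u k / (m k - t)) - (\<Sum>k\<in>UNIV. u k / (m k - l i))
    = (t - l i) * (\<Sum>k\<in>UNIV. u k / ((m k - t) * (m k - l i)))"
   unfolding sum_subtractf[symmetric] sum_distrib_left
  proof (rule sum.cong[OF refl])
   fix k
   have "m k - t ~= 0" "m k - l i ~= 0" using mt n' by auto
   then show "u k / (m k - t) - u k / (m k - l i) = (t - l i) * (u k / ((m k - t) * (m k - l i)))"
    by (simp add: divide_simps) (simp add: algebra_simps)
  qed
  finally have "(l i - t) * f t = 0"
   unfolding f_def by (simp add: prod_remove_UNIV[of "%j. l j - t" i] algebra_simps)
  then show "f t = 0" using t by auto
 qed
 moreover have "(m k - l i) * (m k - l i) = (l i - m k)^2" for k by (simp add: power2_eq_square algebra_simps)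
 ultimately show ?thesis unfolding f_def by (simp add: eq_neg_iff_add_eq_0)
qed

text \<open>Here a stands for \<alpha>^2. Reversing the factors with index above k in both products
  extracts the same power of -1, so the sign of u_k, their quotient, is that of the product of a l_k
  - l_i over i > k.\<close>

lemma secular_prod_split:
 fixes l :: "'n::{finite,linorder} => real"
 assumes dec: "!!i j. i < j ==> l j < l i" and pos: "!!i. 0 < l i" and a: "0 < a" "a < 1"
 shows "\<exists>c X Y. 0 < X & 0 < Y & (\<Prod>j\<in>UNIV - {k}. a * l j - a * l k) = (-1) ^ c * X &
  (\<Prod>i\<in>UNIV. l i - a * l k) = (-1) ^ c * Y * (\<Prod>i\<in>{k<..}. a * l k - l i)"
proof -
 have neg: "(\<Prod>i\<in>A. f i - (b::real)) = (-1) ^ card A * (\<Prod>i\<in>A. b - f i)" for A :: "'n set" and f b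
  by (simp flip: prod_constant prod.distrib)
 have U: "UNIV - {k} = {..<k} \<union> {k<..}" "UNIV = {..k} \<union> {k<..}" by auto
 have 1: "(\<Prod>j\<in>UNIV - {k}. a * l j - a * l k) = (\<Prod>j\<in>{..<k}. a * l j - a * l k) * (\<Prod>j\<in>{k<..}. a * l j - a * l k)"
  by (subst U(1), rule prod.union_disjoint) auto
 have 2: "(\<Prod>i\<in>UNIV. l i - a * l k) = (\<Prod>i\<in>{..k}. l i - a * l k) * (\<Prod>i\<in>{k<..}. l i - a * l k)"
  by (subst U(2), rule prod.union_disjoint) auto
 have p1: "0 < (\<Prod>j\<in>{..<k}. a * l j - a * l k)" "0 < (\<Prod>j\<in>{k<..}. a * l k - a * l j)"
  using dec a by (auto intro!: prod_pos)
 have "a * l k < l i" if "i \<le> k" for i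
  using dec[of i k] pos[of k] a that by (cases "i = k") (auto intro: less_trans[of "a * l k" "l k"])
 then have p2: "0 < (\<Prod>i\<in>{..k}. l i - a * l k)" by (auto intro!: prod_pos)
 show ?thesis
  using p1 p2 unfolding 1 2 neg[of _ _ "{k<..}"]
  by (intro exI[of _ "card {k<..}"] exI[of _ "(\<Prod>j\<in>{..<k}. a * l j - a * l k) * (\<Prod>j\<in>{k<..}. a * l k - a * l j)"]
    exI[of _ "\<Prod>i\<in>{..k}. l i - a * l k"]) auto
qed

text \<open>Induction from the top index down. If m is the successor of k, the hypothesis for m
  gives l_j \<le> a l_m < a l_k for all j > m, so every factor except a l_k - l_m is positive and
  u_k \<ge> 0 decides that one. The inequality is weak because u_k may vanish.\<close>

lemma secular_interlace:
 fixes l :: "'n::{finite,linorder} => real"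
 assumes dec: "!!i j. i < j ==> l j < l i" and pos: "!!i. 0 < l i" and a: "0 < a" "a < 1"
  and u: "!!k. 0 \<le> u k" "!!k. u k * (\<Prod>j\<in>UNIV - {k}. a * l j - a * l k) = (\<Prod>i\<in>UNIV. l i - a * l k)"
 shows "k < i ==> l i \<le> a * l k"
proof (induction k arbitrary: i rule: measure_induct_rule[where f = "%k. card {k<..}"])
 case (less k)
 define m where "m = Min {k<..}"
 have A: "{k<..} ~= {}" using less(2) by auto
 then have m: "k < m" "!!j. k < j ==> m \<le> j" using Min_in[OF _ A] by (auto simp: m_def)
 have "card {m<..} < card {k<..}" using m by (intro psubset_card_mono) auto
 note IH = less(1)[OF this]
 have lt: "l j < a * l k" if "k < j" "j ~= m" for j
 proof -
  have "l j \<le> a * l m" using IH m that by (metis le_neq_trans)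
  also have "... < a * l k" using dec m a by simp
  finally show ?thesis .
 qed
 obtain c X Y where *: "0 < X" "0 < Y" "(\<Prod>j\<in>UNIV - {k}. a * l j - a * l k) = (-1) ^ c * X"
  "(\<Prod>i\<in>UNIV. l i - a * l k) = (-1) ^ c * Y * (\<Prod>i\<in>{k<..}. a * l k - l i)"
  using secular_prod_split[of l a k, OF dec pos a] by metis
 then have "(-1) ^ c * (u k * X) = (-1) ^ c * (Y * (\<Prod>i\<in>{k<..}. a * l k - l i))"
  using u(2)[of k] by (simp add: algebra_simps)
 then have "u k * X = Y * (\<Prod>i\<in>{k<..}. a * l k - l i)" by (simp only: mult_cancel_left) auto
 then have "0 \<le> (\<Prod>i\<in>{k<..}. a * l k - l i)" using * u(1)[of k]
  by (metis less_eq_real_def mult_nonneg_nonneg zero_le_mult_iff not_less)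
 also have "... = (a * l k - l m) * (\<Prod>i\<in>{k<..} - {m}. a * l k - l i)"
  using m by (intro prod.remove) auto
 finally have "0 \<le> a * l k - l m"
  using lt m prod_pos[of "{k<..} - {m}" "%i. a * l k - l i"]
  by (auto simp: zero_le_mult_iff)
 then show ?case using lt[of i] less(2) by (cases "i = m") auto
qed

lemma secular_weight_pos:
 fixes l :: "'n::{finite,linorder} => real"
 assumes gap: "!!i j. i < j ==> l j < a * l i" and pos: "!!i. 0 < l i" and a: "0 < a" "a < 1"
 shows "0 < (\<Prod>i\<in>UNIV. l i - a * l k) / (\<Prod>j\<in>UNIV - {k}. a * l j - a * l k)"
proof -
 have dec: "l j < l i" if "i < j" for i j
  using gap[OF that] pos[of i] a by (smt (verit) mult_less_cancel_right1)
 obtain c X Y where *: "0 < X" "0 < Y" "(\<Prod>j\<in>UNIV - {k}. a * l j - a * l k) = (-1) ^ c * X"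
  "(\<Prod>i\<in>UNIV. l i - a * l k) = (-1) ^ c * Y * (\<Prod>i\<in>{k<..}. a * l k - l i)"
  using secular_prod_split[of l a k, OF dec pos a] by metis
 have "0 < (\<Prod>i\<in>{k<..}. a * l k - l i)" using gap by (intro prod_pos) auto
 moreover have "(-1) ^ c * Y * P / ((-1) ^ c * X) = Y * P / X" for P :: real by (simp add: mult.assoc)
 ultimately show ?thesis unfolding * by (simp add: * mult.assoc)
qed

subsection \<open>The real orthogonal matrix of the normal form\<close>

lemma T_tilde_nth:
 fixes S v :: "('n::finite) rvec"
 assumes "!!i j. (S$i)^2 ~= \<alpha>^2 * (S$j)^2"
 shows "T_tilde \<alpha> S v$i$j = v$j / ((S$i)^2 - \<alpha>\<^sup>2 * (S$j)^2) /
  sqrt (\<Sum>k\<in>UNIV. (v$k)^2 / ((S$i)^2 - \<alpha>\<^sup>2 * (S$k)^2)^2)"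
proof -
 have "mat ((S$i)^2) - \<alpha>\<^sup>2 *\<^sub>R (dmat S**dmat S) = dmat (\<chi> k. (S$i)^2 - \<alpha>\<^sup>2 * (S$k)^2)" for i
  by (simp add: dmat_mult_dmat vec_eq_iff mat_def power2_eq_square)
 then have N: "matrix_inv (mat ((S$i)^2) - \<alpha>\<^sup>2 *\<^sub>R (dmat S**dmat S))
   = dmat (\<chi> k. inverse ((S$i)^2 - \<alpha>\<^sup>2 * (S$k)^2))" for i
  using assms by (simp add: matrix_inv_dmat)
 have "v \<bullet> ((dmat n**dmat n) *v v) = (\<Sum>k\<in>UNIV. (v$k)^2 * (n$k)^2)" for n
  by (simp add: dmat_mult_dmat dmat_vector inner_vec_def power2_eq_square mult_ac)
 then show ?thesis
  unfolding T_tilde_def Let_def N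
  by (simp add: dmat_vector divide_inverse mult_ac power_inverse)
qed

text \<open>Row i is the normalised eigenvector (l_i - m)^(-1) v of diag(m) + v v^T for the
  eigenvalue l_i; the eigenvalue equation is the secular equation, that the v_k^2/(l_i - m_k) sum to
  1.\<close>

lemma T_tilde_orthogonal:
 fixes S v :: "('n::finite) rvec"
 assumes S: "inj (%i. (S$i)^2)" and ne: "!!i j. (S$i)^2 ~= \<alpha>^2 * (S$j)^2"
  and v: "!!k. v$k ~= 0"
  and sec: "secular (%i. (S$i)^2) (%i. \<alpha>^2 * (S$i)^2) (%k. (v$k)^2)"
 shows "orthogonal_matrix (T_tilde \<alpha> S v)"
  "(\<Sum>j\<in>UNIV. T_tilde \<alpha> S v$j$i * (S$j)^2 * T_tilde \<alpha> S v$j$k) =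
   (if i = k then \<alpha>\<^sup>2 * (S$i)^2 else 0) + v$i * v$k"
proof -
 let ?l = "%i. (S$i)^2" and ?m = "%i. \<alpha>^2 * (S$i)^2" and ?T = "T_tilde \<alpha> S v"
 define N where "N i = (\<Sum>k\<in>UNIV. (v$k)^2 / (?l i - ?m k)^2)" for i
 have Npos: "0 < N i" for i unfolding N_def using v ne by (intro sum_pos) auto
 have T: "?T$i$j = v$j / (?l i - ?m j) / sqrt (N i)" for i j
  using T_tilde_nth[OF ne] by (simp add: N_def)
 have sum1: "(\<Sum>k\<in>UNIV. (v$k)^2 / (?l i - ?m k)) = 1" for i
  using secular_sum[OF sec] ne by simp
 have TT: "?T**Finite_Cartesian_Product.transpose ?T = mat 1"
 proof -
  have "(\<Sum>k\<in>UNIV. ?T$i$k * ?T$j$k) = (if i = j then 1 else 0)" for i j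
  proof (cases "i = j")
   case True
   have "(\<Sum>k\<in>UNIV. ?T$i$k * ?T$i$k) = (\<Sum>k\<in>UNIV. (v$k)^2 / (?l i - ?m k)^2) / N i"
    unfolding T sum_divide_distrib using Npos[of i] less_imp_le[OF Npos[of i]]
    by (intro sum.cong) (simp_all add: power2_eq_square)
   then show ?thesis using True Npos[of i] by (simp add: N_def)
  next
   case False
   then have l: "?l i ~= ?l j" using S by (auto dest: injD)
   \<comment> \<open>Partial fractions turn the inner product of two rows into a difference of two
     secular sums, each equal to 1.\<close>
   have "?T$i$k * ?T$j$k = ((v$k)^2 / (?l j - ?m k) - (v$k)\<^sup>2 / (?l i - ?m k)) / ((?l i - ?l j) * (sqrt (N i) * sqrt (N j)))" for k
   proof -
    have "?l i - ?m k ~= 0" "?l j - ?m k ~= 0" "?l i - ?l j ~= 0" using l ne by auto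
    then have "v$k / (?l i - ?m k) * (v$k / (?l j - ?m k)) = ((v$k)^2 / (?l j - ?m k) - (v$k)\<^sup>2 / (?l i - ?m k)) / (?l i - ?l j)"
     by (simp add: divide_simps) algebra
    then have "v$k / (?l i - ?m k) / sqrt (N i) * (v$k / (?l j - ?m k) / sqrt (N j))
     = ((v$k)^2 / (?l j - ?m k) - (v$k)\<^sup>2 / (?l i - ?m k)) / (?l i - ?l j) / (sqrt (N i) * sqrt (N j))"
     by (simp only: times_divide_times_eq)
    then show ?thesis unfolding T by (simp only: divide_divide_eq_left)
   qed
   then show ?thesis using False
    by (simp add: sum_divide_distrib[symmetric] sum_subtractf sum1)
  qed
  then show ?thesis by (simp add: vec_eq_iff matrix_mult_nth Finite_Cartesian_Product.transpose_def mat_def)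
 qed
 then show orth: "orthogonal_matrix ?T"
  by (simp add: orthogonal_matrix_def matrix_left_right_inverse)
 define M :: "real ^ 'n ^ 'n" where "M = (\<chi> i k. (if i = k then ?m i else 0) + v$i * v$k)"
 have "?T**M = dmat (\<chi> i. ?l i)**?T"
 proof -
  have "(\<Sum>k\<in>UNIV. ?T$i$k * M$k$j) = ?l i * ?T$i$j" for i j
  proof -
   have "(\<Sum>k\<in>UNIV. ?T$i$k * M$k$j) = ?T$i$j * ?m j + (\<Sum>k\<in>UNIV. ?T$i$k * v$k) * v$j"
    by (simp add: M_def distrib_left sum.distrib sum_distrib_right mult.assoc if_distrib [of "%x. _ * x"] cong: if_cong)
   also have "(\<Sum>k\<in>UNIV. ?T$i$k * v$k) = (\<Sum>k\<in>UNIV. (v$k)^2 / (?l i - ?m k)) / sqrt (N i)"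
    unfolding T sum_divide_distrib by (simp add: power2_eq_square)
   also have "... = 1 / sqrt (N i)" by (simp add: sum1)
   also have "?T$i$j * ?m j + 1 / sqrt (N i) * v$j = ?l i * ?T$i$j"
    unfolding T using ne[of i j] Npos[of i] by (simp add: field_simps)
   finally show ?thesis .
  qed
  then show ?thesis by (simp add: vec_eq_iff dmat_mult_left) (simp add: matrix_mult_nth)
 qed
 then have "Finite_Cartesian_Product.transpose ?T**(dmat (\<chi> i. ?l i)**?T) = M"
  by (metis orth mm_assoc matrix_mul_lid orthogonal_matrix_def)
 then have "(Finite_Cartesian_Product.transpose ?T**(dmat (\<chi> i. ?l i)**?T))$i$k = M$i$k" by simp
 then show "(\<Sum>j\<in>UNIV. ?T$j$i * ?l j * ?T$j$k) = (if i = k then ?m i else 0) + v$i * v$k"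
  by (cases "i = k") (simp_all add: dmat_mult_left M_def matrix_mult_nth Finite_Cartesian_Product.transpose_def mult.assoc)
qed

subsection \<open>Finite linear orders\<close>

text \<open>The least point with h k < k would be sent to a smaller point of the same kind, and
  dually for a greatest point with k < h k. This is what matches two decreasing lists of equal or
  nearby eigenvalues index by index.\<close>

lemma strict_mono_self_eq:
 fixes h :: "'n::{finite,linorder} => 'n"
 assumes h: "!!i j. i < j ==> h i < h j" shows "h i = i"
proof -
 have "{i. h i < i} = {}"
 proof (rule ccontr)
  assume ne: "{i. h i < i} ~= {}"
  define k where "k = Min {i. h i < i}"
  have "h k < k" using Min_in[OF _ ne] by (simp add: k_def)
  then have "h k \<in> {i. h i < i}" using h by simp
  then have "k \<le> h k" unfolding k_def by (intro Min_le) auto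
  then show False using \<open>h k < k\<close> by simp
 qed
 moreover have "{i. i < h i} = {}"
 proof (rule ccontr)
  assume ne: "{i. i < h i} ~= {}"
  define k where "k = Max {i. i < h i}"
  have "k < h k" using Max_in[OF _ ne] by (simp add: k_def)
  then have "h k \<in> {i. i < h i}" using h by simp
  then have "h k \<le> k" unfolding k_def by (intro Max_ge) auto
  then show False using \<open>k < h k\<close> by simp
 qed
 ultimately show ?thesis by (metis (mono_tags, lifting) empty_Collect_eq neq_iff)
qed

lemma decreasing_eq:
 fixes f g :: "'n::{finite,linorder} => real"
 assumes f: "!!i j. i < j ==> f j < f i" and g: "!!i j. i < j ==> g j < g i"
  and "!!i. \<exists>j. f j = g i"
 shows "f i = g i"
proof -
 obtain h where h: "f (h i) = g i" for i using assms(3) by metis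
 have "h i < h j" if "i < j" for i j
 proof (rule ccontr)
  assume "\<not> h i < h j"
  then have "h j < h i \<or> h i = h j" by auto
  then have "f (h i) \<le> f (h j)" by (elim disjE) (use f in \<open>auto intro: less_imp_le\<close>)
  then show False using g[OF that] h by (metis not_less)
 qed
 then show ?thesis using strict_mono_self_eq[of h i] h[of i] by simp
qed

lemma nonzero_row:
 fixes A :: "'a::field ^ 'n ^ 'n"
 assumes "det A ~= 0" shows "\<exists>j. A$i$j ~= 0"
proof (rule ccontr)
 assume "\<nexists>j. A$i$j ~= 0"
 then have "row i A = 0" by (simp add: row_def vec_eq_iff)
 then show False using assms det_zero_row(2) by blast
qed

text \<open>Entrywise r_ij (f_j - g_i) = 0. Each row of r has a non-zero entry, so every g_i is some
  f_j, and as both decrease, f = g; distinctness of the values then kills the off-diagonal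
  entries.\<close>

lemma intertwiner_diagonal:
 fixes r :: "('n::{finite,linorder}) cmat"
 assumes det: "det r ~= 0"
  and f: "!!i j. i < j ==> f j < f i" and g: "!!i j. i < j ==> g j < g i"
  and r: "r**dmat (cvec (\<chi> i. f i)) = dmat (cvec (\<chi> i. g i))**r"
 shows "f = g" "r = dmat (\<chi> i. r$i$i)"
proof -
 have e: "r$i$j * (of_real (f j) - of_real (g i)) = 0" for i j
  using arg_cong[OF r, of "%A. A$i$j"] by (simp add: dmat_mult_left dmat_mult_right algebra_simps)
 show fg: "f = g"
 proof
  fix i
  have "\<exists>j. f j = g i" for i
   using nonzero_row[OF det, of i] e by (metis eq_iff_diff_eq_0 mult_eq_0_iff of_real_eq_iff)
  then show "f i = g i" using decreasing_eq[of f g i] f g by blast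
 qed
 have "f i ~= f j" if "i ~= j" for i j using f that by (metis less_irrefl neq_iff)
 then have "r$i$j = 0" if "i ~= j" for i j
  using e[of i j] that unfolding fg[symmetric] by (metis eq_iff_diff_eq_0 mult_eq_0_iff of_real_eq_iff)
 then show "r = dmat (\<chi> i. r$i$i)" by (simp add: vec_eq_iff)
qed

subsection \<open>The vector v and the matrix T\<close>

lemma ln_gap_iff:
 assumes "0 < s" "0 < t" "\<alpha> ~= 0"
 shows "ln s > ln t + gap \<alpha> \<longleftrightarrow> t\<^sup>2 < \<alpha>^2 * s^2" "ln s \<ge> ln t + gap \<alpha> \<longleftrightarrow> t\<^sup>2 \<le> \<alpha>\<^sup>2 * s^2"
proof -
 have p: "0 < \<bar>\<alpha>\<bar> * s" using assms by simp
 have "ln (\<bar>\<alpha>\<bar> * s) = ln \<bar>\<alpha>\<bar> + ln s" using assms by (simp add: ln_mult)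
 then have "ln s > ln t + gap \<alpha> \<longleftrightarrow> ln t < ln (\<bar>\<alpha>\<bar> * s)" "ln s \<ge> ln t + gap \<alpha> \<longleftrightarrow> ln t \<le> ln (\<bar>\<alpha>\<bar> * s)"
  by (auto simp: gap_def)
 moreover have "t^2 < \<alpha>^2 * s^2 \<longleftrightarrow> t < \<bar>\<alpha>\<bar> * s" "t^2 \<le> \<alpha>\<^sup>2 * s^2 \<longleftrightarrow> t \<le> \<bar>\<alpha>\<bar> * s"
  using abs_le_square_iff[of "\<bar>\<alpha>\<bar> * s" t] abs_le_square_iff[of t "\<bar>\<alpha>\<bar> * s"] assms
  by (auto simp: power_mult_distrib not_le[symmetric] simp del: not_le)
 ultimately show "ln s > ln t + gap \<alpha> \<longleftrightarrow> t\<^sup>2 < \<alpha>^2 * s^2" "ln s \<ge> ln t + gap \<alpha> \<longleftrightarrow> t\<^sup>2 \<le> \<alpha>\<^sup>2 * s^2"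
  using p assms by simp_all
qed

lemma rephased_outer: "rephased v w ==> outer w = outer v"
 by (auto simp: rephased_def outer_smult)

context reduction begin

lemma alpha2: "0 < \<alpha>^2" "\<alpha>^2 < 1" "\<alpha> ~= 0"
 using alpha by auto

lemma gap_pos: "0 < gap \<alpha>"
proof -
 have "\<bar>\<alpha>\<bar> < 1" using alpha by (metis abs_square_less_1)
 then show ?thesis using alpha2(3) by (simp add: gap_def)
qed

lemma outer_rephased:
 assumes "rephased vh w" shows "outer (A *v w) = outer (A *v vh)"
 using rephased_outer[OF assms] by (simp flip: outer_mult_vec)

lemma normal_data_outer:
 assumes nd: "normal_data \<sigma> \<rho> Delta T" and w: "rephased vh w" and v: "cvec v = Sinh Delta *v (\<rho>\<^sup>H *v w)"
 shows "T\<^sup>H**(Sinh Delta**Sinh Delta)**T = \<alpha>^2 *\<^sub>R (Sinh Delta**Sinh Delta) + outer (cvec v)"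
proof -
 have "outer (cvec v) = outer (Sinh Delta *v (\<rho>\<^sup>H *v vh))"
  unfolding v matrix_vector_mul_assoc by (rule outer_rephased[OF w])
 then show ?thesis using nd sinh_sigma_outer[of \<rho> Delta] by (simp add: normal_data_def)
qed

text \<open>The determinant of T^H (S^2 - t) T is computed twice, once using that T is unitary and
  once as diagonal plus rank one.\<close>

lemma secular_normal_data:
 fixes T :: "'n cmat"
 assumes T: "unitary T"
  and M: "T\<^sup>H**(Sinh Delta**Sinh Delta)**T = \<alpha>^2 *\<^sub>R (Sinh Delta**Sinh Delta) + outer (cvec v)"
 shows "secular (%i. (sinh (Delta$i))^2) (%i. \<alpha>^2 * (sinh (Delta$i))^2) (%k. (v$k)^2)"
proof -
 let ?l = "%i. (sinh (Delta$i))^2" and ?m = "%i. \<alpha>^2 * (sinh (Delta$i))^2"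
 define f where "f t = (\<Prod>i\<in>UNIV. ?l i - t) - ((\<Prod>k\<in>UNIV. ?m k - t) + (\<Sum>k\<in>UNIV. (v$k)^2 * (\<Prod>j\<in>UNIV - {k}. ?m j - t)))" for t
 have SS: "Sinh Delta**Sinh Delta = dmat (cvec (\<chi> i. ?l i))"
  by (simp add: Sinh_def dmat_mult_dmat vec_eq_iff power2_eq_square)
 have zero: "f t = 0" if t: "t \<notin> range ?m" for t
 proof -
  have ne: "?m k - t ~= 0" for k using t by auto
  have "T\<^sup>H**(Sinh Delta**Sinh Delta - t *\<^sub>R mat 1)**T = T\<^sup>H**(Sinh Delta**Sinh Delta)**T - t *\<^sub>R mat 1"
   using unitaryD[OF T] by (simp add: mm_ring)
  also have "... = dmat (cvec (\<chi> i. ?m i - t)) + (\<chi> i j. cvec v$i * cvec v$j)"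
   unfolding M unfolding SS by (auto simp: vec_eq_iff outer_def mat_def complex_eq_iff)
  finally have "det (T\<^sup>H**(Sinh Delta**Sinh Delta - t *\<^sub>R mat 1)**T) =
    (\<Prod>i\<in>UNIV. cvec (\<chi> i. ?m i - t)$i) * (1 + (\<Sum>i\<in>UNIV. cvec v$i * cvec v$i / cvec (\<chi> i. ?m i - t)$i))"
   using det_diagonal_plus_rank_one[of "cvec (\<chi> i. ?m i - t)" "cvec v" "cvec v"] ne by (simp flip: of_real_diff)
  also have "... = of_real ((\<Prod>i\<in>UNIV. ?m i - t) * (1 + (\<Sum>i\<in>UNIV. (v$i)^2 / (?m i - t))))"
   by (simp add: power2_eq_square)
  also have "(\<Prod>i\<in>UNIV. ?m i - t) * (1 + (\<Sum>i\<in>UNIV. (v$i)^2 / (?m i - t))) =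
    (\<Prod>k\<in>UNIV. ?m k - t) + (\<Sum>k\<in>UNIV. (v$k)^2 * (\<Prod>j\<in>UNIV - {k}. ?m j - t))"
  proof -
   have "(\<Prod>i\<in>UNIV. ?m i - t) * ((v$k)^2 / (?m k - t)) = (v$k)^2 * (\<Prod>j\<in>UNIV - {k}. ?m j - t)" for k
    using ne[of k] by (simp add: prod_remove_UNIV[of _ k])
   then show ?thesis by (simp add: distrib_left sum_distrib_left)
  qed
  finally have 1: "det (T\<^sup>H**(Sinh Delta**Sinh Delta - t *\<^sub>R mat 1)**T) = of_real ..." .
  have "Sinh Delta**Sinh Delta - t *\<^sub>R mat 1 = dmat (cvec (\<chi> i. ?l i - t))"
   unfolding SS by (auto simp: vec_eq_iff mat_def complex_eq_iff)
  then have "det (Sinh Delta**Sinh Delta - t *\<^sub>R mat 1) = of_real (\<Prod>i\<in>UNIV. ?l i - t)" by (simp add: det_dmat)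
  moreover have "det (T\<^sup>H) * det T = 1" by (metis T det_I det_mul unitary_def)
  then have "det (T\<^sup>H**A**T) = det A" for A :: "'n cmat" by (simp add: det_mul)
  ultimately have "complex_of_real (\<Prod>i\<in>UNIV. ?l i - t) = of_real ((\<Prod>k\<in>UNIV. ?m k - t) + (\<Sum>k\<in>UNIV. (v$k)^2 * (\<Prod>j\<in>UNIV - {k}. ?m j - t)))"
   using 1 by simp
  then show ?thesis unfolding f_def by (simp only: of_real_eq_iff diff_self)
 qed
 have "isCont f t" for t unfolding f_def by (intro continuous_intros)
 then have "f t = 0" for t
  by (rule isCont_eq_zero_off_finite[where A = "range ?m"]) (use zero in auto)
 then show ?thesis unfolding secular_def f_def by simp
qed

lemma secular_chamber:
 fixes Delta :: "'n rvec"
 assumes D: "Delta \<in> chamber" and s: "secular (%i. (sinh (Delta$i))^2) (%i. \<alpha>^2 * (sinh (Delta$i))^2) u"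
 shows "u k = inverse (\<Prod>j\<in>UNIV - {k}. \<alpha>^2 * (sinh (Delta$j))^2 - \<alpha>\<^sup>2 * (sinh (Delta$k))^2) *
  (\<Prod>i\<in>UNIV. (sinh (Delta$i))^2 - \<alpha>\<^sup>2 * (sinh (Delta$k))^2)"
proof -
 have "(\<Prod>j\<in>UNIV - {k}. \<alpha>^2 * (sinh (Delta$j))^2 - \<alpha>\<^sup>2 * (sinh (Delta$k))^2) ~= 0"
  using chamber_sinh_neq[OF D] alpha2 by (auto simp flip: right_diff_distrib)
 then show ?thesis using secularD[OF s, of k] by (simp add: field_simps)
qed

lemma chamber_squares:
 assumes "Delta \<in> chamber" shows "0 < (sinh (Delta$i))^2" "i < j ==> (sinh (Delta$j))\<^sup>2 < (sinh (Delta$i))^2"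
proof -
 show "0 < (sinh (Delta$i))^2" using chamber_pos[OF assms, of i] by (simp only: zero_less_power)
 show "i < j ==> (sinh (Delta$j))\<^sup>2 < (sinh (Delta$i))^2"
  using chamber_pos[OF assms, of j] chamber_strict[OF assms, of i j] by (intro power_strict_mono) auto
qed

lemma chamber_region_iff:
 fixes Delta :: "'n rvec"
 assumes "Delta \<in> chamber"
 shows "(\<chi> i. ln (sinh (Delta$i))) \<in> region \<alpha> \<longleftrightarrow> (\<forall>i j. i < j --> (sinh (Delta$j))\<^sup>2 < \<alpha>^2 * (sinh (Delta$i))^2)"
 using ln_gap_iff(1)[OF chamber_pos[OF assms] chamber_pos[OF assms] alpha2(3)] by (simp add: region_def)

lemma region_neq:
 fixes l :: "'n => real"
 assumes "!!i j. i < j ==> l j < \<alpha>^2 * l i" "!!i. 0 < l i"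
 shows "l i ~= \<alpha>^2 * l j" "i ~= j ==> l i ~= l j" "i < j ==> l j < l i"
proof -
 have a: "\<alpha>^2 * l i < l i" for i using assms(2)[of i] alpha2 by simp
 have b: "l j < l i" if "i < j" for i j using assms(1)[OF that] a[of i] by linarith
 have c: "\<alpha>^2 * l j < \<alpha>^2 * l i" if "i < j" for i j using b[OF that] alpha2 by simp
 show "l i ~= \<alpha>^2 * l j"
  using assms(1)[of j i] a[of j] b[of i j] by (cases i j rule: linorder_cases) auto
 show "i ~= j ==> l i ~= l j" using b by (metis less_irrefl neq_iff)
 show "i < j ==> l j < l i" by (rule b)
qed

text \<open>Read as S^2 T = T (\<alpha>^2 S^2 + v v^T), the hypothesis gives (l_i - \<alpha>^2 l_j)
  T_ij = c_i v_j, where c_i is the i-th entry of T v. Row i of T is thus a multiple of row i of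
  \<open>T_tilde\<close>; unitarity fixes the modulus of c_i, and p_i is its argument.\<close>

lemma T_phases:
 fixes v :: "'n rvec" and T :: "'n cmat"
 assumes D: "Delta \<in> chamber" and T: "unitary T"
  and M: "T\<^sup>H**(Sinh Delta**Sinh Delta)**T = \<alpha>^2 *\<^sub>R (Sinh Delta**Sinh Delta) + outer (cvec v)"
  and v: "!!i. 0 \<le> v$i" and reg: "(\<chi> i. ln (sinh (Delta$i))) \<in> region \<alpha>"
 shows "!!i. 0 < v$i" "orthogonal_matrix (T_tilde \<alpha> (\<chi> i. sinh (Delta$i)) v)"
  "\<exists>p. T = exp_i p**map_matrix complex_of_real (T_tilde \<alpha> (\<chi> i. sinh (Delta$i)) v)"
proof -
 let ?S = "\<chi> i. sinh (Delta$i)" let ?l = "%i. (sinh (Delta$i))^2"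
 have gap: "?l j < \<alpha>^2 * ?l i" if "i < j" for i j using reg that chamber_region_iff[OF D] by blast
 note l = region_neq[of ?l, OF gap chamber_squares(1)[OF D]]
 note sec = secular_normal_data[OF T M]
 show vpos: "0 < v$i" for i
 proof -
  have "0 < (v$i)^2"
   using secular_weight_pos[of ?l "\<alpha>^2" i, OF gap chamber_squares(1)[OF D] alpha2(1,2)]
   unfolding secular_chamber[OF D sec, of i] by (simp add: divide_inverse mult.commute)
  then show ?thesis using v[of i] by (simp add: zero_less_power2)
 qed
 have vnz: "v$i ~= 0" for i using vpos[of i] by simp
 show "orthogonal_matrix (T_tilde \<alpha> ?S v)"
  by (rule T_tilde_orthogonal(1)) (use l sec vnz in \<open>auto intro!: injI\<close>)
 define N where "N i = (\<Sum>k\<in>UNIV. (v$k)^2 / (?l i - \<alpha>\<^sup>2 * ?l k)^2)" for i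
 have Npos: "0 < N i" for i unfolding N_def using vnz l(1) by (intro sum_pos) auto
 have Tt: "T_tilde \<alpha> ?S v$i$j = v$j / (?l i - \<alpha>\<^sup>2 * ?l j) / sqrt (N i)" for i j
  using T_tilde_nth[of ?S \<alpha> v] l(1) by (simp add: N_def)
 define c where "c i = (\<Sum>k\<in>UNIV. T$i$k * of_real (v$k))" for i
 have SS: "Sinh Delta**Sinh Delta = dmat (cvec (\<chi> i. ?l i))"
  by (simp add: Sinh_def dmat_mult_dmat vec_eq_iff power2_eq_square)
 have T1: "T$i$j = c i * of_real (v$j / (?l i - \<alpha>\<^sup>2 * ?l j))" for i j
 proof -
  have "(T**T\<^sup>H)**(Sinh Delta**Sinh Delta)**T = T**(\<alpha>^2 *\<^sub>R (Sinh Delta**Sinh Delta) + outer (cvec v))"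
   by (simp add: M[symmetric] mm_assoc)
  then have "dmat (cvec (\<chi> i. ?l i))**T = \<alpha>^2 *\<^sub>R (T**dmat (cvec (\<chi> i. ?l i))) + T**outer (cvec v)"
   by (simp add: unitaryD[OF T] SS mm_ring)
  then have "(dmat (cvec (\<chi> i. ?l i))**T)$i$j = (\<alpha>^2 *\<^sub>R (T**dmat (cvec (\<chi> i. ?l i))) + T**outer (cvec v))$i$j"
   by simp
  moreover have "(T**outer (cvec v))$i$j = c i * of_real (v$j)"
   by (simp add: matrix_mult_nth outer_def c_def sum_distrib_right mult.assoc)
  ultimately have "of_real (?l i) * T$i$j = of_real (\<alpha>^2 * ?l j) * T$i$j + c i * of_real (v$j)"
   by (simp add: dmat_mult_left dmat_mult_right) (simp add: scaleR_conv_of_real algebra_simps)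
  then have "of_real (?l i - \<alpha>\<^sup>2 * ?l j) * T$i$j = c i * of_real (v$j)" by (simp add: algebra_simps)
  moreover have "complex_of_real (?l i - \<alpha>\<^sup>2 * ?l j) ~= 0" using l(1)[of i j] by (metis eq_iff_diff_eq_0 of_real_eq_0_iff)
  ultimately show ?thesis by (metis (no_types, lifting) nonzero_mult_div_cancel_left of_real_divide times_divide_eq_right)
 qed
 have c1: "cmod (c i) = 1 / sqrt (N i)" for i
 proof -
  have "(\<Sum>k\<in>UNIV. T$i$k * cnj (T$i$k)) = 1"
   using arg_cong[OF unitaryD(2)[OF T], of "%A. A$i$i"] by (simp add: matrix_mult_nth mat_def)
  moreover have "T$i$k * cnj (T$i$k) = of_real ((cmod (c i))^2 * ((v$k)^2 / (?l i - \<alpha>\<^sup>2 * ?l k)^2))" for k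
  proof -
   have "z * of_real r * cnj (z * of_real r) = of_real ((cmod z)^2 * r^2)" for z r
   proof -
    have "z * of_real r * cnj (z * of_real r) = (z * cnj z) * (of_real r * of_real r)" by (simp add: mult_ac)
    then show ?thesis by (simp only: complex_norm_square[symmetric] of_real_mult[symmetric] power2_eq_square[of r])
   qed
   from this[of "c i" "v$k / (?l i - \<alpha>\<^sup>2 * ?l k)"] show ?thesis unfolding T1 by (simp only: power_divide)
  qed
  ultimately have "complex_of_real ((cmod (c i))^2 * N i) = 1"
   unfolding N_def sum_distrib_left of_real_sum by simp
  then have "(cmod (c i))^2 * N i = 1" using of_real_eq_1_iff by blast
  then have "(cmod (c i))^2 = (1 / sqrt (N i))^2" using Npos[of i] by (simp add: field_simps power2_eq_square)
  then show ?thesis using Npos[of i] by (simp add: power2_eq_iff_nonneg)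
 qed
 define p where "p = (\<chi> i. Arg (c i))"
 have "T = exp_i p**map_matrix complex_of_real (T_tilde \<alpha> ?S v)"
 proof -
  have "c i = exp (\<i> * of_real (p$i)) * of_real (1 / sqrt (N i))" for i
   by (metis (no_types, lifting) c1 cis_conv_exp mult.commute p_def rcis_cmod_Arg rcis_def vec_lambda_beta)
  then have "T$i$j = exp (\<i> * of_real (p$i)) * of_real (T_tilde \<alpha> ?S v$i$j)" for i j
   unfolding T1 Tt by simp
  then show ?thesis by (simp add: vec_eq_iff exp_i_def dmat_mult_left)
 qed
 then show "\<exists>p. T = exp_i p**map_matrix complex_of_real (T_tilde \<alpha> ?S v)" ..
qed

lemma region_weak:
 fixes T :: "'n cmat"
 assumes D: "Delta \<in> chamber" and T: "unitary T"
  and M: "T\<^sup>H**(Sinh Delta**Sinh Delta)**T = \<alpha>^2 *\<^sub>R (Sinh Delta**Sinh Delta) + outer (cvec v)" and "i < j"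
 shows "ln (sinh (Delta$i)) \<ge> ln (sinh (Delta$j)) + gap \<alpha>"
proof -
 have "(sinh (Delta$j))^2 \<le> \<alpha>\<^sup>2 * (sinh (Delta$i))^2"
  using secular_interlace[of "%i. (sinh (Delta$i))^2" "\<alpha>^2" "%k. (v$k)^2" i j]
   chamber_squares[OF D] alpha2 secularD[OF secular_normal_data[OF T M]] \<open>i < j\<close> by simp
 then show ?thesis using ln_gap_iff(2)[OF chamber_pos[OF D] chamber_pos[OF D] alpha2(3)] by simp
qed

subsection \<open>Phases of the normal form\<close>

lemma wN_conj_dmat:
 assumes D: "Delta \<in> chamber"
 shows "(dmat m)\<^sup>H**wN Delta T**dmat m = SinhI Delta**(Lam x y Delta**((dmat m)\<^sup>H**T**dmat m) - (1 / x) *\<^sub>R (Cosh Delta**((dmat m)\<^sup>H**dmat m)))"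
proof -
 have "(dmat m)\<^sup>H**SinhI Delta = SinhI Delta**(dmat m)\<^sup>H" "(dmat m)\<^sup>H**Lam x y Delta = Lam x y Delta**(dmat m)\<^sup>H"
  "(dmat m)\<^sup>H**Cosh Delta = Cosh Delta**(dmat m)\<^sup>H"
  by (simp_all add: ctrans_dmat SinhI_def Lam_def Cosh_def dmat_mult_commute)
 then have c: "(dmat m)\<^sup>H**SinhI Delta = SinhI Delta**(dmat m)\<^sup>H" "A**(dmat m)\<^sup>H**Lam x y Delta = A**Lam x y Delta**(dmat m)\<^sup>H"
  "A**(dmat m)\<^sup>H**Cosh Delta = A**Cosh Delta**(dmat m)\<^sup>H" for A :: "'n cmat"
  by (simp_all flip: mm_assoc)
 show ?thesis by (simp add: mm_ring c)
qed

text \<open>Diagonal unitaries commute with cosh and sinh, so multiplying \<rho> by m on the right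
  is matched in the lower blocks by m^H on the left and m on the right; T is conjugated along the
  way. R balances the determinant.\<close>

lemma normal_form_phase:
 assumes g: "NF \<rho> Delta T \<in> C" and D: "Delta \<in> chamber" and \<rho>: "unitary \<rho>"
  and R: "stab R" and m: "!!i. cmod (m$i) = 1" and det: "det R * det (dmat m) = 1"
 shows "(NF \<rho> Delta T, NF (R**\<rho>**dmat m) Delta ((dmat m)\<^sup>H**T**dmat m)) \<in> G"
proof -
 let ?M = "dmat m"
 have uM: "unitary ?M" using m by (simp add: unitary_dmat)
 \<comment> \<open>With c^n = conj(det m) each right block c m has determinant 1, and the factors
   conj(c) on the left turn the determinant there into det R det m.\<close>
 obtain c where c: "c ^ CARD('n) = cnj (det ?M)" "cmod c = 1"
  using exists_root[of "cnj (det ?M)" "CARD('n)"] unitary_det[OF uM] by auto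
 have cc: "cnj c * c = 1" "c * cnj c = 1" using c(2) by (simp_all add: complex_norm_square[symmetric] mult.commute)
 have MM: "det ?M * cnj (det ?M) = 1" using unitary_det[OF uM] by (simp add: complex_norm_square[symmetric])
 let ?R = "mat (cnj c)**R" and ?r = "mat (cnj c)**?M\<^sup>H" and ?k = "mat c**?M"
 have s: "stab ?R" using c(2) by (intro stab_mult stab_mat R) simp
 have u: "unitary ?r" "unitary ?k" using c(2) uM by (auto intro!: unitary_mult unitary_mat)
 have "det ?R * det ?r = (det R * det ?M) * (cnj (det ?M) * det ?M)"
  by (simp add: det_mul det_mat det_ctrans c(1) flip: complex_cnj_power)
 then have d1: "det ?R * det ?r = 1" using det MM by (simp add: mult.commute)
 have "det ?k * det ?k = (det ?M * cnj (det ?M)) * (det ?M * cnj (det ?M))"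
  by (simp add: det_mul det_mat c(1))
 then have d2: "det ?k * det ?k = 1" using MM by simp
 have MC: "?M\<^sup>H**Sinh Delta**?M = Sinh Delta" "?M\<^sup>H**Cosh Delta**?M = Cosh Delta"
  "A**?M**Sinh Delta = A**Sinh Delta**?M" "A**?M**Cosh Delta = A**Cosh Delta**?M" for A :: "'n cmat"
 proof -
  have e: "?M**Sinh Delta = Sinh Delta**?M" "?M**Cosh Delta = Cosh Delta**?M"
   by (simp_all add: Sinh_def Cosh_def dmat_mult_commute)
  then show "A**?M**Sinh Delta = A**Sinh Delta**?M" "A**?M**Cosh Delta = A**Cosh Delta**?M"
   by (simp_all flip: mm_assoc)
  have "?M\<^sup>H**X**?M = X" if "?M**X = X**?M" for X
  proof -
   have "?M\<^sup>H**X**?M = ?M\<^sup>H**(?M**X)" unfolding that by (simp only: mm_assoc)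
   then show ?thesis by (simp only: mm_assoc unitaryD[OF uM] matrix_mul_lid)
  qed
  then show "?M\<^sup>H**Sinh Delta**?M = Sinh Delta" "?M\<^sup>H**Cosh Delta**?M = Cosh Delta" using e by blast+
 qed
 have sc: "mat (cnj c)**A**(mat c**B) = A**B" for A B :: "'n cmat"
 proof -
  have "mat (cnj c)**A**(mat c**B) = mat (cnj c)**(A**mat c)**B" by (simp add: mm_assoc)
  also have "... = (mat (cnj c)**mat c)**A**B" by (simp only: mat_mult_commute[of A] mm_assoc)
  finally show ?thesis by (simp add: mat_mult_mat cc)
 qed
 have "blk ?R 0 0 ?r**kN \<rho> Delta**blk ?k 0 0 ?k = blk (mat (cnj c)**(R**\<rho>**Cosh Delta)**(mat c**?M))
   (mat (cnj c)**(R**\<rho>**Sinh Delta)**(mat c**?M)) (mat (cnj c)**(?M\<^sup>H**Sinh Delta)**(mat c**?M))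
   (mat (cnj c)**(?M\<^sup>H**Cosh Delta)**(mat c**?M))"
  by (simp add: Hyp_def blk_mult mm_assoc)
 also have "... = kN (R**\<rho>**?M) Delta"
  unfolding sc by (simp add: MC Hyp_def blk_mult)
 finally have K: "blk ?R 0 0 ?r**kN \<rho> Delta**blk ?k 0 0 ?k = kN (R**\<rho>**?M) Delta" .
 have W: "?k\<^sup>H**wN Delta T**?k = wN Delta (?M\<^sup>H**T**?M)"
 proof -
  have "?k\<^sup>H**wN Delta T**?k = mat (cnj c)**(?M\<^sup>H**wN Delta T)**(mat c**?M)"
   by (simp only: ctrans_mult ctrans_mat mat_mult_commute[of "?M\<^sup>H"] mm_assoc)
  also have "... = wN Delta (?M\<^sup>H**T**?M)"
   unfolding sc wN_conj_dmat[OF D] by (simp add: unitaryD[OF uM])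
  finally show ?thesis .
 qed
 have "blk ?R 0 0 ?r**NF \<rho> Delta T**blk ?k 0 0 ?k = (blk ?R 0 0 ?r**kN \<rho> Delta**blk ?k 0 0 ?k)**bR (?k\<^sup>H**wN Delta T**?k)"
  unfolding normal_form_eq[OF D] using bR_gauge[OF u(2,2)] by (simp flip: mm_assoc)
 also have "... = NF (R**\<rho>**?M) Delta (?M\<^sup>H**T**?M)"
  unfolding K W normal_form_eq[OF D] ..
 finally show ?thesis using gauge_relI[OF g s u(1) d1 u(2,2) d2] by metis
qed

end

section \<open>Unitaries that adjust a determinant, and making v real and non-negative\<close>

lemma exists_unit_orthogonal:
 fixes z :: "('n::finite) cvec"
 assumes "CARD('n) ~= 1"
 shows "\<exists>u. (\<Sum>k\<in>UNIV. u$k * cnj (u$k)) = 1 & (\<Sum>k\<in>UNIV. cnj (u$k) * z$k) = 0"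
proof -
 obtain i j :: 'n where ij: "i ~= j"
  using assms by (metis (full_types) UNIV_eq_I card_1_singleton_iff singletonI One_nat_def)
 \<comment> \<open>In the plane of the coordinates i and j the vector (conj z_j, -conj z_i) is
   orthogonal to z; if both entries of z vanish, the i-th axis serves. Two distinct indices exist
   because n is at least 2.\<close>
 define w :: "'n cvec" where "w = (if z$i = 0 & z$j = 0 then axis i 1
  else (\<chi> k. if k = i then cnj (z$j) else if k = j then - cnj (z$i) else 0))"
 have s2: "(\<Sum>k\<in>UNIV. f k) = f i + f j" if "!!k. k ~= i ==> k ~= j ==> f k = 0" for f :: "'n => complex"
 proof -
  have "(\<Sum>k\<in>UNIV. f k) = (\<Sum>k\<in>{i,j}. f k)" by (rule sum.mono_neutral_right) (use that in auto)
  then show ?thesis using ij by simp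
 qed
 have orth: "(\<Sum>k\<in>UNIV. cnj (w$k) * z$k) = 0"
  using ij by (subst s2) (auto simp: w_def axis_def)
 define N where "N = (\<Sum>k\<in>UNIV. (cmod (w$k))^2)"
 have "w ~= 0" using ij by (auto simp: w_def vec_eq_iff axis_def)
 then obtain k where "w$k ~= 0" by (auto simp: vec_eq_iff)
 then have N: "0 < N" unfolding N_def by (intro sum_pos2[of _ k]) auto
 define u where "u = (\<chi> k. w$k / of_real (sqrt N))"
 have "u$k * cnj (u$k) = of_real ((cmod (w$k))^2 / N)" for k
 proof -
  have "u$k * cnj (u$k) = (w$k * cnj (w$k)) / (of_real (sqrt N) * of_real (sqrt N))" by (simp add: u_def)
  then show ?thesis using N
   by (simp only: complex_norm_square[symmetric] of_real_mult[symmetric] real_sqrt_mult_self abs_of_pos of_real_divide)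
 qed
 then have "(\<Sum>k\<in>UNIV. u$k * cnj (u$k)) = of_real (\<Sum>k\<in>UNIV. (cmod (w$k))^2 / N)"
  by simp
 also have "... = 1" using N by (simp add: N_def sum_divide_distrib[symmetric])
 finally have "(\<Sum>k\<in>UNIV. u$k * cnj (u$k)) = 1" .
 moreover have "(\<Sum>k\<in>UNIV. cnj (u$k) * z$k) = 0"
  using orth by (simp add: u_def sum_divide_distrib[symmetric])
 ultimately show ?thesis by blast
qed

text \<open>R = 1 + (d - 1) u u^H with a unit vector u orthogonal to z. It corrects a determinant
  without moving the given vector; for n = 1 a non-zero vector is fixed by R = 1 only.\<close>

lemma exists_fixing_unitary:
 fixes z :: "('n::finite) cvec"
 assumes "CARD('n) ~= 1" "cmod d = 1"
 shows "\<exists>R. unitary R & R *v z = z & R\<^sup>H *v z = z & det R = d"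
proof -
 obtain u where u: "(\<Sum>k\<in>UNIV. u$k * cnj (u$k)) = 1" "(\<Sum>k\<in>UNIV. cnj (u$k) * z$k) = 0"
  using exists_unit_orthogonal[OF assms(1)] by blast
 define R :: "complex => 'n cmat" where "R c = mat 1 + (\<chi> i j. (c * u$i) * cnj (u$j))" for c
 have Rz: "R c *v z = z" for c
  using u(2) by (simp add: R_def matrix_vector_mult_add_rdistrib) (simp add: matrix_vector_mult_def vec_eq_iff mult.assoc sum_distrib_left[symmetric])
 have det: "det (R c) = 1 + c" for c
  using det_rank_one_update[of "\<chi> i. c * u$i" "\<chi> j. cnj (u$j)"] u(1)
  by (simp add: R_def mult.left_commute sum_distrib_left[symmetric] mult.commute)
 have ct: "(R c)\<^sup>H = R (cnj c)" for c by (auto simp: R_def vec_eq_iff mat_def)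
 have mult: "R a**R b = R (a + b + a * b)" for a b
 proof -
  let ?E = "%c. (\<chi> i j. (c * u$i) * cnj (u$j)) :: 'n cmat"
  have "?E a**?E b = ?E (a * b)"
  proof -
   have "(\<Sum>k\<in>UNIV. a * u$i * cnj (u$k) * (b * u$k * cnj (u$j))) = a * b * u$i * cnj (u$j) * (\<Sum>k\<in>UNIV. u$k * cnj (u$k))" for i j
    unfolding sum_distrib_left by (rule sum.cong) (simp_all add: mult_ac)
   then show ?thesis using u(1) by (simp add: vec_eq_iff matrix_mult_nth)
  qed
  then show ?thesis by (simp add: R_def mm_ring) (simp add: vec_eq_iff algebra_simps)
 qed
 have "cnj d * d = 1" using assms(2) by (simp add: complex_norm_square[symmetric] mult.commute)
 then have "cnj (d - 1) + (d - 1) + cnj (d - 1) * (d - 1) = 0" by (simp add: algebra_simps)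
 then have "unitary (R (d - 1))" unfolding unitary_def ct mult by (simp add: R_def vec_eq_iff)
 then show ?thesis using Rz det[of "d - 1"] ct by (intro exI[of _ "R (d - 1)"]) simp
qed

lemma cnj_mult_self_divide_norm: "z ~= 0 ==> cnj z * z / of_real (cmod z) = of_real (cmod z)"
proof -
 assume "z ~= 0"
 have "cnj z * z = of_real (cmod z) * of_real (cmod z)"
  by (metis complex_norm_square mult.commute of_real_mult power2_eq_square)
 then show ?thesis using \<open>z ~= 0\<close> by simp
qed

context reduction begin

lemma stab_of_fixes: "unitary R ==> R\<^sup>H *v vh = vh ==> stab R"
 unfolding stab_outer using outer_mult_vec[of "R\<^sup>H" vh] by simp

lemma exists_phases:
 fixes u :: "'n cvec"
 shows "\<exists>m. (\<forall>i. cmod (m$i) = 1) & (dmat m)\<^sup>H *v u = cvec (\<chi> i. cmod (u$i))"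
proof -
 let ?m = "\<chi> i. if u$i = 0 then 1 else u$i / of_real (cmod (u$i))"
 have "(dmat ?m)\<^sup>H *v u = cvec (\<chi> i. cmod (u$i))"
  using cnj_mult_self_divide_norm by (simp add: ctrans_dmat dmat_vector vec_eq_iff)
 then show ?thesis by (intro exI[of _ ?m]) (auto simp: norm_divide)
qed

lemma normal_form_rephase:
 assumes nd: "normal_data \<sigma> \<rho> Delta T" and g: "NF \<rho> Delta T \<in> C"
 shows "\<exists>m R w v. (\<forall>i. cmod (m$i) = 1) & unitary R & R\<^sup>H**\<sigma>**\<sigma>\<^sup>H**R = \<sigma>**\<sigma>\<^sup>H &
    rephased vh w & (\<forall>i. 0 \<le> v$i) &
    (let \<rho>' = R**\<rho>**dmat m; T' = (dmat m)\<^sup>H**T**dmat m in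
     normal_data \<sigma> \<rho>' Delta T' & (NF \<rho> Delta T, NF \<rho>' Delta T') \<in> G &
     cvec v = Sinh Delta *v (\<rho>'\<^sup>H *v w))"
proof (cases "CARD('n) = 1")
 \<comment> \<open>For n = 1, \<rho> and T are left alone and the phase goes into w = c vh.\<close>
 case True
 then obtain a :: 'n where a: "UNIV = {a}" by (metis card_1_singletonE)
 define u where "u = (Sinh Delta *v (\<rho>\<^sup>H *v vh))$a"
 define c where "c = (if u = 0 then 1 else cnj u / of_real (cmod u))"
 have c: "cmod c = 1" "c * u = of_real (cmod u)"
  using cnj_mult_self_divide_norm[of u] by (auto simp: c_def norm_divide)
 have "Sinh Delta *v (\<rho>\<^sup>H *v (c *s vh)) = c *s (Sinh Delta *v (\<rho>\<^sup>H *v vh))"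
  by (simp add: vector_scalar_commute)
 also have "... = cvec (\<chi> i. cmod u)"
 proof -
  have "i = a" for i using a by auto
  then show ?thesis using c(2) unfolding vec_eq_iff u_def by (metis cvec_nth vec_lambda_beta vector_smult_component)
 qed
 finally have "cvec (\<chi> i. cmod u) = Sinh Delta *v (\<rho>\<^sup>H *v (c *s vh))" by simp
 moreover have "rephased vh (c *s vh)" using c True by (auto simp: rephased_def)
 moreover have "(NF \<rho> Delta T, NF \<rho> Delta T) \<in> G" using equiv_gauge g by (meson equivE refl_onD)
 ultimately show ?thesis using nd
  by (intro exI[of _ "\<chi> i. 1"] exI[of _ "mat 1"] exI[of _ "c *s vh"] exI[of _ "\<chi> i. cmod u"]) (simp add: dmat_one)
next
 case False
 obtain m where m: "!!i. cmod (m$i) = 1"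
  "(dmat m)\<^sup>H *v (Sinh Delta *v (\<rho>\<^sup>H *v vh)) = cvec (\<chi> i. cmod ((Sinh Delta *v (\<rho>\<^sup>H *v vh))$i))"
  using exists_phases by blast
 have uM: "unitary (dmat m)" using m by (simp add: unitary_dmat)
 \<comment> \<open>R compensates det m and fixes \<open>vh\<close>, so \<Sigma> \<rho>^H vh only
   acquires the phases conj(m_i), which were chosen to make it non-negative.\<close>
 have "cmod (cnj (det (dmat m))) = 1" using unitary_det[OF uM] by simp
 then obtain R where R: "unitary R" "R *v vh = vh" "R\<^sup>H *v vh = vh" "det R = cnj (det (dmat m))"
  using exists_fixing_unitary[OF False] by blast
 have st: "stab R" using R by (intro stab_of_fixes)
 have D: "Delta \<in> chamber" "unitary \<rho>" using nd by (auto simp: normal_data_def)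
 have "det R * det (dmat m) = 1" using R(4) unitary_det[OF uM] by (simp add: complex_norm_square[symmetric] mult.commute)
 then have G: "(NF \<rho> Delta T, NF (R**\<rho>**dmat m) Delta ((dmat m)\<^sup>H**T**dmat m)) \<in> G"
  using normal_form_phase[OF g D st m(1)] by blast
 have nd': "normal_data \<sigma> (R**\<rho>**dmat m) Delta ((dmat m)\<^sup>H**T**dmat m)"
  using normal_form_constrainedD(1)[OF _ _ D(1)] gauge_rel_in_C[OF G] unitary_mult R D uM by blast
 have "Sinh Delta**(dmat m)\<^sup>H = (dmat m)\<^sup>H**Sinh Delta"
  by (simp add: Sinh_def ctrans_dmat dmat_mult_commute)
 then have "Sinh Delta *v ((R**\<rho>**dmat m)\<^sup>H *v vh) = (dmat m)\<^sup>H *v (Sinh Delta *v (\<rho>\<^sup>H *v (R\<^sup>H *v vh)))"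
  by (simp add: ctrans_mult matrix_vector_mul_assoc mm_assoc)
 then have "cvec (\<chi> i. cmod ((Sinh Delta *v (\<rho>\<^sup>H *v vh))$i)) = Sinh Delta *v ((R**\<rho>**dmat m)\<^sup>H *v vh)"
  using m(2) R(3) by simp
 moreover have "rephased vh vh" unfolding rephased_def by (intro exI[of _ 1]) simp
 ultimately show ?thesis using m R(1) st nd' G
  by (intro exI[of _ m] exI[of _ R] exI[of _ vh] exI[of _ "\<chi> i. cmod ((Sinh Delta *v (\<rho>\<^sup>H *v vh))$i)"])
    (simp add: stab_def)
qed

subsection \<open>Coordinates\<close>

text \<open>\<open>Dl q\<close> is the \<Delta> with \<Sigma>_i = sinh \<Delta>_i = e^(q_i),
  \<open>eq q\<close> is \<Sigma> itself, and \<open>TN\<close> is the matrix T with phases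
  p.\<close>

definition Dl :: "'n rvec => 'n rvec" where "Dl q = (\<chi> i. arsinh (exp (q$i)))"
definition eq :: "'n rvec => 'n rvec" where "eq q = (\<chi> i. exp (q$i))"
definition TN :: "'n rvec => 'n rvec => 'n rvec => 'n cmat"
 where "TN q p v = exp_i p**map_matrix complex_of_real (T_tilde \<alpha> (eq q) v)"

lemma sinh_Dl [simp]: "sinh (Dl q$i) = exp (q$i)"
 by (simp add: Dl_def)

lemma Dl_ln_sinh: "Delta \<in> chamber ==> Dl (\<chi> i. ln (sinh (Delta$i))) = Delta"
proof -
 assume "Delta \<in> chamber"
 then have "sinh (Dl (\<chi> i. ln (sinh (Delta$i)))$i) = sinh (Delta$i)" for i
  using chamber_pos[of Delta i] by simp
 then show ?thesis by (simp add: vec_eq_iff del: sinh_Dl)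
qed

lemma region_strict: "q \<in> region \<alpha> ==> i < j ==> q$j < q$i"
 using gap_pos unfolding region_def by (smt (verit) mem_Collect_eq)

lemma Dl_chamber: "q \<in> region \<alpha> ==> Dl q \<in> chamber"
proof -
 assume q: "q \<in> region \<alpha>"
 have "Dl q$j < Dl q$i" if "i < j" for i j
  using region_strict[OF q that] sinh_Dl by (metis exp_less_cancel_iff sinh_real_less_iff)
 moreover have "0 < Dl q$i" for i
  using sinh_Dl by (metis exp_gt_zero sinh_0 sinh_real_less_iff)
 ultimately show ?thesis by (simp add: chamber_def)
qed

lemma Dl_inj: "Dl q = Dl q' \<longleftrightarrow> q = q'"
 by (metis exp_inj_iff sinh_Dl vec_eq_iff)

lemma ln_sinh_Dl: "(\<chi> i. ln (sinh (Dl q$i))) = q"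
 by (simp add: vec_eq_iff)

lemma coords_iff: "coords \<alpha> vh \<sigma> x y g q p \<longleftrightarrow> q \<in> region \<alpha> &
  (\<exists>\<rho> w v. unitary \<rho> & rephased vh w & (\<forall>i. 0 \<le> v$i) & cvec v = Sinh (Dl q) *v (\<rho>\<^sup>H *v w) &
    (g, NF \<rho> (Dl q) (TN q p v)) \<in> G)"
 by (simp add: coords_def Dl_def TN_def eq_def Let_def)

text \<open>Inside the region the weights v_k^2 are positive, so the v of \<open>coords\<close>,
  only required to be non-negative, has positive entries.\<close>

lemma coordsE:
 assumes "coords \<alpha> vh \<sigma> x y g q p"
 obtains \<rho> w v where "q \<in> region \<alpha>" "Dl q \<in> chamber" "unitary \<rho>" "det \<rho> = 1" "rephased vh w" "!!i. 0 < v$i"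
  "cvec v = Sinh (Dl q) *v (\<rho>\<^sup>H *v w)" "(g, NF \<rho> (Dl q) (TN q p v)) \<in> G"
  "NF \<rho> (Dl q) (TN q p v) \<in> C" "normal_data \<sigma> \<rho> (Dl q) (TN q p v)"
  "secular (%i. (exp (q$i))^2) (%i. \<alpha>^2 * (exp (q$i))^2) (%k. (v$k)^2)"
proof -
 obtain \<rho> w v where *: "q \<in> region \<alpha>" "unitary \<rho>" "rephased vh w" "!!i. 0 \<le> v$i"
  "cvec v = Sinh (Dl q) *v (\<rho>\<^sup>H *v w)" "(g, NF \<rho> (Dl q) (TN q p v)) \<in> G"
  using assms unfolding coords_iff by blast
 note D = Dl_chamber[OF *(1)]
 have C: "NF \<rho> (Dl q) (TN q p v) \<in> C" using gauge_rel_in_C[OF *(6)] by simp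
 have nd: "normal_data \<sigma> \<rho> (Dl q) (TN q p v)" "det \<rho> = 1" using normal_form_constrainedD[OF C *(2) D] .
 have T: "unitary (TN q p v)" using nd by (simp add: normal_data_def)
 note M = normal_data_outer[OF nd(1) *(3,5)]
 have "0 < v$i" for i using T_phases(1)[OF D T M *(4)] *(1) by (simp add: ln_sinh_Dl)
 then show ?thesis using that[OF *(1) D *(2) nd(2) *(3) _ *(5,6) C nd(1)] secular_normal_data[OF T M] by simp
qed

lemma coords_in_C: "coords \<alpha> vh \<sigma> x y g q p ==> g \<in> C"
 by (metis coordsE gauge_rel_in_C)

lemma normal_data_coords:
 assumes nd: "normal_data \<sigma> \<rho> Delta T" and w: "rephased vh w" and v0: "!!i. 0 \<le> v$i"
  and v: "cvec v = Sinh Delta *v (\<rho>\<^sup>H *v w)"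
  and reg: "(\<chi> i. ln (sinh (Delta$i))) \<in> region \<alpha>"
 shows "orthogonal_matrix (T_tilde \<alpha> (\<chi> i. sinh (Delta$i)) v)"
  "\<exists>p. T = exp_i p**map_matrix complex_of_real (T_tilde \<alpha> (\<chi> i. sinh (Delta$i)) v)"
  "(g, NF \<rho> Delta T) \<in> G ==> \<exists>p. coords \<alpha> vh \<sigma> x y g (\<chi> i. ln (sinh (Delta$i))) p"
proof -
 have D: "Delta \<in> chamber" "unitary T" "unitary \<rho>" using nd by (auto simp: normal_data_def)
 note P = T_phases[OF D(1,2) normal_data_outer[OF nd w v] v0 reg]
 show "orthogonal_matrix (T_tilde \<alpha> (\<chi> i. sinh (Delta$i)) v)" by (rule P)
 show ex: "\<exists>p. T = exp_i p**map_matrix complex_of_real (T_tilde \<alpha> (\<chi> i. sinh (Delta$i)) v)" by (rule P)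
 then obtain p where p: "T = exp_i p**map_matrix complex_of_real (T_tilde \<alpha> (\<chi> i. sinh (Delta$i)) v)" by blast
 let ?q = "\<chi> i. ln (sinh (Delta$i))"
 have "eq ?q = (\<chi> i. sinh (Delta$i))" using chamber_pos[OF D(1)] by (simp add: eq_def vec_eq_iff)
 then have T: "T = TN ?q p v" using p by (simp add: TN_def)
 assume "(g, NF \<rho> Delta T) \<in> G"
 then have "coords \<alpha> vh \<sigma> x y g ?q p"
  unfolding coords_iff Dl_ln_sinh[OF D(1)] using reg D w v0 v T
  by (intro conjI exI[of _ \<rho>] exI[of _ w] exI[of _ v]) simp_all
 then show "\<exists>p. coords \<alpha> vh \<sigma> x y g ?q p" ..
qed

lemma exists_coords:
 assumes nd: "normal_data \<sigma> \<rho> Delta T" and g: "(g, NF \<rho> Delta T) \<in> G"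
  and reg: "(\<chi> i. ln (sinh (Delta$i))) \<in> region \<alpha>"
 shows "\<exists>p. coords \<alpha> vh \<sigma> x y g (\<chi> i. ln (sinh (Delta$i))) p"
proof -
 have "NF \<rho> Delta T \<in> C" using gauge_rel_in_C[OF g] by simp
 from normal_form_rephase[OF nd this] obtain \<rho>' T' w v where
  *: "normal_data \<sigma> \<rho>' Delta T'" "(NF \<rho> Delta T, NF \<rho>' Delta T') \<in> G" "rephased vh w" "!!i. 0 \<le> v$i"
   "cvec v = Sinh Delta *v (\<rho>'\<^sup>H *v w)" unfolding Let_def by blast
 show ?thesis using normal_data_coords(3)[OF *(1,3,4,5) reg gauge_trans[OF g *(2)]] .
qed

text \<open>The lower left block \<Sigma>' = r \<Sigma> k1 gives r \<Sigma>^2 = \<Sigma>'^2 r, so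
  the two spectra agree and r is diagonal. It then commutes with the hyperbolic blocks, and the
  remaining blocks force k1 = k2 = r^H.\<close>

lemma normal_form_gauge_unique:
 assumes nd: "normal_data \<sigma> \<rho> Delta T" "normal_data \<sigma> \<rho>' Delta' T'" and G: "(NF \<rho> Delta T, NF \<rho>' Delta' T') \<in> G"
 shows "Delta' = Delta" "\<exists>R d. stab R & unitary (dmat d) & \<rho>' = R**\<rho>**(dmat d)\<^sup>H & T' = dmat d**T**(dmat d)\<^sup>H"
proof -
 have D: "Delta \<in> chamber" "Delta' \<in> chamber" "unitary \<rho>" "unitary \<rho>'" using nd by (auto simp: normal_data_def)
 have CC: "NF \<rho> Delta T \<in> C" "NF \<rho>' Delta' T' \<in> C" using gauge_rel_in_C[OF G] by auto
 have det: "det \<rho> = 1" "det \<rho>' = 1" using normal_form_constrainedD CC D by blast+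
 note f = normal_form_constrained[OF nd(1) det(1)] and f' = normal_form_constrained[OF nd(2) det(2)]
 obtain R r k1 k2 where *: "stab R" "unitary r" "det R * det r = 1" "unitary k1" "unitary k2"
  "det k1 * det k2 = 1" "NF \<rho>' Delta' T' = blk R 0 0 r**NF \<rho> Delta T**blk k1 0 0 k2"
  using G by (auto simp: gauge_rel_iff)
 obtain k \<omega> \<nu> kR where h: "k \<in> SUnn" "regular k" "kR \<in> SUnn" "NF \<rho> Delta T = k**bR \<omega>" "NF \<rho> Delta T = bL \<nu>**kR"
  "k_L (NF \<rho> Delta T) = k" "b_R (NF \<rho> Delta T) = bR \<omega>"
  by (rule constrainedE[OF CC(1)])
 have hk: "k = kN \<rho> Delta" "\<omega> = wN Delta T"
  using h f by (auto simp: bR_def blk_eq_iff)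
 note st = gauge_step[OF h(1-5) *(1-6,7)]
 have K: "kN \<rho>' Delta' = blk R 0 0 r**kN \<rho> Delta**blk k1 0 0 k2" using st(2) f'(2) hk by simp
 have W: "wN Delta' T' = k1\<^sup>H**wN Delta T**k2" using st(3) f'(3) hk by (simp add: bR_def blk_eq_iff)
 have e: "\<rho>'**Cosh Delta' = R**\<rho>**Cosh Delta**k1" "Sinh Delta' = r**Sinh Delta**k1" "Cosh Delta' = r**Cosh Delta**k2"
  using K by (auto simp: Hyp_def blk_mult blk_eq_iff mm_assoc)
 have SS: "Sinh Delta**Sinh Delta = dmat (cvec (\<chi> i. (sinh (Delta$i))^2))" for Delta :: "'n rvec"
  by (simp add: Sinh_def dmat_mult_dmat vec_eq_iff power2_eq_square)
 have dr: "det r ~= 0" using unitary_det[OF *(2)] by auto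
 have "Sinh Delta'**Sinh Delta' = Sinh Delta'**(Sinh Delta')\<^sup>H" by simp
 also have "... = r**Sinh Delta**(k1**k1\<^sup>H)**Sinh Delta**r\<^sup>H"
  unfolding e(2) by (simp only: ctrans_mult ctrans_Cosh mm_assoc)
 finally have "Sinh Delta'**Sinh Delta' = r**Sinh Delta**Sinh Delta**r\<^sup>H" by (simp add: unitaryD[OF *(4)])
 then have "(Sinh Delta'**Sinh Delta')**r = r**Sinh Delta**Sinh Delta**(r\<^sup>H**r)"
  by (simp only: mm_assoc)
 then have "r**(Sinh Delta**Sinh Delta) = (Sinh Delta'**Sinh Delta')**r" by (simp add: unitaryD[OF *(2)] mm_assoc)
 note id = intertwiner_diagonal[OF dr _ _ this[unfolded SS]]
 have "(%i. (sinh (Delta$i))^2) = (%i. (sinh (Delta'$i))^2)" using id(1) chamber_squares(2)[OF D(1)] chamber_squares(2)[OF D(2)] by blast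
 then have "(sinh (Delta$i))^2 = (sinh (Delta'$i))^2" for i by metis
 then have "sinh (Delta$i) = sinh (Delta'$i)" for i using chamber_pos[OF D(1), of i] chamber_pos[OF D(2), of i]
  by (metis less_imp_le power2_eq_iff_nonneg)
 then show DD: "Delta' = Delta" by (simp add: vec_eq_iff)
 obtain d where d: "r = dmat d" using id(2) chamber_squares(2)[OF D(1)] chamber_squares(2)[OF D(2)] by blast
 have c: "(dmat d)\<^sup>H**Sinh Delta = Sinh Delta**(dmat d)\<^sup>H" "(dmat d)\<^sup>H**Cosh Delta = Cosh Delta**(dmat d)\<^sup>H"
  by (simp_all add: Sinh_def Cosh_def ctrans_dmat dmat_mult_commute)
 have "Sinh Delta**k1 = (r\<^sup>H**r)**Sinh Delta**k1" by (simp add: unitaryD[OF *(2)])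
 also have "... = r\<^sup>H**Sinh Delta" using e(2) DD by (simp flip: mm_assoc)
 also have "... = Sinh Delta**(dmat d)\<^sup>H" by (simp add: d c)
 finally have "SinhI Delta**Sinh Delta**k1 = SinhI Delta**Sinh Delta**(dmat d)\<^sup>H" by (simp flip: mm_assoc)
 then have k1: "k1 = (dmat d)\<^sup>H" by (simp add: Sinh_SinhI[OF D(1)])
 have "Cosh Delta**k2 = (r\<^sup>H**r)**Cosh Delta**k2" by (simp add: unitaryD[OF *(2)])
 also have "... = r\<^sup>H**Cosh Delta" using e(3) DD by (simp flip: mm_assoc)
 also have "... = Cosh Delta**(dmat d)\<^sup>H" by (simp add: d c)
 finally have "CoshI Delta**Cosh Delta**k2 = CoshI Delta**Cosh Delta**(dmat d)\<^sup>H" by (simp flip: mm_assoc)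
 then have k2: "k2 = (dmat d)\<^sup>H" by (simp add: Cosh_CoshI)
 have "\<rho>'**(Cosh Delta**CoshI Delta) = R**\<rho>**Cosh Delta**(dmat d)\<^sup>H**CoshI Delta"
  using e(1) unfolding DD k1 by (simp add: mm_assoc)
 also have "... = R**\<rho>**(dmat d)\<^sup>H**(Cosh Delta**CoshI Delta)"
  by (simp add: mm_assoc) (simp add: c mm_assoc[symmetric])
 finally have \<rho>': "\<rho>' = R**\<rho>**(dmat d)\<^sup>H" by (simp add: Cosh_CoshI)
 let ?e = "\<chi> i. cnj (d$i)"
 have ed: "(dmat ?e)\<^sup>H = dmat d" "(dmat d)\<^sup>H = dmat ?e" by (simp_all add: ctrans_dmat vec_eq_iff)
 have ud: "dmat d**dmat ?e = mat 1" using unitaryD(2)[OF *(2)] by (simp add: d ed)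
 have "wN Delta T' = dmat d**wN Delta T**dmat ?e" using W unfolding DD k1 k2 by (simp add: ctrans_dmat)
 also have "... = wN Delta (dmat d**T**dmat ?e)"
  using wN_conj_dmat[OF D(1), of ?e T] by (simp add: ed ud)
 finally have "Sinh Delta**wN Delta T' + (1 / x) *\<^sub>R Cosh Delta = Sinh Delta**wN Delta (dmat d**T**dmat ?e) + (1 / x) *\<^sub>R Cosh Delta" by simp
 then have "Lam x y Delta**T' = Lam x y Delta**(dmat d**T**dmat ?e)"
  by (simp add: mm_assoc Sinh_SinhI[OF D(1)])
 then have "T' = dmat d**T**dmat ?e" using Lam_props(3) matrix_mult_cancel_left by blast
 then show "\<exists>R d. stab R & unitary (dmat d) & \<rho>' = R**\<rho>**(dmat d)\<^sup>H & T' = dmat d**T**(dmat d)\<^sup>H"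
  using \<rho>' *(1,2) d ed by metis
qed

lemma TN_nth:
 assumes "q \<in> region \<alpha>"
 shows "TN q p v$i$j = exp (\<i> * of_real (p$i)) * of_real (T_tilde \<alpha> (eq q) v$i$j)"
 by (simp add: TN_def exp_i_def dmat_mult_left)

lemma region_exp:
 assumes "q \<in> region \<alpha>" "i < j" shows "(exp (q$j))^2 < \<alpha>^2 * (exp (q$i))^2"
proof -
 have "q$i > q$j + gap \<alpha>" using assms by (simp add: region_def)
 then show ?thesis using ln_gap_iff(1)[of "exp (q$i)" "exp (q$j)" \<alpha>] alpha2 by simp
qed

lemma region_exp_neq:
 fixes q :: "'n rvec"
 assumes "q \<in> region \<alpha>"
 shows "(exp (q$i))^2 ~= \<alpha>^2 * (exp (q$j))^2" "i ~= j ==> (exp (q$i))\<^sup>2 ~= (exp (q$j))^2"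
 using region_neq(1,2)[of "%i. (exp (q$i))^2" i j] region_exp[OF assms] by (metis exp_gt_zero zero_less_power)+

lemma eq_nth [simp]: "eq q$i = exp (q$i)"
 by (simp add: eq_def)

text \<open>The phase p_i is read off from the entry T_ii, whose modulus is this number.\<close>

lemma T_tilde_diag_pos:
 assumes q: "q \<in> region \<alpha>" and v: "!!i. 0 < v$i"
 shows "0 < T_tilde \<alpha> (eq q) v$i$i"
proof -
 have ne: "(eq q$i)^2 ~= \<alpha>^2 * (eq q$j)^2" for i j using region_exp_neq(1)[OF q] by (simp add: eq_def)
 have "0 < (\<Sum>k\<in>UNIV. (v$k)^2 / ((eq q$i)^2 - \<alpha>\<^sup>2 * (eq q$k)^2)^2)"
  using v ne by (intro sum_pos) (auto simp: less_imp_neq[symmetric])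
 moreover have "0 < (eq q$i)^2 - \<alpha>\<^sup>2 * (eq q$i)^2" using alpha2 by (simp add: eq_def)
 ultimately show ?thesis unfolding T_tilde_nth[OF ne] using v[of i] by simp
qed

lemma exp_i_eq_iff: "exp (\<i> * complex_of_real s) = exp (\<i> * complex_of_real t) \<longleftrightarrow> (\<exists>k::int. t - s = 2 * pi * of_int k)"
proof -
 have "exp (\<i> * complex_of_real s) = exp (\<i> * complex_of_real t) \<longleftrightarrow> (\<exists>k::int. \<i> * complex_of_real t = \<i> * complex_of_real s + (of_int (2 * k) * pi) * \<i>)"
  by (metis (no_types) exp_eq)
 also have "... \<longleftrightarrow> (\<exists>k::int. t - s = 2 * pi * of_int k)"
  by (intro ex_cong1) (auto simp: complex_eq_iff algebra_simps)
 finally show ?thesis .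
qed

lemma coords_gauge_iff:
 assumes "coords \<alpha> vh \<sigma> x y g q p" "coords \<alpha> vh \<sigma> x y h q' p'"
 shows "(g, h) \<in> G \<longleftrightarrow> q = q' & (\<forall>i. \<exists>k::int. p'$i - p$i = 2 * pi * of_int k)"
proof -
 obtain \<rho> w v where a: "q \<in> region \<alpha>" "Dl q \<in> chamber" "unitary \<rho>" "det \<rho> = 1" "rephased vh w" "!!i. 0 < v$i"
  "cvec v = Sinh (Dl q) *v (\<rho>\<^sup>H *v w)" "(g, NF \<rho> (Dl q) (TN q p v)) \<in> G"
  "NF \<rho> (Dl q) (TN q p v) \<in> C" "normal_data \<sigma> \<rho> (Dl q) (TN q p v)"
  "secular (%i. (exp (q$i))^2) (%i. \<alpha>^2 * (exp (q$i))^2) (%k. (v$k)^2)"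
  using assms(1) by (rule coordsE) blast
 obtain \<rho>' w' v' where b: "q' \<in> region \<alpha>" "Dl q' \<in> chamber" "unitary \<rho>'" "det \<rho>' = 1" "rephased vh w'" "!!i. 0 < v'$i"
  "cvec v' = Sinh (Dl q') *v (\<rho>'\<^sup>H *v w')" "(h, NF \<rho>' (Dl q') (TN q' p' v')) \<in> G"
  "NF \<rho>' (Dl q') (TN q' p' v') \<in> C" "normal_data \<sigma> \<rho>' (Dl q') (TN q' p' v')"
  "secular (%i. (exp (q'$i))^2) (%i. \<alpha>^2 * (exp (q'$i))^2) (%k. (v'$k)^2)"
  using assms(2) by (rule coordsE) blast
 let ?g = "NF \<rho> (Dl q) (TN q p v)" and ?h = "NF \<rho>' (Dl q') (TN q' p' v')"
 have gh: "(g, h) \<in> G \<longleftrightarrow> (?g, ?h) \<in> G"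
  using a(8) b(8) gauge_sym gauge_trans by metis
 have vq: "v = v'" if qq: "q = q'"
 proof -
  have "(v$k)^2 = (v'$k)^2" for k
   using secular_chamber[of "Dl q" "%k. (v$k)^2" k] secular_chamber[of "Dl q" "%k. (v'$k)^2" k] a(2,11) b(11) qq by simp
  then show ?thesis using a(6) b(6) by (simp add: vec_eq_iff) (metis less_imp_le power2_eq_iff_nonneg)
 qed
 show ?thesis unfolding gh
 proof
  assume G: "(?g, ?h) \<in> G"
  have "Dl q' = Dl q" by (rule normal_form_gauge_unique(1)[OF a(10) b(10) G])
  then have qq: "q = q'" by (simp add: Dl_inj)
  note v = vq[OF qq]
  obtain R d where R: "stab R" "unitary (dmat d)" "\<rho>' = R**\<rho>**(dmat d)\<^sup>H" "TN q' p' v' = dmat d**TN q p v **(dmat d)\<^sup>H"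
   using normal_form_gauge_unique(2)[OF a(10) b(10) G] by blast
  have uR: "unitary R" "R\<^sup>H**outer vh**R = outer vh" using R(1) by (auto simp: stab_outer)
  have cS: "Sinh (Dl q)**dmat d = dmat d**Sinh (Dl q)" by (simp add: Sinh_def dmat_mult_commute)
  have "outer (cvec v') = outer ((Sinh (Dl q)**\<rho>'\<^sup>H) *v vh)"
   unfolding b(7) qq matrix_vector_mul_assoc by (rule outer_rephased[OF b(5)])
  also have "... = (dmat d**Sinh (Dl q)**\<rho>\<^sup>H**R\<^sup>H)**outer vh**(dmat d**Sinh (Dl q)**\<rho>\<^sup>H**R\<^sup>H)\<^sup>H"
   unfolding outer_mult_vec R(3) by (simp add: ctrans_mult mm_assoc cS)
  also have "... = (dmat d**Sinh (Dl q)**\<rho>\<^sup>H)**(R\<^sup>H**outer vh**R)**(dmat d**Sinh (Dl q)**\<rho>\<^sup>H)\<^sup>H"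
   by (simp add: ctrans_mult mm_assoc)
  also have "... = outer (dmat d *v ((Sinh (Dl q)**\<rho>\<^sup>H) *v vh))"
   unfolding uR outer_mult_vec by (simp add: matrix_vector_mul_assoc mm_assoc)
  also have "... = outer (dmat d *v cvec v)"
   unfolding a(7) matrix_vector_mul_assoc mm_assoc by (rule outer_rephased[OF a(5), symmetric])
  finally have "outer (cvec v')$i$j = outer (dmat d *v cvec v)$i$j" for i j by simp
  then have E: "of_real (v'$i) * of_real (v'$j) = d$i * cnj (d$j) * (of_real (v$i) * of_real (v$j))" for i j
   by (simp add: outer_def dmat_vector mult_ac)
  \<comment> \<open>All v_i are positive, so the entries of d share one phase; conjugation by
    \<open>dmat d\<close> then leaves T unchanged.\<close>
  then have dd: "d$i * cnj (d$j) = 1" for i j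
   using less_imp_neq[OF a(6)[of i], symmetric] less_imp_neq[OF a(6)[of j], symmetric] E[of i j] by (simp add: v[symmetric])
  have "TN q' p' v' = TN q p v"
   unfolding R(4) by (simp add: ctrans_dmat dmat_mult_left dmat_mult_right vec_eq_iff) (metis dd mult.commute mult.left_commute mult.right_neutral)
  then have E: "TN q p' v$i$i = TN q p v$i$i" for i by (simp add: qq v)
  have "exp (\<i> * of_real (p'$i)) = exp (\<i> * complex_of_real (p$i))" for i
   using less_imp_neq[OF T_tilde_diag_pos[OF a(1,6), of i], symmetric] E[of i] by (simp add: TN_nth[OF a(1)])
  then show "q = q' & (\<forall>i. \<exists>k::int. p'$i - p$i = 2 * pi * of_int k)"
   using qq exp_i_eq_iff by metis
 next
  assume r: "q = q' & (\<forall>i. \<exists>k::int. p'$i - p$i = 2 * pi * of_int k)"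
  then have qq: "q = q'" by simp
  note v = vq[OF qq]
  have "exp (\<i> * of_real (p$i)) = exp (\<i> * complex_of_real (p'$i))" for i using r exp_i_eq_iff by blast
  then have T: "TN q' p' v' = TN q p v" by (simp add: TN_def exp_i_def qq v)
  \<comment> \<open>Equal q give equal v, hence \<rho>^H w = \<rho>'^H w'. So this matrix sends w to
    w', both of them phases of \<open>vh\<close>, and lies in the stabiliser; its determinant is
    1.\<close>
  let ?R = "\<rho>'**\<rho>\<^sup>H"
  have uR: "unitary ?R" using a b by (simp add: unitary_mult)
  have e: "\<rho>\<^sup>H *v w = \<rho>'\<^sup>H *v w'"
  proof -
   have "(SinhI (Dl q)**Sinh (Dl q)) *v (\<rho>\<^sup>H *v w) = (SinhI (Dl q)**Sinh (Dl q)) *v (\<rho>'\<^sup>H *v w')"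
    using a(7) b(7) v qq by (simp flip: matrix_vector_mul_assoc)
   then show ?thesis by (simp add: Sinh_SinhI[OF a(2)])
  qed
  have "?R\<^sup>H**outer vh**?R = \<rho>**(\<rho>'\<^sup>H**outer w'**(\<rho>'\<^sup>H)\<^sup>H)**\<rho>\<^sup>H"
   by (simp add: ctrans_mult mm_assoc rephased_outer[OF b(5)])
  also have "... = (\<rho>**\<rho>\<^sup>H)**outer w**(\<rho>**\<rho>\<^sup>H)"
   unfolding outer_mult_vec e[symmetric] by (simp add: outer_mult_vec[symmetric] mm_assoc)
  also have "... = outer vh" by (simp add: unitaryD[OF a(3)] rephased_outer[OF a(5)])
  finally have R: "stab ?R" using uR by (simp add: stab_outer)
  have "kN \<rho>' (Dl q) = blk ?R 0 0 (mat 1)**kN \<rho> (Dl q)"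
   by (simp add: mm_assoc blk_mult) (simp add: mm_assoc[symmetric] unitaryD[OF a(3)])
  then have "?h = blk ?R 0 0 (mat 1)**?g**blk (mat 1) 0 0 (mat 1)"
   unfolding T unfolding qq[symmetric] normal_form_eq[OF a(2)] by (simp add: blk_mat mm_assoc)
  moreover have "det ?R = 1" using a(4) b(4) by (simp add: det_mul det_ctrans)
  ultimately show "(?g, ?h) \<in> G" using R a(9) by (intro gauge_relI) simp_all
 qed
qed

subsection \<open>Descent of the Hamiltonians\<close>

lemma matpow_conj: "A**B = mat 1 ==> matpow (B**X**A) m = B**matpow X m**A" if "B**A = mat 1" for A :: "'k::finite cmat"
proof (induction m)
 case 0
 then show ?case using that by (simp add: matpow_def)
next
 case (Suc m)
 have IH: "matpow (B**X**A) m = B**matpow X m**A" using Suc by blast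
 have "matpow (B**X**A) (Suc m) = (B**X**A)**(B**matpow X m**A)"
  unfolding IH[symmetric] by (simp add: matpow_def)
 also have "... = B**X**(A**B)**matpow X m**A" by (simp only: mm_assoc)
 also have "... = B**matpow X (Suc m)**A" using Suc.prems by (simp add: matpow_def mm_assoc)
 finally show ?case .
qed

text \<open>A left factor conjugates \<open>g**Inn**g\<^sup>H**Inn\<close>, and a right factor drops
  out of it.\<close>

lemma Phi_gauge:
 assumes D: "Unn D" and k: "Unn k" shows "Phi m (D**g**k) = Phi m g"
proof -
 let ?J = "g**Inn**g\<^sup>H**Inn" let ?Di = "Inn**D\<^sup>H**Inn"
 have "(D**g**k)**Inn**(D**g**k)\<^sup>H**Inn = D**g**(k**Inn**k\<^sup>H)**g\<^sup>H**(Inn**Inn)**D\<^sup>H**Inn"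
  by (simp add: ctrans_mult mm_assoc)
 also have "... = D**?J**?Di" unfolding Unn_flip[OF k] by (simp only: mm_assoc)
 finally have "matpow ((D**g**k)**Inn**(D**g**k)\<^sup>H**Inn) m = D**matpow ?J m**?Di"
  using matpow_conj Unn_left[OF D] Unn_right[OF D] by metis
 moreover have "trace (D**matpow ?J m**?Di) = trace (?Di**(D**matpow ?J m))" by (rule trace_mul_sym)
 moreover have "?Di**(D**matpow ?J m) = matpow ?J m"
  by (simp only: mm_assoc Unn_left[OF D] matrix_mul_lid)
 ultimately show ?thesis by (simp add: Phi_def)
qed

lemma Phi_gauge_rel: "(g, h) \<in> G ==> Phi m g = Phi m h"
 by (auto simp: gauge_rel_iff stab_def Phi_gauge Unn_blk_diag)

lemma Phi_descends: "\<exists>\<phi>. \<forall>c \<in> reduced_space \<sigma> x y. \<forall>g\<in>c. Phi m g = \<phi> c"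
proof -
 have "Phi m g = Phi m (SOME h. h \<in> c)" if c: "c \<in> reduced_space \<sigma> x y" "g \<in> c" for c g
 proof -
  have "(SOME h. h \<in> c) \<in> c" using c(2) by (rule someI)
  then have "(g, SOME h. h \<in> c) \<in> G"
   using c quotient_eq_iff[OF equiv_gauge] unfolding reduced_space_def by blast
  then show ?thesis by (rule Phi_gauge_rel)
 qed
 then show ?thesis by (intro exI[of _ "%c. Phi m (SOME h. h \<in> c)"] ballI)
qed

end

subsection \<open>The first Hamiltonian\<close>

context reduction begin

text \<open>In a = e^(q_i) and b = e^(q_k) the factor is a rational function of a^2 and b^2 that
  splits; its pieces are those of which the diagonal of \<open>T_tilde\<close> is built. Whichever
  of i and k is smaller, the gap gives both numerator factors the same sign.\<close>

lemma gap_factor_pos: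
 fixes q :: "'n rvec"
 assumes q: "q \<in> region \<alpha>" and ik: "i ~= k"
 shows "1 - (\<alpha> - inverse \<alpha>)\<^sup>2 / (4 * (sinh (q$i - q$k))^2) =
   ((exp (q$k))^2 - \<alpha>\<^sup>2 * (exp (q$i))^2) * (\<alpha>^2 * (exp (q$k))^2 - (exp (q$i))\<^sup>2) /
   ((\<alpha>^2 * (exp (q$k))^2 - \<alpha>\<^sup>2 * (exp (q$i))^2) * ((exp (q$k))^2 - (exp (q$i))\<^sup>2))"
  "0 < 1 - (\<alpha> - inverse \<alpha>)\<^sup>2 / (4 * (sinh (q$i - q$k))^2)"
proof -
 define a b where "a = exp (q$i)" and "b = exp (q$k)"
 have ab: "0 < a" "0 < b" by (simp_all add: a_def b_def)
 have ne: "a^2 ~= b^2" using region_exp_neq(2)[OF q, of i k] ik by (simp add: a_def b_def)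
 have s: "sinh (q$i - q$k) = (a^2 - b\<^sup>2) / (2 * a * b)"
  using ab by (simp add: sinh_field_def exp_diff a_def[symmetric] b_def[symmetric] exp_minus field_simps power2_eq_square)
 have s0: "a^2 - b\<^sup>2 ~= 0" "b^2 - a\<^sup>2 ~= 0" using ne by auto
 have 4: "4 * (sinh (q$i - q$k))^2 = (a^2 - b\<^sup>2)^2 / (a^2 * b^2)"
  unfolding s using ab by (simp add: power_divide power_mult_distrib field_simps)
 have al: "(\<alpha> - inverse \<alpha>)^2 = (\<alpha>^2 - 1)^2 / \<alpha>^2"
  using alpha2 by (simp add: field_simps power2_eq_square)
 have "1 - ((\<alpha>^2 - 1)^2 / \<alpha>^2) / ((a^2 - b\<^sup>2)^2 / (a^2 * b^2)) = 1 - ((\<alpha>^2 - 1)^2 * (a^2 * b^2)) / (\<alpha>^2 * (a^2 - b\<^sup>2)^2)"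
  by simp
 also have "... = (\<alpha>^2 * (a^2 - b\<^sup>2)^2 - (\<alpha>^2 - 1)\<^sup>2 * (a^2 * b^2)) / (\<alpha>^2 * (a^2 - b\<^sup>2)^2)"
  using alpha2 s0 by (simp add: diff_divide_distrib)
 also have "\<alpha>^2 * (a^2 - b\<^sup>2)^2 - (\<alpha>^2 - 1)\<^sup>2 * (a^2 * b^2) = (b^2 - \<alpha>\<^sup>2 * a^2) * (\<alpha>^2 * b^2 - a\<^sup>2)"
  by algebra
 also have "\<alpha>^2 * (a^2 - b\<^sup>2)^2 = (\<alpha>^2 * b^2 - \<alpha>\<^sup>2 * a^2) * (b^2 - a\<^sup>2)"
  by algebra
 finally show eq: "1 - (\<alpha> - inverse \<alpha>)\<^sup>2 / (4 * (sinh (q$i - q$k))^2) =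
   ((exp (q$k))^2 - \<alpha>\<^sup>2 * (exp (q$i))^2) * (\<alpha>^2 * (exp (q$k))^2 - (exp (q$i))\<^sup>2) /
   ((\<alpha>^2 * (exp (q$k))^2 - \<alpha>\<^sup>2 * (exp (q$i))^2) * ((exp (q$k))^2 - (exp (q$i))\<^sup>2))"
  unfolding 4 al a_def b_def .
 have a2: "\<alpha>^2 * t^2 < t^2" if "0 < t" for t :: real using alpha2 that by simp
 have "0 < (b^2 - \<alpha>\<^sup>2 * a^2) * (\<alpha>^2 * b^2 - a\<^sup>2)"
 proof (cases "i < k")
  case True
  then have "b^2 < \<alpha>^2 * a^2" using region_exp[OF q] by (simp add: a_def b_def)
  moreover have "\<alpha>^2 * b^2 < a^2" using calculation a2[OF ab(1)] a2[OF ab(2)] by linarith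
  ultimately show ?thesis by (simp add: mult_neg_neg)
 next
  case False
  then have "a^2 < \<alpha>^2 * b^2" using region_exp[OF q, of k i] ik by (simp add: a_def b_def)
  moreover have "\<alpha>^2 * a^2 < b^2" using calculation a2[OF ab(1)] a2[OF ab(2)] by linarith
  ultimately show ?thesis by simp
 qed
 moreover have "(\<alpha>^2 * b^2 - \<alpha>\<^sup>2 * a^2) * (b^2 - a\<^sup>2) = \<alpha>^2 * (b^2 - a\<^sup>2)^2" by algebra
 moreover have "0 < \<alpha>^2 * (b^2 - a\<^sup>2)^2" using alpha2 s0 by simp
 ultimately show "0 < 1 - (\<alpha> - inverse \<alpha>)\<^sup>2 / (4 * (sinh (q$i - q$k))^2)"
  unfolding eq a_def[symmetric] b_def[symmetric] by simp
qed

text \<open>The square of the entry is v_i^2 / ((l_i - m_i)^2 N). The secular identity at m_i gives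
  v_i^2, its derivative at l_i gives N, and the four products \<open>A\<close>, \<open>B\<close>,
  \<open>E\<close>, \<open>F\<close> combine factor by factor.\<close>

lemma T_tilde_diag:
 assumes q: "q \<in> region \<alpha>" and v: "!!i. 0 < v$i"
  and sec: "secular (%i. (exp (q$i))^2) (%i. \<alpha>^2 * (exp (q$i))^2) (%k. (v$k)^2)"
 shows "T_tilde \<alpha> (eq q) v$i$i = (\<Prod>k\<in>UNIV - {i}. sqrt (1 - (\<alpha> - inverse \<alpha>)\<^sup>2 / (4 * (sinh (q$i - q$k))^2)))"
proof -
 let ?l = "%i. (exp (q$i))^2" and ?m = "%i. \<alpha>^2 * (exp (q$i))^2" and ?t = "T_tilde \<alpha> (eq q) v$i$i"
 have ne': "(eq q$i)^2 ~= \<alpha>^2 * (eq q$j)^2" for i j using region_exp_neq(1)[OF q] by simp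
 define N where "N = (\<Sum>k\<in>UNIV. (v$k)^2 / (?l i - ?m k)^2)"
 define A where "A = (\<Prod>j\<in>UNIV - {i}. ?l j - ?m i)"
 define B where "B = (\<Prod>j\<in>UNIV - {i}. ?m j - ?m i)"
 define E where "E = (\<Prod>j\<in>UNIV - {i}. ?l j - ?l i)"
 define F where "F = (\<Prod>j\<in>UNIV - {i}. ?m j - ?l i)"
 have N0: "0 < N" unfolding N_def
  using v region_exp_neq(1)[OF q] by (intro sum_pos) (auto simp: less_imp_neq[symmetric])
 have nz: "B ~= 0" "E ~= 0" "F ~= 0" "?l i - ?m i ~= 0"
 proof -
  have d: "?l j ~= ?l i" if "j ~= i" for j using region_exp_neq(2)[OF q that] .
  have d': "?m j ~= ?l i" for j using region_exp_neq(1)[OF q, of i j] by metis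
  show "E ~= 0" unfolding E_def using d by (subst prod_zero_iff) auto
  show "F ~= 0" unfolding F_def using d' by (subst prod_zero_iff) auto
  show "B ~= 0" unfolding B_def using d alpha2 by (subst prod_zero_iff) auto
  show "?l i - ?m i ~= 0" using d'[of i] by linarith
 qed
 have vi: "(v$i)^2 * B = (?l i - ?m i) * A"
  using secularD[OF sec, of i] unfolding A_def B_def by (simp only: prod_remove_UNIV[of "%j. ?l j - ?m i" i])
 have Ni: "N * ((?m i - ?l i) * F) = - E"
  using secular_sum_square[OF sec region_exp_neq(1)[OF q], of i] unfolding N_def E_def F_def
  by (simp only: prod_remove_UNIV[of "%j. ?m j - ?l i" i])
 have "?t\<^sup>2 = (v$i)^2 / (?l i - ?m i)^2 / N"
 proof -
  have "?t = v$i / (?l i - ?m i) / sqrt N"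
   using T_tilde_nth[OF ne', where v = v and i = i and j = i] by (simp add: N_def)
  then show ?thesis using N0 by (simp add: power_divide power_mult_distrib)
 qed
 also have "(v$i)^2 = (?l i - ?m i) * A / B" using vi nz by (simp add: field_simps)
 also have "N = E / ((?l i - ?m i) * F)"
 proof -
  have "N * ((?l i - ?m i) * F) = E" using Ni by algebra
  then show ?thesis using nz by (simp add: field_simps)
 qed
 also have "(?l i - ?m i) * A / B / (?l i - ?m i)^2 / (E / ((?l i - ?m i) * F)) = (A * F) / (B * E)"
  using nz by (simp add: power2_eq_square)
 also have "... = (\<Prod>k\<in>UNIV - {i}. 1 - (\<alpha> - inverse \<alpha>)\<^sup>2 / (4 * (sinh (q$i - q$k))^2))"
  unfolding A_def B_def E_def F_def prod.distrib[symmetric] prod_dividef[symmetric]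
  by (rule prod.cong[OF refl]) (simp add: gap_factor_pos(1)[OF q])
 also have "... = (\<Prod>k\<in>UNIV - {i}. sqrt (1 - (\<alpha> - inverse \<alpha>)\<^sup>2 / (4 * (sinh (q$i - q$k))^2)))^2"
  unfolding prod_power_distrib
 proof (rule prod.cong[OF refl])
  fix k assume "k \<in> UNIV - {i}"
  then have "0 < 1 - (\<alpha> - inverse \<alpha>)\<^sup>2 / (4 * (sinh (q$i - q$k))^2)" by (intro gap_factor_pos(2)[OF q]) auto
  then show "1 - (\<alpha> - inverse \<alpha>)\<^sup>2 / (4 * (sinh (q$i - q$k))^2) = (sqrt (1 - (\<alpha> - inverse \<alpha>)\<^sup>2 / (4 * (sinh (q$i - q$k))^2)))^2"
   by (simp only: real_sqrt_pow2[OF less_imp_le])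
 qed
 finally have "?t\<^sup>2 = (\<Prod>k\<in>UNIV - {i}. sqrt (1 - (\<alpha> - inverse \<alpha>)\<^sup>2 / (4 * (sinh (q$i - q$k))^2)))^2" .
 moreover have "0 \<le> (\<Prod>k\<in>UNIV - {i}. sqrt (1 - (\<alpha> - inverse \<alpha>)\<^sup>2 / (4 * (sinh (q$i - q$k))^2)))"
  using gap_factor_pos(2)[OF q] by (intro prod_nonneg) (auto intro: less_imp_le)
 ultimately show ?thesis using T_tilde_diag_pos[OF q v, of i] by (simp add: power2_eq_iff_nonneg)
qed

lemma trace_mult_ctrans: "trace (A**A\<^sup>H) = of_real (\<Sum>i\<in>UNIV. \<Sum>j\<in>UNIV. (cmod (A$i$j))^2)" for A :: "'n cmat"
 by (simp add: trace_def matrix_mult_nth flip: complex_norm_square)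

lemma Phi_one: "Phi 1 g = - (1 / 2) * Re (trace (g**Inn**g\<^sup>H**Inn))"
 by (simp add: Phi_def matpow_def)

lemma Phi_one_bR: "Phi 1 (bR \<omega>) = 1 / 2 * (\<Sum>i\<in>UNIV. \<Sum>j\<in>UNIV. (cmod (\<omega>$i$j))^2) - 1 / 2 * CARD('n) * (x^2 + 1 / x^2)"
proof -
 have "bR \<omega>**Inn**(bR \<omega>)\<^sup>H**Inn = blk (x^2 *\<^sub>R mat 1 - \<omega>**\<omega>\<^sup>H) ((1 / x) *\<^sub>R \<omega>) (- (1 / x) *\<^sub>R \<omega>\<^sup>H) ((1 / x^2) *\<^sub>R mat 1)"
  by (simp add: bR_def Inn_def smat_eq blk_simps ctrans_simps mm_ring power2_eq_square blk_eq_iff)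
 then show ?thesis
  unfolding Phi_one by (simp add: trace_blk trace_sub trace_scaleR trace_I trace_mult_ctrans del: of_real_sum) (simp add: field_simps)
qed

lemma wN_nth: "wN Delta T$i$j = of_real (inverse (sinh (Delta$i))) *
  (of_real (sqrt (y^2 + x^2 * (sinh (Delta$i))^2)) * T$i$j - of_real (if i = j then cosh (Delta$i) / x else 0))"
 by (simp add: SinhI_def Lam_def Cosh_def dmat_mult_left) (simp add: scaleR_conv_of_real)

lemma row_norm_wN:
 assumes T: "unitary T" and d: "Delta$i ~= 0"
 shows "(\<Sum>j\<in>UNIV. (cmod (wN Delta T$i$j))^2) = x^2 + 1 / x^2 + (y^2 + 1 / x^2) / (sinh (Delta$i))^2
   - 2 * (sqrt (y^2 + x^2 * (sinh (Delta$i))^2) * cosh (Delta$i) / (x * (sinh (Delta$i))^2)) * Re (T$i$i)"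
proof -
 define s c where "s = sinh (Delta$i)" and "c = cosh (Delta$i)"
 define L where "L = sqrt (y^2 + x^2 * s^2)"
 have s: "s ~= 0" using d by (simp add: s_def)
 have L2: "L^2 = y^2 + x^2 * s^2" by (simp add: L_def s_def)
 have c2: "c^2 = s^2 + 1" by (simp add: c_def s_def cosh_square_eq)
 have "(\<Sum>k\<in>UNIV. T$i$k * cnj (T$i$k)) = 1"
  using arg_cong[OF unitaryD(2)[OF T], of "%A. A$i$i"] by (simp add: matrix_mult_nth mat_def)
 then have "complex_of_real (\<Sum>k\<in>UNIV. (cmod (T$i$k))^2) = 1" by (simp flip: complex_norm_square)
 then have T1: "(\<Sum>k\<in>UNIV. (cmod (T$i$k))^2) = 1" using of_real_eq_1_iff by blast
 have "(cmod (wN Delta T$i$j))^2 = (L / s)^2 * (cmod (T$i$j))^2 +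
   (if j = i then (c / (x * s))\<^sup>2 - 2 * (L * c / (x * s^2)) * Re (T$i$i) else 0)" for j
 proof -
  have m: "Re (of_real a * z) = a * Re z" "Im (of_real a * z) = a * Im z" for a z by simp_all
  have re: "Re (wN Delta T$i$j) = inverse s * (L * Re (T$i$j) - (if i = j then c / x else 0))"
   "Im (wN Delta T$i$j) = inverse s * (L * Im (T$i$j))"
   unfolding wN_nth s_def[symmetric] c_def[symmetric] L_def[symmetric]
   by (simp_all only: m minus_complex.sel Re_complex_of_real Im_complex_of_real diff_zero)
  show ?thesis unfolding cmod_power2 re using s x_pos
   by (cases "i = j") (simp_all add: field_simps power2_eq_square)
 qed
 then have "(\<Sum>j\<in>UNIV. (cmod (wN Delta T$i$j))^2) = (L / s)^2 + (c / (x * s))^2 - 2 * (L * c / (x * s^2)) * Re (T$i$i)"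
  by (simp add: sum.distrib sum_distrib_left[symmetric] T1)
 also have "(L / s)^2 + (c / (x * s))^2 = x^2 + 1 / x^2 + (y^2 + 1 / x^2) / s^2"
  using s x_pos by (simp add: power_divide power_mult_distrib L2 c2 field_simps)
 finally show ?thesis by (simp add: s_def c_def L_def)
qed

text \<open>The pseudo-unitary k_L does not change \<Phi>_1, which is therefore half the squared
  norm of \<omega> minus n (x^2 + x^(-2))/2; each row of \<omega> gives back one x^2 + x^(-2). Only
  the cross term of a row sees T, through Re T_ii.\<close>

lemma Phi_one_coords:
 assumes "coords \<alpha> vh \<sigma> x y g q p"
 shows "Phi 1 g = 1 / 2 * (1 / x^2 + y^2) * (\<Sum>i\<in>UNIV. exp (- 2 * q$i))
    - (\<Sum>i\<in>UNIV. cos (p$i) *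
      sqrt (1 + (1 + y^2 / x^2) * exp (- 2 * q$i) + y^2 / x^2 * exp (- 4 * q$i)) *
      (\<Prod>k\<in>UNIV - {i}. sqrt (1 - (\<alpha> - inverse \<alpha>)\<^sup>2 / (4 * (sinh (q$i - q$k))^2))))"
proof -
 obtain \<rho> w v where a: "q \<in> region \<alpha>" "Dl q \<in> chamber" "unitary \<rho>" "!!i. 0 < v$i"
  "(g, NF \<rho> (Dl q) (TN q p v)) \<in> G" "normal_data \<sigma> \<rho> (Dl q) (TN q p v)"
  "secular (%i. (exp (q$i))^2) (%i. \<alpha>^2 * (exp (q$i))^2) (%k. (v$k)^2)"
  using assms by (rule coordsE) blast
 let ?T = "TN q p v"
 have T: "unitary ?T" using a(6) by (simp add: normal_data_def)
 have kU: "Unn (kN \<rho> (Dl q))" using a(3) by (intro Unn_mult Unn_blk_diag Unn_Hyp) auto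
 have I: "Unn (mat 1 :: 'n bmat)" by (simp add: Unn_def)
 have "Phi 1 g = Phi 1 (kN \<rho> (Dl q)**bR (wN (Dl q) ?T)**mat 1)"
  using Phi_gauge_rel[OF a(5)] by (simp add: normal_form_eq[OF a(2)])
 also have "... = Phi 1 (bR (wN (Dl q) ?T))" by (rule Phi_gauge[OF kU I])
 finally have 1: "Phi 1 g = Phi 1 (bR (wN (Dl q) ?T))" .
 let ?t = "%i. (\<Prod>k\<in>UNIV - {i}. sqrt (1 - (\<alpha> - inverse \<alpha>)\<^sup>2 / (4 * (sinh (q$i - q$k))^2)))"
 let ?r = "%i. sqrt (1 + (1 + y^2 / x^2) * exp (- 2 * q$i) + y^2 / x^2 * exp (- 4 * q$i))"
 have row: "(\<Sum>j\<in>UNIV. (cmod (wN (Dl q) ?T$i$j))^2) = x^2 + 1 / x^2 + (1 / x^2 + y^2) * exp (- 2 * q$i) - 2 * (cos (p$i) * ?r i * ?t i)" for i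
 proof -
  let ?s = "exp (q$i)"
  have d: "Dl q$i ~= 0" using a(2) unfolding chamber_def by (metis (mono_tags, lifting) less_irrefl mem_Collect_eq)
  have e2: "exp (- 2 * q$i) = 1 / ?s\<^sup>2" "exp (- 4 * q$i) = 1 / ?s ^ 4"
   using exp_of_nat_mult[of 2 "q$i"] exp_of_nat_mult[of 4 "q$i"] by (simp_all add: exp_minus divide_inverse)
  have c: "cosh (Dl q$i) = sqrt (1 + ?s\<^sup>2)"
   using cosh_square_eq[of "Dl q$i"] by (metis add.commute cosh_real_nonneg real_sqrt_unique sinh_Dl)
  \<comment> \<open>The bracket of the Hamiltonian is (\<Lambda>_i cosh \<Delta>_i / (x
    \<Sigma>_i^2))^2.\<close>
  have "?r i = sqrt ((y^2 + x^2 * ?s\<^sup>2) * (1 + ?s\<^sup>2) / (x * ?s\<^sup>2)^2)"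
   unfolding e2 using x_pos by (intro arg_cong[of _ _ sqrt]) (simp add: field_simps power2_eq_square power4_eq_xxxx)
  also have "... = sqrt (y^2 + x^2 * ?s\<^sup>2) * sqrt (1 + ?s\<^sup>2) / (x * ?s\<^sup>2)"
   using x_pos by (simp add: real_sqrt_mult real_sqrt_divide)
  finally have r: "sqrt (y^2 + x^2 * (sinh (Dl q$i))^2) * cosh (Dl q$i) / (x * (sinh (Dl q$i))^2) = ?r i"
   by (simp add: c)
  have h1: "?T$i$i = exp (\<i> * of_real (p$i)) * of_real (?t i)"
   unfolding TN_nth[OF a(1)] T_tilde_diag[OF a(1,4,7)] ..
  have h2: "Re (exp (\<i> * of_real a) * of_real b) = cos a * b" for a b by (simp add: Re_exp)
  have "Re (?T$i$i) = cos (p$i) * ?t i" by (simp only: h1 h2)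
  then show ?thesis unfolding row_norm_wN[OF T d] r e2 by simp
 qed
 define E H where "E = (\<Sum>i\<in>UNIV. exp (- 2 * q$i))" and "H = (\<Sum>i\<in>UNIV. cos (p$i) * ?r i * ?t i)"
 have "(\<Sum>i\<in>UNIV. x^2 + 1 / x^2 + (1 / x^2 + y^2) * exp (- 2 * q$i) - 2 * (cos (p$i) * ?r i * ?t i))
  = CARD('n) * (x^2 + 1 / x^2) + (1 / x^2 + y^2) * E - 2 * H"
  unfolding E_def H_def by (simp only: sum.distrib sum_subtractf sum_distrib_left sum_constant distrib_left)
 note this[folded E_def H_def]
 then show ?thesis unfolding 1 Phi_one_bR row unfolding E_def[symmetric] H_def[symmetric] by (simp only:) (simp add: algebra_simps)
qed

end

subsection \<open>Differentiability of matrix-valued maps\<close>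

lemma bounded_linear_differentiable:
 "bounded_linear L ==> f differentiable F ==> (%u. L (f u)) differentiable F"
 unfolding differentiable_def using bounded_linear.has_derivative by blast

lemma linear_axis: "linear (axis i :: 'a::real_vector => 'a ^ 'n)"
 by (rule linearI) (auto simp: axis_def vec_eq_iff)

lemma vec_differentiableI:
 fixes f :: "'a::real_normed_vector => 'b::euclidean_space ^ 'n"
 assumes "!!i. (%u. f u$i) differentiable at a"
 shows "f differentiable at a"
proof -
 have f: "f = (%u. \<Sum>i\<in>UNIV. axis i (f u$i))"
  by (auto simp: fun_eq_iff vec_eq_iff axis_def)
 have "bounded_linear (axis i :: 'b => 'b ^ 'n)" for i
  by (simp add: linear_axis linear_conv_bounded_linear[symmetric])
 then have "(%u. axis i (f u$i)) differentiable at a" for i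
  using assms bounded_linear_differentiable by blast
 then show ?thesis by (subst f) (intro differentiable_sum; simp)
qed

lemma vec_nth_differentiable:
 fixes f :: "'a::real_normed_vector => 'b::real_normed_vector ^ 'n"
 assumes "f differentiable at a" shows "(%u. f u$i) differentiable at a"
 using bounded_linear_differentiable[OF bounded_linear_vec_nth assms] .

lemma matrix_differentiableI:
 fixes f :: "'a::real_normed_vector => 'b::euclidean_space ^ 'n ^ 'm"
 shows "(!!i j. (%u. f u$i$j) differentiable at a) ==> f differentiable at a"
 by (intro vec_differentiableI) auto

lemma matrix_differentiableD:
 fixes f :: "'a::real_normed_vector => 'b::real_normed_vector ^ 'n ^ 'm"
 shows "f differentiable at a ==> (%u. f u$i$j) differentiable at a"
 by (intro vec_nth_differentiable)

lemma bounded_bilinear_matrix_mult: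
 "bounded_bilinear ((**) :: 'n::finite cmat => 'n cmat => 'n cmat)"
 unfolding bilinear_conv_bounded_bilinear[symmetric] bilinear_def
 by (auto intro!: linearI simp: mm_ring)

lemma matrix_mult_differentiable:
 fixes f g :: "'a::real_normed_vector => 'n::finite cmat"
 assumes "f differentiable at a" "g differentiable at a" shows "(%u. f u**g u) differentiable at a"
 using assms bounded_bilinear.FDERIV[OF bounded_bilinear_matrix_mult] unfolding differentiable_def by blast

lemma bounded_linear_ctrans: "bounded_linear (ctrans :: 'n::finite cmat => 'n cmat)"
 by (simp add: linear_conv_bounded_linear[symmetric] linearI ctrans_add ctrans_scaleR)

lemma ctrans_differentiable:
 fixes f :: "'a::real_normed_vector => 'n::finite cmat"
 shows "f differentiable at a ==> (%u. (f u)\<^sup>H) differentiable at a"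
 by (rule bounded_linear_differentiable[OF bounded_linear_ctrans])

lemma blk_differentiable:
 fixes A B C D :: "'a::real_normed_vector => 'n::finite cmat"
 assumes "A differentiable at a" "B differentiable at a" "C differentiable at a" "D differentiable at a"
 shows "(%u. blk (A u) (B u) (C u) (D u)) differentiable at a"
proof (rule matrix_differentiableI)
 fix i j :: "'n + 'n"
 show "(%u. blk (A u) (B u) (C u) (D u)$i$j) differentiable at a"
  by (cases i; cases j) (simp_all add: assms matrix_differentiableD)
qed

lemma of_real_differentiable:
 "f differentiable at a ==> (%u. complex_of_real (f u)) differentiable at a"
 by (rule bounded_linear_differentiable[OF bounded_linear_of_real])

lemma dmat_differentiable:
 fixes d :: "'a::real_normed_vector => 'n::finite cvec"
 assumes "!!i. (%u. d u$i) differentiable at a" shows "(%u. dmat (d u)) differentiable at a"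
proof (rule matrix_differentiableI)
 show "(%u. dmat (d u)$i$j) differentiable at a" for i j by (cases "i = j") (simp_all add: assms)
qed

lemma dmat_cvec_differentiable:
 fixes d :: "'a::real_normed_vector => 'n::finite rvec"
 assumes "!!i. (%u. d u$i) differentiable at a" shows "(%u. dmat (cvec (d u))) differentiable at a"
 by (rule dmat_differentiable) (simp add: assms of_real_differentiable)

lemma prod_differentiable:
 fixes f :: "'i => 'a::real_normed_vector => 'b::real_normed_field"
 assumes "!!i. i \<in> A ==> f i differentiable at a" shows "(%u. \<Prod>i\<in>A. f i u) differentiable at a"
 using assms
proof (induction A rule: infinite_finite_induct)
 case (insert i A)
 then have "(%u. f i u * (\<Prod>i\<in>A. f i u)) differentiable at a" by (intro differentiable_mult) auto
 then show ?case using insert by simp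
qed auto

lemma real_compose_differentiable:
 fixes g :: "'a::real_normed_vector => real"
 assumes "g differentiable at a" "(f has_real_derivative D) (at (g a))"
 shows "(%u. f (g u)) differentiable at a"
 by (rule differentiable_compose[OF _ assms(1)]) (use assms(2) in \<open>auto simp: differentiable_def has_field_derivative_def\<close>)

lemma exp_differentiable: "(g :: 'a::real_normed_vector => real) differentiable at a ==> (%u. exp (g u)) differentiable at a"
 by (rule real_compose_differentiable) (auto intro!: DERIV_exp)

lemma sqrt_differentiable: "(g :: 'a::real_normed_vector => real) differentiable at a ==> 0 < g a ==> (%u. sqrt (g u)) differentiable at a"
 by (rule real_compose_differentiable) (auto intro!: DERIV_real_sqrt)

lemma ln_differentiable: "(g :: 'a::real_normed_vector => real) differentiable at a ==> 0 < g a ==> (%u. ln (g u)) differentiable at a"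
 by (rule real_compose_differentiable) (auto intro!: DERIV_ln)

lemma exp_i_differentiable:
 fixes p :: "'a::real_normed_vector => real"
 assumes "p differentiable at a" shows "(%u. exp (\<i> * complex_of_real (p u))) differentiable at a"
proof -
 have "(exp has_derivative (*) (exp z)) (at z)" for z :: complex
  using DERIV_exp[of z] by (simp add: has_field_derivative_def)
 then have "(exp :: complex => complex) differentiable at z" for z unfolding differentiable_def by blast
 then show ?thesis
  by (rule differentiable_compose) (intro differentiable_mult differentiable_const of_real_differentiable assms)
qed

lemma differentiable_cong_open:
 assumes "f differentiable at a" "open U" "a \<in> U" "!!u. u \<in> U ==> f u = g u"
 shows "g differentiable at a"
 using assms has_derivative_transform_within_open unfolding differentiable_def by (metis (no_types, lifting))

subsection \<open>Unitary matrices with a prescribed value\<close>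

text \<open>Complex Householder reflection along a - b'. It sends a to b' only when their inner
  product is real, so b is first turned by the phase c.\<close>

lemma exists_unitary_mapping:
 fixes a b :: "('n::finite) cvec"
 assumes n: "(\<Sum>k\<in>UNIV. (cmod (a$k))^2) = (\<Sum>k\<in>UNIV. (cmod (b$k))^2)"
 shows "\<exists>U. unitary U & U *v a = b"
proof -
 define z where "z = (\<Sum>k\<in>UNIV. cnj (a$k) * b$k)"
 define c where "c = (if z = 0 then 1 else cnj z / of_real (cmod z))"
 have c: "cmod c = 1" "c * z = of_real (cmod z)"
  using cnj_mult_self_divide_norm[of z] by (auto simp: c_def norm_divide)
 then have cc: "cnj c * c = 1" by (simp add: complex_norm_square[symmetric] mult.commute)
 define b' where "b' = c *s b"
 define w where "w = a - b'"
 define W where "W = (\<Sum>k\<in>UNIV. (cmod (w$k))^2)"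
 have bb: "(\<Sum>k\<in>UNIV. b'$k * cnj (b'$k)) = (\<Sum>k\<in>UNIV. a$k * cnj (a$k))"
 proof -
  have "(\<Sum>k\<in>UNIV. b'$k * cnj (b'$k)) = of_real (\<Sum>k\<in>UNIV. (cmod (b$k))^2)"
   unfolding of_real_sum by (rule sum.cong) (simp_all only: b'_def vector_smult_component complex_norm_square[symmetric] norm_mult c mult_1)
  also have "... = (\<Sum>k\<in>UNIV. a$k * cnj (a$k))"
   unfolding n[symmetric] of_real_sum by (simp only: complex_norm_square)
  finally show ?thesis .
 qed
 have ab: "(\<Sum>k\<in>UNIV. cnj (a$k) * b'$k) = of_real (cmod z)"
  using c(2) by (simp add: b'_def z_def sum_distrib_left mult_ac)
 then have "cnj (\<Sum>k\<in>UNIV. cnj (a$k) * b'$k) = of_real (cmod z)" by simp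
 then have ba: "(\<Sum>k\<in>UNIV. cnj (b'$k) * a$k) = of_real (cmod z)" by (simp add: mult.commute)
 have Wc: "complex_of_real W = (\<Sum>k\<in>UNIV. w$k * cnj (w$k))"
  unfolding W_def of_real_sum by (simp only: complex_norm_square)
 have "(\<Sum>k\<in>UNIV. w$k * cnj (w$k)) = (\<Sum>k\<in>UNIV. a$k * cnj (a$k)) + (\<Sum>k\<in>UNIV. b'$k * cnj (b'$k))
   - (\<Sum>k\<in>UNIV. cnj (b'$k) * a$k) - (\<Sum>k\<in>UNIV. cnj (a$k) * b'$k)"
  by (simp add: w_def sum.distrib sum_subtractf algebra_simps)
 then have W2: "complex_of_real W = 2 * ((\<Sum>k\<in>UNIV. a$k * cnj (a$k)) - of_real (cmod z))"
  unfolding Wc bb ab ba by simp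
 have wa: "(\<Sum>k\<in>UNIV. cnj (w$k) * a$k) = of_real W / 2"
 proof -
  have "(\<Sum>k\<in>UNIV. cnj (w$k) * a$k) = (\<Sum>k\<in>UNIV. a$k * cnj (a$k)) - (\<Sum>k\<in>UNIV. cnj (b'$k) * a$k)"
   by (simp add: w_def sum_subtractf algebra_simps)
  then show ?thesis unfolding W2 ba by simp
 qed
 have "\<exists>U. unitary U & U *v a = b'"
 proof (cases "w = 0")
  case True
  then show ?thesis by (intro exI[of _ "mat 1"]) (simp add: w_def)
 next
  case False
  then obtain k where "w$k ~= 0" by (auto simp: vec_eq_iff)
  then have W0: "0 < W" unfolding W_def by (intro sum_pos2[of _ k]) auto
  define U :: "'n cmat" where "U = mat 1 - (2 / W) *\<^sub>R outer w"
  have ct: "U\<^sup>H = U" by (auto simp: U_def vec_eq_iff outer_def mat_def)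
  have ow: "outer w**outer w = W *\<^sub>R outer w"
  proof -
   have "(\<Sum>k\<in>UNIV. w$i * cnj (w$k) * (w$k * cnj (w$j))) = of_real W * (w$i * cnj (w$j))" for i j
    unfolding Wc sum_distrib_right by (rule sum.cong) (simp_all add: mult_ac)
   then show ?thesis by (simp add: vec_eq_iff matrix_mult_nth outer_def) (simp add: scaleR_conv_of_real)
  qed
  have "U**U = mat 1 - (4 / W) *\<^sub>R outer w + (4 / (W * W)) *\<^sub>R (W *\<^sub>R outer w)"
   by (simp add: U_def mm_ring ow) (simp add: vec_eq_iff scaleR_conv_of_real algebra_simps)
  then have "unitary U" using W0 by (simp add: unitary_def ct)
  moreover have "U *v a = b'"
  proof -
   have "(outer w *v a)$i = w$i * (of_real W / 2)" for i
    unfolding wa[symmetric] by (simp add: outer_def matrix_vector_mult_def sum_distrib_left mult.assoc)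
   then have o: "outer w *v a = (W / 2) *\<^sub>R w" by (simp add: vec_eq_iff) (simp add: scaleR_conv_of_real mult.commute)
   have "((2 / W) *\<^sub>R outer w) *v a = (2 / W) *\<^sub>R (outer w *v a)"
    by (simp add: vec_eq_iff matrix_vector_mult_def scaleR_sum_right)
   then have "U *v a = a - w" using W0 by (simp add: U_def matrix_vector_mult_diff_rdistrib o)
   then show ?thesis by (simp add: w_def)
  qed
  ultimately show ?thesis by blast
 qed
 then obtain U where U: "unitary U" "U *v a = b'" by blast
 have "mat (cnj c) *v b' = b"
  using cc by (simp add: vec_eq_iff matrix_vector_mult_def mat_def b'_def if_distrib [of "%x. x * _"] mult.assoc[symmetric] cong: if_cong)
 then have "(mat (cnj c)**U) *v a = b" using U by (simp flip: matrix_vector_mul_assoc)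
 moreover have "unitary (mat (cnj c)**U)" using c U by (intro unitary_mult unitary_mat) auto
 ultimately show ?thesis by blast
qed

subsection \<open>Local sections\<close>

text \<open>Householder reflection along u - z, which exchanges u and z when they have equal
  length.\<close>

definition hh :: "('n::finite) rvec => 'n rvec => real ^ 'n ^ 'n"
 where "hh u z = (\<chi> i j. (if i = j then 1 else 0) - 2 * (u$i - z$i) * (u$j - z$j) / (\<Sum>k\<in>UNIV. (u$k - z$k)^2))"

lemma hh_reflection:
 fixes u z :: "('n::finite) rvec"
 assumes n: "(\<Sum>k\<in>UNIV. (u$k)^2) = (\<Sum>k\<in>UNIV. (z$k)^2)" and ne: "u ~= z"
 defines "H \<equiv> map_matrix complex_of_real (hh u z)"
 shows "unitary H" "H *v cvec u = cvec z" "det H = -1"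
proof -
 define w where "w = u - z"
 define W where "W = (\<Sum>k\<in>UNIV. (w$k)^2)"
 have "w ~= 0" using ne by (simp add: w_def)
 then obtain k where "w$k ~= 0" by (auto simp: vec_eq_iff)
 then have W0: "0 < W" unfolding W_def by (intro sum_pos2[of _ k]) auto
 have H: "H$i$j = of_real ((if i = j then 1 else 0) - 2 * w$i * w$j / W)" for i j
  by (simp add: H_def hh_def w_def W_def)
 have uw: "(\<Sum>k\<in>UNIV. w$k * u$k) = W / 2"
 proof -
  have "W = (\<Sum>k\<in>UNIV. (u$k)^2) + (\<Sum>k\<in>UNIV. (z$k)^2) - 2 * (\<Sum>k\<in>UNIV. z$k * u$k)"
   by (simp add: W_def w_def power2_diff sum.distrib sum_subtractf sum_distrib_left mult_ac)
  moreover have "(\<Sum>k\<in>UNIV. w$k * u$k) = (\<Sum>k\<in>UNIV. (u$k)^2) - (\<Sum>k\<in>UNIV. z$k * u$k)"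
   by (simp add: w_def left_diff_distrib sum_subtractf power2_eq_square)
  ultimately show ?thesis using n by simp
 qed
 have "(\<Sum>k\<in>UNIV. ((if i = k then 1 else 0) - 2 * w$i * w$k / W) * u$k) = z$i" for i
 proof -
  have "((if i = k then 1 else 0) - 2 * w$i * w$k / W) * u$k = (if i = k then u$k else 0) - (2 * w$i / W) * (w$k * u$k)" for k
   by (simp add: algebra_simps)
  then have "(\<Sum>k\<in>UNIV. ((if i = k then 1 else 0) - 2 * w$i * w$k / W) * u$k) = u$i - (2 * w$i / W) * (W / 2)"
   by (simp only: sum_subtractf sum_distrib_left[symmetric] uw) simp
  also have "... = u$i - w$i" using W0 by simp
  finally show ?thesis by (simp add: w_def)
 qed
 then show "H *v cvec u = cvec z"
  by (simp add: vec_eq_iff matrix_vector_mult_def H flip: of_real_mult of_real_sum del: of_real_diff)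
 have "(\<Sum>k\<in>UNIV. ((if k = i then 1 else 0) - 2 * w$k * w$i / W) * ((if k = j then 1 else 0) - 2 * w$k * w$j / W)) = (if i = j then 1 else 0)" for i j
 proof -
  have "((if k = i then 1 else 0) - 2 * w$k * w$i / W) * ((if k = j then 1 else 0) - 2 * w$k * w$j / W)
   = (if k = i then (if k = j then 1 else 0) - 2 * w$k * w$j / W else 0) - (if k = j then 2 * w$k * w$i / W else 0)
    + (4 * w$i * w$j / (W * W)) * (w$k)^2" for k
   by (simp add: algebra_simps power2_eq_square)
  then have "(\<Sum>k\<in>UNIV. ((if k = i then 1 else 0) - 2 * w$k * w$i / W) * ((if k = j then 1 else 0) - 2 * w$k * w$j / W))
    = (if i = j then 1 else 0) - 2 * w$i * w$j / W - 2 * w$j * w$i / W + (4 * w$i * w$j / (W * W)) * W"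
   by (simp only: sum.distrib sum_subtractf sum_distrib_left[symmetric] W_def[symmetric]) simp
  then show ?thesis using W0 by simp
 qed
 then show "unitary H"
  by (simp add: unitary_def vec_eq_iff matrix_mult_nth H mat_def flip: of_real_mult of_real_sum del: of_real_diff)
 have "H = mat 1 + (\<chi> i j. (of_real (- 2 * w$i / W)) * of_real (w$j))"
  by (auto simp: vec_eq_iff H mat_def)
 then have "det H = 1 + (\<Sum>i\<in>UNIV. of_real (w$i) * of_real (- 2 * w$i / W))"
  using det_rank_one_update[of "\<chi> i. of_real (- 2 * w$i / W)" "\<chi> j. of_real (w$j)"] by simp
 also have "(\<Sum>i\<in>UNIV. complex_of_real (w$i) * of_real (- 2 * w$i / W)) = of_real ((- 2 / W) * (\<Sum>i\<in>UNIV. (w$i)^2))"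
  unfolding sum_distrib_left of_real_sum by (rule sum.cong) (simp_all add: power2_eq_square)
 finally show "det H = -1" using W0 by (simp add: W_def[symmetric])
qed

section \<open>Frame and section over the whole coordinate region\<close>

context reduction begin

text \<open>\<open>wt\<close> is v_k^2 as a function of q. \<open>uN\<close> is \<Sigma>^(-1) v,
  which has to equal \<rho>^H w for a phase w of \<open>vh\<close>; a frame \<rho> over q is thus a
  unitary that takes \<open>uN q\<close> to such a w.\<close>

definition wt :: "'n rvec => 'n => real"
 where "wt q k = (\<Prod>i\<in>UNIV. (exp (q$i))^2 - \<alpha>\<^sup>2 * (exp (q$k))^2) /
  (\<Prod>j\<in>UNIV - {k}. \<alpha>^2 * (exp (q$j))^2 - \<alpha>\<^sup>2 * (exp (q$k))^2)"

definition vN :: "'n rvec => 'n rvec" where "vN q = (\<chi> k. sqrt (wt q k))"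
definition uN :: "'n rvec => 'n rvec" where "uN q = (\<chi> k. vN q$k / exp (q$k))"

lemma wt_pos: "q \<in> region \<alpha> ==> 0 < wt q k"
 unfolding wt_def using secular_weight_pos[of "%i. (exp (q$i))^2" "\<alpha>^2" k, OF region_exp _ alpha2(1,2)] by simp

lemma vN_pos: "q \<in> region \<alpha> ==> 0 < vN q$k"
 using wt_pos by (simp add: vN_def)

lemma uN_pos: "q \<in> region \<alpha> ==> 0 < uN q$k"
 using vN_pos by (simp add: uN_def)

lemma denominator_neq:
 fixes q :: "'n rvec"
 assumes q: "q \<in> region \<alpha>"
 shows "(\<Prod>j\<in>UNIV - {k}. \<alpha>^2 * (exp (q$j))^2 - \<alpha>\<^sup>2 * (exp (q$k))^2) ~= 0"
proof -
 have "\<alpha>^2 * (exp (q$j))^2 - \<alpha>\<^sup>2 * (exp (q$k))^2 ~= 0" if "j ~= k" for j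
  using region_exp_neq(2)[OF q that] alpha2 by simp
 then show ?thesis by (subst prod_zero_iff) auto
qed

lemma secular_vN:
 assumes q: "q \<in> region \<alpha>"
 shows "secular (%i. (exp (q$i))^2) (%i. \<alpha>^2 * (exp (q$i))^2) (%k. (vN q$k)^2)"
proof (rule secularI)
 show "inj (%i. \<alpha>^2 * (exp (q$i))^2)"
  using region_exp_neq(2)[OF q] alpha2 by (intro injI) (metis mult_left_cancel less_irrefl)
 show "(vN q$k)^2 * (\<Prod>j\<in>UNIV - {k}. \<alpha>^2 * (exp (q$j))^2 - \<alpha>\<^sup>2 * (exp (q$k))^2)
   = (\<Prod>i\<in>UNIV. (exp (q$i))^2 - \<alpha>\<^sup>2 * (exp (q$k))^2)" for k
  using denominator_neq[OF q, of k] less_imp_le[OF wt_pos[OF q, of k]] by (simp add: vN_def) (simp add: wt_def)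
qed

lemma norm_vh: "\<alpha>\<^sup>2 ^ CARD('n) * (1 + (\<Sum>k\<in>UNIV. (cmod (vh$k))^2) / \<alpha>^2) = 1"
proof -
 have "smat (\<alpha>^2) + outer vh = dmat (\<chi> i. of_real (\<alpha>^2)) + (\<chi> i j. vh$i * (\<chi> j. cnj (vh$j))$j)"
  by (simp add: vec_eq_iff smat_def mat_def outer_def)
 then have "det (smat (\<alpha>^2) + outer vh) = (\<Prod>i\<in>(UNIV :: 'n set). of_real (\<alpha>^2)) * (1 + (\<Sum>i\<in>UNIV. cnj (vh$i) * vh$i / of_real (\<alpha>^2)))"
  using det_diagonal_plus_rank_one[of "\<chi> i. of_real (\<alpha>^2)" vh "\<chi> j. cnj (vh$j)"] alpha2 by simp
 also have "... = complex_of_real (\<alpha>\<^sup>2 ^ CARD('n) * (1 + (\<Sum>k\<in>UNIV. (cmod (vh$k))^2) / \<alpha>^2))"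
  by (simp add: sum_divide_distrib[symmetric] mult.commute[of "cnj _"] flip: complex_norm_square)
 finally have "complex_of_real (\<alpha>\<^sup>2 ^ CARD('n) * (1 + (\<Sum>k\<in>UNIV. (cmod (vh$k))^2) / \<alpha>^2)) = det (\<sigma>**\<sigma>\<^sup>H)"
  by (simp add: sigma_outer)
 also have "... = 1" by (simp add: det_mul det_ctrans det_sigma)
 finally show ?thesis using of_real_eq_1_iff by blast
qed

text \<open>Both squared lengths L satisfy \<alpha>^(2n) (1 + L/\<alpha>^2) = 1: that of
  \<open>vh\<close> because det \<sigma> = 1, that of \<open>uN q\<close> by the secular identity at
  t = 0.\<close>

lemma norm_uN:
 assumes q: "q \<in> region \<alpha>" shows "(\<Sum>k\<in>UNIV. (uN q$k)^2) = (\<Sum>k\<in>UNIV. (cmod (vh$k))^2)"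
proof -
 let ?P = "\<Prod>i\<in>UNIV. (exp (q$i))^2" and ?a = "\<alpha>^2"
 have P: "?P ~= 0" by simp
 have "?P = (\<Prod>k\<in>UNIV. ?a * (exp (q$k))^2) * (1 + (\<Sum>k\<in>UNIV. (vN q$k)^2 / (?a * (exp (q$k))^2)))"
  using secular_factor[OF secular_vN[OF q], of 0] alpha2 by simp
 also have "(\<Prod>k\<in>UNIV. ?a * (exp (q$k))^2) = ?a ^ CARD('n) * ?P" by (simp add: prod.distrib)
 also have "(\<Sum>k\<in>UNIV. (vN q$k)^2 / (?a * (exp (q$k))^2)) = (\<Sum>k\<in>UNIV. (uN q$k)^2) / ?a"
  by (simp add: uN_def sum_divide_distrib power_divide mult.commute)
 finally have "?P * (?a ^ CARD('n) * (1 + (\<Sum>k\<in>UNIV. (uN q$k)^2) / ?a)) = ?P * 1"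
  by (simp only: mult_ac mult_1_right)
 then have "?a ^ CARD('n) * (1 + (\<Sum>k\<in>UNIV. (uN q$k)^2) / ?a) = 1" using P mult_left_cancel by blast
 then have "?a ^ CARD('n) * (1 + (\<Sum>k\<in>UNIV. (uN q$k)^2) / ?a) = ?a ^ CARD('n) * (1 + (\<Sum>k\<in>UNIV. (cmod (vh$k))^2) / ?a)"
  using norm_vh by simp
 moreover have "?a ^ CARD('n) ~= 0" using alpha2 by simp
 ultimately have "(\<Sum>k\<in>UNIV. (uN q$k)^2) / ?a = (\<Sum>k\<in>UNIV. (cmod (vh$k))^2) / ?a"
  by (metis add_left_cancel mult_left_cancel)
 then show ?thesis using alpha2 by simp
qed

text \<open>The determinant is -1 because the reflection in the moving frame contributes another -1.
  The phase of det U is corrected by a unitary that fixes \<open>vh\<close>, or for n = 1 by a phase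
  of \<open>vh\<close>.\<close>

lemma exists_rho_base:
 fixes z :: "'n rvec"
 assumes z: "(\<Sum>k\<in>UNIV. (z$k)^2) = (\<Sum>k\<in>UNIV. (cmod (vh$k))^2)"
 shows "\<exists>\<rho> w. unitary \<rho> & det \<rho> = -1 & rephased vh w & \<rho> *v cvec z = w"
proof -
 have "(\<Sum>k\<in>UNIV. (cmod (cvec z$k))^2) = (\<Sum>k\<in>UNIV. (cmod (vh$k))^2)" using z by simp
 then obtain U where U: "unitary U" "U *v cvec z = vh" using exists_unitary_mapping by blast
 have dU: "cmod (det U) = 1" "cnj (det U) * det U = 1"
  using unitary_det[OF U(1)] by (simp_all add: complex_norm_square[symmetric] mult.commute)
 show ?thesis
 proof (cases "CARD('n) = 1")
  case True
  let ?c = "- cnj (det U)"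
  have "mat ?c *v vh = ?c *s vh"
   by (simp add: vec_eq_iff matrix_vector_mult_def mat_def if_distrib [of "%x. x * _"] cong: if_cong)
  then have "(mat ?c**U) *v cvec z = ?c *s vh" using U by (simp flip: matrix_vector_mul_assoc)
  moreover have "unitary (mat ?c**U)" using U dU by (intro unitary_mult unitary_mat) auto
  moreover have "det (mat ?c**U) = -1" using dU True by (simp add: det_mul det_mat)
  moreover have "rephased vh (?c *s vh)" unfolding rephased_def using dU True by (intro exI[of _ ?c]) simp
  ultimately show ?thesis by blast
 next
  case False
  have "cmod (- cnj (det U)) = 1" using dU by simp
  then obtain R where R: "unitary R" "R *v vh = vh" "det R = - cnj (det U)"
   using exists_fixing_unitary[OF False] by blast
  have "det (R**U) = -1" using R dU by (simp add: det_mul)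
  moreover have "(R**U) *v cvec z = vh" using U R by (simp flip: matrix_vector_mul_assoc)
  moreover have "rephased vh vh" unfolding rephased_def by (intro exI[of _ 1]) simp
  ultimately show ?thesis using unitary_mult[OF R(1) U(1)] by blast
 qed
qed

text \<open>Every point of the region occurs: the analysis of the normal form is run backwards, from
  q to v by \<open>secularI\<close> and from v to T by \<open>T_tilde_orthogonal\<close>.\<close>

lemma coords_normal_form:
 assumes q: "q \<in> region \<alpha>" and \<rho>: "unitary \<rho>" "det \<rho> = 1" and w: "rephased vh w" and r: "\<rho> *v cvec (uN q) = w"
 shows "normal_data \<sigma> \<rho> (Dl q) (TN q p (vN q))" "coords \<alpha> vh \<sigma> x y (NF \<rho> (Dl q) (TN q p (vN q))) q p"
proof -
 note D = Dl_chamber[OF q]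
 let ?T = "T_tilde \<alpha> (eq q) (vN q)" and ?v = "vN q"
 have v: "cvec ?v = Sinh (Dl q) *v (\<rho>\<^sup>H *v w)"
 proof -
  have "\<rho>\<^sup>H *v w = (\<rho>\<^sup>H**\<rho>) *v cvec (uN q)" unfolding r[symmetric] by (simp only: matrix_vector_mul_assoc)
  also have "... = cvec (uN q)" by (simp add: unitaryD[OF \<rho>(1)])
  finally have r: "\<rho>\<^sup>H *v w = cvec (uN q)" .
  have "exp (q$i) * uN q$i = vN q$i" for i by (simp add: uN_def)
  then show ?thesis unfolding r by (simp add: Sinh_def dmat_vector vec_eq_iff of_real_mult[symmetric] del: of_real_mult)
 qed
 have to: "orthogonal_matrix ?T" "(\<Sum>j\<in>UNIV. ?T$j$i * (exp (q$j))^2 * ?T$j$k) =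
   (if i = k then \<alpha>\<^sup>2 * (exp (q$i))^2 else 0) + ?v$i * ?v$k" for i k
 proof -
  have "inj (%i. (eq q$i)^2)" using region_exp_neq(2)[OF q] by (intro injI) (metis eq_nth)
  moreover have "(eq q$i)^2 ~= \<alpha>^2 * (eq q$j)^2" for i j using region_exp_neq(1)[OF q] by simp
  moreover have "?v$k ~= 0" for k using vN_pos[OF q, of k] by simp
  moreover have "secular (%i. (eq q$i)^2) (%i. \<alpha>^2 * (eq q$i)^2) (%k. (?v$k)^2)" using secular_vN[OF q] by simp
  ultimately have "orthogonal_matrix ?T" "!!i k. (\<Sum>j\<in>UNIV. ?T$j$i * (eq q$j)^2 * ?T$j$k) =
   (if i = k then \<alpha>\<^sup>2 * (eq q$i)^2 else 0) + ?v$i * ?v$k"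
   using T_tilde_orthogonal[of "eq q" \<alpha> ?v] by blast+
  then show "orthogonal_matrix ?T" "(\<Sum>j\<in>UNIV. ?T$j$i * (exp (q$j))^2 * ?T$j$k) =
   (if i = k then \<alpha>\<^sup>2 * (exp (q$i))^2 else 0) + ?v$i * ?v$k" for i k by simp_all
 qed
 have ee: "cnj (exp (\<i> * complex_of_real t)) * exp (\<i> * complex_of_real t) = 1" for t
  by (simp add: exp_cnj flip: exp_add)
 have X: "(TN q p ?v)\<^sup>H$i$j * (of_real s * TN q p ?v$j$k) = of_real (?T$j$i * s * ?T$j$k)" for i j k s
 proof -
  have "(TN q p ?v)\<^sup>H$i$j * (of_real s * TN q p ?v$j$k) = (cnj (exp (\<i> * of_real (p$j))) * exp (\<i> * of_real (p$j))) * of_real (?T$j$i * s * ?T$j$k)"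
   by (simp add: TN_nth[OF q] mult_ac)
  then show ?thesis by (simp only: ee mult_1)
 qed
 have "unitary (TN q p ?v)"
 proof -
  have "(\<Sum>j\<in>UNIV. ?T$j$i * 1 * ?T$j$k) = (if i = k then 1 else 0)" for i k
   using arg_cong[OF to(1)[unfolded orthogonal_matrix], of "%A. A$i$k"]
   by (simp add: matrix_mult_nth mat_def Finite_Cartesian_Product.transpose_def)
  then show ?thesis
   unfolding unitary_def using X[of _ _ 1] by (simp add: vec_eq_iff matrix_mult_nth mat_def del: ctrans_nth flip: of_real_mult of_real_sum)
 qed
 moreover have "(TN q p ?v)\<^sup>H**(Sinh (Dl q)**Sinh (Dl q))**TN q p ?v = Sinh (Dl q)**\<rho>\<^sup>H**\<sigma>**\<sigma>\<^sup>H**\<rho>**Sinh (Dl q)"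
 proof -
  have SS: "Sinh (Dl q)**Sinh (Dl q) = dmat (cvec (\<chi> i. (exp (q$i))^2))"
   by (simp add: Sinh_def dmat_mult_dmat vec_eq_iff power2_eq_square)
  have "((TN q p ?v)\<^sup>H**(dmat (cvec (\<chi> i. (exp (q$i))^2))**TN q p ?v))$i$k
    = of_real ((if i = k then \<alpha>\<^sup>2 * (exp (q$i))^2 else 0) + ?v$i * ?v$k)" for i k
  proof -
   have dm: "(dmat (cvec d)**A)$j$k = of_real (d$j) * A$j$k" for d and A :: "'n cmat" and j k
    by (simp add: dmat_mult_left)
   show ?thesis
    unfolding to(2)[symmetric] of_real_sum matrix_mult_nth[of "(TN q p ?v)\<^sup>H"]
    by (rule sum.cong[OF refl]) (simp only: dm X vec_lambda_beta)
  qed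
  then have "(TN q p ?v)\<^sup>H**(Sinh (Dl q)**Sinh (Dl q))**TN q p ?v = \<alpha>^2 *\<^sub>R (Sinh (Dl q)**Sinh (Dl q)) + outer (cvec ?v)"
   unfolding SS mm_assoc by (auto simp: vec_eq_iff outer_def) (simp_all add: scaleR_conv_of_real)
  also have "outer (cvec ?v) = outer (Sinh (Dl q) *v (\<rho>\<^sup>H *v vh))"
   unfolding v matrix_vector_mul_assoc by (rule outer_rephased[OF w])
  finally show ?thesis using sinh_sigma_outer[OF \<rho>(1), of "Dl q"] by simp
 qed
 ultimately show nd: "normal_data \<sigma> \<rho> (Dl q) (TN q p ?v)" using \<rho> D by (simp add: normal_data_def)
 have "NF \<rho> (Dl q) (TN q p ?v) \<in> C" by (rule normal_form_constrained(1)[OF nd \<rho>(2)])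
 then have "(NF \<rho> (Dl q) (TN q p ?v), NF \<rho> (Dl q) (TN q p ?v)) \<in> G" using equiv_gauge by (meson equivE refl_onD)
 then show "coords \<alpha> vh \<sigma> x y (NF \<rho> (Dl q) (TN q p ?v)) q p"
  unfolding coords_iff using q \<rho> w v less_imp_le[OF vN_pos[OF q]] by blast
qed

lemma open_region: "open (region \<alpha> :: 'n rvec set)"
proof -
 have "region \<alpha> = (\<Inter>i. \<Inter>j. {q :: 'n rvec. i < j --> q$j + gap \<alpha> < q$i})" by (auto simp: region_def)
 moreover have "open {q :: 'n rvec. i < j --> q$j + gap \<alpha> < q$i}" for i j
  by (cases "i < j") (auto intro!: open_Collect_less continuous_intros)
 ultimately show ?thesis by (simp add: open_INT)
qed

text \<open>The frame \<open>\<rho>(q)\<close> of the section is a constant times a real reflection, so that \<open>\<rho>\<^sup>Hd\<rho>\<close> is real.\<close>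

definition rhoN :: "'n cmat => 'n rvec => 'n rvec => 'n cmat"
 where "rhoN \<rho> z q = \<rho>**map_matrix complex_of_real (hh (uN q) z)"

text \<open>All entries of \<open>uN q\<close> are positive and all entries of z negative, so the
  reflection that exchanges them is defined over the whole region.\<close>

definition base_frame :: "'n cmat => 'n rvec => bool"
 where "base_frame \<rho> z \<longleftrightarrow> unitary \<rho> & det \<rho> = -1 & (\<exists>w. rephased vh w & \<rho> *v cvec z = w) &
  (\<Sum>k\<in>UNIV. (z$k)^2) = (\<Sum>k\<in>UNIV. (cmod (vh$k))^2) & (\<forall>k. z$k < 0)"

definition sectionN :: "'n cmat => 'n rvec => 'n rvec => 'n rvec => 'n bmat"
 where "sectionN \<rho> z q p = NF (rhoN \<rho> z q) (Dl q) (TN q p (vN q))"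

lemma exists_base_frame:
 fixes q :: "'n rvec"
 assumes "q \<in> region \<alpha>" shows "\<exists>\<rho> z. base_frame \<rho> z"
proof -
 let ?z = "- uN q"
 have n: "(\<Sum>k\<in>UNIV. (?z$k)^2) = (\<Sum>k\<in>UNIV. (cmod (vh$k))^2)" using norm_uN[OF assms] by simp
 moreover have "?z$k < 0" for k using uN_pos[OF assms] by simp
 ultimately show ?thesis using exists_rho_base[OF n] unfolding base_frame_def by blast
qed

lemma rhoN_props:
 assumes b: "base_frame \<rho> z" and q: "q \<in> region \<alpha>"
 shows "unitary (rhoN \<rho> z q)" "det (rhoN \<rho> z q) = 1" "\<exists>w. rephased vh w & rhoN \<rho> z q *v cvec (uN q) = w"
proof -
 have n: "(\<Sum>k\<in>UNIV. (uN q$k)^2) = (\<Sum>k\<in>UNIV. (z$k)^2)" using norm_uN[OF q] b by (simp add: base_frame_def)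
 have "uN q ~= z" using uN_pos[OF q] b unfolding base_frame_def by (metis less_asym)
 note H = hh_reflection[OF n this]
 show "unitary (rhoN \<rho> z q)" "det (rhoN \<rho> z q) = 1" "\<exists>w. rephased vh w & rhoN \<rho> z q *v cvec (uN q) = w"
  using b H by (auto simp: rhoN_def base_frame_def unitary_mult det_mul simp flip: matrix_vector_mul_assoc)
qed

lemma sectionN_coords:
 assumes "base_frame \<rho> z" "q \<in> region \<alpha>"
 shows "coords \<alpha> vh \<sigma> x y (sectionN \<rho> z q p) q p" "normal_data \<sigma> (rhoN \<rho> z q) (Dl q) (TN q p (vN q))"
 using coords_normal_form[OF assms(2)] rhoN_props[OF assms] unfolding sectionN_def by blast+

lemma Cosh_Dl: "Cosh (Dl q) = dmat (cvec (\<chi> i. sqrt (1 + (exp (q$i))^2)))"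
proof -
 have "cosh (Dl q$i) = sqrt (1 + (exp (q$i))^2)" for i
  using cosh_square_eq[of "Dl q$i"] by (metis add.commute cosh_real_nonneg real_sqrt_unique sinh_Dl)
 then show ?thesis by (simp add: Cosh_def)
qed

lemma Sinh_Dl: "Sinh (Dl q) = dmat (cvec (\<chi> i. exp (q$i)))"
 by (simp add: Sinh_def)

lemma SinhI_Dl: "SinhI (Dl q) = dmat (cvec (\<chi> i. inverse (exp (q$i))))"
 by (simp add: SinhI_def)

lemma CoshI_Dl: "CoshI (Dl q) = dmat (cvec (\<chi> i. inverse (sqrt (1 + (exp (q$i))^2))))"
proof -
 have "cosh (Dl q$i) = sqrt (1 + (exp (q$i))^2)" for i
  using cosh_square_eq[of "Dl q$i"] by (metis add.commute cosh_real_nonneg real_sqrt_unique sinh_Dl)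
 then show ?thesis by (simp add: CoshI_def)
qed

lemma Lam_Dl: "Lam x y (Dl q) = dmat (cvec (\<chi> i. sqrt (y^2 + x^2 * (exp (q$i))^2)))"
 by (simp add: Lam_def)

context
 fixes Q :: "'a::real_normed_vector => 'n rvec" and U :: "'a set" and a :: 'a
 assumes Q: "Q differentiable at a" and U: "open U" "a \<in> U" and reg: "!!u. u \<in> U ==> Q u \<in> region \<alpha>"
begin

lemma exp_Q_differentiable: "(%u. exp (Q u$i)) differentiable at a"
 by (intro exp_differentiable vec_nth_differentiable Q)

lemma hyperbolic_differentiable:
 "(%u. Sinh (Dl (Q u))) differentiable at a" "(%u. SinhI (Dl (Q u))) differentiable at a"
 "(%u. Cosh (Dl (Q u))) differentiable at a" "(%u. CoshI (Dl (Q u))) differentiable at a"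
 "(%u. Lam x y (Dl (Q u))) differentiable at a"
proof -
 have p: "0 < 1 + (exp t)^2" "0 < y^2 + x^2 * (exp t)^2" for t :: real
  using y_pos by (simp_all add: add_pos_nonneg)
 have n: "sqrt (1 + (exp t)^2) ~= 0" for t :: real using p(1)[of t] by simp
 show "(%u. Sinh (Dl (Q u))) differentiable at a"
  unfolding Sinh_Dl by (intro dmat_cvec_differentiable) (simp add: exp_Q_differentiable)
 show "(%u. SinhI (Dl (Q u))) differentiable at a"
  unfolding SinhI_Dl by (intro dmat_cvec_differentiable) (simp add: exp_Q_differentiable)
 have s: "(%u. sqrt (1 + (exp (Q u$i))^2)) differentiable at a" for i
  by (intro sqrt_differentiable p differentiable_add differentiable_const differentiable_power exp_Q_differentiable)
 then show "(%u. Cosh (Dl (Q u))) differentiable at a"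
  unfolding Cosh_Dl by (intro dmat_cvec_differentiable) simp
 show "(%u. CoshI (Dl (Q u))) differentiable at a"
  unfolding CoshI_Dl by (intro dmat_cvec_differentiable) (simp only: vec_lambda_beta differentiable_inverse s n not_False_eq_True)
 have "(%u. sqrt (y^2 + x^2 * (exp (Q u$i))^2)) differentiable at a" for i
  by (intro sqrt_differentiable p differentiable_add differentiable_mult differentiable_const differentiable_power exp_Q_differentiable)
 then show "(%u. Lam x y (Dl (Q u))) differentiable at a"
  unfolding Lam_Dl by (intro dmat_cvec_differentiable) simp
qed

lemma wt_differentiable: "(%u. wt (Q u) k) differentiable at a"
 unfolding wt_def
 by (intro differentiable_divide prod_differentiable differentiable_diff differentiable_mult
   differentiable_power differentiable_const exp_Q_differentiable denominator_neq reg U)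

lemma vN_differentiable: "(%u. vN (Q u)$k) differentiable at a"
 unfolding vN_def vec_lambda_beta by (intro sqrt_differentiable wt_differentiable wt_pos reg U)

lemma uN_differentiable: "(%u. uN (Q u)$k) differentiable at a"
 unfolding uN_def vec_lambda_beta
 by (intro differentiable_divide vN_differentiable exp_Q_differentiable) simp

lemma hh_differentiable:
 assumes b: "base_frame \<rho> z"
 shows "(%u. hh (uN (Q u)) z$i$j) differentiable at a"
proof -
 have "0 < uN (Q a)$k - z$k" for k
 proof -
  have "0 < uN (Q a)$k" "z$k < 0" using uN_pos[OF reg[OF U(2)]] b by (auto simp: base_frame_def)
  then show ?thesis by simp
 qed
 then have "0 < (\<Sum>k\<in>UNIV. (uN (Q a)$k - z$k)^2)"
  by (intro sum_pos zero_less_power) auto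
 then have n: "(\<Sum>k\<in>UNIV. (uN (Q a)$k - z$k)^2) ~= 0" by simp
 show ?thesis unfolding hh_def vec_lambda_beta
  by (intro differentiable_diff differentiable_const differentiable_divide differentiable_mult
    differentiable_sum ballI finite differentiable_power uN_differentiable n)
qed

lemma rhoN_differentiable:
 assumes b: "base_frame \<rho> z"
 shows "(%u. rhoN \<rho> z (Q u)) differentiable at a"
proof -
 have "(%u. map_matrix complex_of_real (hh (uN (Q u)) z)) differentiable at a"
  by (rule matrix_differentiableI) (simp add: of_real_differentiable hh_differentiable[OF b])
 then show ?thesis unfolding rhoN_def by (intro matrix_mult_differentiable differentiable_const)
qed

lemma T_tilde_differentiable: "(%u. T_tilde \<alpha> (eq (Q u)) (vN (Q u))$i$j) differentiable at a"
proof -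
 have ne: "(exp (Q u$i))^2 - \<alpha>\<^sup>2 * (exp (Q u$j))^2 ~= 0" if "u \<in> U" for u i j
  using region_exp_neq(1)[OF reg[OF that], of i j] by simp
 let ?f = "%u. vN (Q u)$j / ((exp (Q u$i))^2 - \<alpha>\<^sup>2 * (exp (Q u$j))^2) /
  sqrt (\<Sum>k\<in>UNIV. (vN (Q u)$k)^2 / ((exp (Q u$i))^2 - \<alpha>\<^sup>2 * (exp (Q u$k))^2)^2)"
 have pos: "0 < (\<Sum>k\<in>UNIV. (vN (Q a)$k)^2 / ((exp (Q a$i))^2 - \<alpha>\<^sup>2 * (exp (Q a$k))^2)^2)"
  using vN_pos[OF reg[OF U(2)]] ne[OF U(2)] by (intro sum_pos) (auto simp: less_imp_neq[symmetric])
 then have nz: "sqrt (\<Sum>k\<in>UNIV. (vN (Q a)$k)^2 / ((exp (Q a$i))^2 - \<alpha>\<^sup>2 * (exp (Q a$k))^2)^2) ~= 0" by simp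
 have nz2: "((exp (Q a$i))^2 - \<alpha>\<^sup>2 * (exp (Q a$k))^2)^2 ~= 0" for k using ne[OF U(2)] by simp
 have "?f differentiable at a"
  by (intro differentiable_divide vN_differentiable differentiable_diff differentiable_mult differentiable_power
    differentiable_const exp_Q_differentiable ne[OF U(2)] sqrt_differentiable differentiable_sum ballI finite nz nz2 pos)
 then show ?thesis
 proof (rule differentiable_cong_open[OF _ U])
  fix u assume "u \<in> U"
  then have "(eq (Q u)$i)^2 ~= \<alpha>^2 * (eq (Q u)$j)^2" for i j using region_exp_neq(1)[OF reg] by simp
  from T_tilde_nth[OF this] show "?f u = T_tilde \<alpha> (eq (Q u)) (vN (Q u))$i$j" by simp
 qed
qed

lemma section_parts_differentiable:
 assumes b: "base_frame \<rho> z" and P: "P differentiable at a"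
 shows "(%u. TN (Q u) (P u) (vN (Q u))) differentiable at a"
  "(%u. wN (Dl (Q u)) (TN (Q u) (P u) (vN (Q u)))) differentiable at a"
  "(%u. nN (rhoN \<rho> z (Q u)) (Dl (Q u)) (TN (Q u) (P u) (vN (Q u)))) differentiable at a"
  "(%u. sectionN \<rho> z (Q u) (P u)) differentiable at a"
proof -
 have "(%u. exp_i (P u)) differentiable at a"
  unfolding exp_i_def by (intro dmat_differentiable) (simp add: exp_i_differentiable vec_nth_differentiable P)
 moreover have "(%u. map_matrix complex_of_real (T_tilde \<alpha> (eq (Q u)) (vN (Q u)))) differentiable at a"
  by (rule matrix_differentiableI) (simp add: of_real_differentiable T_tilde_differentiable)
 ultimately show T: "(%u. TN (Q u) (P u) (vN (Q u))) differentiable at a"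
  unfolding TN_def by (rule matrix_mult_differentiable)
 show w: "(%u. wN (Dl (Q u)) (TN (Q u) (P u) (vN (Q u)))) differentiable at a"
  by (intro matrix_mult_differentiable hyperbolic_differentiable differentiable_diff differentiable_scaleR differentiable_const T)
 show "(%u. nN (rhoN \<rho> z (Q u)) (Dl (Q u)) (TN (Q u) (P u) (vN (Q u)))) differentiable at a"
  by (intro matrix_mult_differentiable hyperbolic_differentiable differentiable_diff differentiable_scaleR
    differentiable_const T ctrans_differentiable rhoN_differentiable[OF b])
 have d1: "(%u. blk (rhoN \<rho> z (Q u)) 0 0 (mat 1)) differentiable at a"
  by (intro blk_differentiable differentiable_const rhoN_differentiable[OF b])
 have d2: "(%u. Hyp (Dl (Q u))) differentiable at a"
  unfolding Hyp_def by (intro blk_differentiable hyperbolic_differentiable)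
 have d3: "(%u. bR (wN (Dl (Q u)) (TN (Q u) (P u) (vN (Q u))))) differentiable at a"
  unfolding bR_def by (intro blk_differentiable differentiable_const w)
 have "(%u. kN (rhoN \<rho> z (Q u)) (Dl (Q u))**bR (wN (Dl (Q u)) (TN (Q u) (P u) (vN (Q u))))) differentiable at a"
  by (rule matrix_mult_differentiable[OF matrix_mult_differentiable[OF d1 d2] d3])
 then show "(%u. sectionN \<rho> z (Q u) (P u)) differentiable at a"
  by (rule differentiable_cong_open[OF _ U]) (simp add: sectionN_def normal_form_eq Dl_chamber reg)
qed

end

lemma exists_local_section:
 fixes q p :: "'n rvec"
 assumes q: "q \<in> region \<alpha>"
 shows "\<exists>U S. (q, p) \<in> U & local_section \<alpha> vh \<sigma> x y U S"
proof -
 obtain \<rho> z where b: "base_frame \<rho> z" using exists_base_frame[OF q] by blast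
 let ?U = "(region \<alpha> \<times> UNIV) :: ('n rvec \<times> 'n rvec) set" and ?S = "%(q, p). sectionN \<rho> z q p"
 have op: "open ?U" using open_region by (intro open_Times) auto
 have "?S differentiable at u" if u: "u \<in> ?U" for u
 proof -
  have "fst differentiable at u" "snd differentiable at u"
   unfolding differentiable_def
   using bounded_linear_imp_has_derivative[OF bounded_linear_fst] bounded_linear_imp_has_derivative[OF bounded_linear_snd] by blast+
  from section_parts_differentiable(4)[OF this(1) op u _ b this(2)]
  show ?thesis by (auto simp: case_prod_unfold)
 qed
 then have "?S differentiable_on ?U" by (intro differentiable_at_imp_differentiable_on) auto
 then have "local_section \<alpha> vh \<sigma> x y ?U ?S"
  unfolding local_section_def using op sectionN_coords(1)[OF b] by auto
 then show ?thesis using q by (intro exI[of _ ?U] exI[of _ ?S]) simp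
qed

end

subsection \<open>The two-form\<close>

lemma pw_add_left: "pairing_wedge (%Z. A Z + B Z) C X Y = pairing_wedge A C X Y + pairing_wedge B C X Y"
 for A :: "'a => 'k::finite cmat"
 by (simp add: pairing_wedge_def pairing_def mm_ring trace_add)
lemma pw_diff_left: "pairing_wedge (%Z. A Z - B Z) C X Y = pairing_wedge A C X Y - pairing_wedge B C X Y"
 for A :: "'a => 'k::finite cmat"
 by (simp add: pairing_wedge_def pairing_def mm_ring trace_sub)
lemma pw_uminus_left: "pairing_wedge (%Z. - A Z) C X Y = - pairing_wedge A C X Y"
 for A :: "'a => 'k::finite cmat"
 by (simp add: pairing_wedge_def pairing_def mm_ring trace_uminus)
lemma pw_scaleR_left: "pairing_wedge (%Z. c *\<^sub>R A Z) C X Y = c * pairing_wedge A C X Y"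
 for A :: "'a => 'k::finite cmat"
 by (simp add: pairing_wedge_def pairing_def mm_ring trace_scaleR algebra_simps)

lemma pw_swap: "pairing_wedge A B X Y = - pairing_wedge B A X Y" for A :: "'a => 'k::finite cmat"
 by (simp add: pairing_wedge_def pairing_def trace_mul_sym[of "B _"])

lemma pw_add_right: "pairing_wedge C (%Z. A Z + B Z) X Y = pairing_wedge C A X Y + pairing_wedge C B X Y"
 for A :: "'a => 'k::finite cmat"
 by (simp add: pw_swap[of C] pw_add_left)
lemma pw_diff_right: "pairing_wedge C (%Z. A Z - B Z) X Y = pairing_wedge C A X Y - pairing_wedge C B X Y"
 for A :: "'a => 'k::finite cmat"
 by (simp add: pw_swap[of C] pw_diff_left)
lemma pw_uminus_right: "pairing_wedge C (%Z. - A Z) X Y = - pairing_wedge C A X Y"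
 for A :: "'a => 'k::finite cmat"
 by (simp add: pw_swap[of C] pw_uminus_left)
lemma pw_scaleR_right: "pairing_wedge C (%Z. c *\<^sub>R A Z) X Y = c * pairing_wedge C A X Y"
 for A :: "'a => 'k::finite cmat"
 by (simp add: pw_swap[of C] pw_scaleR_left)

lemma pw_move_left: "pairing_wedge (%Z. M**A Z) B X Y = pairing_wedge A (%Z. B Z**M) X Y"
 for A :: "'a => 'k::finite cmat"
proof -
 have "trace (M**A Z**B Z') = trace (A Z**(B Z'**M))" for Z Z'
  by (simp only: mm_assoc[symmetric] trace_mul_sym[of M])
 then show ?thesis by (simp add: pairing_wedge_def pairing_def)
qed

lemma pw_move_right: "pairing_wedge (%Z. A Z**M) B X Y = pairing_wedge A (%Z. M**B Z) X Y"
 for A :: "'a => 'k::finite cmat"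
 by (simp add: pairing_wedge_def pairing_def mm_assoc)

lemma pw_conj_move: "pairing_wedge (%Z. M**A Z**N) B X Y = pairing_wedge A (%Z. N**B Z**M) X Y"
 for A :: "'a => 'k::finite cmat"
proof -
 have "trace (M**A Z**N**B Z') = trace (A Z**(N**B Z'**M))" for Z Z'
  by (simp only: mm_assoc[symmetric] trace_mul_sym[of M])
 then show ?thesis by (simp add: pairing_wedge_def pairing_def)
qed

lemma pw_conj: "N**M = mat 1 ==> pairing_wedge (%Z. M**A Z**N) (%Z. M**B Z**N) X Y = pairing_wedge A B X Y"
 for A :: "'a => 'k::finite cmat"
proof -
 assume NM: "N**M = mat 1"
 have "N**(M**B Z**N)**M = (N**M)**B Z**(N**M)" for Z by (simp only: mm_assoc)
 then show ?thesis by (simp add: pw_conj_move NM)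
qed

text \<open>The Lie algebra of U(n,n), in which the Maurer-Cartan forms of k_L and k_R take their
  values.\<close>

definition unnL :: "('n::finite) bmat => bool"
 where "unnL M \<longleftrightarrow> M\<^sup>H**Inn + Inn**M = 0"

lemma unnL_ctrans: "unnL M ==> M\<^sup>H = - (Inn**M**Inn)"
proof -
 assume "unnL M"
 then have "M\<^sup>H**Inn = - (Inn**M)" by (simp add: unnL_def eq_neg_iff_add_eq_0)
 then have "M\<^sup>H**(Inn**Inn) = - (Inn**M**Inn)"
  by (simp only: mm_assoc matrix_uminus_left)
 then show ?thesis by simp
qed

text \<open>Adjoints in the Lie algebra are \<open>- (Inn**M**Inn)\<close>, so the trace of MN is
  its own conjugate: the Lie algebra is isotropic for the pairing. This and the orthogonality of
  strictly upper blocks to block diagonal ones kill most terms of the two-form.\<close>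

lemma pairing_unnL: assumes "unnL M" "unnL N" shows "pairing M N = 0"
proof -
 have "cnj (trace (M**N)) = trace (N\<^sup>H**M\<^sup>H)" by (simp add: trace_ctrans[symmetric] ctrans_mult)
 also have "... = trace (Inn**N**(Inn**Inn)**M**Inn)"
  unfolding unnL_ctrans[OF assms(1)] unnL_ctrans[OF assms(2)]
  by (simp only: matrix_uminus_left matrix_uminus_right minus_minus mm_assoc)
 also have "... = trace ((Inn**N**M)**Inn)" by simp
 also have "... = trace (Inn**(Inn**N**M))" by (rule trace_mul_sym)
 also have "... = trace (N**M)" by (simp only: mm_assoc Inn_Inn matrix_mul_lid)
 also have "... = trace (M**N)" by (rule trace_mul_sym)
 finally show ?thesis unfolding pairing_def by (metis complex_cnj_cancel_iff cnj.sel(2) neg_equal_zero)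
qed

lemma pw_unnL: "(!!Z. unnL (A Z)) ==> (!!Z. unnL (B Z)) ==> pairing_wedge A B X Y = 0"
 by (simp add: pairing_wedge_def pairing_unnL)

lemma unnL_conj:
 assumes k: "Unn k" and M: "unnL M" shows "unnL (k**M**(Inn**k\<^sup>H**Inn))"
proof -
 let ?ki = "Inn**k\<^sup>H**Inn"
 have "Inn**M\<^sup>H**Inn = - ((Inn**Inn)**M**(Inn**Inn))"
  unfolding unnL_ctrans[OF M] by (simp only: mm_assoc matrix_uminus_left matrix_uminus_right)
 then have M': "Inn**M\<^sup>H**Inn = - M" by simp
 have "(k**M**?ki)\<^sup>H**Inn = Inn**k**(Inn**M\<^sup>H**(Inn**Inn))**k\<^sup>H**Inn"
  by (simp add: ctrans_mult mm_assoc)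
 also have "... = Inn**k**(Inn**M\<^sup>H**Inn)**?ki" by (simp only: mm_assoc)
 also have "... = - (Inn**(k**M**?ki))"
  unfolding M' by (simp only: mm_assoc matrix_uminus_left matrix_uminus_right)
 finally show ?thesis by (simp add: unnL_def)
qed

definition bdiag :: "('n::finite) bmat => bool" where "bdiag M \<longleftrightarrow> (\<exists>a d. M = blk a 0 0 d)"
definition bsup :: "('n::finite) bmat => bool" where "bsup M \<longleftrightarrow> (\<exists>b. M = blk 0 b 0 0)"

lemma trace_zero: "trace 0 = 0"
 by (simp add: trace_def)

lemma pairing_bsup: "bsup M ==> bsup N ==> pairing M N = 0" "bsup M ==> bdiag N ==> pairing M N = 0"
 "bdiag N ==> bsup M ==> pairing N M = 0"
 by (auto simp: bsup_def bdiag_def pairing_def blk_mult trace_blk trace_zero)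

lemma pw_bsup: "(!!Z. bsup (A Z)) ==> (!!Z. bsup (B Z)) ==> pairing_wedge A B X Y = 0"
 "(!!Z. bsup (A Z)) ==> (!!Z. bdiag (B Z)) ==> pairing_wedge A B X Y = 0"
 "(!!Z. bdiag (A Z)) ==> (!!Z. bsup (B Z)) ==> pairing_wedge A B X Y = 0"
 by (simp_all add: pairing_wedge_def pairing_bsup)

text \<open>\<open>lam\<close> and \<open>bet\<close> are the forms of b_L and b_R,
  \<open>chi\<close> and \<open>eta\<close> those of k_L and k_R, and \<open>gam\<close> is dg
  g^(-1), split along both factorisations. Passing from chi and eta to gam adds two cross terms,
  which are opposite by cyclicity of the trace.\<close>

lemma symp_reduce:
 fixes g gi :: "('n::finite) bmat" and lam bet gam chi eta :: "'a => 'n bmat"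
 assumes g: "g**gi = mat 1" "gi**g = mat 1"
  and chi: "!!Z. gam Z = chi Z + g**bet Z**gi" and eta: "!!Z. gam Z = lam Z + g**eta Z**gi"
 shows "pairing_wedge lam chi X Y + pairing_wedge bet eta X Y =
  pairing_wedge lam gam X Y + pairing_wedge bet (%Z. gi**gam Z**g) X Y"
proof -
 have e: "gi**gam Z**g = gi**lam Z**g + eta Z" for Z
 proof -
  have "gi**gam Z**g = gi**lam Z**g + (gi**g)**eta Z**(gi**g)"
   unfolding eta by (simp only: mm_ring)
  then show ?thesis by (simp add: g)
 qed
 have "pairing_wedge lam gam X Y = pairing_wedge lam chi X Y + pairing_wedge lam (%Z. g**bet Z**gi) X Y"
  unfolding chi by (rule pw_add_right)
 moreover have "pairing_wedge bet (%Z. gi**gam Z**g) X Y = pairing_wedge bet (%Z. gi**lam Z**g) X Y + pairing_wedge bet eta X Y"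
  unfolding e by (rule pw_add_right)
 moreover have "pairing_wedge lam (%Z. g**bet Z**gi) X Y = - pairing_wedge bet (%Z. gi**lam Z**g) X Y"
  unfolding pw_swap[of lam] by (simp add: pw_conj_move)
 ultimately show ?thesis by simp
qed

text \<open>
 Gauge invariance at the level of Maurer-Cartan forms: \<open>\<delta>\<close> and \<open>\<kappa>\<close> are the infinitesimal left and
 right gauge parameters, and \<open>\<delta>t\<close> is \<open>\<delta>\<close> moved through \<open>b\<^sub>L\<close>.
\<close>

lemma symp_gauge_algebra:
 fixes g gi bl bli br bri :: "('n::finite) bmat" and lam bet gam chi eta \<delta> \<delta>t \<kappa> :: "'a => 'n bmat"
 assumes g: "g**gi = mat 1" "gi**g = mat 1"
  and bl: "bl**bli = mat 1" "bli**bl = mat 1" and br: "br**bri = mat 1" "bri**br = mat 1"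
  and chi: "!!Z. gam Z = chi Z + g**bet Z**gi" "!!Z. unnL (chi Z)"
  and eta: "!!Z. gam Z = lam Z + g**eta Z**gi" "!!Z. unnL (eta Z)"
  and Ad: "!!M. unnL M ==> unnL (bli**g**M**gi**bl)" "!!M. unnL M ==> unnL (br**gi**M**g**bri)"
  and sup: "!!Z. bsup (lam Z)" "!!Z. bsup (bet Z)" "!!Z. bsup (bli**lam Z**bl)" "!!Z. bsup (br**bet Z**bri)"
  and del: "!!Z. bdiag (\<delta> Z)" "!!Z. unnL (\<delta> Z)" "!!Z. bdiag (\<delta>t Z)" "!!Z. unnL (\<delta>t Z)" "!!Z. bdiag (\<kappa> Z)" "!!Z. unnL (\<kappa> Z)"
  and newsup: "!!Z. bsup (\<delta> Z - bl**\<delta>t Z**bli)" "!!Z. bsup (\<kappa> Z - bri**\<kappa> Z**br)"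
 shows "pairing_wedge (%Z. lam Z + (\<delta> Z - bl**\<delta>t Z**bli)) (%Z. \<delta> Z + (gam Z + g**\<kappa> Z**gi)) X Y
   + pairing_wedge (%Z. bet Z + (\<kappa> Z - bri**\<kappa> Z**br)) (%Z. \<kappa> Z + (gi**gam Z**g + gi**\<delta> Z**g)) X Y
   = pairing_wedge lam gam X Y + pairing_wedge bet (%Z. gi**gam Z**g) X Y"
proof -
 let ?W = "%a b. pairing_wedge a b X Y"
 let ?g' = "%Z. gi**gam Z**g"
 have e: "gi**gam Z**g = gi**lam Z**g + eta Z" for Z
 proof -
  have "gi**gam Z**g = gi**lam Z**g + (gi**g)**eta Z**(gi**g)"
   unfolding eta(1) by (simp only: mm_ring)
  then show ?thesis by (simp add: g)
 qed
 have c: "br**gi**gam Z**g**bri = br**gi**chi Z**g**bri + br**bet Z**bri" for Z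
 proof -
  have "br**gi**gam Z**g**bri = br**gi**chi Z**g**bri + br**(gi**g)**bet Z**(gi**g)**bri"
   unfolding chi(1) by (simp only: mm_ring)
  then show ?thesis by (simp add: g)
 qed
 have l: "bli**gam Z**bl = bli**lam Z**bl + bli**g**eta Z**gi**bl" for Z
  unfolding eta(1) by (simp only: mm_ring)
 have z1: "?W lam \<delta> = 0" "?W bet \<kappa> = 0" "?W (%Z. \<delta> Z - bl**\<delta>t Z**bli) \<delta> = 0" "?W (%Z. \<kappa> Z - bri**\<kappa> Z**br) \<kappa> = 0"
  by (rule pw_bsup(2); fact sup del newsup)+
 have k1: "?W lam (%Z. g**\<kappa> Z**gi) = - ?W \<kappa> (%Z. gi**lam Z**g)"
  unfolding pw_swap[of lam] by (simp add: pw_conj_move)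
 have k2: "?W \<kappa> ?g' = ?W \<kappa> (%Z. gi**lam Z**g)"
  unfolding e pw_add_right pw_unnL[of \<kappa> eta, OF del(6) eta(2)] by simp
 \<comment> \<open>Carried past b_R, gam splits into a Lie algebra part and a strictly upper part.
   As \<kappa> is both in the Lie algebra and block diagonal, it is orthogonal to each.\<close>
 have k3: "?W (%Z. bri**\<kappa> Z**br) ?g' = 0"
 proof -
  have "?W (%Z. bri**\<kappa> Z**br) ?g' = ?W \<kappa> (%Z. br**gi**gam Z**g**bri)"
   by (simp add: pw_conj_move mm_assoc)
  also have "... = ?W \<kappa> (%Z. br**gi**chi Z**g**bri) + ?W \<kappa> (%Z. br**bet Z**bri)"
   unfolding c by (rule pw_add_right)
  also have "?W \<kappa> (%Z. br**gi**chi Z**g**bri) = 0" by (rule pw_unnL) (intro del Ad chi)+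
  also have "?W \<kappa> (%Z. br**bet Z**bri) = 0" by (rule pw_bsup(3)) (intro del sup)+
  finally show ?thesis by simp
 qed
 have d1: "?W \<delta> gam = ?W \<delta> (%Z. g**bet Z**gi)"
  unfolding chi(1) pw_add_right pw_unnL[of \<delta> chi, OF del(2) chi(2)] by simp
 have d2: "?W bet (%Z. gi**\<delta> Z**g) = - ?W \<delta> (%Z. g**bet Z**gi)"
  unfolding pw_swap[of bet] by (simp add: pw_conj_move)
 have d3: "?W (%Z. bl**\<delta>t Z**bli) gam = 0"
 proof -
  have "?W (%Z. bl**\<delta>t Z**bli) gam = ?W \<delta>t (%Z. bli**lam Z**bl) + ?W \<delta>t (%Z. bli**g**eta Z**gi**bl)"
   unfolding pw_conj_move l by (rule pw_add_right)
  also have "?W \<delta>t (%Z. bli**g**eta Z**gi**bl) = 0" by (rule pw_unnL) (intro del Ad eta)+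
  also have "?W \<delta>t (%Z. bli**lam Z**bl) = 0" by (rule pw_bsup(3)) (intro del sup)+
  finally show ?thesis by simp
 qed
 have x1: "?W \<delta> (%Z. g**\<kappa> Z**gi) = - ?W \<kappa> (%Z. gi**\<delta> Z**g)"
  unfolding pw_swap[of \<delta>] by (simp add: pw_conj_move)
 have x2: "?W (%Z. bl**\<delta>t Z**bli) (%Z. g**\<kappa> Z**gi) = 0"
  unfolding pw_conj_move mm_assoc by (rule pw_unnL) (intro del Ad)+
 have x3: "?W (%Z. bri**\<kappa> Z**br) (%Z. gi**\<delta> Z**g) = 0"
  unfolding pw_conj_move mm_assoc by (rule pw_unnL) (intro del Ad)+
 show ?thesis
  using z1 k1 k2 k3 d1 d2 d3 x1 x2 x3
  by (simp add: pw_add_left pw_add_right pw_diff_left)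
qed

section \<open>Factors of constrained elements as polynomial maps\<close>

context reduction begin

text \<open>On the constrained set the diagonal blocks of b_L and b_R are known, so \<omega> and
  \<nu> are polynomials in the entries of g and their conjugates: \<omega> comes from k_L^H I g = I
  b_R, and -\<nu> is a block of g I g^H. In this way the factors defined by \<open>THE\<close>
  become differentiable in g.\<close>

definition wF :: "'n bmat => 'n cmat"
 where "wF g = (1 / x) *\<^sub>R ((blk11 g)\<^sup>H**blk12 g - (blk21 g)\<^sup>H**blk22 g)"
definition nF :: "'n bmat => 'n cmat"
 where "nF g = blk12 g**(blk22 g)\<^sup>H - blk11 g**(blk21 g)\<^sup>H"
definition bRi :: "'n cmat => 'n bmat"
 where "bRi \<omega> = blk (smat (1 / x)) (- \<omega>) 0 (smat x)"
definition bLi :: "'n cmat => 'n bmat"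
 where "bLi \<nu> = blk (y *\<^sub>R matrix_inv \<sigma>) (- (1 / y) *\<^sub>R (matrix_inv \<sigma>**\<nu>)) 0 (smat (1 / y))"

lemma bR_bRi: "bR \<omega>**bRi \<omega> = mat 1" "bRi \<omega>**bR \<omega> = mat 1"
 using x_pos by (simp_all add: bR_def bRi_def blk_mult smat_eq mm_ring blk_mat)

lemma bL_bLi: "bL \<nu>**bLi \<nu> = mat 1" "bLi \<nu>**bL \<nu> = mat 1"
 using y_pos by (simp_all add: bL_def bLi_def blk_mult smat_eq mm_ring blk_mat sigma_inv)

lemma constrained_factors:
 assumes "g \<in> C"
 shows "b_R g = bR (wF g)" "b_L g = bL (nF g)" "k_L g = g**bRi (wF g)" "k_R g = bLi (nF g)**g"
  "k_L g \<in> SUnn" "k_R g \<in> SUnn" "g = k_L g**bR (wF g)" "g = bL (nF g)**k_R g"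
proof -
 obtain k \<omega> \<nu> kR where h: "k \<in> SUnn" "regular k" "kR \<in> SUnn" "g = k**bR \<omega>" "g = bL \<nu>**kR"
  "k_L g = k" "b_R g = bR \<omega>" "k_R g = kR" "b_L g = bL \<nu>" using assms by (rule constrainedE)
 have w: "wF g = \<omega>"
 proof -
  have "k\<^sup>H**Inn**g = (k\<^sup>H**Inn**k)**bR \<omega>" unfolding h(4) by (simp only: mm_assoc)
  then have 1: "k\<^sup>H**Inn**g = Inn**bR \<omega>" using h(1) by (simp add: SUnn_iff Unn_def)
  obtain a b c d where k: "k = blk a b c d" by (rule blk_cases)
  have g: "blk11 g = x *\<^sub>R a" "blk21 g = x *\<^sub>R c"
   unfolding h(4) k by (simp_all add: bR_def blk_mult smat_eq mm_ring)
  have "blk12 (k\<^sup>H**Inn**g) = \<omega>" unfolding 1 by (simp add: Inn_def bR_def blk_mult mm_ring)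
  moreover have "blk12 (k\<^sup>H**Inn**blk A B C' D) = a\<^sup>H**B - c\<^sup>H**D" for A B C' D
   unfolding k by (simp add: Inn_def blk_simps mm_ring)
  from this[of "blk11 g" "blk12 g" "blk21 g" "blk22 g"] have "blk12 (k\<^sup>H**Inn**g) = a\<^sup>H**blk12 g - c\<^sup>H**blk22 g"
   by (simp only: blk_collapse)
  ultimately have "a\<^sup>H**blk12 g - c\<^sup>H**blk22 g = \<omega>" by simp
  then show ?thesis using x_pos by (simp add: wF_def g ctrans_scaleR mm_ring flip: scaleR_diff_right)
 qed
 have n: "nF g = \<nu>"
 proof -
  have "g**Inn**g\<^sup>H = bL \<nu>**Inn**(bL \<nu>)\<^sup>H" by (rule constrained_metric[OF assms h(9)])
  moreover have "blk12 (bL \<nu>**Inn**(bL \<nu>)\<^sup>H) = - \<nu>"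
   using y_pos by (simp add: bL_def Inn_def blk_simps smat_eq ctrans_simps mm_ring)
  moreover have "blk12 (blk A B C' D**Inn**(blk A B C' D)\<^sup>H) = A**C'\<^sup>H - B**D\<^sup>H" for A B C' D :: "'n cmat"
   by (simp add: Inn_def blk_simps mm_ring)
  ultimately have "blk11 g**(blk21 g)\<^sup>H - blk12 g**(blk22 g)\<^sup>H = - \<nu>"
   by (metis blk_collapse)
  then show ?thesis unfolding nF_def by (simp add: algebra_simps)
 qed
 show "b_R g = bR (wF g)" "b_L g = bL (nF g)" "k_L g \<in> SUnn" "k_R g \<in> SUnn"
  "g = k_L g**bR (wF g)" "g = bL (nF g)**k_R g" using h w n by auto
 have "g**bRi \<omega> = k" unfolding h(4) by (simp add: mm_assoc[symmetric] bR_bRi)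
 then show "k_L g = g**bRi (wF g)" using h(6) w by simp
 have "bLi \<nu>**g = kR" unfolding h(5) by (simp add: mm_assoc bL_bLi)
 then show "k_R g = bLi (nF g)**g" using h(8) n by simp
qed

lemma wF_gauge:
 assumes "unitary R" "unitary r"
 shows "wF (blk R 0 0 r**g**blk k1 0 0 k2) = k1\<^sup>H**wF g**k2"
proof -
 obtain A B C' D where g: "g = blk A B C' D" by (rule blk_cases)
 have u: "M**R\<^sup>H**R = M" "M**r\<^sup>H**r = M" for M :: "'n cmat"
  by (simp_all add: mm_assoc[symmetric] unitaryD assms)
 show ?thesis by (simp add: g wF_def blk_mult ctrans_mult mm_ring u)
qed

lemma nF_gauge:
 assumes "unitary k1" "unitary k2"
 shows "nF (blk R 0 0 r**g**blk k1 0 0 k2) = R**nF g**r\<^sup>H"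
proof -
 obtain A B C' D where g: "g = blk A B C' D" by (rule blk_cases)
 have u: "M**k1**k1\<^sup>H = M" "M**k2**k2\<^sup>H = M" for M :: "'n cmat"
  by (simp_all add: mm_assoc[symmetric] unitaryD assms)
 show ?thesis by (simp add: g nF_def blk_mult ctrans_mult mm_ring u)
qed

end

lemma matrix_mult_has_derivative:
 fixes f g :: "'a::real_normed_vector => 'n::finite cmat"
 assumes "(f has_derivative f') (at a)" "(g has_derivative g') (at a)"
 shows "((%u. f u**g u) has_derivative (%Z. f a**g' Z + f' Z**g a)) (at a)"
 using bounded_bilinear.FDERIV[OF bounded_bilinear_matrix_mult assms] .

lemma ctrans_has_derivative:
 fixes f :: "'a::real_normed_vector => 'n::finite cmat"
 shows "(f has_derivative f') (at a) ==> ((%u. (f u)\<^sup>H) has_derivative (%Z. (f' Z)\<^sup>H)) (at a)"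
 by (rule bounded_linear.has_derivative[OF bounded_linear_ctrans])

lemma bounded_linear_blk12: "bounded_linear (%M. blk 0 M 0 0 :: ('n::finite) bmat)"
 by (simp add: linear_conv_bounded_linear[symmetric] linearI blk_add blk_scaleR)

lemma bounded_linear_blk_diag1: "bounded_linear (%M. blk M 0 0 0 :: ('n::finite) bmat)"
 by (simp add: linear_conv_bounded_linear[symmetric] linearI blk_add blk_scaleR)

lemma bounded_linear_blk_diag2: "bounded_linear (%M. blk 0 0 0 M :: ('n::finite) bmat)"
 by (simp add: linear_conv_bounded_linear[symmetric] linearI blk_add blk_scaleR)

lemma bounded_linear_parts: "bounded_linear (blk11 :: ('n::finite) bmat => _)" "bounded_linear (blk12 :: 'n bmat => _)"
 "bounded_linear (blk21 :: 'n bmat => _)" "bounded_linear (blk22 :: 'n bmat => _)"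
 by (auto simp: linear_conv_bounded_linear[symmetric] blk11_def blk12_def blk21_def blk22_def vec_eq_iff intro!: linearI)

lemma blk_diag_has_derivative:
 fixes R r :: "'a::real_normed_vector => 'n::finite cmat"
 assumes "(R has_derivative R') (at a)" "(r has_derivative r') (at a)"
 shows "((%u. blk (R u) 0 0 (r u)) has_derivative (%Z. blk (R' Z) 0 0 (r' Z))) (at a)"
proof -
 have "((%u. blk (R u) 0 0 0 + blk 0 0 0 (r u)) has_derivative (%Z. blk (R' Z) 0 0 0 + blk 0 0 0 (r' Z))) (at a)"
  by (intro has_derivative_add bounded_linear.has_derivative[OF bounded_linear_blk_diag1]
    bounded_linear.has_derivative[OF bounded_linear_blk_diag2] assms)
 then show ?thesis by (simp add: blk_add)
qed

lemma frechet_derivative_eq_open: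
 assumes "open U" "a \<in> U" "!!u. u \<in> U ==> f u = g u" "(g has_derivative g') (at a)"
 shows "frechet_derivative f (at a) = g'"
proof -
 have "(f has_derivative g') (at a)"
  using has_derivative_transform_within_open[OF assms(4,1,2)] assms(3) by simp
 then show ?thesis by (simp add: frechet_derivative_at[symmetric])
qed

lemma has_derivative_const_on_open:
 assumes "open U" "a \<in> U" "!!u. u \<in> U ==> f u = c" "(f has_derivative f') (at a)"
 shows "f' Z = 0"
proof -
 have "((%u. c) has_derivative f') (at a)"
  using has_derivative_transform_within_open[OF assms(4,1,2)] assms(3) by simp
 then have "f' = (%Z. 0)" using has_derivative_unique[OF _ has_derivative_const] by blast
 then show ?thesis by simp
qed

lemma Unn_derivative:
 assumes "open U" "a \<in> U" "!!u. u \<in> U ==> Unn (k u)" "(k has_derivative k') (at a)"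
 shows "(k a)\<^sup>H**Inn**k' Z + (k' Z)\<^sup>H**Inn**k a = 0"
proof -
 have "((%u. (k u)\<^sup>H**Inn**k u) has_derivative (%Z. (k a)\<^sup>H**Inn**k' Z + ((k a)\<^sup>H**0 + (k' Z)\<^sup>H**Inn)**k a)) (at a)"
  by (intro matrix_mult_has_derivative ctrans_has_derivative assms(4) has_derivative_const)
 from has_derivative_const_on_open[OF assms(1,2) _ this, of Inn Z] show ?thesis
  using assms(3) by (simp add: Unn_def)
qed

lemma unitary_derivative:
 fixes k :: "'a::real_normed_vector => 'n::finite cmat"
 assumes "open U" "a \<in> U" "!!u. u \<in> U ==> unitary (k u)" "(k has_derivative k') (at a)"
 shows "(k a)\<^sup>H**k' Z + (k' Z)\<^sup>H**k a = 0"
proof -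
 have "((%u. (k u)\<^sup>H**k u) has_derivative (%Z. (k a)\<^sup>H**k' Z + (k' Z)\<^sup>H**k a)) (at a)"
  by (intro matrix_mult_has_derivative ctrans_has_derivative assms(4))
 from has_derivative_const_on_open[OF assms(1,2) _ this, of "mat 1" Z] show ?thesis
  using assms(3) by (simp add: unitary_def)
qed

lemma unnL_right:
 assumes k: "Unn k" and e: "k\<^sup>H**Inn**k' + k'\<^sup>H**Inn**k = 0"
 shows "unnL (k'**(Inn**k\<^sup>H**Inn))"
proof -
 let ?ki = "Inn**k\<^sup>H**Inn"
 have kk: "k**?ki = mat 1" by (rule Unn_right[OF k])
 have kk': "?ki\<^sup>H**k\<^sup>H = mat 1" using arg_cong[OF kk, of ctrans] by (simp add: ctrans_mult)
 have "(k'**?ki)\<^sup>H**Inn + Inn**(k'**?ki) = ?ki\<^sup>H**k'\<^sup>H**Inn**(k**?ki) + (?ki\<^sup>H**k\<^sup>H)**Inn**k'**?ki"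
  unfolding kk kk' ctrans_mult[of k' ?ki] by (simp only: mm_assoc matrix_mul_rid matrix_mul_lid)
 also have "... = ?ki\<^sup>H**(k\<^sup>H**Inn**k' + k'\<^sup>H**Inn**k)**?ki"
  by (simp only: mm_ring add.commute)
 finally show ?thesis unfolding unnL_def e by simp
qed

lemma unnL_left:
 assumes k: "Unn k" and e: "k\<^sup>H**Inn**k' + k'\<^sup>H**Inn**k = 0"
 shows "unnL ((Inn**k\<^sup>H**Inn)**k')"
proof -
 have "((Inn**k\<^sup>H**Inn)**k')\<^sup>H**Inn = k'\<^sup>H**Inn**k**(Inn**Inn)"
  by (simp only: ctrans_mult ctrans_ctrans ctrans_Inn mm_assoc)
 moreover have "Inn**((Inn**k\<^sup>H**Inn)**k') = (Inn**Inn)**k\<^sup>H**Inn**k'" by (simp only: mm_assoc)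
 ultimately show ?thesis using e by (simp add: unnL_def add.commute)
qed

lemma unnL_blk_diag: "unnL (blk a 0 0 d) \<longleftrightarrow> a\<^sup>H = - a & d\<^sup>H = - d"
proof -
 have z: "blk a b c e = 0 \<longleftrightarrow> a = 0 & b = 0 & c = 0 & e = 0" for a b c e :: "'n::finite cmat"
  by (metis blk_eq_iff blk_zero)
 have m: "- p - q = 0 \<longleftrightarrow> p = - q" "- p + - q = 0 \<longleftrightarrow> p = - q" for p q :: "'n::finite cmat"
 proof -
  have e: "- p - q = - (p + q)" by simp
  show "- p - q = 0 \<longleftrightarrow> p = - q" unfolding e by (simp only: neg_equal_0_iff_equal eq_neg_iff_add_eq_0)
  then show "- p + - q = 0 \<longleftrightarrow> p = - q" by simp
 qed
 show ?thesis
  by (simp add: unnL_def Inn_def blk_simps mm_ring z m eq_neg_iff_add_eq_0 neg_eq_iff_add_eq_0)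
qed

section \<open>Pull-backs of the two-form and their gauge invariance\<close>

context reduction begin

lemma factor_maps_differentiable:
 assumes "F differentiable at a"
 shows "(%u. wF (F u)) differentiable at a" "(%u. nF (F u)) differentiable at a"
 unfolding wF_def nF_def
 by (intro differentiable_scaleR differentiable_const differentiable_diff matrix_mult_differentiable ctrans_differentiable
   bounded_linear_differentiable[OF bounded_linear_parts(1)] bounded_linear_differentiable[OF bounded_linear_parts(2)]
   bounded_linear_differentiable[OF bounded_linear_parts(3)] bounded_linear_differentiable[OF bounded_linear_parts(4)] assms)+

definition invC :: "'n bmat => 'n bmat"
 where "invC g = bRi (wF g)**(Inn**(k_L g)\<^sup>H**Inn)"

lemma invC: assumes "g \<in> C" shows "g**invC g = mat 1" "invC g**g = mat 1"
proof -
 note f = constrained_factors[OF assms]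
 have U: "Unn (k_L g)" using f(5) by (simp add: SUnn_iff)
 have "g**invC g = k_L g**(bR (wF g)**bRi (wF g))**(Inn**(k_L g)\<^sup>H**Inn)"
  unfolding invC_def by (subst f(7)) (simp only: mm_assoc)
 then show "g**invC g = mat 1" by (simp add: bR_bRi Unn_right[OF U])
 then show "invC g**g = mat 1" using matrix_left_right_inverse by blast
qed

text \<open>The diagonal blocks of b_L and b_R are constant, so their forms have only a corner,
  d\<nu>/y^2 and d\<omega>/x. The other two conclusions record that the forms of k_L and k_R,
  expressed through gam, are Lie algebra valued.\<close>

lemma pull_symp_constrained:
 assumes U: "open U" "a \<in> U" and FC: "!!u. u \<in> U ==> F u \<in> C"
  and F': "(F has_derivative F') (at a)"
  and w': "((%u. wF (F u)) has_derivative w') (at a)" and n': "((%u. nF (F u)) has_derivative n') (at a)"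
 defines "g \<equiv> F a" and "gi \<equiv> invC (F a)"
 defines "lam \<equiv> %Z. blk 0 ((1 / y^2) *\<^sub>R n' Z) 0 0" and "bet \<equiv> %Z. blk 0 ((1 / x) *\<^sub>R w' Z) 0 0"
 defines "gam \<equiv> %Z. F' Z**gi"
 shows "pull_symp F a X Y = pairing_wedge lam gam X Y + pairing_wedge bet (%Z. gi**gam Z**g) X Y"
  "unnL (gam Z - g**bet Z**gi)" "unnL (gi**gam Z**g - gi**lam Z**g)"
proof -
 have gC: "g \<in> C" using FC U by (simp add: g_def)
 note f = constrained_factors[OF gC]
 let ?bL = "bL (nF g)" and ?bli = "bLi (nF g)" and ?bR = "bR (wF g)" and ?bri = "bRi (wF g)"
 let ?kL = "k_L g" and ?kR = "k_R g" let ?kLi = "Inn**?kL\<^sup>H**Inn" and ?kRi = "Inn**?kR\<^sup>H**Inn"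
 have UL: "Unn ?kL" and UR: "Unn ?kR" using f by (auto simp: SUnn_iff)
 have gg: "g**gi = mat 1" "gi**g = mat 1" unfolding gi_def g_def[symmetric] by (rule invC[OF gC])+
 have gi: "gi = ?bri**?kLi" unfolding gi_def g_def[symmetric] invC_def ..
 have kRi: "?kRi = gi**?bL"
 proof -
  have "?kR**(gi**?bL) = ?bli**(g**gi)**?bL" unfolding f(4) by (simp only: mm_assoc)
  then have "?kR**(gi**?bL) = mat 1" by (simp add: gg bL_bLi)
  then have "(?kRi**?kR)**(gi**?bL) = ?kRi" by (simp flip: mm_assoc)
  then show ?thesis by (simp add: Unn_left[OF UR])
 qed
 have dbL: "((%u. bL (nF (F u))) has_derivative (%Z. blk 0 ((1 / y) *\<^sub>R n' Z) 0 0)) (at a)"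
 proof -
  have e: "bL n = bL 0 + blk 0 ((1 / y) *\<^sub>R n) 0 0" for n by (simp add: bL_def blk_add)
  have "((%u. bL 0 + blk 0 ((1 / y) *\<^sub>R nF (F u)) 0 0) has_derivative (%Z. 0 + blk 0 ((1 / y) *\<^sub>R n' Z) 0 0)) (at a)"
   by (intro has_derivative_add has_derivative_const bounded_linear.has_derivative[OF bounded_linear_blk12] has_derivative_scaleR_right n')
  then show ?thesis by (subst e) simp
 qed
 have dbR: "((%u. bR (wF (F u))) has_derivative (%Z. blk 0 (w' Z) 0 0)) (at a)"
 proof -
  have e: "bR n = bR 0 + blk 0 n 0 0" for n by (simp add: bR_def blk_add)
  have "((%u. bR 0 + blk 0 (wF (F u)) 0 0) has_derivative (%Z. 0 + blk 0 (w' Z) 0 0)) (at a)"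
   by (intro has_derivative_add has_derivative_const bounded_linear.has_derivative[OF bounded_linear_blk12] w')
  then show ?thesis by (subst e) simp
 qed
 have dbRi: "((%u. bRi (wF (F u))) has_derivative (%Z. blk 0 (- w' Z) 0 0)) (at a)"
 proof -
  have e: "bRi n = bRi 0 + blk 0 (- n) 0 0" for n by (simp add: bRi_def blk_add)
  have "((%u. bRi 0 + blk 0 (- wF (F u)) 0 0) has_derivative (%Z. 0 + blk 0 (- w' Z) 0 0)) (at a)"
   by (intro has_derivative_add has_derivative_const bounded_linear.has_derivative[OF bounded_linear_blk12] has_derivative_minus w')
  then show ?thesis by (subst e) simp
 qed
 have dbLi: "((%u. bLi (nF (F u))) has_derivative (%Z. blk 0 (- (1 / y) *\<^sub>R (matrix_inv \<sigma>**n' Z)) 0 0)) (at a)"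
 proof -
  have e: "bLi n = bLi 0 + blk 0 (- (1 / y) *\<^sub>R (matrix_inv \<sigma>**n)) 0 0" for n by (simp add: bLi_def blk_add)
  have "((%u. bLi 0 + blk 0 (- (1 / y) *\<^sub>R (matrix_inv \<sigma>**nF (F u))) 0 0) has_derivative
    (%Z. 0 + blk 0 (- (1 / y) *\<^sub>R (matrix_inv \<sigma>**n' Z + 0**nF (F a))) 0 0)) (at a)"
   by (intro has_derivative_add has_derivative_const bounded_linear.has_derivative[OF bounded_linear_blk12]
     has_derivative_scaleR_right matrix_mult_has_derivative n')
  then show ?thesis by (subst e) simp
 qed
 have dkL: "((%u. k_L (F u)) has_derivative (%Z. g**blk 0 (- w' Z) 0 0 + F' Z**?bri)) (at a)"
 proof -
  have "((%u. F u**bRi (wF (F u))) has_derivative (%Z. g**blk 0 (- w' Z) 0 0 + F' Z**?bri)) (at a)"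
   unfolding g_def by (intro matrix_mult_has_derivative F' dbRi)
  then show ?thesis
   by (rule has_derivative_transform_within_open[OF _ U]) (simp add: constrained_factors(3)[OF FC])
 qed
 have dkR: "((%u. k_R (F u)) has_derivative (%Z. ?bli**F' Z + blk 0 (- (1 / y) *\<^sub>R (matrix_inv \<sigma>**n' Z)) 0 0**g)) (at a)"
 proof -
  have "((%u. bLi (nF (F u))**F u) has_derivative (%Z. ?bli**F' Z + blk 0 (- (1 / y) *\<^sub>R (matrix_inv \<sigma>**n' Z)) 0 0**g)) (at a)"
   unfolding g_def by (intro matrix_mult_has_derivative F' dbLi)
  then show ?thesis
   by (rule has_derivative_transform_within_open[OF _ U]) (simp add: constrained_factors(4)[OF FC])
 qed
 have fr: "frechet_derivative (%u. b_L (F u)) (at a) = (%Z. blk 0 ((1 / y) *\<^sub>R n' Z) 0 0)"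
  "frechet_derivative (%u. b_R (F u)) (at a) = (%Z. blk 0 (w' Z) 0 0)"
  "frechet_derivative (%u. k_L (F u)) (at a) = (%Z. g**blk 0 (- w' Z) 0 0 + F' Z**?bri)"
  "frechet_derivative (%u. k_R (F u)) (at a) = (%Z. ?bli**F' Z + blk 0 (- (1 / y) *\<^sub>R (matrix_inv \<sigma>**n' Z)) 0 0**g)"
  by (intro frechet_derivative_eq_open[OF U _ dbL] frechet_derivative_eq_open[OF U _ dbR]
    frechet_derivative_eq_open[OF U _ dkL] frechet_derivative_eq_open[OF U _ dkR] constrained_factors FC refl; assumption?)+
 have inv: "matrix_inv (b_L (F a)) = ?bli" "matrix_inv (b_R (F a)) = ?bri" "matrix_inv (k_L (F a)) = ?kLi" "matrix_inv (k_R (F a)) = ?kRi"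
  unfolding g_def[symmetric] f(1,2) Unn_inv[OF UL] Unn_inv[OF UR] by (intro matrix_inv_eqI bL_bLi bR_bRi refl)+
 have lam: "blk 0 ((1 / y) *\<^sub>R n' Z) 0 0**?bli = lam Z" for Z
  by (simp add: bLi_def lam_def blk_mult smat_eq mm_ring power2_eq_square)
 have bet: "?bri**blk 0 (w' Z) 0 0 = bet Z" for Z
  by (simp add: bRi_def bet_def blk_mult smat_eq mm_ring)
 define chi eta where "chi Z = (g**blk 0 (- w' Z) 0 0 + F' Z**?bri)**?kLi"
  and "eta Z = ?kRi**(?bli**F' Z + blk 0 (- (1 / y) *\<^sub>R (matrix_inv \<sigma>**n' Z)) 0 0**g)" for Z
 have p1: "pull_symp F a X Y = pairing_wedge lam chi X Y + pairing_wedge bet eta X Y"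
  unfolding pull_symp_def Let_def fr inv lam bet chi_def eta_def ..
 have c: "gam Z = chi Z + g**bet Z**gi" for Z
 proof -
  have "bet Z**?bri = blk 0 (w' Z) 0 0"
   using x_pos by (simp add: bet_def bRi_def blk_mult smat_eq mm_ring)
  then have "g**bet Z**gi = g**blk 0 (w' Z) 0 0**?kLi"
   unfolding gi by (simp only: mm_assoc[symmetric]) (simp only: mm_assoc[of "bet Z"])
  moreover have "blk 0 (- w' Z) 0 0 = - blk 0 (w' Z) 0 0" by (simp add: blk_uminus)
  ultimately show ?thesis unfolding chi_def gam_def gi
   by (simp add: mm_ring)
 qed
 have e: "gam Z = lam Z + g**eta Z**gi" for Z
 proof -
  have l: "?bL**blk 0 (- (1 / y) *\<^sub>R (matrix_inv \<sigma>**n' Z)) 0 0 = - lam Z"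
   by (simp add: bL_def lam_def blk_mult blk_uminus mm_ring power2_eq_square sigma_inv blk_eq_iff)
  have "g**eta Z**gi = (g**gi)**((?bL**?bli)**F' Z**gi + (?bL**blk 0 (- (1 / y) *\<^sub>R (matrix_inv \<sigma>**n' Z)) 0 0)**(g**gi))"
   unfolding eta_def kRi by (simp only: matrix_add_ldistrib matrix_add_rdistrib mm_assoc)
  then have "g**eta Z**gi = F' Z**gi - lam Z" unfolding l gg bL_bLi by simp
  then show ?thesis by (simp add: gam_def)
 qed
 show "pull_symp F a X Y = pairing_wedge lam gam X Y + pairing_wedge bet (%Z. gi**gam Z**g) X Y"
  unfolding p1 by (rule symp_reduce[OF gg c e])
 have Lu: "Unn (k_L (F u))" "Unn (k_R (F u))" if "u \<in> U" for u
  using constrained_factors[OF FC[OF that]] by (auto simp: SUnn_iff)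
 have "unnL (chi Z)"
  unfolding chi_def by (rule unnL_right[OF UL]) (use Unn_derivative[OF U Lu(1) dkL] in \<open>simp add: g_def\<close>)
 then show "unnL (gam Z - g**bet Z**gi)" by (simp add: c)
 have "unnL (eta Z)"
  unfolding eta_def by (rule unnL_left[OF UR]) (use Unn_derivative[OF U Lu(2) dkR] in \<open>simp add: g_def\<close>)
 moreover have "gi**gam Z**g - gi**lam Z**g = (gi**g)**eta Z**(gi**g)"
  unfolding e by (simp only: mm_ring) simp
 ultimately show "unnL (gi**gam Z**g - gi**lam Z**g)" by (simp add: gg)
qed

text \<open>With \<delta> = D^(-1) dD on the left and \<kappa> = dk k^(-1) on the right, the forms
  of F2 are the expressions of \<open>symp_gauge_algebra\<close>, conjugated by the values
  \<open>Da\<close> and \<open>ka\<close> of the gauge factors at a; the pairing does not see the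
  conjugation.\<close>

lemma pull_symp_gauge:
 fixes F1 F2 :: "'a::real_normed_vector => 'n bmat"
 assumes U: "open U" "a \<in> U" and C1: "!!u. u \<in> U ==> F1 u \<in> C" and C2: "!!u. u \<in> U ==> F2 u \<in> C"
  and F2: "!!u. u \<in> U ==> F2 u = blk (R u) 0 0 (r u)**F1 u**blk (k1 u) 0 0 (k2 u)"
  and uni: "!!u. u \<in> U ==> stab (R u)" "!!u. u \<in> U ==> unitary (r u)" "!!u. u \<in> U ==> unitary (k1 u)" "!!u. u \<in> U ==> unitary (k2 u)"
  and d: "F1 differentiable at a" "R differentiable at a" "r differentiable at a" "k1 differentiable at a" "k2 differentiable at a"
 shows "pull_symp F2 a X Y = pull_symp F1 a X Y"
proof -
 have uR: "unitary (R u)" if "u \<in> U" for u using uni(1)[OF that] by (simp add: stab_def)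
 obtain F' R' r' k1' k2' where D: "(F1 has_derivative F') (at a)" "(R has_derivative R') (at a)" "(r has_derivative r') (at a)"
  "(k1 has_derivative k1') (at a)" "(k2 has_derivative k2') (at a)"
  using d unfolding differentiable_def by blast
 obtain w' n' where wn: "((%u. wF (F1 u)) has_derivative w') (at a)" "((%u. nF (F1 u)) has_derivative n') (at a)"
  using factor_maps_differentiable[OF d(1)] unfolding differentiable_def by blast
 define g gi where "g = F1 a" and "gi = invC (F1 a)"
 have gC: "g \<in> C" using C1 U by (simp add: g_def)
 note f = constrained_factors[OF gC]
 have gg: "g**gi = mat 1" "gi**g = mat 1" unfolding g_def gi_def by (rule invC, simp add: C1 U)+
 define Da ka where "Da = blk (R a) 0 0 (r a)" and "ka = blk (k1 a) 0 0 (k2 a)"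
 have ua: "unitary (R a)" "unitary (r a)" "unitary (k1 a)" "unitary (k2 a)" using uR uni U by auto
 have DD: "Da\<^sup>H**Da = mat 1" "Da**Da\<^sup>H = mat 1" "ka\<^sup>H**ka = mat 1" "ka**ka\<^sup>H = mat 1"
  using ua by (simp_all add: Da_def ka_def blk_simps unitaryD blk_mat)
 define d1 d2 c1 c2 where "d1 Z = (R a)\<^sup>H**R' Z" and "d2 Z = (r a)\<^sup>H**r' Z"
  and "c1 Z = k1' Z**(k1 a)\<^sup>H" and "c2 Z = k2' Z**(k2 a)\<^sup>H" for Z
 have eq0: "A + B = 0 \<longleftrightarrow> B = - A" for A B :: "'n cmat" by (auto simp: eq_neg_iff_add_eq_0 add.commute)
 have prim: "R' Z = R a**d1 Z" "r' Z = r a**d2 Z" "k1' Z = c1 Z**k1 a" "k2' Z = c2 Z**k2 a" for Z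
  unfolding d1_def d2_def c1_def c2_def mm_assoc
  by (simp_all add: unitaryD ua) (simp_all add: mm_assoc[symmetric] unitaryD ua)
 have anti: "(d1 Z)\<^sup>H = - d1 Z" "(d2 Z)\<^sup>H = - d2 Z" for Z
  using unitary_derivative[OF U uR D(2), of Z] unitary_derivative[OF U uni(2) D(3), of Z]
  unfolding eq0 by (simp_all add: d1_def d2_def ctrans_mult)
 have anti': "(c1 Z)\<^sup>H = - c1 Z" "(c2 Z)\<^sup>H = - c2 Z" for Z
 proof -
  have "(c Z)\<^sup>H = - c Z" if u: "!!u. u \<in> U ==> unitary (k u)" and k: "(k has_derivative k') (at a)" and c: "c Z = k' Z**(k a)\<^sup>H"
   for k k' and c :: "'a => 'n cmat"
  proof -
   have uk: "unitary (k a)" using u U by simp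
   have e: "(k' Z)\<^sup>H**k a = - ((k a)\<^sup>H**k' Z)" using unitary_derivative[OF U u k, of Z] by (simp add: eq0)
   have "(c Z)\<^sup>H = k a**((k' Z)\<^sup>H**k a)**(k a)\<^sup>H"
    unfolding c by (simp add: ctrans_mult mm_assoc) (simp add: mm_assoc[symmetric] unitaryD uk)
   also have "... = - ((k a**(k a)\<^sup>H)**k' Z**(k a)\<^sup>H)" unfolding e by (simp only: mm_ring)
   finally show ?thesis by (simp add: unitaryD uk c)
  qed
  then show "(c1 Z)\<^sup>H = - c1 Z" "(c2 Z)\<^sup>H = - c2 Z" using uni(3,4) D(4,5) by (auto simp: c1_def c2_def)
 qed
 define \<delta> \<kappa> \<delta>t where "\<delta> Z = blk (d1 Z) 0 0 (d2 Z)" and "\<kappa> Z = blk (c1 Z) 0 0 (c2 Z)"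
  and "\<delta>t Z = blk (matrix_inv \<sigma>**d1 Z**\<sigma>) 0 0 (d2 Z)" for Z
 \<comment> \<open>Derivative of the commutation of R with \<sigma>\<sigma>^H. It makes \<delta>
   anti-Hermitian even after it has been carried past \<sigma>, so that \<open>\<delta>t\<close>
   lies in the Lie algebra.\<close>
 have comm: "\<sigma>**\<sigma>\<^sup>H**d1 Z = d1 Z**\<sigma>**\<sigma>\<^sup>H" for Z
 proof -
  let ?s = "\<sigma>**\<sigma>\<^sup>H"
  have c: "?s**R u = R u**?s" if "u \<in> U" for u using uni(1)[OF that] by (simp add: stab_iff_commute mm_assoc)
  have "((%u. ?s**R u - R u**?s) has_derivative (%Z. (?s**R' Z + 0**R a) - (R a**0 + R' Z**?s))) (at a)"
   by (intro has_derivative_diff matrix_mult_has_derivative D(2) has_derivative_const)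
  from has_derivative_const_on_open[OF U _ this, of 0] have "?s**R' Z = R' Z**?s" using c by simp
  then have "(?s**R a)**d1 Z = R a**(d1 Z**?s)" unfolding prim by (simp only: mm_assoc)
  then have "R a**(?s**d1 Z) = R a**(d1 Z**?s)" unfolding c[OF U(2)] by (simp only: mm_assoc)
  then have "((R a)\<^sup>H**R a)**(?s**d1 Z) = ((R a)\<^sup>H**R a)**(d1 Z**?s)" by (simp only: mm_assoc[symmetric])
  then show ?thesis by (simp add: unitaryD ua mm_assoc)
 qed
 have anti_t: "(matrix_inv \<sigma>**d1 Z**\<sigma>)\<^sup>H = - (matrix_inv \<sigma>**d1 Z**\<sigma>)" for Z
 proof -
  let ?i = "matrix_inv \<sigma>"
  have i: "\<sigma>\<^sup>H**?i\<^sup>H = mat 1" using arg_cong[OF sigma_inv(2), of ctrans] by (simp add: ctrans_mult)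
  have "(?i**d1 Z**\<sigma>)\<^sup>H = - (\<sigma>\<^sup>H**d1 Z**?i\<^sup>H)"
   by (simp add: ctrans_mult anti mm_ring)
  also have "\<sigma>\<^sup>H**d1 Z**?i\<^sup>H = ?i**(\<sigma>**\<sigma>\<^sup>H**d1 Z)**?i\<^sup>H"
   by (simp add: mm_assoc sigma_inv)
  also have "... = ?i**d1 Z**\<sigma>**(\<sigma>\<^sup>H**?i\<^sup>H)" unfolding comm by (simp only: mm_assoc)
  finally show ?thesis by (simp add: i)
 qed
 let ?n = "nF g" and ?w = "wF g"
 define lam bet gam where "lam Z = blk 0 ((1 / y^2) *\<^sub>R n' Z) 0 0" and "bet Z = blk 0 ((1 / x) *\<^sub>R w' Z) 0 0" and "gam Z = F' Z**gi" for Z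
 note P1 = pull_symp_constrained[OF U C1 D(1) wn, folded gi_def, folded g_def]
 note P1' = P1[folded lam_def bet_def gam_def]
 have new1: "\<delta> Z - bL ?n**\<delta>t Z**bLi ?n = blk 0 ((1 / y^2) *\<^sub>R (d1 Z**?n - ?n**d2 Z)) 0 0" for Z
  using y_pos unfolding \<delta>_def \<delta>t_def bL_def bLi_def
  by (simp add: blk_mult blk_diff smat_eq mm_ring sigma_inv blk_eq_iff power2_eq_square scaleR_diff_right)
    (simp add: mm_assoc[symmetric] sigma_inv)
 have new2: "\<kappa> Z - bRi ?w**\<kappa> Z**bR ?w = blk 0 ((1 / x) *\<^sub>R (?w**c2 Z - c1 Z**?w)) 0 0" for Z
  using x_pos unfolding \<kappa>_def bR_def bRi_def
  by (simp add: blk_mult blk_diff smat_eq mm_ring blk_eq_iff scaleR_diff_right)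
 define F2' where "F2' Z = (Da**g)**blk (k1' Z) 0 0 (k2' Z) + (Da**F' Z + blk (R' Z) 0 0 (r' Z)**g)**ka" for Z
 have dF2: "(F2 has_derivative F2') (at a)"
 proof -
  have "((%u. blk (R u) 0 0 (r u)**F1 u**blk (k1 u) 0 0 (k2 u)) has_derivative F2') (at a)"
   unfolding F2'_def Da_def ka_def g_def
   by (intro matrix_mult_has_derivative blk_diag_has_derivative D)
  then show ?thesis by (rule has_derivative_transform_within_open[OF _ U]) (simp add: F2)
 qed
 define w2' where "w2' Z = (k1 a)\<^sup>H**?w**k2' Z + ((k1 a)\<^sup>H**w' Z + (k1' Z)\<^sup>H**?w)**k2 a" for Z
 have dw2: "((%u. wF (F2 u)) has_derivative w2') (at a)"
 proof -
  have "((%u. (k1 u)\<^sup>H**wF (F1 u)**k2 u) has_derivative w2') (at a)"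
   unfolding w2'_def g_def by (intro matrix_mult_has_derivative ctrans_has_derivative D wn)
  then show ?thesis by (rule has_derivative_transform_within_open[OF _ U]) (simp add: F2 wF_gauge uR uni)
 qed
 define n2' where "n2' Z = R a**?n**(r' Z)\<^sup>H + (R a**n' Z + R' Z**?n)**(r a)\<^sup>H" for Z
 have dn2: "((%u. nF (F2 u)) has_derivative n2') (at a)"
 proof -
  have "((%u. R u**nF (F1 u)**(r u)\<^sup>H) has_derivative n2') (at a)"
   unfolding n2'_def g_def by (intro matrix_mult_has_derivative ctrans_has_derivative D wn)
  then show ?thesis by (rule has_derivative_transform_within_open[OF _ U]) (simp add: F2 nF_gauge uR uni)
 qed
 define g2 gi2 where "g2 = F2 a" and "gi2 = invC (F2 a)"
 note P2 = pull_symp_constrained(1)[OF U C2 dF2 dw2 dn2, folded gi2_def, folded g2_def]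
 have g2: "g2 = Da**g**ka" unfolding g2_def g_def Da_def ka_def by (rule F2[OF U(2)])
 have gi2: "gi2 = ka\<^sup>H**gi**Da\<^sup>H"
 proof -
  have "g2**(ka\<^sup>H**gi**Da\<^sup>H) = Da**(g**((ka**ka\<^sup>H)**gi))**Da\<^sup>H" unfolding g2 by (simp only: mm_assoc)
  then have e: "g2**(ka\<^sup>H**gi**Da\<^sup>H) = mat 1" by (simp add: DD gg)
  have "gi2**g2 = mat 1" unfolding gi2_def g2_def by (rule invC(2)[OF C2[OF U(2)]])
  then have "gi2**(g2**(ka\<^sup>H**gi**Da\<^sup>H)) = ka\<^sup>H**gi**Da\<^sup>H" by (simp add: mm_assoc)
  then show ?thesis unfolding e by simp
 qed
 have blkd: "blk (R' Z) 0 0 (r' Z) = Da**\<delta> Z" "blk (k1' Z) 0 0 (k2' Z) = \<kappa> Z**ka" for Z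
  by (simp_all add: Da_def \<delta>_def ka_def \<kappa>_def blk_mult prim)
 have gam2: "F2' Z**gi2 = Da**(\<delta> Z + (gam Z + g**\<kappa> Z**gi))**Da\<^sup>H" for Z
 proof -
  have "F2' Z**gi2 = Da**g**\<kappa> Z**(ka**ka\<^sup>H)**gi**Da\<^sup>H + Da**F' Z**(ka**ka\<^sup>H)**gi**Da\<^sup>H
    + Da**\<delta> Z**g**(ka**ka\<^sup>H)**gi**Da\<^sup>H"
   unfolding F2'_def gi2 blkd by (simp only: matrix_add_rdistrib matrix_add_ldistrib mm_assoc add.assoc)
  also have "... = Da**g**\<kappa> Z**gi**Da\<^sup>H + Da**(F' Z**gi)**Da\<^sup>H + Da**\<delta> Z**(g**gi)**Da\<^sup>H"
   unfolding DD by (simp only: mm_assoc matrix_mul_rid)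
  finally show ?thesis unfolding gg gam_def
   by (simp add: mm_ring)
 qed
 have gam2': "gi2**(F2' Z**gi2)**g2 = ka\<^sup>H**(\<kappa> Z + (gi**gam Z**g + gi**\<delta> Z**g))**ka" for Z
 proof -
  have "gi2**(F2' Z**gi2)**g2 = ka\<^sup>H**(gi**(Da\<^sup>H**Da)**(\<delta> Z + (gam Z + g**\<kappa> Z**gi))**(Da\<^sup>H**Da)**g)**ka"
   unfolding gam2 unfolding gi2 g2 by (simp only: mm_assoc)
  also have "gi**(Da\<^sup>H**Da)**(\<delta> Z + (gam Z + g**\<kappa> Z**gi))**(Da\<^sup>H**Da)**g
   = gi**\<delta> Z**g + gi**gam Z**g + (gi**g)**\<kappa> Z**(gi**g)"
   unfolding DD by (simp only: matrix_mul_rid matrix_add_rdistrib matrix_add_ldistrib mm_assoc add.assoc)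
  finally show ?thesis unfolding gg by (simp add: add_ac)
 qed
 have lam2: "blk 0 ((1 / y^2) *\<^sub>R n2' Z) 0 0 = Da**(lam Z + (\<delta> Z - bL ?n**\<delta>t Z**bLi ?n))**Da\<^sup>H" for Z
 proof -
  have r: "(r' Z)\<^sup>H = - (d2 Z**(r a)\<^sup>H)" by (simp add: prim ctrans_mult anti matrix_uminus_left)
  show ?thesis unfolding new1 n2'_def r unfolding prim lam_def Da_def
   by (simp add: blk_simps mm_ring blk_eq_iff scaleR_diff_right scaleR_add_right)
 qed
 have bet2: "blk 0 ((1 / x) *\<^sub>R w2' Z) 0 0 = ka\<^sup>H**(bet Z + (\<kappa> Z - bRi ?w**\<kappa> Z**bR ?w))**ka" for Z
 proof -
  have r: "(k1' Z)\<^sup>H = - ((k1 a)\<^sup>H**c1 Z)" by (simp add: prim ctrans_mult anti' matrix_uminus_right)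
  show ?thesis unfolding new2 w2'_def r unfolding prim bet_def ka_def
   by (simp add: blk_simps mm_ring blk_eq_iff scaleR_diff_right scaleR_add_right)
 qed
 have UL: "Unn (k_L g)" and UR: "Unn (k_R g)" using f by (auto simp: SUnn_iff)
 have "pull_symp F2 a X Y = pairing_wedge (%Z. lam Z + (\<delta> Z - bL ?n**\<delta>t Z**bLi ?n)) (%Z. \<delta> Z + (gam Z + g**\<kappa> Z**gi)) X Y
   + pairing_wedge (%Z. bet Z + (\<kappa> Z - bRi ?w**\<kappa> Z**bR ?w)) (%Z. \<kappa> Z + (gi**gam Z**g + gi**\<delta> Z**g)) X Y"
 proof -
  have s: "pull_symp F2 a X Y = pairing_wedge (%Z. Da**(lam Z + (\<delta> Z - bL ?n**\<delta>t Z**bLi ?n))**Da\<^sup>H) (%Z. Da**(\<delta> Z + (gam Z + g**\<kappa> Z**gi))**Da\<^sup>H) X Y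
    + pairing_wedge (%Z. ka\<^sup>H**(bet Z + (\<kappa> Z - bRi ?w**\<kappa> Z**bR ?w))**ka) (%Z. ka\<^sup>H**(\<kappa> Z + (gi**gam Z**g + gi**\<delta> Z**g))**ka) X Y"
   by (simp only: P2 gam2' lam2 bet2) (simp only: gam2)
  show ?thesis unfolding s by (simp only: pw_conj[OF DD(1)] pw_conj[OF DD(4)])
 qed
 also have "... = pairing_wedge lam gam X Y + pairing_wedge bet (%Z. gi**gam Z**g) X Y"
 proof (rule symp_gauge_algebra[where chi = "%Z. gam Z - g**bet Z**gi" and eta = "%Z. gi**gam Z**g - gi**lam Z**g"])
  show "g**gi = mat 1" "gi**g = mat 1" by (rule gg)+
  show "bL ?n**bLi ?n = mat 1" "bLi ?n**bL ?n = mat 1" by (rule bL_bLi)+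
  show "bR ?w**bRi ?w = mat 1" "bRi ?w**bR ?w = mat 1" by (rule bR_bRi)+
  show "gam Z = gam Z - g**bet Z**gi + g**bet Z**gi" for Z by simp
  show "unnL (gam Z - g**bet Z**gi)" for Z by (rule P1'(2))
  show "unnL (gi**gam Z**g - gi**lam Z**g)" for Z using P1'(3) by simp
  show "gam Z = lam Z + g**(gi**gam Z**g - gi**lam Z**g)**gi" for Z
  proof -
   have "g**(gi**gam Z**g - gi**lam Z**g)**gi = (g**gi)**gam Z**(g**gi) - (g**gi)**lam Z**(g**gi)"
    by (simp only: mm_ring)
   then show ?thesis by (simp add: gg)
  qed
  have inv: "Inn**(k_L g)\<^sup>H**Inn = bR ?w**gi" "Inn**(k_R g)\<^sup>H**Inn = gi**bL ?n"
  proof -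
   have "(Inn**(k_L g)\<^sup>H**Inn)**(k_L g**(bR ?w**gi)) = bR ?w**gi"
    by (simp only: mm_assoc Unn_left[OF UL] matrix_mul_lid)
   moreover have "k_L g**(bR ?w**gi) = mat 1" using f(7) gg by (simp add: mm_assoc)
   ultimately show "Inn**(k_L g)\<^sup>H**Inn = bR ?w**gi" by simp
   have "((gi**bL ?n)**k_R g)**(Inn**(k_R g)\<^sup>H**Inn) = gi**bL ?n"
    by (simp only: mm_assoc[symmetric, of _ "k_R g"] Unn_right[OF UR] matrix_mul_rid)
   moreover have "(gi**bL ?n)**k_R g = mat 1" using f(8) gg by (simp add: mm_assoc[symmetric])
   ultimately show "Inn**(k_R g)\<^sup>H**Inn = gi**bL ?n" by simp
  qed
  show "unnL (bLi ?n**g**M**gi**bL ?n)" if "unnL M" for M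
   using unnL_conj[OF UR that] unfolding inv unfolding f(4) by (simp only: mm_assoc)
  show "unnL (bR ?w**gi**M**g**bRi ?w)" if "unnL M" for M
  proof -
   have kk: "Inn**(Inn**(k_L g)\<^sup>H**Inn)\<^sup>H**Inn = k_L g"
   proof -
    have "Inn**(Inn**(k_L g)\<^sup>H**Inn)\<^sup>H**Inn = (Inn**Inn)**k_L g**(Inn**Inn)"
     by (simp only: ctrans_mult ctrans_ctrans ctrans_Inn mm_assoc)
    then show ?thesis by simp
   qed
   have "Unn (Inn**(k_L g)\<^sup>H**Inn)" using Unn_matrix_inv[OF UL] by (simp add: Unn_inv[OF UL])
   from unnL_conj[OF this that] show ?thesis unfolding kk unfolding inv unfolding f(3) by (simp only: mm_assoc)
  qed
  show "bsup (lam Z)" "bsup (bet Z)" "bsup (bLi ?n**lam Z**bL ?n)" "bsup (bR ?w**bet Z**bRi ?w)"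
   "bsup (\<delta> Z - bL ?n**\<delta>t Z**bLi ?n)" "bsup (\<kappa> Z - bRi ?w**\<kappa> Z**bR ?w)" for Z
   unfolding new1 new2 bsup_def by (simp_all add: lam_def bet_def bL_def bLi_def bR_def bRi_def blk_mult blk_eq_iff)
  show "bdiag (\<delta> Z)" "bdiag (\<delta>t Z)" "bdiag (\<kappa> Z)" "unnL (\<delta> Z)" "unnL (\<delta>t Z)" "unnL (\<kappa> Z)" for Z
   using anti anti' anti_t unfolding bdiag_def by (auto simp: \<delta>_def \<delta>t_def \<kappa>_def unnL_blk_diag)
 qed
 also have "... = pull_symp F1 a X Y" using P1'(1) by simp
 finally show ?thesis .
qed

end

subsection \<open>The two-form on the section\<close>

text \<open>Real matrices: the pairing, an imaginary part of a trace, vanishes on them.\<close>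

definition rl :: "complex ^ 'n ^ 'm => bool" where "rl A \<longleftrightarrow> (\<forall>i j. Im (A$i$j) = 0)"

lemma rl_mult: "rl A ==> rl B ==> rl (A**B)"
 by (simp add: rl_def matrix_mult_nth)
lemma rl_add: "rl A ==> rl B ==> rl (A + B)" by (simp add: rl_def)
lemma rl_diff: "rl A ==> rl B ==> rl (A - B)" by (simp add: rl_def)
lemma rl_scaleR: "rl A ==> rl (c *\<^sub>R A)" by (simp add: rl_def)
lemma rl_ctrans: "rl A ==> rl (A\<^sup>H)" by (simp add: rl_def)
lemma rl_dmat_cvec: "rl (dmat (cvec d))" by (simp add: rl_def)
lemma rl_of_real: "rl (map_matrix complex_of_real A)" by (simp add: rl_def)
lemmas rl_intros = rl_mult rl_add rl_diff rl_scaleR rl_ctrans rl_dmat_cvec rl_of_real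

lemma pw_rl: "(!!Z. rl (A Z)) ==> (!!Z. rl (B Z)) ==> pairing_wedge A B X Y = 0"
 for A :: "'a => 'k::finite cmat"
proof -
 have "rl M ==> rl N ==> pairing M N = 0" for M N :: "'k cmat"
  using rl_mult[of M N] by (simp add: pairing_def trace_def rl_def)
 then show "(!!Z. rl (A Z)) ==> (!!Z. rl (B Z)) ==> pairing_wedge A B X Y = 0"
  by (simp add: pairing_wedge_def)
qed

lemma rl_derivative:
 fixes M :: "'a::real_normed_vector => 'k::finite cmat"
 assumes U: "open U" "a \<in> U" and r: "!!u. u \<in> U ==> rl (M u)" and M: "(M has_derivative M') (at a)"
 shows "rl (M' Z)"
proof -
 have "Im (M' Z$i$j) = 0" for i j
 proof -
  have "((%u. Im (M u$i$j)) has_derivative (%Z. Im (M' Z$i$j))) (at a)"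
   by (intro bounded_linear.has_derivative[OF bounded_linear_Im] bounded_linear.has_derivative[OF bounded_linear_vec_nth] M)
  from has_derivative_const_on_open[OF U _ this, of 0] show ?thesis using r by (simp add: rl_def)
 qed
 then show ?thesis by (simp add: rl_def)
qed

text \<open>
 In the next lemma \<open>\<Omega> = E\<Omega>t\<close> with a diagonal unitary \<open>E\<close> and a real \<open>\<Omega>t\<close>; all terms containing \<open>l\<close>
 alone or \<open>dq\<close> alone are traces of real matrices or cancel in pairs.
\<close>

lemma section_algebra:
 fixes S Si G CI E Ot :: "'k::finite cmat" and Th p l Ot' :: "'a => 'k cmat" and x y :: real
 assumes xy: "x ~= 0" "y ~= 0"
  and SS: "S**Si = mat 1" "Si**S = mat 1" and EE: "E\<^sup>H**E = mat 1"
  and comm: "!!Z. Th Z**S = S**Th Z" "!!Z. Th Z**Si = Si**Th Z" "!!Z. Th Z**CI = CI**Th Z"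
   "Si**G = G**Si" "S**CI = CI**S" "Si**CI = CI**Si" "!!Z. Th Z**E = E**Th Z"
  and ct: "S\<^sup>H = S" "!!Z. (Th Z)\<^sup>H = Th Z" "!!Z. (p Z)\<^sup>H = p Z"
  and rl: "rl S" "rl Si" "rl G" "rl CI" "!!Z. rl (Th Z)" "!!Z. rl (p Z)" "!!Z. rl (l Z)" "rl Ot" "!!Z. rl (Ot' Z)"
 defines "Om \<equiv> E**Ot" and "Pp \<equiv> %Z. mat \<i>**p Z"
 defines "Om' \<equiv> %Z. E**(Pp Z**Ot + Ot' Z)"
 defines "Yf \<equiv> %Z. Om' Z - Th Z**Om"
 defines "w' \<equiv> %Z. Si**Yf Z + (1 / x) *\<^sub>R (Si**Th Z**CI)"
 defines "nn \<equiv> Si**(y^2 *\<^sub>R G - (1 / x) *\<^sub>R Om\<^sup>H)"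
 defines "nn' \<equiv> %Z. - (Si**(y^2 *\<^sub>R (Th Z**CI) + (1 / x) *\<^sub>R (Om' Z - Om**Th Z)\<^sup>H))"
 defines "BR \<equiv> %Z. (Ot' Z - Th Z**Ot)**Ot\<^sup>H + Ot**(Ot' Z - Ot**Th Z)\<^sup>H + Ot**(S**l Z**Si)**Ot\<^sup>H"
 shows "(1 / y^2) * pairing_wedge (%Z. l Z**nn + nn' Z) (%Z. - (x *\<^sub>R (Yf Z**S))) X Y
   + x * pairing_wedge w' (%Z. CI**Th Z**S - S**l Z**G) X Y = - (1 / y^2) * pairing_wedge Pp BR X Y"
proof -
 let ?W = "%a b. pairing_wedge a b X Y"
 have moveSi: "?W (%Z. Si**A Z) (%Z. B Z**S) = ?W A B" for A B :: "'a => 'k cmat"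
  unfolding pw_move_left by (simp add: mm_assoc[symmetric] SS)
 have moveSi': "?W (%Z. Si**A Z) (%Z. S**B Z) = ?W A (%Z. S**B Z**Si)" for A B :: "'a => 'k cmat"
  by (rule pw_move_left)
 have n1: "?W nn' (%Z. - (x *\<^sub>R (Yf Z**S))) = x * y^2 * ?W (%Z. Th Z**CI) Yf + ?W (%Z. (Om' Z - Om**Th Z)\<^sup>H) Yf"
 proof -
  have "?W nn' (%Z. - (x *\<^sub>R (Yf Z**S))) = x * ?W (%Z. Si**(y^2 *\<^sub>R (Th Z**CI) + (1 / x) *\<^sub>R (Om' Z - Om**Th Z)\<^sup>H)) (%Z. Yf Z**S)"
   unfolding nn'_def by (simp only: pw_uminus_left pw_uminus_right pw_scaleR_right minus_minus)
  also have "... = x * (y^2 * ?W (%Z. Th Z**CI) Yf + (1 / x) * ?W (%Z. (Om' Z - Om**Th Z)\<^sup>H) Yf)"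
   unfolding moveSi by (simp only: pw_add_left pw_scaleR_left)
  finally show ?thesis using xy by (simp add: algebra_simps)
 qed
 have w1: "?W w' (%Z. CI**Th Z**S) = - ?W (%Z. Th Z**CI) Yf"
 proof -
  have r: "?W (%Z. Si**Th Z**CI) (%Z. CI**Th Z**S) = 0" by (intro pw_rl rl_intros rl)
  have "?W w' (%Z. CI**Th Z**S) = ?W (%Z. Si**Yf Z) (%Z. (CI**Th Z)**S)"
   unfolding w'_def pw_add_left pw_scaleR_left r by simp
  also have "... = ?W Yf (%Z. Th Z**CI)" unfolding moveSi comm(3) ..
  finally show ?thesis using pw_swap by metis
 qed
 have l1: "?W (%Z. l Z**nn) (%Z. - (x *\<^sub>R (Yf Z**S))) = - x * y^2 * ?W l (%Z. G**Si**Yf Z**S) + ?W (%Z. S**l Z**Si**Om\<^sup>H) Yf"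
 proof -
  have e: "l Z**nn = y^2 *\<^sub>R (l Z**(G**Si)) - (1 / x) *\<^sub>R (l Z**Si**Om\<^sup>H)" for Z
   by (simp add: nn_def mm_ring) (simp add: mm_assoc[symmetric] comm(4))
  have "?W (%Z. l Z**nn) (%Z. - (x *\<^sub>R (Yf Z**S))) = - x * (y^2 * ?W (%Z. l Z**(G**Si)) (%Z. Yf Z**S) - (1 / x) * ?W (%Z. l Z**Si**Om\<^sup>H) (%Z. Yf Z**S))"
   unfolding e by (simp only: pw_uminus_right pw_scaleR_right pw_diff_left pw_scaleR_left)
  also have "?W (%Z. l Z**(G**Si)) (%Z. Yf Z**S) = ?W l (%Z. G**Si**Yf Z**S)"
   unfolding pw_move_right by (simp only: mm_assoc)
  also have "?W (%Z. l Z**Si**Om\<^sup>H) (%Z. Yf Z**S) = ?W (%Z. S**(l Z**Si**Om\<^sup>H)) Yf"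
   by (rule pw_move_left[symmetric])
  finally show ?thesis using xy by (simp add: mm_assoc algebra_simps)
 qed
 have l2: "?W w' (%Z. S**l Z**G) = - ?W l (%Z. G**Si**Yf Z**S)"
 proof -
  have r: "?W (%Z. Si**Th Z**CI) (%Z. S**l Z**G) = 0" by (intro pw_rl rl_intros rl)
  have "?W w' (%Z. S**l Z**G) = ?W (%Z. Si**Yf Z) (%Z. S**l Z**G)"
   unfolding w'_def pw_add_left pw_scaleR_left r by simp
  also have "... = - ?W (%Z. S**l Z**G) (%Z. Si**Yf Z)" by (rule pw_swap)
  also have "?W (%Z. S**l Z**G) (%Z. Si**Yf Z) = ?W l (%Z. G**Si**Yf Z**S)"
   unfolding pw_conj_move by (simp only: mm_assoc)
  finally show ?thesis .
 qed
 \<comment> \<open>The dq parts of the two pairings cancel each other, and so do the parts with l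
   and cosh. What survives is the pairing of the terms in \<Omega>^H with \<open>Yf\<close>.\<close>
 have tot: "(1 / y^2) * ?W (%Z. l Z**nn + nn' Z) (%Z. - (x *\<^sub>R (Yf Z**S)))
   + x * ?W w' (%Z. CI**Th Z**S - S**l Z**G)
   = (1 / y^2) * (?W (%Z. (Om' Z - Om**Th Z)\<^sup>H) Yf + ?W (%Z. S**l Z**Si**Om\<^sup>H) Yf)"
  unfolding pw_add_left pw_diff_right n1 w1 l1 l2 using xy by (simp add: field_simps)
 define Yr where "Yr Z = Ot' Z - Th Z**Ot" for Z
 define Vr where "Vr Z = Ot' Z - Ot**Th Z" for Z
 have Yf: "Yf Z = E**(Pp Z**Ot + Yr Z)" for Z
  by (simp add: Yf_def Om'_def Om_def Yr_def mm_ring comm(7))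
 have pim: "(Pp Z)\<^sup>H = - Pp Z" for Z
 proof -
  have "(Pp Z)\<^sup>H = p Z**mat (cnj \<i>)" by (simp add: Pp_def ctrans_mult ct)
  also have "... = - Pp Z" by (simp add: Pp_def mat_mult_left mat_mult_right vec_eq_iff)
  finally show ?thesis .
 qed
 have V: "(Om' Z - Om**Th Z)\<^sup>H = (- (Ot\<^sup>H**Pp Z) + (Vr Z)\<^sup>H)**E\<^sup>H" for Z
 proof -
  have "Om' Z - Om**Th Z = E**(Pp Z**Ot + Vr Z)"
   by (simp add: Om'_def Om_def Vr_def mm_ring)
  then show ?thesis by (simp add: ctrans_simps pim matrix_uminus_right)
 qed
 \<comment> \<open>The phases of \<Omega> meet as E^H E and disappear. Everything left is real
   except \<open>Pp\<close>, so only the terms with exactly one \<open>Pp\<close>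
   contribute.\<close>
 have cancelE: "?W (%Z. A Z**E\<^sup>H) (%Z. E**B Z) = ?W A B" for A B :: "'a => 'k cmat"
  unfolding pw_move_right by (simp add: mm_assoc EE)
 have "?W (%Z. (Om' Z - Om**Th Z)\<^sup>H) Yf + ?W (%Z. S**l Z**Si**Om\<^sup>H) Yf
   = ?W (%Z. - (Ot\<^sup>H**Pp Z) + (Vr Z)\<^sup>H) (%Z. Pp Z**Ot + Yr Z) + ?W (%Z. S**l Z**Si**Ot\<^sup>H) (%Z. Pp Z**Ot + Yr Z)"
 proof -
  have "S**l Z**Si**Om\<^sup>H = (S**l Z**Si**Ot\<^sup>H)**E\<^sup>H" for Z by (simp add: Om_def ctrans_mult mm_assoc)
  then show ?thesis unfolding V Yf by (simp only: cancelE)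
 qed
 also have "... = - ?W Pp (%Z. Yr Z**Ot\<^sup>H) - ?W Pp (%Z. Ot**(Vr Z)\<^sup>H) - ?W Pp (%Z. Ot**(S**l Z**Si)**Ot\<^sup>H)"
 proof -
  have r: "?W (%Z. (Vr Z)\<^sup>H) Yr = 0" "?W (%Z. S**l Z**Si**Ot\<^sup>H) Yr = 0"
   unfolding Vr_def Yr_def by (intro pw_rl rl_intros rl)+
  have pp: "?W (%Z. Ot\<^sup>H**Pp Z) (%Z. Pp Z**Ot) = 0"
  proof -
   have "trace (Ot\<^sup>H**Pp Z**(Pp Z'**Ot)) = - trace (Ot\<^sup>H**p Z**p Z'**Ot)" for Z Z'
   proof -
    have "Ot\<^sup>H**(mat \<i>**p Z)**(mat \<i>**p Z'**Ot) = mat \<i>**(mat \<i>**(Ot\<^sup>H**p Z**p Z'**Ot))"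
     by (simp only: mm_assoc mat_mult_commute[of "Ot\<^sup>H"] mat_mult_commute[of "mat \<i>**Ot\<^sup>H**p Z"])
    also have "... = - (Ot\<^sup>H**p Z**p Z'**Ot)" by (simp add: mat_mult_left vec_eq_iff mult.assoc[symmetric])
    finally show ?thesis by (simp add: Pp_def trace_uminus)
   qed
   moreover have "Im (trace (Ot\<^sup>H**p Z**p Z'**Ot)) = 0" for Z Z'
   proof -
    have "rl (Ot\<^sup>H**p Z**p Z'**Ot)" by (intro rl_intros rl)
    then show ?thesis by (simp add: rl_def trace_def)
   qed
   ultimately show ?thesis by (simp add: pairing_wedge_def pairing_def)
  qed
  have a: "?W (%Z. Ot\<^sup>H**Pp Z) Yr = ?W Pp (%Z. Yr Z**Ot\<^sup>H)" by (rule pw_move_left)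
  have b: "?W A (%Z. Pp Z**Ot) = - ?W Pp (%Z. Ot**A Z)" for A
   unfolding pw_swap[of A] by (simp only: pw_move_right)
  show ?thesis unfolding pw_add_left pw_add_right pw_uminus_left r pp a b by (simp add: mm_assoc)
 qed
 also have "... = - ?W Pp BR" unfolding BR_def Yr_def[symmetric] Vr_def[symmetric] pw_add_right by simp
 finally have "?W (%Z. (Om' Z - Om**Th Z)\<^sup>H) Yf + ?W (%Z. S**l Z**Si**Om\<^sup>H) Yf = - ?W Pp BR" .
 then show ?thesis unfolding tot by simp
qed

lemma pw_i_diag:
 fixes d :: "'a => ('k::finite) rvec" and B :: "'a => 'k cmat"
 shows "pairing_wedge (%Z. mat \<i>**dmat (cvec (d Z))) B X Y =
  (\<Sum>i\<in>UNIV. d X$i * Re (B Y$i$i) - d Y$i * Re (B X$i$i))"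
proof -
 have "trace (mat \<i>**dmat (cvec (d Z))**M) = (\<Sum>i\<in>UNIV. \<i> * (of_real (d Z$i) * M$i$i))" for Z M
  by (simp add: trace_def mm_assoc[symmetric]) (simp add: mat_mult_left dmat_mult_left)
 then show ?thesis by (simp add: pairing_wedge_def pairing_def sum_subtractf)
qed

section \<open>Derivatives along the section\<close>

context reduction begin

lemma dmat_cvec_has_derivative:
 fixes d :: "'a::real_normed_vector => 'n rvec"
 assumes "!!i. ((%u. d u$i) has_derivative (%Z. d' Z$i)) (at a)"
 shows "((%u. dmat (cvec (d u))) has_derivative (%Z. dmat (cvec (d' Z)))) (at a)"
proof -
 have e: "dmat (cvec v) = (\<Sum>i\<in>UNIV. (v$i) *\<^sub>R dmat (cvec (axis i 1)))" for v :: "'n rvec"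
 proof -
  have "(\<Sum>k\<in>UNIV. (v$k) *\<^sub>R dmat (cvec (axis k 1)) :: 'n cmat)$i$j = dmat (cvec v)$i$j" for i j
  proof -
   have "(\<Sum>k\<in>UNIV. (v$k) *\<^sub>R dmat (cvec (axis k 1)) :: 'n cmat)$i$j
     = (\<Sum>k\<in>UNIV. if i = k then of_real (if i = j then v$i else 0) else 0)"
    by (simp only: sum_component) (rule sum.cong, simp_all add: axis_def scaleR_conv_of_real[where 'a=complex])
   then show ?thesis by simp
  qed
  then show ?thesis by (simp add: vec_eq_iff)
 qed
 have "((%u. \<Sum>i\<in>UNIV. (d u$i) *\<^sub>R dmat (cvec (axis i 1)) :: 'n cmat) has_derivative (%Z. \<Sum>i\<in>UNIV. (d' Z$i) *\<^sub>R dmat (cvec (axis i 1)))) (at a)"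
  by (intro has_derivative_sum has_derivative_scaleR_left assms)
 then show ?thesis unfolding e[symmetric] .
qed

text \<open>With sinh = e^q, d sinh = sinh dq and d cosh = (sinh^2/cosh) dq = (cosh - 1/cosh) dq; in
  the last form the cosh part cancels against d sinh when blocks are combined.\<close>

lemma hyperbolic_has_derivative:
 fixes Q :: "'a::real_normed_vector => 'n rvec"
 assumes Q: "(Q has_derivative Q') (at a)"
 defines "S \<equiv> Sinh (Dl (Q a))" and "Gm \<equiv> Cosh (Dl (Q a))" and "Si \<equiv> SinhI (Dl (Q a))" and "CI \<equiv> CoshI (Dl (Q a))"
  and "Th \<equiv> %Z. dmat (cvec (Q' Z))"
 shows "((%u. Sinh (Dl (Q u))) has_derivative (%Z. S**Th Z)) (at a)"
  "((%u. SinhI (Dl (Q u))) has_derivative (%Z. - (Si**Th Z))) (at a)"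
  "((%u. Cosh (Dl (Q u))) has_derivative (%Z. Gm**Th Z - CI**Th Z)) (at a)"
proof -
 have Qi: "((%u. Q u$i) has_derivative (%Z. Q' Z$i)) (at a)" for i
  by (rule bounded_linear.has_derivative[OF bounded_linear_vec_nth Q])
 have chain: "((%u. f (Q u$i)) has_derivative (%Z. D * Q' Z$i)) (at a)"
  if "(f has_real_derivative D) (at (Q a$i))" for f D i
  using has_derivative_compose[OF Qi that[unfolded has_field_derivative_def]] .
 have "((%u. dmat (cvec (\<chi> i. exp (Q u$i)))) has_derivative (%Z. dmat (cvec (\<chi> i. exp (Q a$i) * Q' Z$i)))) (at a)"
  by (intro dmat_cvec_has_derivative) (simp add: chain[OF DERIV_exp])
 then show "((%u. Sinh (Dl (Q u))) has_derivative (%Z. S**Th Z)) (at a)"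
  unfolding Sinh_Dl S_def Th_def dmat_mult_dmat by (rule has_derivative_eq_rhs) (simp add: fun_eq_iff vec_eq_iff)
 have "((%u. dmat (cvec (\<chi> i. inverse (exp (Q u$i))))) has_derivative (%Z. dmat (cvec (\<chi> i. - inverse (exp (Q a$i)) * Q' Z$i)))) (at a)"
 proof (intro dmat_cvec_has_derivative)
  fix i
  have "((%t. inverse (exp t)) has_real_derivative - inverse (exp (Q a$i))) (at (Q a$i))"
   by (auto intro!: derivative_eq_intros simp: power2_eq_square)
  from chain[OF this] show "((%u. (\<chi> i. inverse (exp (Q u$i)))$i) has_derivative (%Z. (\<chi> i. - inverse (exp (Q a$i)) * Q' Z$i)$i)) (at a)" by simp
 qed
 then show "((%u. SinhI (Dl (Q u))) has_derivative (%Z. - (Si**Th Z))) (at a)"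
  unfolding SinhI_Dl Si_def Th_def dmat_mult_dmat by (rule has_derivative_eq_rhs) (simp add: fun_eq_iff vec_eq_iff)
 let ?r = "%t. sqrt (1 + (exp t)^2)"
 have "((%u. dmat (cvec (\<chi> i. ?r (Q u$i)))) has_derivative (%Z. dmat (cvec (\<chi> i. (?r (Q a$i) - inverse (?r (Q a$i))) * Q' Z$i)))) (at a)"
 proof (intro dmat_cvec_has_derivative)
  fix i
  let ?t = "Q a$i"
  have p: "0 < 1 + (exp ?t)^2" by (simp add: add_pos_nonneg)
  have "(?r has_real_derivative (2 * (exp ?t * exp ?t)) * (inverse (?r ?t) / 2)) (at ?t)"
   using p by (auto intro!: derivative_eq_intros)
  moreover have "(2 * (exp ?t * exp ?t)) * (inverse (?r ?t) / 2) = ?r ?t - inverse (?r ?t)"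
  proof -
   have "?r ?t * ?r ?t = 1 + exp ?t * exp ?t" using p by (simp add: power2_eq_square)
   then show ?thesis using p by (simp add: field_simps)
  qed
  ultimately have "(?r has_real_derivative (?r ?t - inverse (?r ?t))) (at ?t)" by simp
  from chain[OF this] show "((%u. (\<chi> i. ?r (Q u$i))$i) has_derivative (%Z. (\<chi> i. (?r (Q a$i) - inverse (?r (Q a$i))) * Q' Z$i)$i)) (at a)" by simp
 qed
 then show "((%u. Cosh (Dl (Q u))) has_derivative (%Z. Gm**Th Z - CI**Th Z)) (at a)"
  unfolding Cosh_Dl CoshI_Dl Gm_def CI_def Th_def dmat_mult_dmat
  by (rule has_derivative_eq_rhs) (auto simp: fun_eq_iff vec_eq_iff left_diff_distrib)
qed

lemma exp_i_has_derivative: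
 fixes P :: "'a::real_normed_vector => 'n rvec"
 assumes P: "(P has_derivative P') (at a)"
 shows "((%u. exp_i (P u)) has_derivative (%Z. exp_i (P a)**(mat \<i>**dmat (cvec (P' Z))))) (at a)"
proof -
 have e: "exp_i p = dmat (cvec (\<chi> i. cos (p$i))) + mat \<i>**dmat (cvec (\<chi> i. sin (p$i)))" for p :: "'n rvec"
  by (simp add: exp_i_def vec_eq_iff mat_mult_left cis_conv_exp[symmetric] complex_eq_iff)
 have Pi: "((%u. P u$i) has_derivative (%Z. P' Z$i)) (at a)" for i
  by (rule bounded_linear.has_derivative[OF bounded_linear_vec_nth P])
 have chain: "((%u. f (P u$i)) has_derivative (%Z. D * P' Z$i)) (at a)"
  if "(f has_real_derivative D) (at (P a$i))" for f D i
  using has_derivative_compose[OF Pi that[unfolded has_field_derivative_def]] .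
 have c: "((%u. dmat (cvec (\<chi> i. cos (P u$i)))) has_derivative (%Z. dmat (cvec (\<chi> i. - sin (P a$i) * P' Z$i)))) (at a)"
  by (intro dmat_cvec_has_derivative) (simp only: vec_lambda_beta chain[OF DERIV_cos])
 have s: "((%u. dmat (cvec (\<chi> i. sin (P u$i)))) has_derivative (%Z. dmat (cvec (\<chi> i. cos (P a$i) * P' Z$i)))) (at a)"
  by (intro dmat_cvec_has_derivative) (simp only: vec_lambda_beta chain[OF DERIV_sin])
 have "((%u. dmat (cvec (\<chi> i. cos (P u$i))) + mat \<i>**dmat (cvec (\<chi> i. sin (P u$i)))) has_derivative
   (%Z. dmat (cvec (\<chi> i. - sin (P a$i) * P' Z$i)) + (mat \<i>**dmat (cvec (\<chi> i. cos (P a$i) * P' Z$i)) + 0**dmat (cvec (\<chi> i. sin (P a$i)))))) (at a)"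
  by (intro has_derivative_add matrix_mult_has_derivative has_derivative_const c s)
 moreover have "dmat (cvec (\<chi> i. - sin (P a$i) * P' Z$i)) + (mat \<i>**dmat (cvec (\<chi> i. cos (P a$i) * P' Z$i)) + 0**dmat (cvec (\<chi> i. sin (P a$i))))
   = exp_i (P a)**(mat \<i>**dmat (cvec (P' Z)))" for Z
 proof -
  have m: "mat \<i>**dmat (cvec (P' Z)) = dmat (\<chi> i. \<i> * of_real (P' Z$i))" by (simp add: mat_mult_left vec_eq_iff)
  show ?thesis unfolding m exp_i_def dmat_mult_dmat
   by (simp add: vec_eq_iff mat_mult_left cis_conv_exp[symmetric] complex_eq_iff)
 qed
 ultimately show ?thesis unfolding e[symmetric] by simp
qed

lemma has_derivative_unique_open:
 assumes "open U" "a \<in> U" "!!u. u \<in> U ==> f u = g u" "(f has_derivative f') (at a)" "(g has_derivative g') (at a)"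
 shows "f' = g'"
 using has_derivative_unique[OF assms(4) has_derivative_transform_within_open[OF assms(5,1,2)]] assms(3) by metis

text \<open>First order perturbation theory. Differentiating T W = S^2 T and multiplying by T^H
  leaves a commutator with S^2, whose diagonal vanishes, so the diagonal of T (Th - m) T^H has real
  part t. The derivative of \<Omega>\<Omega>^H = y^2 + x^2 S^2 supplies the rest: 2 x^2 s^2 t - 2
  L^2 t = -2 y^2 t.\<close>

lemma BR_diagonal:
 fixes L :: "'n rvec" and S T T' m W Th Ot' :: "'n cmat"
 assumes S: "S = dmat (cvec s)" "!!i. s$i ~= 0" and Th: "Th = dmat (cvec t)" and T: "unitary T"
  and W: "T**W = S**S**T" "W**T\<^sup>H = T\<^sup>H**(S**S)"
  and dW: "T'**W + T**((Th - m)**W + W**(Th - m)\<^sup>H) = S**S**T' + 2 *\<^sub>R (S**S**Th**T)"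
  and Ot: "Ot = dmat (cvec L)**T" and L: "!!i. (L$i)^2 = y^2 + x^2 * (s$i)^2"
  and dO: "Ot**Ot'\<^sup>H + Ot'**Ot\<^sup>H = (2 * x^2) *\<^sub>R (S**S**Th)"
 shows "Re (((Ot' - Th**Ot)**Ot\<^sup>H + Ot**(Ot' - Ot**Th)\<^sup>H + Ot**m**Ot\<^sup>H)$i$i) = - 2 * y^2 * t$i"
proof -
 define N where "N = T**(Th - m)**T\<^sup>H"
 have N: "Re (N$i$i) = t$i"
 proof -
  have "(T'**W + T**((Th - m)**W + W**(Th - m)\<^sup>H))**T\<^sup>H
    = T'**(W**T\<^sup>H) + T**(Th - m)**(W**T\<^sup>H) + (T**W)**(Th - m)\<^sup>H**T\<^sup>H"
   by (simp add: mm_ring add.assoc)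
  also have "... = (T'**T\<^sup>H)**(S**S) + N**(S**S) + (S**S)**N\<^sup>H"
   unfolding W by (simp add: N_def ctrans_mult mm_assoc)
  finally have e: "(T'**T\<^sup>H)**(S**S) + N**(S**S) + (S**S)**N\<^sup>H = (S**S**T' + 2 *\<^sub>R (S**S**Th**T))**T\<^sup>H"
   unfolding dW by simp
  also have "... = (S**S)**(T'**T\<^sup>H) + 2 *\<^sub>R (S**S**Th)"
   by (simp add: matrix_add_rdistrib matrix_scaleR_left) (simp add: mm_assoc[symmetric] unitaryD T)
  finally have e: "(T'**T\<^sup>H)**(S**S) + N**(S**S) + (S**S)**N\<^sup>H = (S**S)**(T'**T\<^sup>H) + 2 *\<^sub>R (S**S**Th)" .
  have "((T'**T\<^sup>H)**(S**S) + N**(S**S) + (S**S)**N\<^sup>H)$i$i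
    = (T'**T\<^sup>H)$i$i * of_real ((s$i)^2) + of_real ((s$i)^2) * (N$i$i + cnj (N$i$i))"
   unfolding S dmat_mult_dmat by (simp add: dmat_mult_left dmat_mult_right power2_eq_square algebra_simps)
  moreover have "((S**S)**(T'**T\<^sup>H) + 2 *\<^sub>R (S**S**Th))$i$i
    = (T'**T\<^sup>H)$i$i * of_real ((s$i)^2) + of_real ((s$i)^2) * of_real (2 * t$i)"
   unfolding S Th dmat_mult_dmat by (simp add: dmat_mult_left dmat_mult_right power2_eq_square scaleR_conv_of_real algebra_simps)
  ultimately have "complex_of_real ((s$i)^2) * (N$i$i + cnj (N$i$i)) = of_real ((s$i)^2) * of_real (2 * t$i)"
   using arg_cong[OF e, of "%M. M$i$i"] by simp
  then have "N$i$i + cnj (N$i$i) = of_real (2 * t$i)" using S(2)[of i] by simp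
  then show ?thesis by (simp add: complex_eq_iff)
 qed
 have OT: "Ot**Th**Ot\<^sup>H - Ot**m**Ot\<^sup>H = dmat (cvec L)**N**dmat (cvec L)"
  by (simp add: Ot N_def ctrans_mult mm_ring)
 have OO: "Ot**Ot\<^sup>H = dmat (cvec L)**dmat (cvec L)"
  unfolding Ot by (simp add: ctrans_mult mm_assoc) (simp add: mm_assoc[symmetric] unitaryD T)
 have "(Ot' - Th**Ot)**Ot\<^sup>H + Ot**(Ot' - Ot**Th)\<^sup>H + Ot**m**Ot\<^sup>H
   = (Ot**Ot'\<^sup>H + Ot'**Ot\<^sup>H) - Th**(Ot**Ot\<^sup>H) - (Ot**Th**Ot\<^sup>H - Ot**m**Ot\<^sup>H)"
  by (simp add: ctrans_simps mm_ring Th)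
 also have "... = (2 * x^2) *\<^sub>R (S**S**Th) - Th**(dmat (cvec L)**dmat (cvec L)) - dmat (cvec L)**N**dmat (cvec L)"
  unfolding dO OT OO ..
 also have "Re (...$i$i) = 2 * x^2 * (s$i)^2 * t$i - t$i * (L$i)^2 - (L$i)\<^sup>2 * Re (N$i$i)"
  unfolding S Th dmat_mult_dmat by (simp add: dmat_mult_left dmat_mult_right power2_eq_square algebra_simps)
 also have "... = - 2 * y^2 * t$i" unfolding N L by (simp add: algebra_simps)
 finally show ?thesis .
qed

text \<open>Lower right block of k_L, recovered from g = k_L b_R: the left blocks of g are x times
  those of k_L.\<close>

definition K22F :: "'n bmat => 'n cmat" where "K22F g = x *\<^sub>R blk22 g - blk21 g**wF g"

lemma sectionN_blocks:
 fixes p :: "'n rvec"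
 assumes b: "base_frame \<rho> z" and q: "q \<in> region \<alpha>"
 defines "F \<equiv> sectionN \<rho> z q p"
 shows "F \<in> C" "blk11 F = x *\<^sub>R (rhoN \<rho> z q**Cosh (Dl q))" "blk21 F = x *\<^sub>R Sinh (Dl q)"
  "blk22 F = Lam x y (Dl q)**TN q p (vN q)" "K22F F = Cosh (Dl q)"
  "wF F = wN (Dl q) (TN q p (vN q))" "nF F = nN (rhoN \<rho> z q) (Dl q) (TN q p (vN q))" "k_L F = kN (rhoN \<rho> z q) (Dl q)"
proof -
 note D = Dl_chamber[OF q]
 let ?T = "TN q p (vN q)" and ?r = "rhoN \<rho> z q"
 have nd: "normal_data \<sigma> ?r (Dl q) ?T" using sectionN_coords(2)[OF b q] .
 note N = normal_form_constrained[OF nd rhoN_props(2)[OF b q]]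
 have e: "F = NF ?r (Dl q) ?T" by (simp add: F_def sectionN_def)
 show C: "F \<in> C" using N e by simp
 have Fe: "F = kN ?r (Dl q)**bR (wN (Dl q) ?T)" using normal_form_eq[OF D] e by simp
 show Fw: "wF F = wN (Dl q) ?T" using constrained_factors(1)[OF C] N(3) e by (simp add: bR_def blk_eq_iff)
 show "nF F = nN ?r (Dl q) ?T" using constrained_factors(2)[OF C] N(4) e y_pos by (simp add: bL_def blk_eq_iff)
 show "k_L F = kN ?r (Dl q)" using N(2) e by simp
 have Sw: "Sinh (Dl q)**wN (Dl q) ?T = Lam x y (Dl q)**?T - (1 / x) *\<^sub>R Cosh (Dl q)"
  using Sinh_SinhI[OF D] by (simp add: mm_assoc)
 show 2: "blk11 F = x *\<^sub>R (?r**Cosh (Dl q))" "blk21 F = x *\<^sub>R Sinh (Dl q)" "blk22 F = Lam x y (Dl q)**?T"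
  unfolding Fe using Sw by (simp_all add: Hyp_def bR_def blk_mult smat_eq matrix_scaleR_right)
 show "K22F F = Cosh (Dl q)"
  unfolding K22F_def 2 Fw matrix_scaleR_left Sw using x_pos by (simp add: scaleR_diff_right)
qed

text \<open>As \<rho> is a constant unitary times a real matrix H, the form \<rho>^H d\<rho> = H^H
  dH is real and \<open>section_algebra\<close> applies. It pairs dp with the diagonal of
  \<open>BR\<close>, whose real part is -2 y^2 dq, and the factor -1/y^2 turns this into twice dp
  wedge dq.\<close>

lemma pull_symp_section:
 fixes Q P :: "'a::real_normed_vector => 'n rvec"
 assumes Q: "(Q has_derivative Q') (at a)" and P: "(P has_derivative P') (at a)"
  and U: "open U" "a \<in> U" and reg: "!!u. u \<in> U ==> Q u \<in> region \<alpha>" and b: "base_frame \<rho>0 z"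
 shows "pull_symp (%u. sectionN \<rho>0 z (Q u) (P u)) a X Y = 2 * (\<Sum>i\<in>UNIV. P' X$i * Q' Y$i - P' Y$i * Q' X$i)"
proof -
 define F where "F u = sectionN \<rho>0 z (Q u) (P u)" for u
 define D where "D u = Dl (Q u)" for u
 define \<rho> where "\<rho> u = rhoN \<rho>0 z (Q u)" for u
 define T where "T u = TN (Q u) (P u) (vN (Q u))" for u
 define Tt where "Tt u = map_matrix complex_of_real (T_tilde \<alpha> (eq (Q u)) (vN (Q u)))" for u
 define H where "H u = map_matrix complex_of_real (hh (uN (Q u)) z)" for u
 have Qd: "Q differentiable at a" and Pd: "P differentiable at a" using Q P unfolding differentiable_def by blast+
 note ctxt = Qd U reg
 have D: "D u \<in> chamber" if "u \<in> U" for u using Dl_chamber[OF reg[OF that]] by (simp add: D_def)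
 have r: "unitary (\<rho> u)" "det (\<rho> u) = 1" if "u \<in> U" for u using rhoN_props[OF b reg[OF that]] by (simp_all add: \<rho>_def)
 have nd: "normal_data \<sigma> (\<rho> u) (D u) (T u)" if "u \<in> U" for u
  using sectionN_coords(2)[OF b reg[OF that], of "P u"] by (simp add: \<rho>_def D_def T_def)
 have Fb: "F u \<in> C" "wF (F u) = wN (D u) (T u)" "nF (F u) = nN (\<rho> u) (D u) (T u)" "k_L (F u) = kN (\<rho> u) (D u)"
  "blk11 (F u) = x *\<^sub>R (\<rho> u**Cosh (D u))" "blk21 (F u) = x *\<^sub>R Sinh (D u)" "blk22 (F u) = Lam x y (D u)**T u" if "u \<in> U" for u
  using sectionN_blocks[OF b reg[OF that], of "P u"] by (simp_all add: F_def D_def \<rho>_def T_def)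
 note FC = Fb(1) and Fw = Fb(2) and Fn = Fb(3) and Fk = Fb(4)
 have SI: "Sinh (D a)**SinhI (D a) = mat 1" "SinhI (D a)**Sinh (D a) = mat 1" using Sinh_SinhI D U by auto
 obtain F' w' n' where F': "(F has_derivative F') (at a)" and w'0: "((%u. wN (D u) (T u)) has_derivative w') (at a)"
  and n'0: "((%u. nN (\<rho> u) (D u) (T u)) has_derivative n') (at a)"
  using section_parts_differentiable(2,3,4)[OF ctxt b Pd] unfolding F_def \<rho>_def D_def T_def differentiable_def by blast
 have w': "((%u. wF (F u)) has_derivative w') (at a)" using has_derivative_transform_within_open[OF w'0 U] Fw by simp
 have n': "((%u. nF (F u)) has_derivative n') (at a)" using has_derivative_transform_within_open[OF n'0 U] Fn by simp
 have "(%u. H u) differentiable at a"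
  unfolding H_def by (rule matrix_differentiableI) (simp add: of_real_differentiable hh_differentiable[OF ctxt b])
 then obtain H' where H': "(H has_derivative H') (at a)" unfolding differentiable_def by auto
 have "(%u. Tt u) differentiable at a"
  unfolding Tt_def by (rule matrix_differentiableI) (simp add: of_real_differentiable T_tilde_differentiable[OF ctxt])
 then obtain T' where T': "(Tt has_derivative T') (at a)" unfolding differentiable_def by auto
 have "(%u. Lam x y (D u)) differentiable at a" unfolding D_def by (rule hyperbolic_differentiable(5)[OF ctxt])
 then obtain L' where L': "((%u. Lam x y (D u)) has_derivative L') (at a)" unfolding differentiable_def by auto
 define S Si Gm CI E where "S = Sinh (D a)" and "Si = SinhI (D a)" and "Gm = Cosh (D a)" and "CI = CoshI (D a)" and "E = exp_i (P a)"
 define Th p where "Th Z = dmat (cvec (Q' Z))" and "p Z = dmat (cvec (P' Z))" for Z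
 note hyp = hyperbolic_has_derivative[OF Q, folded D_def, folded S_def Si_def Gm_def CI_def, folded Th_def]
 note ex = exp_i_has_derivative[OF P, folded E_def, folded p_def]
 define Ot where "Ot = Lam x y (D a)**Tt a"
 define Ot' where "Ot' Z = Lam x y (D a)**T' Z + L' Z**Tt a" for Z
 have Ot': "((%u. Lam x y (D u)**Tt u) has_derivative Ot') (at a)"
  unfolding Ot'_def by (rule matrix_mult_has_derivative[OF L' T'])
 have LamE: "Lam x y Delta**exp_i q = exp_i q**Lam x y Delta" for Delta and q :: "'n rvec"
  by (simp add: Lam_def exp_i_def dmat_mult_commute)
 have LT: "Lam x y (D u)**T u = exp_i (P u)**(Lam x y (D u)**Tt u)" for u
  unfolding T_def TN_def Tt_def[symmetric] by (simp only: mm_assoc LamE)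
 define Om where "Om = E**Ot"
 define Om' where "Om' Z = E**(mat \<i>**p Z**Ot + Ot' Z)" for Z
 have Om: "Lam x y (D a)**T a = Om" by (simp add: LT Om_def E_def Ot_def)
 have Om': "((%u. Lam x y (D u)**T u) has_derivative Om') (at a)"
 proof -
  have "((%u. exp_i (P u)**(Lam x y (D u)**Tt u)) has_derivative (%Z. exp_i (P a)**Ot' Z + E**(mat \<i>**p Z)**(Lam x y (D a)**Tt a))) (at a)"
   by (rule matrix_mult_has_derivative[OF ex Ot'])
  moreover have "(%Z. exp_i (P a)**Ot' Z + E**(mat \<i>**p Z)**(Lam x y (D a)**Tt a)) = Om'"
   by (simp add: fun_eq_iff Om'_def E_def Ot_def mm_ring add.commute)
  ultimately show ?thesis by (simp add: LT)
 qed
 have comm: "Th Z**S = S**Th Z" "Th Z**Si = Si**Th Z" "Th Z**CI = CI**Th Z"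
  "Si**Gm = Gm**Si" "S**CI = CI**S" "Si**CI = CI**Si" "Th Z**E = E**Th Z" "Th Z**Gm = Gm**Th Z" "S**Gm = Gm**S" for Z
  by (simp_all add: Th_def S_def Si_def Gm_def CI_def E_def Sinh_def SinhI_def Cosh_def CoshI_def exp_i_def dmat_mult_commute)
 have uE: "unitary E" by (simp add: E_def exp_i_def unitary_dmat)
 define l where "l Z = (H a)\<^sup>H**H' Z" for Z
 have \<rho>H: "\<rho> u = \<rho>0**H u" for u by (simp add: \<rho>_def rhoN_def H_def)
 have u0: "unitary \<rho>0" using b by (simp add: base_frame_def)
 have uH: "unitary (H u)" if "u \<in> U" for u
 proof -
  have "H u = \<rho>0\<^sup>H**\<rho> u" by (simp add: \<rho>H mm_assoc unitaryD u0)
  then show ?thesis using r(1)[OF that] u0 by (simp add: unitary_mult)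
 qed
 note uHa = unitaryD[OF uH[OF U(2)]]
 have \<rho>': "(\<rho> has_derivative (%Z. \<rho> a**l Z)) (at a)"
 proof -
  have "((%u. \<rho>0**H u) has_derivative (%Z. \<rho>0**H' Z + 0**H a)) (at a)"
   by (intro matrix_mult_has_derivative has_derivative_const H')
  moreover have "\<rho>0**H' Z + 0**H a = \<rho> a**l Z" for Z
  proof -
   have "\<rho> a**l Z = \<rho>0**(H a**(H a)\<^sup>H)**H' Z" by (simp only: \<rho>H l_def mm_assoc)
   then show ?thesis by (simp add: uHa)
  qed
  ultimately show ?thesis by (simp add: \<rho>H[abs_def])
 qed
 have l_anti: "(l Z)\<^sup>H = - l Z" for Z
  using unitary_derivative[OF U uH H', of Z] by (simp add: l_def ctrans_mult eq_neg_iff_add_eq_0 add.commute)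
 have l_rl: "rl (l Z)" for Z
  unfolding l_def by (intro rl_intros rl_derivative[OF U _ H']) (simp_all add: H_def rl_of_real)
 have Ot'_rl: "rl (Ot' Z)" for Z
  by (rule rl_derivative[OF U _ Ot']) (simp add: Tt_def Lam_def rl_mult rl_of_real rl_dmat_cvec)
 have Ot_rl: "rl Ot" by (simp add: Ot_def Tt_def Lam_def rl_mult rl_of_real rl_dmat_cvec)
 have rls: "rl S" "rl Si" "rl Gm" "rl CI" "rl (Th Z)" "rl (p Z)" for Z
  by (simp_all add: S_def Si_def Gm_def CI_def Th_def p_def Sinh_def SinhI_def Cosh_def CoshI_def rl_dmat_cvec)
 define nn where "nn = Si**(y^2 *\<^sub>R Gm - (1 / x) *\<^sub>R Om\<^sup>H)"
 define nn' where "nn' Z = - (Si**(y^2 *\<^sub>R (Th Z**CI) + (1 / x) *\<^sub>R (Om' Z - Om**Th Z)\<^sup>H))" for Z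
 define Yf where "Yf Z = Om' Z - Th Z**Om" for Z
 have w'_eq: "w' Z = Si**Yf Z + (1 / x) *\<^sub>R (Si**Th Z**CI)" for Z
 proof -
  have "((%u. wN (D u) (T u)) has_derivative (%Z. SinhI (D a)**(Om' Z - (1 / x) *\<^sub>R (Gm**Th Z - CI**Th Z))
    + - (Si**Th Z)**(Lam x y (D a)**T a - (1 / x) *\<^sub>R Cosh (D a)))) (at a)"
   by (intro matrix_mult_has_derivative hyp has_derivative_diff has_derivative_scaleR_right Om')
  from has_derivative_unique[OF w'0 this] show ?thesis
   unfolding Om Si_def[symmetric] Gm_def[symmetric] Yf_def
   by (simp add: mm_ring comm(8) scaleR_diff_right) (simp add: mm_assoc[symmetric] comm(3,8))
 qed
 have n'_eq: "n' Z = \<rho> a**(l Z**nn + nn' Z)" for Z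
 proof -
  have "((%u. nN (\<rho> u) (D u) (T u)) has_derivative (%Z. (\<rho> a**SinhI (D a))**(y^2 *\<^sub>R (Gm**Th Z - CI**Th Z) - (1 / x) *\<^sub>R (Om' Z)\<^sup>H)
    + (\<rho> a**- (Si**Th Z) + \<rho> a**l Z**SinhI (D a))**(y^2 *\<^sub>R Cosh (D a) - (1 / x) *\<^sub>R (Lam x y (D a)**T a)\<^sup>H))) (at a)"
   by (intro matrix_mult_has_derivative hyp has_derivative_diff has_derivative_scaleR_right Om' \<rho>' ctrans_has_derivative)
  note e = has_derivative_unique[OF n'0 this]
  have Thc: "(Th Z)\<^sup>H = Th Z" by (simp add: Th_def)
  have c: "Gm**Th Z = Th Z**Gm" "CI**Th Z = Th Z**CI" using comm by auto
  show ?thesis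
   unfolding e Om Si_def[symmetric] Gm_def[symmetric] nn_def nn'_def c
   by (simp add: ctrans_simps Thc mm_ring scaleR_diff_right scaleR_add_right)
 qed
 define gi where "gi = invC (F a)"
 have gi: "gi = blk (smat (1 / x)) (- wN (D a) (T a)) 0 (smat x)**blk (Gm**(\<rho> a)\<^sup>H) (- S) (- (S**(\<rho> a)\<^sup>H)) Gm"
  unfolding gi_def invC_def Fw[OF U(2)] Fk[OF U(2)] bRi_def Hyp_def
  by (simp add: Inn_def blk_simps ctrans_mult matrix_uminus_left matrix_uminus_right Gm_def S_def)
 have F11: "blk11 (F' Z) = x *\<^sub>R (\<rho> a**(Gm**Th Z - CI**Th Z) + \<rho> a**l Z**Gm)"
  and F21: "blk21 (F' Z) = x *\<^sub>R (S**Th Z)" and F22: "blk22 (F' Z) = Om' Z" for Z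
 proof -
  note bl = bounded_linear_parts[THEN bounded_linear.has_derivative, OF F']
  have "(%Z. blk11 (F' Z)) = (%Z. x *\<^sub>R (\<rho> a**(Gm**Th Z - CI**Th Z) + \<rho> a**l Z**Cosh (D a)))"
  proof (rule has_derivative_unique_open[OF U _ bl(1)])
   show "((%u. x *\<^sub>R (\<rho> u**Cosh (D u))) has_derivative (%Z. x *\<^sub>R (\<rho> a**(Gm**Th Z - CI**Th Z) + \<rho> a**l Z**Cosh (D a)))) (at a)"
    by (intro has_derivative_scaleR_right matrix_mult_has_derivative hyp \<rho>')
  qed (rule Fb(5))
  then show "blk11 (F' Z) = x *\<^sub>R (\<rho> a**(Gm**Th Z - CI**Th Z) + \<rho> a**l Z**Gm)" unfolding Gm_def by metis
  have "(%Z. blk21 (F' Z)) = (%Z. x *\<^sub>R (S**Th Z))"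
  proof (rule has_derivative_unique_open[OF U _ bl(3)])
   show "((%u. x *\<^sub>R Sinh (D u)) has_derivative (%Z. x *\<^sub>R (S**Th Z))) (at a)" by (intro has_derivative_scaleR_right hyp)
  qed (rule Fb(6))
  then show "blk21 (F' Z) = x *\<^sub>R (S**Th Z)" by metis
  have "(%Z. blk22 (F' Z)) = Om'"
   by (rule has_derivative_unique_open[OF U _ bl(4) Om']) (rule Fb(7))
  then show "blk22 (F' Z) = Om' Z" by metis
 qed
 have Sw: "S**wN (D a) (T a) = Om - (1 / x) *\<^sub>R Gm" using SI by (simp add: S_def Gm_def Om mm_assoc)
 \<comment> \<open>\<open>lam\<close> and \<open>bet\<close> live in the upper right corner, so only
   the lower left corners of gam and of its conjugate enter the traces.\<close>
 have gam21: "blk21 (F' Z**gi) = - (x *\<^sub>R (Yf Z**S))**(\<rho> a)\<^sup>H" for Z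
 proof -
  have e: "F' Z = blk (blk11 (F' Z)) (blk12 (F' Z)) (x *\<^sub>R (S**Th Z)) (Om' Z)" using F21 F22 by (metis blk_collapse)
  have "blk21 (F' Z**gi) = S**Th Z**Gm**(\<rho> a)\<^sup>H + x *\<^sub>R (Th Z**(S**wN (D a) (T a))**S**(\<rho> a)\<^sup>H) - x *\<^sub>R (Om' Z**S**(\<rho> a)\<^sup>H)"
   by (subst e) (use x_pos in \<open>simp add: gi blk_mult smat_eq mm_ring comm(1) scaleR_diff_right\<close>)
  also have "... = - (x *\<^sub>R (Yf Z**S))**(\<rho> a)\<^sup>H"
   unfolding Sw using x_pos
   by (simp add: Yf_def mm_ring scaleR_diff_right) (simp add: mm_assoc[symmetric] comm(9) comm(1)[symmetric])
  finally show ?thesis .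
 qed
 have eta21: "blk21 (gi**F' Z) = x^2 *\<^sub>R (CI**Th Z**S - S**l Z**Gm)" for Z
 proof -
  have e: "F' Z = blk (x *\<^sub>R (\<rho> a**(Gm**Th Z - CI**Th Z) + \<rho> a**l Z**Gm)) (blk12 (F' Z)) (x *\<^sub>R (S**Th Z)) (Om' Z)" using F11 F21 F22 by (metis blk_collapse)
  have rr: "(\<rho> a)\<^sup>H**(\<rho> a**M) = M" for M by (simp add: mm_assoc unitaryD r U)
  have "blk21 (gi**F' Z) = x^2 *\<^sub>R (Gm**(S**Th Z) - S**(Gm**Th Z - CI**Th Z) - S**l Z**Gm)"
   by (subst e) (simp add: gi blk_mult smat_eq mm_ring, simp add: mm_assoc[symmetric] rr power2_eq_square scaleR_diff_right matrix_scaleR_right mm_ring(1) scaleR_add_right)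
  also have "Gm**(S**Th Z) - S**(Gm**Th Z - CI**Th Z) = CI**Th Z**S"
  proof -
   have "Gm**(S**Th Z) - S**(Gm**Th Z - CI**Th Z) = S**CI**Th Z"
    by (simp add: matrix_diff_ldistrib mm_assoc comm(9))
   also have "... = CI**(Th Z**S)" unfolding comm(1,5) by (simp only: mm_assoc)
   finally show ?thesis by (simp only: mm_assoc)
  qed
  finally show ?thesis .
 qed
 define BR where "BR Z = (Ot' Z - Th Z**Ot)**Ot\<^sup>H + Ot**(Ot' Z - Ot**Th Z)\<^sup>H + Ot**(S**l Z**Si)**Ot\<^sup>H" for Z
 have tr: "pairing_wedge (%Z. blk 0 (A Z) 0 0) B X Y = pairing_wedge A (%Z. blk21 (B Z)) X Y" for A :: "'a => 'n cmat" and B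
 proof -
  have "pairing (blk 0 M 0 0) N = pairing M (blk21 N)" for M :: "'n cmat" and N
   by (rule blk_cases[of N]) (simp add: pairing_def blk_mult trace_blk trace_zero)
  then show ?thesis by (simp add: pairing_wedge_def)
 qed
 have gig: "gi**(F' Z**gi)**F a = gi**F' Z" for Z
  using invC[OF FC[OF U(2)]] by (simp add: gi_def mm_assoc[symmetric])
 have "pull_symp F a X Y = (1 / y^2) * pairing_wedge n' (%Z. - (x *\<^sub>R (Yf Z**S))**(\<rho> a)\<^sup>H) X Y
   + (1 / x) * pairing_wedge w' (%Z. x^2 *\<^sub>R (CI**Th Z**S - S**l Z**Gm)) X Y"
  using pull_symp_constrained(1)[OF U FC F' w' n', of X Y]
  unfolding gi_def[symmetric] gig tr gam21 eta21 pw_scaleR_left by simp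
 also have "pairing_wedge n' (%Z. - (x *\<^sub>R (Yf Z**S))**(\<rho> a)\<^sup>H) X Y = pairing_wedge (%Z. l Z**nn + nn' Z) (%Z. - (x *\<^sub>R (Yf Z**S))) X Y"
  unfolding n'_eq[abs_def] pw_move_left by (simp add: mm_assoc[symmetric] unitaryD r U)
 also have "(1 / x) * pairing_wedge w' (%Z. x^2 *\<^sub>R (CI**Th Z**S - S**l Z**Gm)) X Y = x * pairing_wedge w' (%Z. CI**Th Z**S - S**l Z**Gm) X Y"
  unfolding pw_scaleR_right using x_pos by (simp add: power2_eq_square)
 also have "(1 / y^2) * pairing_wedge (%Z. l Z**nn + nn' Z) (%Z. - (x *\<^sub>R (Yf Z**S))) X Y + x * pairing_wedge w' (%Z. CI**Th Z**S - S**l Z**Gm) X Y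
   = - (1 / y^2) * pairing_wedge (%Z. mat \<i>**p Z) BR X Y"
 proof -
  have z: "x ~= 0" "y ~= 0" using x_pos y_pos by auto
  have ct: "S\<^sup>H = S" "(Th Z)\<^sup>H = Th Z" "(p Z)\<^sup>H = p Z" for Z by (simp_all add: S_def Th_def p_def)
  show ?thesis
   using section_algebra[OF z SI[folded S_def Si_def] unitaryD(1)[OF uE] comm(1-7) ct rls l_rl Ot_rl Ot'_rl, where X = X and Y = Y]
   unfolding w'_eq[abs_def] nn_def nn'_def[abs_def] Yf_def[abs_def] Om_def Om'_def[abs_def] BR_def[abs_def] .
 qed
 also have "pairing_wedge (%Z. mat \<i>**p Z) BR X Y = (\<Sum>i\<in>UNIV. P' X$i * (- 2 * y^2 * Q' Y$i) - P' Y$i * (- 2 * y^2 * Q' X$i))"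
 proof -
  have "Re (BR Z$i$i) = - 2 * y^2 * Q' Z$i" for Z i
  proof -
   \<comment> \<open>By the constraint this is T^H S^2 T. Written through \<rho>, its derivative
     follows from d\<rho> = \<rho> l and dS = S dq alone.\<close>
   define W where "W u = Sinh (D u)**(\<rho> u)\<^sup>H**(\<sigma>**\<sigma>\<^sup>H)**\<rho> u**Sinh (D u)" for u
   have TtE: "Tt u = (exp_i (P u))\<^sup>H**T u" for u
   proof -
    have "unitary (exp_i (P u))" by (simp add: exp_i_def unitary_dmat)
    then show ?thesis by (simp add: T_def TN_def Tt_def mm_assoc unitaryD)
   qed
   have uT: "unitary (Tt u)" if "u \<in> U" for u
    using nd[OF that] unfolding TtE normal_data_def by (intro unitary_mult) (auto simp: exp_i_def unitary_dmat)
   have TW: "Tt u**W u = Sinh (D u)**Sinh (D u)**Tt u" if u: "u \<in> U" for u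
   proof -
    have "(T u)**((T u)\<^sup>H**(Sinh (D u)**Sinh (D u))**T u) = T u**W u"
     using nd[OF u] by (simp add: normal_data_def W_def mm_assoc)
    then have "T u**W u = Sinh (D u)**Sinh (D u)**T u"
     using nd[OF u] by (simp add: normal_data_def mm_assoc unitaryD)
    then have "(exp_i (P u))\<^sup>H**(T u**W u) = (exp_i (P u))\<^sup>H**(Sinh (D u)**Sinh (D u))**T u"
     by (simp add: mm_assoc)
    also have "(exp_i (P u))\<^sup>H**(Sinh (D u)**Sinh (D u)) = Sinh (D u)**Sinh (D u)**(exp_i (P u))\<^sup>H"
     unfolding exp_i_def Sinh_def ctrans_dmat dmat_mult_dmat by (simp add: mult.commute)
    finally show ?thesis by (simp add: TtE mm_assoc)
   qed
   have Wc: "(W a)\<^sup>H = W a" by (simp add: W_def ctrans_mult mm_assoc)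
   define W' where "W' Z = (Th Z - S**l Z**Si)**W a + W a**(Th Z - S**l Z**Si)\<^sup>H" for Z
   have W': "(W has_derivative W') (at a)"
   proof -
    let ?R = "(\<sigma>**\<sigma>\<^sup>H)"
    have 1: "((%u. \<rho> u**Sinh (D u)) has_derivative (%Z. \<rho> a**(S**Th Z) + \<rho> a**l Z**Sinh (D a))) (at a)"
     by (intro matrix_mult_has_derivative hyp \<rho>')
    have 2: "\<rho> a**(S**Th Z) + \<rho> a**l Z**Sinh (D a) = (\<rho> a**S)**(Th Z - S**l Z**Si)\<^sup>H" for Z
     using SI by (simp add: ctrans_simps S_def Si_def Th_def l_anti mm_ring) (simp add: mm_assoc[symmetric])
    have 3: "((%u. (\<rho> u**Sinh (D u))\<^sup>H**?R**(\<rho> u**Sinh (D u))) has_derivative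
      (%Z. ((\<rho> a**Sinh (D a))\<^sup>H**?R)**((\<rho> a**S)**(Th Z - S**l Z**Si)\<^sup>H)
       + ((\<rho> a**Sinh (D a))\<^sup>H**0 + ((\<rho> a**S)**(Th Z - S**l Z**Si)\<^sup>H)\<^sup>H**?R)**(\<rho> a**Sinh (D a)))) (at a)"
     by (intro matrix_mult_has_derivative ctrans_has_derivative has_derivative_const 1[unfolded 2])
    have 4: "(\<rho> u**Sinh (D u))\<^sup>H**?R**(\<rho> u**Sinh (D u)) = W u" for u
     by (simp add: W_def ctrans_mult mm_assoc)
    show ?thesis using 3 unfolding 4
     by (rule has_derivative_eq_rhs)
       (simp add: fun_eq_iff W'_def W_def ctrans_mult mm_assoc S_def add.commute)
   qed
   have dW: "T' Z**W a + Tt a**W' Z = S**S**T' Z + 2 *\<^sub>R (S**S**Th Z**Tt a)"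
   proof -
    have "((%u. Tt u**W u - Sinh (D u)**Sinh (D u)**Tt u) has_derivative
     (%Z. (Tt a**W' Z + T' Z**W a) - (Sinh (D a)**Sinh (D a)**T' Z + (Sinh (D a)**(S**Th Z) + S**Th Z**Sinh (D a))**Tt a))) (at a)"
     by (intro has_derivative_diff matrix_mult_has_derivative T' W' hyp)
    from has_derivative_const_on_open[OF U _ this, of 0 Z]
    have "Tt a**W' Z + T' Z**W a = S**S**T' Z + (S**(S**Th Z) + S**(Th Z**S))**Tt a"
     using TW by (simp add: S_def mm_assoc)
    moreover have "(S**(S**Th Z) + S**(Th Z**S))**Tt a = 2 *\<^sub>R (S**S**Th Z**Tt a)"
     unfolding comm(1) by (simp only: mm_assoc matrix_add_rdistrib scaleR_2)
    ultimately show ?thesis by (simp add: add.commute)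
   qed
   have dO: "Ot**(Ot' Z)\<^sup>H + Ot' Z**Ot\<^sup>H = (2 * x^2) *\<^sub>R (S**S**Th Z)"
   proof -
    let ?O = "%u. Lam x y (D u)**Tt u"
    have "((%u. ?O u**(?O u)\<^sup>H - x\<^sup>2 *\<^sub>R (Sinh (D u)**Sinh (D u))) has_derivative
     (%Z. (?O a**(Ot' Z)\<^sup>H + Ot' Z**(?O a)\<^sup>H) - x\<^sup>2 *\<^sub>R (Sinh (D a)**(S**Th Z) + S**Th Z**Sinh (D a)))) (at a)"
     by (intro has_derivative_diff has_derivative_scaleR_right matrix_mult_has_derivative ctrans_has_derivative Ot' hyp)
    moreover have "?O u**(?O u)\<^sup>H - x\<^sup>2 *\<^sub>R (Sinh (D u)**Sinh (D u)) = y^2 *\<^sub>R mat 1" if "u \<in> U" for u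
    proof -
     have "?O u**(?O u)\<^sup>H = Lam x y (D u)**(Tt u**(Tt u)\<^sup>H)**Lam x y (D u)"
      by (simp add: ctrans_mult Lam_props(1) mm_assoc)
     then show ?thesis by (simp add: unitaryD uT[OF that] Lam_props(2))
    qed
    ultimately have "?O a**(Ot' Z)\<^sup>H + Ot' Z**(?O a)\<^sup>H = x^2 *\<^sub>R (S**(S**Th Z) + S**(Th Z**S))"
     using has_derivative_const_on_open[OF U, where f' = "%Z. (?O a**(Ot' Z)\<^sup>H + Ot' Z**(?O a)\<^sup>H) - x\<^sup>2 *\<^sub>R (Sinh (D a)**(S**Th Z) + S**Th Z**Sinh (D a))"]
     by (metis (no_types, lifting) S_def eq_iff_diff_eq_0 mm_assoc)
    then show ?thesis unfolding comm(1) Ot_def[symmetric] by (simp add: mm_assoc scaleR_2[symmetric])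
   qed
   have W2: "W a**(Tt a)\<^sup>H = (Tt a)\<^sup>H**(S**S)"
    using arg_cong[OF TW[OF U(2)], of ctrans] by (simp add: ctrans_mult Wc S_def mm_assoc)
   have "(sqrt (y^2 + x^2 * (exp (Q a$i))^2))^2 = y^2 + x^2 * (exp (Q a$i))^2" for i by simp
   then show ?thesis
    unfolding BR_def
    by (intro BR_diagonal[OF _ _ _ uT[OF U(2)] TW[OF U(2), folded S_def] W2 dW[unfolded W'_def] _ _ dO,
       where s = "eq (Q a)" and L = "\<chi> i. sqrt (y^2 + x^2 * (exp (Q a$i))^2)"])
      (simp_all add: S_def D_def Sinh_Dl Th_def Ot_def Lam_Dl eq_def)
  qed
  then show ?thesis unfolding p_def pw_i_diag by simp
 qed
 finally show ?thesis
  unfolding F_def[abs_def] using y_pos by (simp add: sum_distrib_left algebra_simps)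
qed

end

subsection \<open>Perturbation of simple spectra\<close>

lemma isCont_tendsto_nhds: "isCont f a ==> (f \<longlongrightarrow> f a) (nhds a)"
 by (simp add: isCont_def tendsto_at_iff_tendsto_nhds)

text \<open>If d is below the distances from m_i to the other roots, f a changes sign between m_i -
  d and m_i + d because m_i is simple. The sign change survives near a, and the intermediate value
  theorem yields a root in between.\<close>

lemma simple_roots_persist:
 fixes f :: "'a::real_normed_vector => real => real" and m :: "'n::finite => real"
 assumes c: "!!l. isCont (%u. f u l) a" and fa: "!!l. f a l = (\<Prod>j\<in>UNIV. l - m j)" and m: "inj m"
  and f: "!!u. continuous_on UNIV (f u)" and e: "0 < e"
 shows "eventually (%u. \<forall>i. \<exists>l. \<bar>l - m i\<bar> < e & f u l = 0) (nhds a)"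
proof (rule eventually_all_finite)
 fix i
 define A where "A = insert (e / 2) ((%j. \<bar>m i - m j\<bar> / 2) ` (UNIV - {i}))"
 define d where "d = Min A"
 have A: "finite A" "A ~= {}" by (auto simp: A_def)
 have "0 < t" if "t \<in> A" for t using that e m by (auto simp: A_def inj_def)
 then have d: "0 < d" using Min_in[OF A] by (simp add: d_def)
 have "d \<le> e / 2" unfolding d_def by (rule Min_le[OF A(1)]) (simp add: A_def)
 then have de: "d < e" using e by simp
 have dj: "d < \<bar>m i - m j\<bar>" if "j ~= i" for j
 proof -
  have "d \<le> \<bar>m i - m j\<bar> / 2" unfolding d_def by (rule Min_le[OF A(1)]) (use that in \<open>auto simp: A_def\<close>)
  then have "2 * d \<le> \<bar>m i - m j\<bar>" by simp
  then show ?thesis using d by linarith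
 qed
 have "f a (m i - d) * f a (m i + d) = (\<Prod>j\<in>UNIV. (m i - m j)^2 - d\<^sup>2)"
  unfolding fa prod.distrib[symmetric] by (rule prod.cong) (simp_all add: power2_eq_square algebra_simps)
 also have "... = - d\<^sup>2 * (\<Prod>j\<in>UNIV - {i}. (m i - m j)^2 - d\<^sup>2)" by (subst prod_remove_UNIV[of _ i]) simp
 also have "... < 0"
 proof -
  have "0 < (m i - m j)^2 - d\<^sup>2" if "j ~= i" for j using dj[OF that] d by (metis abs_le_square_iff abs_of_pos diff_gt_0_iff_gt not_less)
  then have "0 < (\<Prod>j\<in>UNIV - {i}. (m i - m j)^2 - d\<^sup>2)" by (intro prod_pos) auto
  then show ?thesis using d by simp
 qed
 finally have neg: "f a (m i - d) * f a (m i + d) < 0" .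
 have "isCont (%u. f u (m i - d) * f u (m i + d)) a" by (intro continuous_intros c)
 from order_tendstoD(2)[OF isCont_tendsto_nhds[OF this] neg] show "eventually (%u. \<exists>l. \<bar>l - m i\<bar> < e & f u l = 0) (nhds a)"
 proof (rule eventually_mono)
  fix u assume n: "f u (m i - d) * f u (m i + d) < 0"
  have cu: "continuous_on {m i - d..m i + d} (f u)" using f continuous_on_subset by blast
  obtain l where "m i - d \<le> l" "l \<le> m i + d" "f u l = 0"
  proof -
   have "\<exists>l. m i - d \<le> l & l \<le> m i + d & f u l = 0"
  proof (cases "f u (m i - d) \<le> 0")
   case True
   then have "0 \<le> f u (m i + d)" using n by (metis linorder_not_le mult_nonpos_nonpos less_imp_le not_less)
   then show ?thesis using IVT'[of "f u" "m i - d" 0 "m i + d"] True d cu by auto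
  next
   case False
   then have "f u (m i + d) \<le> 0" using n by (metis linorder_not_le mult_nonneg_nonneg less_imp_le not_less)
   then show ?thesis using IVT2'[of "f u" "m i + d" 0 "m i - d"] False d cu by auto
  qed
   then show ?thesis using that by blast
  qed
  then have "\<bar>l - m i\<bar> < e & f u l = 0" using de by linarith
  then show "\<exists>l. \<bar>l - m i\<bar> < e & f u l = 0" ..
 qed
qed

lemma det_differentiable:
 fixes A :: "'a::real_normed_vector => 'k::finite cmat"
 assumes "A differentiable at a" shows "(%u. det (A u)) differentiable at a"
 unfolding det_def
 by (intro differentiable_sum ballI differentiable_mult differentiable_const prod_differentiable matrix_differentiableD assms) simp

lemma Re_differentiable: "f differentiable at a ==> (%u. Re (f u)) differentiable at a"
 by (rule bounded_linear_differentiable[OF bounded_linear_Re])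
lemma Im_differentiable: "f differentiable at a ==> (%u. Im (f u)) differentiable at a"
 by (rule bounded_linear_differentiable[OF bounded_linear_Im])

lemma det_unitary_conj:
 assumes "unitary r" shows "det (mat z - r**dmat d**r\<^sup>H) = (\<Prod>j\<in>UNIV. z - d$j)"
proof -
 have "mat z - r**dmat d**r\<^sup>H = r**(mat z - dmat d)**r\<^sup>H"
  by (simp add: matrix_diff_ldistrib matrix_diff_rdistrib mat_mult_commute[of r]) (simp add: mm_assoc[symmetric] unitaryD assms)
 also have "det ... = det (mat z - dmat d) * det (r**r\<^sup>H)" by (simp add: det_mul)
 also have "mat z - dmat d = dmat (\<chi> j. z - d$j)" by (simp add: vec_eq_iff mat_def)
 finally show ?thesis by (simp add: unitaryD assms det_dmat)
qed

text \<open>Made for differentiating a root at one point: the value of the characteristic polynomial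
  at the old root is differentiable and vanishes at a, while the complementary factor, by which it
  is divided, is known only to be continuous.\<close>

lemma vanishing_mult_continuous_differentiable:
 fixes f h :: "'a::real_normed_vector => real"
 assumes f: "f differentiable at a" and f0: "f a = 0" and h: "isCont h a"
 shows "(%u. f u * h u) differentiable at a"
proof -
 obtain f' where f': "(f has_derivative f') (at a)" using f unfolding differentiable_def by blast
 then have bl: "bounded_linear f'" by (rule has_derivative_bounded_linear)
 obtain B where B: "!!v. norm (f' v) \<le> norm v * B" and B0: "0 < B" using bounded_linear.pos_bounded[OF bl] by blast
 have "((%u. f u * h u) has_derivative (%v. f' v * h a)) (at a)"
  unfolding has_derivative_at_alt
 proof (intro conjI allI impI)
  show "bounded_linear (%v. f' v * h a)" by (rule bounded_linear_mult_const[OF bl])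
  fix e :: real assume e: "0 < e"
  define e1 e2 where "e1 = e / (2 * (\<bar>h a\<bar> + 1))" and "e2 = min 1 (e / (2 * B))"
  have e12: "0 < e1" "0 < e2" using e B0 by (simp_all add: e1_def e2_def add_nonneg_pos)
  obtain d1 where d1: "0 < d1" "!!u. norm (u - a) < d1 ==> norm (f u - f' (u - a)) \<le> e1 * norm (u - a)"
   using f' e12(1) unfolding has_derivative_at_alt by (simp add: f0) blast
  obtain d2 where d2: "0 < d2" "!!u. norm (u - a) < d2 ==> norm (h u - h a) < e2"
   using tendstoD[OF isCont_tendsto_nhds[OF h] e12(2)] unfolding eventually_nhds_metric dist_norm by blast
  show "\<exists>d>0. \<forall>u. norm (u - a) < d --> norm (f u * h u - f a * h a - f' (u - a) * h a) \<le> e * norm (u - a)"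
  proof (intro exI[of _ "min d1 d2"] conjI allI impI)
   show "0 < min d1 d2" using d1 d2 by simp
   fix u assume u: "norm (u - a) < min d1 d2"
   have h1: "norm (h u - h a) \<le> e2" using d2(2)[of u] u by simp
   have hu: "\<bar>h u\<bar> \<le> \<bar>h a\<bar> + 1" using h1 unfolding e2_def real_norm_def by linarith
   have "f u * h u - f a * h a - f' (u - a) * h a = (f u - f' (u - a)) * h u + f' (u - a) * (h u - h a)"
    by (simp add: f0 algebra_simps)
   also have "norm ... \<le> norm (f u - f' (u - a)) * \<bar>h u\<bar> + norm (f' (u - a)) * norm (h u - h a)"
    by (metis norm_mult norm_triangle_ineq real_norm_def)
   also have "... \<le> (e1 * norm (u - a)) * (\<bar>h a\<bar> + 1) + (norm (u - a) * B) * e2"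
    using d1(2)[of u] u B[of "u - a"] h1 hu e12 B0 by (intro add_mono mult_mono) auto
   also have "... \<le> e / 2 * norm (u - a) + norm (u - a) * (e / 2)"
   proof (rule add_mono)
    have "0 < \<bar>h a\<bar> + 1" by simp
    then show "(e1 * norm (u - a)) * (\<bar>h a\<bar> + 1) \<le> e / 2 * norm (u - a)" by (simp add: e1_def field_simps)
    have "B * e2 \<le> B * (e / (2 * B))" using B0 by (intro mult_left_mono) (auto simp: e2_def)
    then have "B * e2 \<le> e / 2" using B0 by simp
    then show "(norm (u - a) * B) * e2 \<le> norm (u - a) * (e / 2)" by (simp add: mult.assoc mult_left_mono)
   qed
   finally show "norm (f u * h u - f a * h a - f' (u - a) * h a) \<le> e * norm (u - a)" by (simp add: algebra_simps)
  qed
 qed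
 then show ?thesis unfolding differentiable_def by blast
qed

lemma exists_gap:
 fixes m :: "('n::{finite,linorder}) rvec"
 assumes dec: "!!i j. i < j ==> m$j < m$i" and e: "0 < e"
 shows "\<exists>d>0. d \<le> e & (\<forall>i j. i < j --> 2 * d \<le> m$i - m$j)"
proof -
 define A where "A = insert e ((%(i, j). (m$i - m$j) / 2) ` {(i, j). i < j})"
 have A: "finite A" "A ~= {}" by (auto simp: A_def)
 have "0 < t" if "t \<in> A" for t using that e dec by (auto simp: A_def)
 then have "0 < Min A" using Min_in[OF A] by simp
 moreover have "Min A \<le> e" by (rule Min_le[OF A(1)]) (simp add: A_def)
 moreover have "2 * Min A \<le> m$i - m$j" if "i < j" for i j
 proof -
  have "Min A \<le> (m$i - m$j) / 2" by (rule Min_le[OF A(1)]) (use that in \<open>auto simp: A_def\<close>)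
  then show ?thesis by simp
 qed
 ultimately show ?thesis by blast
qed

lemma charpoly_roots_persist:
 fixes M :: "'a::real_normed_vector => ('n::{finite,linorder}) cmat"
 assumes M: "M differentiable at a" and M0: "M a = r**dmat (cvec m)**r\<^sup>H" "unitary r"
  and dec: "!!i j. i < j ==> m$j < m$i" and d: "0 < d"
 shows "eventually (%u. \<forall>i. \<exists>l. \<bar>l - m$i\<bar> < d & Re (det (mat (complex_of_real l) - M u)) = 0) (nhds a)"
proof (rule simple_roots_persist[OF _ _ _ _ d])
 have "(%u. Re (det (mat (complex_of_real l) - M u))) differentiable at a" for l
  by (intro Re_differentiable det_differentiable differentiable_diff differentiable_const M)
 then show "isCont (%u. Re (det (mat (complex_of_real l) - M u))) a" for l
  by (rule differentiable_imp_continuous_within)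
 show "inj (($) m)" using dec by (intro injI) (metis less_irrefl linorder_neqE)
 have "det (mat (complex_of_real l) - M a) = complex_of_real (\<Prod>j\<in>UNIV. l - m$j)" for l
  unfolding M0(1) det_unitary_conj[OF M0(2)] by simp
 then show "Re (det (mat (complex_of_real l) - M a)) = (\<Prod>j\<in>UNIV. l - m$j)" for l by (simp only: Re_complex_of_real)
 have "continuous_on UNIV (%l. (mat (complex_of_real l) - M u)$i$j)" for u i j
  by (cases "i = j") (auto simp: mat_def intro!: continuous_intros)
 then show "continuous_on UNIV (%l. Re (det (mat (complex_of_real l) - M u)))" for u
  unfolding det_def by (intro continuous_on_Re continuous_on_sum continuous_on_mult continuous_on_prod continuous_on_const)
qed

text \<open>Continuity comes first: each eigenvalue at a has one of M u nearby, and the resulting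
  index map is strictly monotone, hence the identity. Then m_i(u) = m_i(a) - f u (m_i(a)) / g u,
  where g u is the product over the other eigenvalues; g is continuous and non-zero at a, and the
  numerator vanishes there.\<close>

lemma simple_spectrum_differentiable:
 fixes M :: "'a::real_normed_vector => ('n::{finite,linorder}) cmat" and m :: "'a => 'n rvec"
 assumes U: "open U" "a \<in> U" and M: "M differentiable at a"
  and spec: "!!u. u \<in> U ==> M u = r u**dmat (cvec (m u))**(r u)\<^sup>H" "!!u. u \<in> U ==> unitary (r u)"
  and dec: "!!u i j. u \<in> U ==> i < j ==> m u$j < m u$i"
 shows "m differentiable at a"
proof -
 define f where "f u l = Re (det (mat (complex_of_real l) - M u))" for u l
 have fm: "f u l = (\<Prod>j\<in>UNIV. l - m u$j)" if u: "u \<in> U" for u l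
 proof -
  have "det (mat (complex_of_real l) - M u) = complex_of_real (\<Prod>j\<in>UNIV. l - m u$j)"
   unfolding spec(1)[OF u] det_unitary_conj[OF spec(2)[OF u]] by simp
  then show ?thesis unfolding f_def by (simp only: Re_complex_of_real)
 qed
 have fd: "(%u. f u l) differentiable at a" for l
  unfolding f_def by (intro Re_differentiable det_differentiable differentiable_diff differentiable_const M)
 have inj: "inj (%i. m a$i)" using dec[OF U(2)] by (intro injI) (metis less_irrefl linorder_neqE)
 have cont_m: "isCont (%u. m u$i) a" for i
  unfolding isCont_def
 proof (rule tendstoI)
  fix e :: real assume e: "0 < e"
  obtain d where d: "0 < d" "d \<le> e" and dj: "!!i j. i < j ==> 2 * d \<le> m a$i - m a$j"
   using exists_gap[of "m a" e, OF dec[OF U(2)] e] by blast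
  have "eventually (%u. u \<in> U) (nhds a)" using U eventually_nhds by blast
  moreover have "eventually (%u. \<forall>i. \<exists>l. \<bar>l - m a$i\<bar> < d & f u l = 0) (nhds a)"
   unfolding f_def by (rule charpoly_roots_persist[OF M spec(1)[OF U(2)] spec(2)[OF U(2)] dec[OF U(2)] d(1)])
  ultimately have "eventually (%u. dist (m u$i) (m a$i) < e) (nhds a)"
  proof eventually_elim
   case (elim u)
   have "\<exists>j. \<bar>m u$j - m a$k\<bar> < d" for k
   proof -
    obtain l where l: "\<bar>l - m a$k\<bar> < d" "f u l = 0" using elim(2) by blast
    then obtain j where "l = m u$j" unfolding fm[OF elim(1)] by auto
    then show ?thesis using l by blast
   qed
   then obtain h where h: "!!k. \<bar>m u$h k - m a$k\<bar> < d" by metis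
   have "h k < h k'" if "k < k'" for k k'
   proof -
    have "m u$h k' < m u$h k" using h[of k] h[of k'] dj[OF that] by linarith
    then show ?thesis using dec[OF elim(1), of "h k'" "h k"] by (metis less_asym less_irrefl linorder_neqE)
   qed
   then have "h i = i" by (rule strict_mono_self_eq)
   then show ?case using h[of i] d(2) by (simp add: dist_real_def)
  qed
  then show "eventually (%u. dist (m u$i) (m a$i) < e) (at a)" by (simp add: eventually_at_filter eventually_mono)
 qed
 have "(%u. m u$i) differentiable at a" for i
 proof -
  define g where "g u = (\<Prod>j\<in>UNIV - {i}. m a$i - m u$j)" for u
  have gc: "isCont g a" unfolding g_def by (intro continuous_intros cont_m)
  have ga: "g a ~= 0" using inj by (auto simp: g_def inj_def)
  have "isCont (%u. inverse (g u)) a" by (intro continuous_intros gc ga)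
  moreover have "f a (m a$i) = 0" unfolding fm[OF U(2)] by (auto intro!: bexI[of _ i])
  ultimately have "(%u. f u (m a$i) * inverse (g u)) differentiable at a"
   by (intro vanishing_mult_continuous_differentiable fd)
  then have d1: "(%u. m a$i - f u (m a$i) * inverse (g u)) differentiable at a" by (intro differentiable_diff differentiable_const)
  have "eventually (%u. g u ~= 0) (nhds a)"
   by (rule tendsto_imp_eventually_ne[OF isCont_tendsto_nhds[OF gc] ga])
  then obtain V where V: "open V" "a \<in> V" "!!u. u \<in> V ==> g u ~= 0" unfolding eventually_nhds by blast
  show ?thesis
  proof (rule differentiable_cong_open[OF d1, of "U \<inter> V"])
   fix u assume u: "u \<in> U \<inter> V"
   have "f u (m a$i) = (m a$i - m u$i) * g u"
    using u unfolding g_def by (subst fm, blast, subst prod_remove_UNIV[of _ i]) simp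
   then show "m a$i - f u (m a$i) * inverse (g u) = m u$i" using V(3)[of u] u by (simp add: mult.assoc)
  qed (use U V in auto)
 qed
 then show ?thesis by (rule vec_differentiableI)
qed

text \<open>The product of the \<open>M - m\<^sub>j\<close> over all \<open>j\<close> but \<open>i\<close> is a multiple of the spectral projection for \<open>m\<^sub>i\<close>.\<close>

lemma spectral_projection_differentiable:
 fixes M r :: "'a::real_normed_vector => ('n::{finite,linorder}) cmat" and m :: "'a => 'n rvec"
 assumes U: "open U" "a \<in> U" and M: "M differentiable at a" and m: "m differentiable at a"
  and spec: "!!u. u \<in> U ==> M u = r u**dmat (cvec (m u))**(r u)\<^sup>H" "!!u. u \<in> U ==> unitary (r u)"
  and dec: "!!u i j. u \<in> U ==> i < j ==> m u$j < m u$i"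
 shows "(%u. r u**dmat (axis i 1)**(r u)\<^sup>H) differentiable at a"
proof -
 \<comment> \<open>A product along a list, since matrix multiplication is not commutative; as all
   factors are diagonal in the same basis, the order has no effect.\<close>
 define E where "E js u = foldr (%j A. (M u - smat (m u$j))**A) js (mat 1)" for js u
 have Ed: "(%u. E js u) differentiable at a" for js
 proof (induction js)
  case Nil
  show ?case by (simp add: E_def)
 next
  case (Cons j js)
  have "(%u. (M u - (m u$j) *\<^sub>R mat 1)**E js u) differentiable at a"
   by (intro matrix_mult_differentiable differentiable_diff M Cons differentiable_scaleR vec_nth_differentiable m differentiable_const)
  then show ?case by (simp add: E_def smat_eq)
 qed
 have Ee: "E js u = r u**dmat (cvec (\<chi> k. \<Prod>j\<leftarrow>js. m u$k - m u$j))**(r u)\<^sup>H" if u: "u \<in> U" for js u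
 proof (induction js)
  case Nil
  have "dmat (cvec (\<chi> k. 1)) = (mat 1 :: 'n cmat)" by (simp add: vec_eq_iff mat_def)
  then show ?case by (simp add: E_def unitaryD spec(2)[OF u])
 next
  case (Cons j js)
  have ru: "(r u)\<^sup>H**r u = mat 1" "r u**(r u)\<^sup>H = mat 1" using unitaryD spec(2)[OF u] by blast+
  have e: "M u - smat (m u$j) = r u**(dmat (cvec (m u)) - smat (m u$j))**(r u)\<^sup>H"
   unfolding spec(1)[OF u] by (simp add: smat_eq mm_ring) (simp add: mm_assoc[symmetric] ru)
  have "E (j # js) u = r u**(dmat (cvec (m u)) - smat (m u$j))**((r u)\<^sup>H**r u)**dmat (cvec (\<chi> k. \<Prod>j\<leftarrow>js. m u$k - m u$j))**(r u)\<^sup>H"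
   using Cons e by (simp add: E_def mm_assoc)
  also have "dmat (cvec (m u)) - smat (m u$j) = dmat (cvec (\<chi> k. m u$k - m u$j))" by (simp add: vec_eq_iff smat_def mat_def)
  finally show ?case by (simp add: ru mm_assoc[symmetric] dmat_mult_dmat) (simp add: mm_assoc times_vec_def cvec_def)
 qed
 obtain js where js: "set js = UNIV - {i}" using finite_list[of "UNIV - {i}"] by auto
 define c where "c u = (\<Prod>j\<leftarrow>js. m u$i - m u$j)" for u
 have cd: "(%u. \<Prod>j\<leftarrow>ks. m u$i - m u$j) differentiable at a" for ks
  by (induction ks) (auto intro!: differentiable_mult differentiable_diff vec_nth_differentiable m)
 have ne: "m u$i ~= m u$j" if "u \<in> U" "j ~= i" for u j
  using dec[OF that(1)] that(2) by (metis less_irrefl linorder_neqE)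
 have c0: "c u ~= 0" if "u \<in> U" for u
 proof
  assume "c u = 0"
  then obtain j where "j \<in> set js" "m u$i = m u$j" unfolding c_def prod_list_zero_iff by auto
  then show False using ne[OF that, of j] js by simp
 qed
 have "(%u. inverse (c u) *\<^sub>R E js u) differentiable at a"
  unfolding c_def by (intro differentiable_scaleR differentiable_inverse cd Ed) (use c0[OF U(2)] in \<open>simp add: c_def\<close>)
 then show ?thesis
 proof (rule differentiable_cong_open[OF _ U])
  fix u assume u: "u \<in> U"
  have "(\<Prod>j\<leftarrow>js. m u$k - m u$j) = 0" if "k ~= i" for k
   using js that by (auto simp: prod_list_zero_iff)
  then have "dmat (cvec (\<chi> k. \<Prod>j\<leftarrow>js. m u$k - m u$j)) = c u *\<^sub>R dmat (axis i 1)"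
   by (auto simp: vec_eq_iff axis_def c_def scaleR_conv_of_real[where 'a=complex])
  then show "inverse (c u) *\<^sub>R E js u = r u**dmat (axis i 1)**(r u)\<^sup>H"
   using c0[OF u] by (simp add: Ee[OF u] matrix_scaleR_left matrix_scaleR_right)
 qed
qed

section \<open>Differentiable coordinates and gauge factors along arbitrary maps\<close>

context reduction begin

lemma section_gauge:
 assumes c: "coords \<alpha> vh \<sigma> x y g q p" and b: "base_frame \<rho> z"
 shows "\<exists>R r k1 k2. stab R & unitary r & unitary k1 & unitary k2 & g = blk R 0 0 r**sectionN \<rho> z q p**blk k1 0 0 k2"
proof -
 have q: "q \<in> region \<alpha>" using c by (simp add: coords_iff)
 have "(sectionN \<rho> z q p, g) \<in> G" using coords_gauge_iff[OF sectionN_coords(1)[OF b q] c] by (metis diff_self mult_zero_right of_int_0)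
 then show ?thesis unfolding gauge_rel_iff by blast
qed

text \<open>The last two products of blocks contain neither \<open>k1\<close> nor \<open>k2\<close>:
  up to conjugation by r they depend on q and p only. The first has the simple spectrum x^2
  \<Sigma>^2, the second carries T.\<close>

lemma gauge_blocks:
 assumes b: "base_frame \<rho> z" and q: "q \<in> region \<alpha>" and R: "stab R" and u: "unitary r" "unitary k1" "unitary k2"
  and g: "g = blk R 0 0 r**sectionN \<rho> z q p**blk k1 0 0 k2"
 shows "blk11 g = x *\<^sub>R (R**rhoN \<rho> z q**Cosh (Dl q)**k1)" "blk21 g = x *\<^sub>R (r**Sinh (Dl q)**k1)"
  "blk22 g = r**Lam x y (Dl q)**TN q p (vN q)**k2" "K22F g = r**Cosh (Dl q)**k2"
  "blk21 g**(blk21 g)\<^sup>H = r**dmat (cvec (\<chi> i. x^2 * (exp (q$i))^2))**r\<^sup>H"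
  "blk22 g**(K22F g)\<^sup>H = r**(Lam x y (Dl q)**TN q p (vN q)**Cosh (Dl q))**r\<^sup>H"
proof -
 define F where "F = sectionN \<rho> z q p"
 note F = sectionN_blocks[OF b q, of p, folded F_def]
 have g': "g = blk R 0 0 r**F**blk k1 0 0 k2" by (simp add: g F_def)
 have e: "g = blk (R**blk11 F**k1) (R**blk12 F**k2) (r**blk21 F**k1) (r**blk22 F**k2)"
  unfolding g' by (rule blk_cases[of F]) (simp add: blk_mult)
 show 1: "blk11 g = x *\<^sub>R (R**rhoN \<rho> z q**Cosh (Dl q)**k1)" "blk21 g = x *\<^sub>R (r**Sinh (Dl q)**k1)"
  "blk22 g = r**Lam x y (Dl q)**TN q p (vN q)**k2"
  unfolding e by (simp_all add: F matrix_scaleR_right matrix_scaleR_left mm_assoc)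
 have "wF g = k1\<^sup>H**wF F**k2" using wF_gauge[of R r] R u g' by (simp add: stab_def)
 then have "K22F g = x *\<^sub>R (r**blk22 F**k2) - r**blk21 F**(k1**k1\<^sup>H)**wF F**k2"
  by (subst e, simp add: K22F_def mm_assoc) (simp add: e mm_assoc)
 also have "... = r**K22F F**k2" using u by (simp add: unitaryD K22F_def mm_ring)
 finally show K: "K22F g = r**Cosh (Dl q)**k2" by (simp add: F)
 have "blk21 g**(blk21 g)\<^sup>H = x^2 *\<^sub>R (r**Sinh (Dl q)**(k1**k1\<^sup>H)**Sinh (Dl q)**r\<^sup>H)"
  unfolding 1 by (simp add: ctrans_simps matrix_scaleR_left matrix_scaleR_right mm_assoc power2_eq_square)
 also have "... = r**(x^2 *\<^sub>R (Sinh (Dl q)**Sinh (Dl q)))**r\<^sup>H"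
  using u by (simp add: unitaryD mm_ring)
 also have "x^2 *\<^sub>R (Sinh (Dl q)**Sinh (Dl q)) = dmat (cvec (\<chi> i. x^2 * (exp (q$i))^2))"
  by (simp add: Sinh_Dl dmat_mult_dmat vec_eq_iff power2_eq_square scaleR_conv_of_real[where 'a=complex])
 finally show "blk21 g**(blk21 g)\<^sup>H = r**dmat (cvec (\<chi> i. x^2 * (exp (q$i))^2))**r\<^sup>H" .
 show "blk22 g**(K22F g)\<^sup>H = r**(Lam x y (Dl q)**TN q p (vN q)**Cosh (Dl q))**r\<^sup>H"
  unfolding 1 K by (simp add: ctrans_mult mm_assoc) (simp add: mm_assoc[symmetric] unitaryD u)
qed

lemma blocks_differentiable:
 assumes "F differentiable at a"
 shows "(%u. blk11 (F u)) differentiable at a" "(%u. blk21 (F u)) differentiable at a"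
  "(%u. blk22 (F u)) differentiable at a" "(%u. K22F (F u)) differentiable at a"
proof -
 show b: "(%u. blk11 (F u)) differentiable at a" "(%u. blk21 (F u)) differentiable at a" "(%u. blk22 (F u)) differentiable at a"
  using bounded_linear_differentiable[OF _ assms] bounded_linear_parts by blast+
 show "(%u. K22F (F u)) differentiable at a"
  unfolding K22F_def by (intro differentiable_diff differentiable_scaleR differentiable_const b matrix_mult_differentiable factor_maps_differentiable assms)
qed

lemma T_tilde_nz:
 assumes "q \<in> region \<alpha>" shows "T_tilde \<alpha> (eq q) (vN q)$i$j ~= 0"
proof -
 have ne: "(eq q$i)^2 ~= \<alpha>^2 * (eq q$j)^2" for i j using region_exp_neq(1)[OF assms] by simp
 have "0 < (\<Sum>k\<in>UNIV. (vN q$k)^2 / ((eq q$i)^2 - \<alpha>\<^sup>2 * (eq q$k)^2)^2)"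
  using vN_pos[OF assms] ne by (intro sum_pos) (auto simp: less_imp_neq[symmetric])
 then show ?thesis unfolding T_tilde_nth[OF ne] using vN_pos[OF assms, of j] ne[of i j] by simp
qed

text \<open>
 The maps \<open>r\<close> and \<open>p\<close> below need not even be continuous, but these combinations do not change under the
 remaining freedom in them.
\<close>

lemma frame_products_differentiable:
 fixes F :: "'a::real_normed_vector => 'n bmat"
 assumes U: "open U" "a \<in> U" and F: "F differentiable at a" and q: "!!u. u \<in> U ==> q u \<in> region \<alpha>" and b: "base_frame \<rho> z"
  and uni: "!!u. u \<in> U ==> stab (R u)" "!!u. u \<in> U ==> unitary (r u)" "!!u. u \<in> U ==> unitary (k1 u)" "!!u. u \<in> U ==> unitary (k2 u)"
  and e: "!!u. u \<in> U ==> F u = blk (R u) 0 0 (r u)**sectionN \<rho> z (q u) (p u)**blk (k1 u) 0 0 (k2 u)"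
 shows "q differentiable at a" "(%u. exp (\<i> * of_real (p u$i))) differentiable at a"
  "(%u. r u$k$i * cnj (r u$l$j)) differentiable at a"
proof -
 note gb = gauge_blocks[OF b q uni e]
 define m where "m u = (\<chi> i. x^2 * (exp (q u$i))^2)" for u
 define M where "M u = blk21 (F u)**(blk21 (F u))\<^sup>H" for u
 define X where "X u = blk22 (F u)**(K22F (F u))\<^sup>H" for u
 note bd = blocks_differentiable[OF F]
 have Md: "M differentiable at a" unfolding M_def[abs_def] by (intro matrix_mult_differentiable ctrans_differentiable bd)
 have Xd: "X differentiable at a" unfolding X_def[abs_def] by (intro matrix_mult_differentiable ctrans_differentiable bd)
 have spec: "M u = r u**dmat (cvec (m u))**(r u)\<^sup>H" if "u \<in> U" for u
  unfolding M_def m_def using gb(5)[OF that that that that that that] .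
 have dec: "m u$j < m u$i" if "u \<in> U" "i < j" for u i j
 proof -
  have "exp (q u$j) < exp (q u$i)" using region_strict[OF q[OF that(1)] that(2)] by simp
  then show ?thesis using x_pos by (simp add: m_def power_strict_mono)
 qed
 have md: "m differentiable at a" by (rule simple_spectrum_differentiable[OF U Md spec uni(2) dec])
 have "(%u. ln (m u$i / x^2) / 2) differentiable at a" for i
  by (intro differentiable_divide ln_differentiable differentiable_const vec_nth_differentiable md) (use x_pos in \<open>simp_all add: m_def\<close>)
 moreover have "ln (m u$i / x^2) / 2 = q u$i" for u i
  using x_pos by (simp add: m_def ln_realpow)
 ultimately show qd: "q differentiable at a" by (intro vec_differentiableI) simp
 note Pr = spectral_projection_differentiable[OF U Md md spec uni(2) dec]
 note hyp = hyperbolic_differentiable[OF qd U q]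
 \<comment> \<open>Between the spectral projections for i and j, \<open>X\<close> retains only the
   entry (i, j) of \<Lambda> T cosh, which is e^(i p_i) times a non-vanishing real function of q;
   the projections contribute r_ki conj(r_lj).\<close>
 have main: "(%u. r u$k$i * exp (\<i> * of_real (p u$i)) * cnj (r u$l$j)) differentiable at a" for i j k l
 proof -
  let ?A = "%u. (r u**dmat (axis i 1)**(r u)\<^sup>H)**X u**(r u**dmat (axis j 1)**(r u)\<^sup>H)"
  let ?N = "%u. Lam x y (Dl (q u))$i$i * of_real (T_tilde \<alpha> (eq (q u)) (vN (q u))$i$j) * Cosh (Dl (q u))$j$j"
  have nz: "?N u ~= 0" if "u \<in> U" for u
  proof -
   have "0 < y^2 + x^2 * (exp (q u$i))^2" using y_pos by (simp add: add_pos_nonneg)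
   then have "sqrt (y^2 + x^2 * (exp (q u$i))^2) ~= 0" by simp
   moreover have "sqrt (1 + (exp (q u$j))^2) ~= 0" by (simp add: add_nonneg_eq_0_iff)
   ultimately show ?thesis using T_tilde_nz[OF q[OF that], of i j] by (simp add: Lam_Dl Cosh_Dl)
  qed
  have A: "(%u. ?A u$k$l) differentiable at a"
   by (rule matrix_differentiableD) (intro matrix_mult_differentiable Pr Xd)
  have "(%u. ?A u$k$l / ?N u) differentiable at a"
   by (intro A differentiable_divide differentiable_mult of_real_differentiable T_tilde_differentiable[OF qd U q] matrix_differentiableD hyp nz U)
  then show ?thesis
  proof (rule differentiable_cong_open[OF _ U])
   fix u assume u: "u \<in> U"
   let ?Y = "Lam x y (Dl (q u))**TN (q u) (p u) (vN (q u))**Cosh (Dl (q u))"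
   have "?A u = r u**dmat (axis i 1)**((r u)\<^sup>H**r u)**?Y**((r u)\<^sup>H**r u)**dmat (axis j 1)**(r u)\<^sup>H"
    unfolding X_def gb(6)[OF u u u u u u] by (simp only: mm_assoc)
   also have "... = r u**(dmat (axis i 1)**?Y**dmat (axis j 1))**(r u)\<^sup>H"
    by (simp add: unitaryD uni(2)[OF u] mm_assoc)
   also have "dmat (axis i 1)**?Y**dmat (axis j 1) = (\<chi> k l. if k = i & l = j then ?Y$i$j else 0)"
    by (simp add: dmat_mult_left dmat_mult_right vec_eq_iff axis_def)
   also have "(r u**...**(r u)\<^sup>H)$k$l = r u$k$i * ?Y$i$j * cnj (r u$l$j)"
   proof -
    have "(A**(\<chi> k l. if k = i & l = j then c else 0)**B)$k$l = A$k$i * c * B$j$l" for A B :: "'n cmat" and c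
    proof -
     have "(A**(\<chi> k l. if k = i & l = j then c else 0))$k$s = (if s = j then A$k$i * c else 0)" for s
      by (simp add: matrix_mult_nth if_distrib[of "%x. _ * x"] cong: if_cong)
     then show ?thesis by (simp add: matrix_mult_nth[of _ B] if_distrib[of "%x. x * _"] cong: if_cong)
    qed
    then show ?thesis by simp
   qed
   also have "?Y$i$j = ?N u * exp (\<i> * of_real (p u$i))"
    by (simp add: Lam_Dl Cosh_Dl dmat_mult_left dmat_mult_right TN_nth[OF q[OF u]])
   finally show "?A u$k$l / ?N u = r u$k$i * exp (\<i> * of_real (p u$i)) * cnj (r u$l$j)"
    using nz[OF u] by (simp add: field_simps)
  qed
 qed
 \<comment> \<open>With l = k and j = i, summation over k removes r, as its columns are unit
   vectors.\<close>
 have sd: "(%u. \<Sum>k\<in>UNIV. r u$k$i * exp (\<i> * of_real (p u$i)) * cnj (r u$k$i)) differentiable at a" for i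
  by (intro differentiable_sum ballI main) simp
 have se: "(\<Sum>k\<in>UNIV. r u$k$i * exp (\<i> * of_real (p u$i)) * cnj (r u$k$i)) = exp (\<i> * of_real (p u$i))" if "u \<in> U" for u i
 proof -
  have "((r u)\<^sup>H**r u)$i$i = 1" using unitaryD(1)[OF uni(2)[OF that]] by (simp add: mat_def)
  then have "(\<Sum>k\<in>UNIV. cnj (r u$k$i) * r u$k$i) = 1" by (simp add: matrix_mult_nth)
  moreover have "(\<Sum>k\<in>UNIV. r u$k$i * exp (\<i> * of_real (p u$i)) * cnj (r u$k$i)) = exp (\<i> * of_real (p u$i)) * (\<Sum>k\<in>UNIV. cnj (r u$k$i) * r u$k$i)"
   unfolding sum_distrib_left by (rule sum.cong) (simp_all add: mult_ac)
  ultimately show ?thesis by simp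
 qed
 show ex: "(%u. exp (\<i> * of_real (p u$i))) differentiable at a" for i
  by (rule differentiable_cong_open[OF sd[of i] U se])
 have rd: "(%u. (r u$k$i * exp (\<i> * of_real (p u$i)) * cnj (r u$l$j)) / exp (\<i> * of_real (p u$i))) differentiable at a"
  by (intro differentiable_divide main ex) simp
 show "(%u. r u$k$i * cnj (r u$l$j)) differentiable at a"
 proof (rule differentiable_cong_open[OF rd U])
  have "w * e * v / e = w * v" if "e ~= 0" for w e v :: complex using that by simp
  then show "r u$k$i * exp (\<i> * of_real (p u$i)) * cnj (r u$l$j) / exp (\<i> * of_real (p u$i)) = r u$k$i * cnj (r u$l$j)" for u
   by (metis exp_not_eq_zero)
 qed
qed

lemma coords_cong:
 assumes "coords \<alpha> vh \<sigma> x y g q p" "exp_i p' = exp_i p" shows "coords \<alpha> vh \<sigma> x y g q p'"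
 using assms unfolding coords_iff TN_def by simp

lemma exists_section_gauge:
 fixes F :: "'a::real_normed_vector => 'n bmat"
 assumes c: "!!u. u \<in> U ==> coords \<alpha> vh \<sigma> x y (F u) (q u) (p u)" and b: "base_frame \<rho> z"
 obtains R r k1 k2 where "!!u. u \<in> U ==> stab (R u)" "!!u. u \<in> U ==> unitary (r u)" "!!u. u \<in> U ==> unitary (k1 u)"
  "!!u. u \<in> U ==> unitary (k2 u)"
  "!!u. u \<in> U ==> F u = blk (R u) 0 0 (r u)**sectionN \<rho> z (q u) (p u)**blk (k1 u) 0 0 (k2 u)"
proof -
 have "\<forall>u\<in>U. \<exists>R r k1 k2. stab R & unitary r & unitary k1 & unitary k2 & F u = blk R 0 0 r**sectionN \<rho> z (q u) (p u)**blk k1 0 0 k2"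
  using section_gauge[OF c b] by blast
 then show ?thesis using that unfolding bchoice_iff by blast
qed

lemma differentiable_on_openD: "F differentiable_on U ==> open U ==> u \<in> U ==> F differentiable at u"
 by (simp add: differentiable_on_eq_differentiable_at)

text \<open>The pointwise chosen p may jump by multiples of 2\<pi>; only e^(ip) is known to be
  differentiable. Near a its quotient by the value at a lies in the right half plane, where the
  principal logarithm provides a differentiable lift.\<close>

lemma differentiable_coords:
 fixes F :: "'a::real_normed_vector => 'n bmat"
 assumes U: "open U" "a \<in> U" and F: "F differentiable_on U" and c: "!!u. u \<in> U ==> \<exists>q p. coords \<alpha> vh \<sigma> x y (F u) q p"
 shows "\<exists>V Q P. open V & a \<in> V & V \<subseteq> U & Q differentiable_on V & P differentiable_on V &
    (\<forall>u\<in>V. coords \<alpha> vh \<sigma> x y (F u) (Q u) (P u))"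
proof -
 obtain q p where qp: "!!u. u \<in> U ==> coords \<alpha> vh \<sigma> x y (F u) (q u) (p u)" using c by metis
 have q: "q u \<in> region \<alpha>" if "u \<in> U" for u using qp[OF that] by (simp add: coords_iff)
 obtain \<rho> z where b: "base_frame \<rho> z" using exists_base_frame[OF q[OF U(2)]] by blast
 obtain R r k1 k2 where g: "!!u. u \<in> U ==> stab (R u)" "!!u. u \<in> U ==> unitary (r u)" "!!u. u \<in> U ==> unitary (k1 u)"
  "!!u. u \<in> U ==> unitary (k2 u)"
  "!!u. u \<in> U ==> F u = blk (R u) 0 0 (r u)**sectionN \<rho> z (q u) (p u)**blk (k1 u) 0 0 (k2 u)"
  by (rule exists_section_gauge[of U F q p, OF qp b], assumption, rule that)
 note D = frame_products_differentiable(1,2)[OF U(1) _ differentiable_on_openD[OF F U(1)] q b g]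
 define w where "w i u = exp (\<i> * complex_of_real (p u$i)) / exp (\<i> * complex_of_real (p a$i))" for i u
 have wd: "w i differentiable at u" if "u \<in> U" for i u
  unfolding w_def by (intro differentiable_divide D that differentiable_const exp_not_eq_zero)
 have wc: "continuous_on U (w i)" for i
  using wd differentiable_imp_continuous_within by (intro continuous_at_imp_continuous_on) blast
 define V where "V = U \<inter> (\<Inter>i. {u \<in> U. 0 < Re (w i u)})"
 have o: "open {u \<in> U. 0 < Re (w i u)}" for i
  using continuous_open_preimage[OF wc[of i] U(1) open_halfspace_Re_gt[of 0]] by (simp add: vimage_def Int_def)
 have "open V" unfolding V_def by (intro open_Int open_INT U finite ballI o)
 then have V: "open V" "a \<in> V" "V \<subseteq> U" using U by (auto simp: V_def w_def)
 define P where "P u = (\<chi> i. p a$i + Im (Ln (w i u)))" for u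
 have pos: "w i u \<notin> \<real>\<^sub>\<le>\<^sub>0" "w i u ~= 0" if "u \<in> V" for i u
 proof -
  have "0 < Re (w i u)" using that by (simp add: V_def)
  then show "w i u \<notin> \<real>\<^sub>\<le>\<^sub>0" "w i u ~= 0" by (auto simp: complex_nonpos_Reals_iff)
 qed
 have "(%u. P u$i) differentiable at u" if u: "u \<in> V" for i u
 proof -
  have "(%u. Ln (w i u)) differentiable at u"
  proof -
   obtain w' where w': "(w i has_derivative w') (at u)" using wd[of u i] u V(3) unfolding differentiable_def by blast
   have "(Ln has_derivative (%h. inverse (w i u) * h)) (at (w i u))"
    using has_field_derivative_Ln[OF pos(1)[OF u]] by (simp add: has_field_derivative_def)
   from has_derivative_compose[OF w' this] show ?thesis unfolding differentiable_def by blast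
  qed
  then show ?thesis unfolding P_def vec_lambda_beta by (intro differentiable_add differentiable_const Im_differentiable)
 qed
 then have Pd: "P differentiable_on V" by (intro differentiable_at_imp_differentiable_on vec_differentiableI)
 have Qd: "q differentiable_on V" using D(1) V(3) by (intro differentiable_at_imp_differentiable_on) blast
 have "exp_i (P u) = exp_i (p u)" if u: "u \<in> V" for u
 proof -
  have "exp (\<i> * complex_of_real (P u$i)) = exp (\<i> * complex_of_real (p u$i))" for i
  proof -
   have "cmod (w i u) = 1" by (simp add: w_def norm_divide)
   then have "Re (Ln (w i u)) = 0" using pos(2)[OF u] by simp
   then have "\<i> * complex_of_real (Im (Ln (w i u))) = Ln (w i u)" by (simp add: complex_eq_iff)
   then have "exp (\<i> * complex_of_real (P u$i)) = exp (\<i> * complex_of_real (p a$i)) * exp (Ln (w i u))"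
    by (simp add: P_def distrib_left exp_add)
   also have "... = exp (\<i> * complex_of_real (p u$i))" using pos(2)[OF u] by (simp add: w_def)
   finally show ?thesis .
  qed
  then show ?thesis by (simp add: exp_i_def)
 qed
 then have "\<forall>u\<in>V. coords \<alpha> vh \<sigma> x y (F u) (q u) (P u)" using coords_cong qp V(3) by blast
 then show ?thesis using V Pd Qd by blast
qed

text \<open>
 The frame \<open>r\<close> diagonalises \<open>C\<^sub>FC\<^sub>F\<^sup>H\<close> and is determined up to a common phase of its columns; fixing the
 phase of one entry makes it, and with it the other gauge factors, differentiable.
\<close>

lemma pull_symp_coords:
 fixes F :: "'a::real_normed_vector => 'n bmat"
 assumes U: "open U" "a \<in> U" and F: "F differentiable_on U"
  and Q: "(Q has_derivative Q') (at a)" and P: "(P has_derivative P') (at a)"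
  and c: "!!u. u \<in> U ==> coords \<alpha> vh \<sigma> x y (F u) (Q u) (P u)"
 shows "pull_symp F a X Y = 2 * (\<Sum>i\<in>UNIV. P' X$i * Q' Y$i - P' Y$i * Q' X$i)"
proof -
 have q: "Q u \<in> region \<alpha>" if "u \<in> U" for u using c[OF that] by (simp add: coords_iff)
 obtain \<rho> z where b: "base_frame \<rho> z" using exists_base_frame[OF q[OF U(2)]] by blast
 obtain R r k1 k2 where g: "!!u. u \<in> U ==> stab (R u)" "!!u. u \<in> U ==> unitary (r u)" "!!u. u \<in> U ==> unitary (k1 u)"
  "!!u. u \<in> U ==> unitary (k2 u)"
  "!!u. u \<in> U ==> F u = blk (R u) 0 0 (r u)**sectionN \<rho> z (Q u) (P u)**blk (k1 u) 0 0 (k2 u)"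
  by (rule exists_section_gauge[of U F Q P, OF c b], assumption, rule that)
 note rd = frame_products_differentiable(3)[OF U(1) _ differentiable_on_openD[OF F U(1)] q b g]
 have Qd: "Q differentiable at a" and Pd: "P differentiable at a" using Q P unfolding differentiable_def by blast+
 have Fd: "F differentiable at a" using differentiable_on_openD[OF F U] .
 \<comment> \<open>Some entry of r that does not vanish at a; it serves as the phase
   reference.\<close>
 obtain l j where lj: "r a$l$j ~= 0"
 proof -
  have "det (r a) ~= 0" using unitary_det[OF g(2)[OF U(2)]] by auto
  then show ?thesis using nonzero_row that by blast
 qed
 define V where "V = {u \<in> U. r u$l$j * cnj (r u$l$j) ~= 0}"
 have "continuous_on U (%u. r u$l$j * cnj (r u$l$j))"
  using rd differentiable_imp_continuous_within by (intro continuous_at_imp_continuous_on) blast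
 from continuous_open_preimage[OF this U(1) open_Compl[OF closed_singleton[of 0]]] have Vo: "open V" by (simp add: V_def vimage_def Int_def)
 have V: "open V" "a \<in> V" "!!u. u \<in> V ==> u \<in> U" "!!u. u \<in> V ==> r u$l$j ~= 0" using Vo U lj by (auto simp: V_def)
 \<comment> \<open>This phase makes the reference entry positive, and the entries of
   \<open>r2\<close> become r_ki conj(r_lj) / |r_lj|, which are differentiable by the preceding
   products.\<close>
 define t where "t u = cnj (r u$l$j) / of_real (cmod (r u$l$j))" for u
 have t: "cmod (t u) = 1" "cnj (t u) * t u = 1" "t u * cnj (t u) = 1" if "u \<in> V" for u
 proof -
  show "cmod (t u) = 1" using V(4)[OF that] by (simp add: t_def norm_divide)
  then show "cnj (t u) * t u = 1" "t u * cnj (t u) = 1" by (metis complex_norm_square mult.commute of_real_1 one_power2)+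
 qed
 define R2 r2 where "R2 u = R u**mat (t u)" and "r2 u = r u**mat (t u)" for u
 define h1 h2 where "h1 u = mat (cnj (t u))**k1 u" and "h2 u = mat (cnj (t u))**k2 u" for u
 have uni: "stab (R2 u)" "unitary (r2 u)" "unitary (h1 u)" "unitary (h2 u)" if "u \<in> V" for u
  unfolding R2_def r2_def h1_def h2_def using g(1-4)[OF V(3)[OF that]] t[OF that]
  by (auto intro!: stab_mult stab_mat unitary_mult unitary_mat)
 have e: "F u = blk (R2 u) 0 0 (r2 u)**sectionN \<rho> z (Q u) (P u)**blk (h1 u) 0 0 (h2 u)" if u: "u \<in> V" for u
 proof -
  let ?S = "sectionN \<rho> z (Q u) (P u)"
  have 1: "blk (R2 u) 0 0 (r2 u) = blk (R u) 0 0 (r u)**mat (t u)" "blk (h1 u) 0 0 (h2 u) = mat (cnj (t u))**blk (k1 u) 0 0 (k2 u)"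
   by (simp_all add: mat_eq_blk[of "t u"] mat_eq_blk[of "cnj (t u)"] blk_mult R2_def r2_def h1_def h2_def)
  have "blk (R2 u) 0 0 (r2 u)**?S**blk (h1 u) 0 0 (h2 u) = blk (R u) 0 0 (r u)**(mat (t u)**?S**mat (cnj (t u)))**blk (k1 u) 0 0 (k2 u)"
   unfolding 1 by (simp only: mm_assoc)
  also have "mat (t u)**?S**mat (cnj (t u)) = ?S"
   by (simp add: mat_mult_commute[of "mat (t u)**?S"] mm_assoc mat_mult_mat t[OF u])
  finally show ?thesis using g(5)[OF V(3)[OF u]] by simp
 qed
 have r2d: "r2 differentiable at a"
 proof (rule matrix_differentiableI)
  fix k i
  have p: "0 < Re (r a$l$j * cnj (r a$l$j))" using lj by (simp flip: complex_norm_square of_real_power)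
  have "(%u. r u$k$i * cnj (r u$l$j) / of_real (sqrt (Re (r u$l$j * cnj (r u$l$j))))) differentiable at a"
   using p by (intro differentiable_divide rd U of_real_differentiable sqrt_differentiable Re_differentiable) auto
  moreover have "sqrt (Re (r u$l$j * cnj (r u$l$j))) = cmod (r u$l$j)" for u
   by (simp add: cmod_def power2_eq_square)
  ultimately show "(%u. r2 u$k$i) differentiable at a" by (simp add: r2_def t_def mat_mult_right)
 qed
 note gb = gauge_blocks[OF b q[OF V(3)] uni e]
 note bd = blocks_differentiable[OF Fd]
 note hyp = hyperbolic_differentiable[OF Qd V(1,2) q[OF V(3)]]
 \<comment> \<open>The remaining gauge factors are solved for from the blocks of F, in the order h1,
   h2, R2.\<close>
 have h1d: "h1 differentiable at a"
 proof (rule differentiable_cong_open[OF _ V(1,2)])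
  show "(%u. (1 / x) *\<^sub>R (SinhI (Dl (Q u))**(r2 u)\<^sup>H**blk21 (F u))) differentiable at a"
   by (intro differentiable_scaleR differentiable_const matrix_mult_differentiable hyp ctrans_differentiable r2d bd)
  fix u assume u: "u \<in> V"
  have "(1 / x) *\<^sub>R (SinhI (Dl (Q u))**(r2 u)\<^sup>H**blk21 (F u)) = SinhI (Dl (Q u))**((r2 u)\<^sup>H**r2 u)**Sinh (Dl (Q u))**h1 u"
   unfolding gb(2)[OF u u u u u u] using x_pos by (simp add: mm_ring)
  then show "(1 / x) *\<^sub>R (SinhI (Dl (Q u))**(r2 u)\<^sup>H**blk21 (F u)) = h1 u"
   by (simp add: unitaryD uni[OF u] Sinh_SinhI Dl_chamber q V(3)[OF u])
 qed
 have h2d: "h2 differentiable at a"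
 proof (rule differentiable_cong_open[OF _ V(1,2)])
  show "(%u. CoshI (Dl (Q u))**(r2 u)\<^sup>H**K22F (F u)) differentiable at a"
   by (intro matrix_mult_differentiable hyp ctrans_differentiable r2d bd)
  fix u assume u: "u \<in> V"
  have "CoshI (Dl (Q u))**(r2 u)\<^sup>H**K22F (F u) = CoshI (Dl (Q u))**((r2 u)\<^sup>H**r2 u)**Cosh (Dl (Q u))**h2 u"
   unfolding gb(4)[OF u u u u u u] by (simp add: mm_assoc)
  then show "CoshI (Dl (Q u))**(r2 u)\<^sup>H**K22F (F u) = h2 u"
   by (simp add: unitaryD uni[OF u] Cosh_CoshI)
 qed
 have R2d: "R2 differentiable at a"
 proof (rule differentiable_cong_open[OF _ V(1,2)])
  show "(%u. (1 / x) *\<^sub>R (blk11 (F u)**(h1 u)\<^sup>H**CoshI (Dl (Q u))**(rhoN \<rho> z (Q u))\<^sup>H)) differentiable at a"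
   by (intro differentiable_scaleR differentiable_const matrix_mult_differentiable hyp ctrans_differentiable h1d bd
     rhoN_differentiable[OF Qd V(1,2) q[OF V(3)] b])
  fix u assume u: "u \<in> V"
  let ?r = "rhoN \<rho> z (Q u)"
  have "(1 / x) *\<^sub>R (blk11 (F u)**(h1 u)\<^sup>H**CoshI (Dl (Q u))**?r\<^sup>H) = R2 u**(?r**(Cosh (Dl (Q u))**(h1 u**(h1 u)\<^sup>H)**CoshI (Dl (Q u)))**?r\<^sup>H)"
   unfolding gb(1)[OF u u u u u u] using x_pos by (simp add: mm_ring)
  then show "(1 / x) *\<^sub>R (blk11 (F u)**(h1 u)\<^sup>H**CoshI (Dl (Q u))**?r\<^sup>H) = R2 u"
   by (simp add: unitaryD uni[OF u] Cosh_CoshI rhoN_props(1)[OF b q[OF V(3)[OF u]]])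
 qed
 have "pull_symp F a X Y = pull_symp (%u. sectionN \<rho> z (Q u) (P u)) a X Y"
 proof (rule pull_symp_gauge[OF V(1,2) _ _ e uni])
  show "sectionN \<rho> z (Q u) (P u) \<in> C" if "u \<in> V" for u using sectionN_blocks(1)[OF b q[OF V(3)[OF that]]] .
  show "F u \<in> C" if "u \<in> V" for u using coords_in_C[OF c[OF V(3)[OF that]]] .
  show "(%u. sectionN \<rho> z (Q u) (P u)) differentiable at a"
   by (rule section_parts_differentiable(4)[OF Qd V(1,2) q[OF V(3)] b Pd])
 qed (assumption | rule R2d r2d h1d h2d)+
 also have "... = 2 * (\<Sum>i\<in>UNIV. P' X$i * Q' Y$i - P' Y$i * Q' X$i)"
  by (rule pull_symp_section[OF Q P U q b])
 finally show ?thesis .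
qed

end

subsection \<open>Hermitian matrices with simple spectrum\<close>

text \<open>The eigenvalues are given as zeros of a determinant, as the intermediate value theorem
  produces them. Kernel vectors for distinct ones are orthogonal, and n of them, normalised, form
  the unitary.\<close>

lemma hermitian_simple_spectrum:
 fixes A :: "('n::finite) cmat" and l :: "'n rvec"
 assumes A: "A\<^sup>H = A" and l: "!!i j. i ~= j ==> l$i ~= l$j"
  and z: "!!i. det (mat (complex_of_real (l$i)) - A) = 0"
 shows "\<exists>r. unitary r & A = r**dmat (cvec l)**r\<^sup>H"
proof -
 have "\<exists>v. v ~= 0 & A *v v = of_real (l$i) *s v" for i
 proof -
  have "\<not> invertible (mat (complex_of_real (l$i)) - A)" using z[of i] by (simp add: invertible_det_nz)
  then obtain v where v: "v ~= 0" "(mat (complex_of_real (l$i)) - A) *v v = 0"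
   by (metis invertible_left_inverse matrix_left_invertible_ker)
  then have "mat (complex_of_real (l$i)) *v v = A *v v" by (simp add: matrix_vector_mult_diff_rdistrib)
  moreover have "mat (complex_of_real (l$i)) *v v = of_real (l$i) *s v"
   by (simp add: vec_eq_iff matrix_vector_mult_def mat_def if_distrib[of "%x. x * _"] cong: if_cong)
  ultimately show ?thesis using v by metis
 qed
 then obtain v where v: "!!i. v i ~= 0" "!!i. A *v v i = of_real (l$i) *s v i" by metis
 define s where "s i = (\<Sum>k\<in>UNIV. (cmod (v i$k))^2)" for i
 have s: "0 < s i" for i
 proof -
  obtain k where "v i$k ~= 0" using v(1)[of i] by (auto simp: vec_eq_iff)
  then show ?thesis unfolding s_def by (intro sum_pos2[of _ k]) auto
 qed
 define V where "V = (\<chi> i j. v j$i)"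
 have AV: "A**V = V**dmat (cvec l)"
 proof -
  have "(A *v v j)$i = of_real (l$j) * v j$i" for i j using v(2)[of j] by simp
  then show ?thesis by (simp add: dmat_mult_right vec_eq_iff V_def matrix_mult_nth matrix_vector_mult_def mult.commute)
 qed
 have "(V\<^sup>H**V)**dmat (cvec l) = dmat (cvec l)**(V\<^sup>H**V)"
 proof -
  have "V\<^sup>H**A = dmat (cvec l)**V\<^sup>H" using arg_cong[OF AV, of ctrans] by (simp add: ctrans_mult A)
  then have "V\<^sup>H**(A**V) = dmat (cvec l)**(V\<^sup>H**V)" by (simp add: mm_assoc)
  then show ?thesis unfolding AV by (simp add: mm_assoc)
 qed
 then have "(V\<^sup>H**V)$i$j * of_real (l$j) = of_real (l$i) * (V\<^sup>H**V)$i$j" for i j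
  by (simp add: dmat_mult_left dmat_mult_right vec_eq_iff)
 then have off: "(V\<^sup>H**V)$i$j = 0" if "i ~= j" for i j
  using l[OF that] by (metis mult.commute mult_cancel_left of_real_eq_iff)
 have dia: "(V\<^sup>H**V)$i$i = of_real (s i)" for i
  by (simp add: matrix_mult_nth V_def s_def) (simp add: complex_norm_square[symmetric] mult.commute flip: of_real_power)
 have VV: "V\<^sup>H**V = dmat (cvec (\<chi> i. s i))"
  using off dia by (simp add: vec_eq_iff)
 define N where "N = dmat (cvec (\<chi> i. 1 / sqrt (s i)))"
 define r where "r = V**N"
 have "r\<^sup>H**r = N**(V\<^sup>H**V)**N" by (simp add: r_def N_def ctrans_mult mm_assoc)
 also have "... = mat 1"
 proof -
  have "1 / sqrt (s i) * s i * (1 / sqrt (s i)) = 1" for i using s[of i] by (simp add: real_div_sqrt)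
  then have "complex_of_real (1 / sqrt (s i)) * of_real (s i) * of_real (1 / sqrt (s i)) = 1" for i
   by (metis of_real_1 of_real_mult)
  then show ?thesis unfolding VV N_def by (simp add: dmat_mult_dmat vec_eq_iff mat_def)
 qed
 finally have r: "unitary r" by (simp add: unitary_def)
 have "A**r = r**dmat (cvec l)"
 proof -
  have "A**r = V**(dmat (cvec l)**N)" by (simp add: r_def mm_assoc AV)
  also have "dmat (cvec l)**N = N**dmat (cvec l)" by (simp add: N_def dmat_mult_commute)
  finally show ?thesis by (simp add: r_def mm_assoc)
 qed
 then have "A**(r**r\<^sup>H) = r**dmat (cvec l)**r\<^sup>H" by (simp add: mm_assoc)
 then show ?thesis using r by (auto simp: unitaryD)
qed

lemma simple_spectrum_unique:
 fixes r r' :: "('n::{finite,linorder}) cmat"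
 assumes u: "unitary r" "unitary r'" and e: "r**dmat (cvec m)**r\<^sup>H = r'**dmat (cvec m')**r'\<^sup>H"
  and dec: "!!i j. i < j ==> m$j < m$i" "!!i j. i < j ==> m'$j < m'$i"
 shows "m = m'"
proof -
 let ?w = "r'\<^sup>H**r"
 have "?w**dmat (cvec m) = r'\<^sup>H**(r**dmat (cvec m)**r\<^sup>H)**r"
  by (simp add: mm_assoc) (simp add: mm_assoc[symmetric] unitaryD u)
 also have "... = (r'\<^sup>H**r')**dmat (cvec m')**?w" unfolding e by (simp only: mm_assoc)
 finally have "?w**dmat (cvec m) = dmat (cvec m')**?w" using u by (simp add: unitaryD)
 moreover have "det ?w ~= 0" using unitary_det[OF unitary_mult[of "r'\<^sup>H" r]] u by auto
 ultimately have "($) m = ($) m'" using intertwiner_diagonal(1)[of ?w "($) m" "($) m'"] dec by simp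
 then show ?thesis by (simp add: vec_eq_iff)
qed

text \<open>The n roots found near the n old eigenvalues are distinct, hence the whole spectrum. As
  M u is Hermitian, the determinant is real, so the vanishing of its real part is enough.\<close>

lemma simple_spectrum_persists:
 fixes M :: "'a::real_normed_vector => ('n::{finite,linorder}) cmat"
 assumes M: "M differentiable at a" and herm: "!!u. (M u)\<^sup>H = M u"
  and M0: "M a = r0**dmat (cvec m0)**r0\<^sup>H" "unitary r0" and dec: "!!i j. i < j ==> m0$j < m0$i" and e: "0 < e"
 shows "eventually (%u. \<exists>r m. unitary r & M u = r**dmat (cvec m)**r\<^sup>H & (\<forall>i j. i < j --> m$j < m$i) & (\<forall>i. \<bar>m$i - m0$i\<bar> < e)) (nhds a)"
proof -
 obtain d where d: "0 < d" "d \<le> e" "!!i j. i < j ==> 2 * d \<le> m0$i - m0$j"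
  using exists_gap[of m0 e, OF dec e] by blast
 have "eventually (%u. \<forall>i. \<exists>l. \<bar>l - m0$i\<bar> < d & Re (det (mat (complex_of_real l) - M u)) = 0) (nhds a)"
  by (rule charpoly_roots_persist[OF M M0 dec d(1)])
 then show ?thesis
 proof (rule eventually_mono)
  fix u assume "\<forall>i. \<exists>l. \<bar>l - m0$i\<bar> < d & Re (det (mat (complex_of_real l) - M u)) = 0"
  then obtain l0 where l0: "!!i. \<bar>l0 i - m0$i\<bar> < d" "!!i. Re (det (mat (complex_of_real (l0 i)) - M u)) = 0" by metis
  define l where "l = (\<chi> i. l0 i)"
  have l: "\<bar>l$i - m0$i\<bar> < d" "Re (det (mat (complex_of_real (l$i)) - M u)) = 0" for i using l0 by (simp_all add: l_def)
  have ld: "l$j < l$i" if "i < j" for i j using l(1)[of i] l(1)[of j] d(3)[OF that] by linarith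
  have "det (mat (complex_of_real (l$i)) - M u) = 0" for i
  proof -
   have "(mat (complex_of_real (l$i)) - M u)\<^sup>H = mat (complex_of_real (l$i)) - M u" by (simp add: ctrans_diff herm)
   then have "cnj (det (mat (complex_of_real (l$i)) - M u)) = det (mat (complex_of_real (l$i)) - M u)"
    by (metis det_ctrans)
   then show ?thesis using l(2)[of i] by (metis complex_eq_iff cnj.sel(2) neg_equal_zero zero_complex.simps)
  qed
  moreover have "l$i ~= l$j" if "i ~= j" for i j using ld that by (metis less_irrefl linorder_neqE)
  ultimately obtain r where "unitary r" "M u = r**dmat (cvec l)**r\<^sup>H" using hermitian_simple_spectrum[OF herm] by metis
  moreover have "\<bar>l$i - m0$i\<bar> < e" for i using l(1)[of i] d(2) by linarith
  ultimately show "\<exists>r m. unitary r & M u = r**dmat (cvec m)**r\<^sup>H & (\<forall>i j. i < j --> m$j < m$i) & (\<forall>i. \<bar>m$i - m0$i\<bar> < e)"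
   using ld by blast
 qed
qed

subsection \<open>The Cartan decomposition from the lower left block\<close>

text \<open>The singular value decomposition of the lower left block supplies \<Delta>, \<tau> = r
  and the right factor l1. Pseudo-unitarity then gives k22 k22^H = r cosh^2 r^H and k11^H k11 = l1^H
  cosh^2 l1, which yield l2 and \<rho>, and it determines k12. Regularity becomes a condition on the
  spectrum of one Hermitian matrix.\<close>

lemma regularI_spectrum:
 fixes k :: "('n::{finite,linorder}) bmat"
 assumes k: "Unn k" and r: "unitary r" and M: "blk21 k**(blk21 k)\<^sup>H = r**dmat (cvec m)**r\<^sup>H"
  and dec: "!!i j. i < j ==> m$j < m$i" and pos: "!!i. 0 < m$i"
 shows "regular k"
proof -
 obtain k11 k12 k21 k22 where kb: "k = blk k11 k12 k21 k22" by (rule blk_cases)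
 define Delta where "Delta = (\<chi> i. arsinh (sqrt (m$i)))"
 have sh: "sinh (Delta$i) = sqrt (m$i)" for i by (simp add: Delta_def)
 have Delta: "Delta \<in> chamber"
 proof -
  have "sinh (Delta$j) < sinh (Delta$i)" if "i < j" for i j using dec[OF that] by (simp add: sh)
  moreover have "sinh 0 < sinh (Delta$i)" for i using pos[of i] unfolding sh by simp
  ultimately show ?thesis unfolding chamber_def sinh_real_less_iff by simp
 qed
 define S Si Gm Gi where "S = Sinh Delta" and "Si = SinhI Delta" and "Gm = Cosh Delta" and "Gi = CoshI Delta"
 have SS: "S**Si = mat 1" "Si**S = mat 1" and GG: "Gm**Gi = mat 1" "Gi**Gm = mat 1"
  using Sinh_SinhI[OF Delta] Cosh_CoshI by (simp_all add: S_def Si_def Gm_def Gi_def)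
 have ct: "S\<^sup>H = S" "Si\<^sup>H = Si" "Gm\<^sup>H = Gm" "Gi\<^sup>H = Gi" by (simp_all add: S_def Si_def Gm_def Gi_def)
 have S2: "S**S = dmat (cvec m)"
  using pos by (simp add: S_def Sinh_def sh dmat_mult_dmat vec_eq_iff less_imp_le flip: of_real_mult)
 have G2: "Gm**Gm = S**S + mat 1" by (simp add: Gm_def S_def Cosh_square)
 have SG: "S**Gm = Gm**S" by (simp add: Gm_def S_def Sinh_Cosh_commute)
 have rr: "r**r\<^sup>H = mat 1" "r\<^sup>H**r = mat 1" using unitaryD[OF r] by auto
 have M': "k21**k21\<^sup>H = r**(S**S)**r\<^sup>H" using M by (simp add: kb S2)
 from Unn_flip[OF k] have e1: "k21**k21\<^sup>H - k22**k22\<^sup>H = - mat 1" "k11**k21\<^sup>H - k12**k22\<^sup>H = 0"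
  by (auto simp: kb Inn_def blk_simps blk_eq_iff matrix_uminus_left matrix_uminus_right)
 from k have e2: "k11\<^sup>H**k11 - k21\<^sup>H**k21 = mat 1"
  by (auto simp: Unn_def kb Inn_def blk_simps blk_eq_iff matrix_uminus_left matrix_uminus_right)
 have M22: "k22**k22\<^sup>H = r**(Gm**Gm)**r\<^sup>H"
 proof -
  have "k22**k22\<^sup>H = k21**k21\<^sup>H + mat 1" using e1(1) by (simp add: algebra_simps eq_neg_iff_add_eq_0)
  then show ?thesis by (simp add: M' G2 matrix_add_ldistrib matrix_add_rdistrib rr)
 qed
 define l1 l2 where "l1 = Si**r\<^sup>H**k21" and "l2 = Gi**r\<^sup>H**k22"
 have k21: "k21 = r**S**l1" and k22: "k22 = r**Gm**l2"
 proof -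
  have "r**S**l1 = r**(S**Si)**r\<^sup>H**k21" "r**Gm**l2 = r**(Gm**Gi)**r\<^sup>H**k22"
   by (simp_all only: l1_def l2_def mm_assoc)
  then show "k21 = r**S**l1" "k22 = r**Gm**l2" by (simp_all add: SS GG rr)
 qed
 have "l1**l1\<^sup>H = Si**r\<^sup>H**(k21**k21\<^sup>H)**r**Si" by (simp add: l1_def ctrans_mult ct mm_assoc)
 also have "... = (Si**(r\<^sup>H**r)**S)**(S**(r\<^sup>H**r)**Si)" unfolding M' by (simp only: mm_assoc)
 finally have u1: "unitary l1" using unitary_ctrans[of l1] by (simp add: unitary_def rr SS)
 have "l2**l2\<^sup>H = Gi**r\<^sup>H**(k22**k22\<^sup>H)**r**Gi" by (simp add: l2_def ctrans_mult ct mm_assoc)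
 also have "... = (Gi**(r\<^sup>H**r)**Gm)**(Gm**(r\<^sup>H**r)**Gi)" unfolding M22 by (simp only: mm_assoc)
 finally have u2: "unitary l2" using unitary_ctrans[of l2] by (simp add: unitary_def rr GG)
 define \<rho> where "\<rho> = k11**l1\<^sup>H**Gi"
 have k11: "k11 = \<rho>**Gm**l1"
 proof -
  have "\<rho>**Gm**l1 = k11**(l1\<^sup>H**(Gi**Gm)**l1)" by (simp only: \<rho>_def mm_assoc)
  then show ?thesis by (simp add: GG unitaryD u1)
 qed
 have kk: "k11\<^sup>H**k11 = l1\<^sup>H**(Gm**Gm)**l1"
 proof -
  have "k21\<^sup>H**k21 = l1\<^sup>H**S**(r\<^sup>H**r)**S**l1" unfolding k21 by (simp add: ctrans_mult ct mm_assoc)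
  then have "k21\<^sup>H**k21 = l1\<^sup>H**(S**S)**l1" by (simp add: rr mm_assoc)
  then show ?thesis using e2 by (simp add: G2 matrix_add_ldistrib matrix_add_rdistrib unitaryD u1 algebra_simps)
 qed
 have "\<rho>\<^sup>H**\<rho> = Gi**l1**(k11\<^sup>H**k11)**l1\<^sup>H**Gi" by (simp add: \<rho>_def ctrans_mult ct mm_assoc)
 also have "... = (Gi**(l1**l1\<^sup>H)**Gm)**(Gm**(l1**l1\<^sup>H)**Gi)" unfolding kk by (simp only: mm_assoc)
 finally have u\<rho>: "unitary \<rho>" unfolding unitary_def by (simp add: unitaryD[OF u1] GG)
 have k12: "k12 = \<rho>**S**l2"
 proof -
  have c: "k22\<^sup>H**(r**Gi**l2) = mat 1"
  proof -
   have "k22\<^sup>H**(r**Gi**l2) = l2\<^sup>H**Gm**(r\<^sup>H**r)**Gi**l2" unfolding k22 by (simp add: ctrans_mult ct mm_assoc)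
   then show ?thesis by (simp add: rr) (simp add: mm_assoc[symmetric], simp add: mm_assoc GG unitaryD u2)
  qed
  have "k12 = k12**(k22\<^sup>H**(r**Gi**l2))" by (simp add: c)
  also have "... = (k12**k22\<^sup>H)**(r**Gi**l2)" by (simp only: mm_assoc)
  also have "k12**k22\<^sup>H = k11**k21\<^sup>H" using e1(2) by simp
  also have "(k11**k21\<^sup>H)**(r**Gi**l2) = \<rho>**Gm**(l1**l1\<^sup>H)**S**(r\<^sup>H**r)**Gi**l2"
   unfolding k11 k21 by (simp add: ctrans_mult ct mm_assoc)
  also have "... = \<rho>**(S**Gm)**Gi**l2" unfolding SG by (simp add: rr unitaryD u1 mm_assoc)
  also have "... = \<rho>**S**(Gm**Gi)**l2" by (simp only: mm_assoc)
  finally show ?thesis by (simp add: GG)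
 qed
 have "k = blk \<rho> 0 0 r**Hyp Delta**blk l1 0 0 l2"
  unfolding kb Hyp_def S_def[symmetric] Gm_def[symmetric] by (simp add: blk_mult blk_eq_iff k11 k12 k21 k22)
 then show ?thesis using regular_Hyp[OF u\<rho> r u1 u2 Delta] by simp
qed

context reduction begin

text \<open>Any normal form of g diagonalises the same Hermitian matrix with the eigenvalues x^2
  sinh^2 \<Delta>_i. Decreasing spectra are unique, so the gap condition on m is one on q.\<close>

lemma coordsI_spectrum:
 assumes g: "g \<in> C" and r: "unitary r" and M: "blk21 g**(blk21 g)\<^sup>H = r**dmat (cvec m)**r\<^sup>H"
  and dec: "!!i j. i < j ==> m$j < m$i" and reg: "!!i j. i < j ==> m$j < \<alpha>^2 * m$i"
 shows "\<exists>q p. coords \<alpha> vh \<sigma> x y g q p"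
proof -
 obtain \<rho> Delta T where nd: "normal_data \<sigma> \<rho> Delta T" and G: "(g, NF \<rho> Delta T) \<in> G" using exists_normal_form[OF g] by blast
 have D: "Delta \<in> chamber" using nd by (simp add: normal_data_def)
 obtain R s k1 k2 where u: "unitary s" "unitary k1" "unitary k2" and e: "g = blk R 0 0 s**NF \<rho> Delta T**blk k1 0 0 k2"
  using gauge_sym[OF G] unfolding gauge_rel_iff by blast
 have N: "NF \<rho> Delta T = blk (blk11 (NF \<rho> Delta T)) (blk12 (NF \<rho> Delta T)) (x *\<^sub>R Sinh Delta) (blk22 (NF \<rho> Delta T))"
  by (simp add: normal_form_eq[OF D] Hyp_def bR_def blk_mult smat_eq matrix_scaleR_right)
 have "blk21 g = x *\<^sub>R (s**Sinh Delta**k1)"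
  unfolding e by (subst N) (simp add: blk_mult matrix_scaleR_left matrix_scaleR_right)
 then have "blk21 g**(blk21 g)\<^sup>H = x^2 *\<^sub>R (s**Sinh Delta**(k1**k1\<^sup>H)**Sinh Delta**s\<^sup>H)"
  by (simp add: ctrans_simps matrix_scaleR_left matrix_scaleR_right mm_assoc power2_eq_square)
 also have "... = s**(x^2 *\<^sub>R (Sinh Delta**Sinh Delta))**s\<^sup>H"
  using u by (simp add: unitaryD mm_ring)
 also have "x^2 *\<^sub>R (Sinh Delta**Sinh Delta) = dmat (cvec (\<chi> i. x^2 * (sinh (Delta$i))^2))"
  by (simp add: Sinh_def dmat_mult_dmat vec_eq_iff power2_eq_square scaleR_conv_of_real[where 'a=complex])
 finally have M2: "blk21 g**(blk21 g)\<^sup>H = s**dmat (cvec (\<chi> i. x^2 * (sinh (Delta$i))^2))**s\<^sup>H" .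
 have x2: "0 < x^2" using x_pos by simp
 have m: "m = (\<chi> i. x^2 * (sinh (Delta$i))^2)"
  by (rule simple_spectrum_unique[OF r u(1) _ dec]) (use M M2 chamber_squares(2)[OF D] x2 in auto)
 have "(sinh (Delta$j))^2 < \<alpha>^2 * (sinh (Delta$i))^2" if "i < j" for i j
 proof -
  have "x^2 * (sinh (Delta$j))^2 < x^2 * (\<alpha>^2 * (sinh (Delta$i))^2)" using reg[OF that] by (simp add: m mult_ac)
  then show ?thesis using x2 by (metis mult_less_cancel_left_pos)
 qed
 then have "(\<chi> i. ln (sinh (Delta$i))) \<in> region \<alpha>" using chamber_region_iff[OF D] by blast
 then show ?thesis using exists_coords[OF nd G] by blast
qed

text \<open>Pseudo-unitarity of L preserves g^H I g, and together with the commutation it preserves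
  g I g^H. The corners of b_R and b_L are blocks of these two matrices up to a scalar, and the
  \<Phi>_m depend on the second alone.\<close>

lemma commuting_flow_constrained:
 assumes g: "g \<in> C" and L: "Unn L" "det L = 1" "L**(g**Inn**g\<^sup>H**Inn) = g**Inn**g\<^sup>H**Inn**L"
  and reg: "regular (L**k_L g)"
 shows "L**g \<in> C" "wF (L**g) = wF g" "nF (L**g) = nF g" "Phi m (L**g) = Phi m g"
proof -
 note f = constrained_factors[OF g]
 have "(L**g)**Inn**(L**g)\<^sup>H = L**(g**Inn**g\<^sup>H**Inn)**(Inn**L\<^sup>H)"
  by (simp add: ctrans_mult mm_assoc) (simp add: mm_assoc[symmetric])
 also have "... = g**Inn**g\<^sup>H**(Inn**(L**Inn**L\<^sup>H))" unfolding L(3) by (simp only: mm_assoc)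
 finally have m: "(L**g)**Inn**(L**g)\<^sup>H = g**Inn**g\<^sup>H" by (simp add: Unn_flip[OF L(1)])
 have m2: "(L**g)\<^sup>H**Inn**(L**g) = g\<^sup>H**Inn**g"
 proof -
  have "(L**g)\<^sup>H**Inn**(L**g) = g\<^sup>H**(L\<^sup>H**Inn**L)**g" by (simp add: ctrans_mult mm_assoc)
  then show ?thesis unfolding L(1)[unfolded Unn_def] .
 qed
 have k: "L**k_L g \<in> SUnn" using f(5) L by (simp add: SUnn_iff Unn_mult det_mul)
 have e: "L**g = (L**k_L g)**bR (wF g)" using f(7) by (simp add: mm_assoc[symmetric])
 show "L**g \<in> C" by (rule constrainedI_metric(1)[OF k reg e]) (simp add: m constrained_metric[OF g f(2)])
 have w: "wF h = (1 / x) *\<^sub>R blk12 (h\<^sup>H**Inn**h)" "nF h = - blk12 (h**Inn**h\<^sup>H)" for h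
  by (rule blk_cases[of h]; simp add: wF_def nF_def Inn_def blk_simps matrix_uminus_left matrix_uminus_right)+
 show "wF (L**g) = wF g" "nF (L**g) = nF g" unfolding w m m2 by simp_all
 show "Phi m (L**g) = Phi m g" unfolding Phi_def m ..
qed

end

subsection \<open>Cayley transforms\<close>

text \<open>A is self-adjoint for the indefinite form, so its pseudo-adjoint exchanges D = 1 - itA
  and P = 1 + itA; these commute, which makes their quotient pseudo-unitary.\<close>

lemma cayley_transform:
 fixes A D P B :: "('n::finite) bmat"
 assumes A: "Inn**A\<^sup>H**Inn = A" and D: "D = mat 1 - mat (\<i> * of_real t)**A" "det D ~= 0"
  and P: "P = mat 1 + mat (\<i> * of_real t)**A"
 shows "Unn (matrix_inv D**P)" "B**A = A**B ==> (matrix_inv D**P)**B = B**(matrix_inv D**P)"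
proof -
 note Di = matrix_inv_works[OF D(2)]
 have AA: "A**(mat c**A) = mat c**(A**A)" for c by (simp only: mm_assoc mat_mult_commute[of A])
 have DP: "D**P = P**D"
  by (simp add: D P matrix_add_ldistrib matrix_add_rdistrib matrix_diff_ldistrib matrix_diff_rdistrib)
 have Ad: "A\<^sup>H**Inn = Inn**A"
 proof -
  have "Inn**(Inn**A\<^sup>H**Inn) = Inn**A" unfolding A ..
  then show ?thesis by (simp add: mm_assoc)
 qed
 have "(mat (\<i> * of_real t)**A)\<^sup>H**Inn = - (Inn**(mat (\<i> * of_real t)**A))"
 proof -
  let ?c = "\<i> * complex_of_real t"
  have m: "mat (- ?c) = - (mat ?c :: 'n bmat)" by (simp add: mat_def vec_eq_iff)
  have "(mat ?c**A)\<^sup>H**Inn = mat (- ?c)**(A\<^sup>H**Inn)"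
   by (simp only: ctrans_mult ctrans_mat mat_mult_commute mm_assoc complex_cnj_mult complex_cnj_i complex_cnj_complex_of_real mult_minus_left)
  also have "... = - (mat ?c**Inn**A)" unfolding Ad m by (simp only: matrix_uminus_left mm_assoc)
  also have "mat ?c**Inn = Inn**mat ?c" by (rule mat_mult_commute[symmetric])
  finally show ?thesis by (simp only: mm_assoc)
 qed
 then have PI: "P\<^sup>H**Inn = Inn**D" and DI: "D\<^sup>H**Inn = Inn**P"
  by (simp_all add: D P ctrans_add ctrans_diff matrix_add_ldistrib matrix_add_rdistrib matrix_diff_ldistrib matrix_diff_rdistrib)
 let ?K = "matrix_inv D**P"
 have DK: "D**?K = P" by (simp add: mm_assoc Di)
 have "?K**D = matrix_inv D**(D**P)" by (simp only: DP mm_assoc)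
 then have KD: "?K**D = P" by (simp add: mm_assoc Di)
 have dD: "det (D\<^sup>H) ~= 0" using D by (simp add: det_ctrans)
 have "D\<^sup>H**(?K\<^sup>H**Inn**?K)**D = (?K**D)\<^sup>H**Inn**(?K**D)" by (simp add: ctrans_mult mm_assoc)
 also have "... = D\<^sup>H**Inn**D" unfolding KD PI DI by (simp only: mm_assoc[symmetric] DP)
 finally have e: "D\<^sup>H**(?K\<^sup>H**Inn**?K)**D = D\<^sup>H**Inn**D" .
 have "?K\<^sup>H**Inn**?K = Inn"
  by (rule matrix_mult_cancel_left[OF dD], rule matrix_mult_cancel_right[OF D(2)], rule e)
 then show "Unn ?K" by (simp add: Unn_def)
 assume BA: "B**A = A**B"
 have "B**(mat c**A) = mat c**A**B" for c
 proof -
  have "B**(mat c**A) = mat c**(B**A)" by (simp only: mm_assoc mat_mult_commute[of B])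
  then show ?thesis by (simp only: BA mm_assoc)
 qed
 then have BD: "B**D = D**B" and BP: "B**P = P**B"
  by (simp_all add: D P matrix_add_ldistrib matrix_add_rdistrib matrix_diff_ldistrib matrix_diff_rdistrib)
 have "D**(?K**B) = D**(B**?K)"
 proof -
  have "D**(?K**B) = B**P" by (simp add: mm_assoc Di BP)
  also have "... = B**D**?K" by (simp only: mm_assoc[symmetric] DK)
  finally show ?thesis by (simp only: BD mm_assoc)
 qed
 then show "?K**B = B**?K" by (rule matrix_mult_cancel_left[OF D(2)])
qed

text \<open>Cramer's rule: every entry of the inverse is a quotient of determinants.\<close>

lemma matrix_inv_differentiable:
 fixes A :: "'a::real_normed_vector => 'k::finite cmat"
 assumes A: "A differentiable at a" and U: "open U" "a \<in> U" and d: "!!u. u \<in> U ==> det (A u) ~= 0"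
 shows "(%u. matrix_inv (A u)) differentiable at a"
proof (rule matrix_differentiableI)
 fix k j
 let ?B = "%u. (\<chi> i l. if l = k then axis j 1$i else A u$i$l) :: 'k cmat"
 have "(%u. ?B u) differentiable at a"
 proof (rule matrix_differentiableI)
  show "(%u. ?B u$i$l) differentiable at a" for i l
   by (cases "l = k") (simp_all add: matrix_differentiableD A)
 qed
 then have "(%u. det (?B u) / det (A u)) differentiable at a"
  by (intro differentiable_divide det_differentiable A d U)
 then show "(%u. matrix_inv (A u)$k$j) differentiable at a"
 proof (rule differentiable_cong_open[OF _ U])
  fix u assume u: "u \<in> U"
  have "A u *v (matrix_inv (A u) *v axis j 1) = axis j 1"
   by (simp add: matrix_vector_mul_assoc matrix_inv_works[OF d[OF u]])
  then have "matrix_inv (A u) *v axis j 1 = (\<chi> k. det (\<chi> i l. if l = k then axis j 1$i else A u$i$l) / det (A u))"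
   using cramer[OF d[OF u]] by blast
  from arg_cong[OF this, of "%v. v$k"] show "det (?B u) / det (A u) = matrix_inv (A u)$k$j"
   by (simp add: matrix_vector_mult_def axis_def if_distrib[of "%x. _ * x"] cong: if_cong)
 qed
qed

subsection \<open>The flows of the Hamiltonians\<close>

lemma matpow_commute: "B**A = A**B ==> B**matpow A m = matpow A m**B"
proof (induction m)
 case (Suc m)
 have "B**matpow A (Suc m) = (B**A)**matpow A m" by (simp add: matpow_def mm_assoc)
 also have "... = A**(B**matpow A m)" using Suc.prems by (simp add: mm_assoc)
 also have "... = matpow A (Suc m)**B" using Suc by (simp add: matpow_def mm_assoc)
 finally show ?case .
qed (simp add: matpow_def)

text \<open>Under the trace against a matrix commuting with J, the m terms of the product rule
  coincide. \<open>B\<close> is kept general because the induction step replaces it by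
  \<open>B**J a\<close>.\<close>

lemma matpow_has_derivative:
 fixes J :: "'a::real_normed_vector => 'k::finite cmat"
 assumes J: "(J has_derivative J') (at a)"
 shows "\<exists>D. ((%u. matpow (J u) m) has_derivative D) (at a) &
  (\<forall>B Z. B**J a = J a**B --> trace (B**D Z) = of_nat m * trace (B**matpow (J a) (m - 1)**J' Z))"
proof (induction m)
 case 0
 show ?case by (rule exI[of _ "%Z. 0"]) (simp add: matpow_def trace_zero)
next
 case (Suc m)
 then obtain D where D: "((%u. matpow (J u) m) has_derivative D) (at a)"
  "!!B Z. B**J a = J a**B ==> trace (B**D Z) = of_nat m * trace (B**matpow (J a) (m - 1)**J' Z)" by blast
 have "((%u. J u**matpow (J u) m) has_derivative (%Z. J a**D Z + J' Z**matpow (J a) m)) (at a)"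
  by (rule matrix_mult_has_derivative[OF J D(1)])
 moreover have "trace (B**(J a**D Z + J' Z**matpow (J a) m)) = of_nat (Suc m) * trace (B**matpow (J a) m**J' Z)"
  if B: "B**J a = J a**B" for B Z
 proof -
  have c: "matpow (J a) m**B = B**matpow (J a) m" using matpow_commute[OF B] ..
  have BJ: "(B**J a)**J a = J a**(B**J a)" by (metis B mm_assoc)
  have "trace (B**J a**D Z) = of_nat m * trace (B**matpow (J a) m**J' Z)"
  proof (cases m)
   case 0
   then show ?thesis using D(2)[OF BJ] by simp
  next
   case (Suc k)
   then show ?thesis unfolding D(2)[OF BJ] by (simp add: matpow_def mm_assoc)
  qed
  moreover have "trace (B**J' Z**matpow (J a) m) = trace (B**matpow (J a) m**J' Z)"
   unfolding trace_mul_sym[of "B**J' Z"] by (simp add: mm_assoc c)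
  ultimately show ?thesis
   by (simp add: matrix_add_ldistrib mm_assoc trace_add distrib_right add.commute)
 qed
 ultimately show ?case by (intro exI[of _ "%Z. J a**D Z + J' Z**matpow (J a) m"]) (simp add: matpow_def)
qed

lemma Re_trace_star:
 fixes A M :: "('n::finite) bmat"
 assumes A: "Inn**A\<^sup>H**Inn = A" shows "Re (trace (A**(Inn**M\<^sup>H**Inn))) = Re (trace (A**M))"
proof -
 have "trace (A**(Inn**M\<^sup>H**Inn)) = trace ((Inn**A\<^sup>H**Inn)**(Inn**M\<^sup>H**Inn))" unfolding A ..
 also have "... = trace (Inn**(A\<^sup>H**(Inn**Inn)**M\<^sup>H**Inn))" by (simp only: mm_assoc)
 also have "... = trace ((A\<^sup>H**M\<^sup>H)**(Inn**Inn))" by (subst trace_mul_sym) (simp add: mm_assoc[symmetric])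
 also have "... = cnj (trace (M**A))" by (simp add: trace_ctrans[symmetric] ctrans_mult)
 finally show ?thesis by (simp add: trace_mul_sym[of M])
qed

text \<open>Self-adjoint matrices are orthogonal to the Lie algebra under the real part of the
  trace. Powers of g I g^H I are self-adjoint, and so the parts of dg g^(-1) that come from k_L and
  k_R drop out of d\<Phi>_m.\<close>

lemma Re_trace_unnL:
 fixes A M :: "('n::finite) bmat"
 assumes A: "Inn**A\<^sup>H**Inn = A" and M: "unnL M" shows "Re (trace (A**M)) = 0"
proof -
 have "Inn**M\<^sup>H**Inn = - ((Inn**Inn)**M**(Inn**Inn))"
  unfolding unnL_ctrans[OF M] by (simp only: mm_assoc matrix_uminus_left matrix_uminus_right)
 then show ?thesis using Re_trace_star[OF A, of M] by (simp add: matrix_uminus_right trace_uminus)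
qed

lemma Unn_norm_det:
 fixes g :: "('k::finite) bmat"
 assumes g: "Unn g" shows "cmod (det g) = 1"
proof -
 have "det (Inn**(Inn :: 'k bmat)) = 1" by simp
 then have I: "det (Inn :: 'k bmat) * det (Inn :: 'k bmat) = 1" by (simp only: det_mul)
 have "det ((Inn**g\<^sup>H**Inn)**g) = 1" by (simp add: Unn_left[OF g])
 then have "(det (Inn :: 'k bmat) * det (Inn :: 'k bmat)) * (cnj (det g) * det g) = 1" by (simp add: det_mul det_ctrans mult_ac)
 then have "complex_of_real ((cmod (det g))^2) = of_real 1" unfolding I by (simp only: complex_norm_square mult.commute mult_1_left of_real_1)
 then have "(cmod (det g))^2 = 1" unfolding of_real_eq_iff .
 then show ?thesis by (simp add: power2_eq_1_iff) (metis norm_ge_zero not_one_le_zero neg_0_le_iff_le)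
qed

lemma matpow_differentiable:
 fixes J :: "'a::real_normed_vector => 'k::finite cmat"
 shows "J differentiable at a ==> (%u. matpow (J u) m) differentiable at a"
 using matpow_has_derivative unfolding differentiable_def by blast

lemma mat_i_scaleR: "mat (\<i> * complex_of_real t)**A = t *\<^sub>R (mat \<i>**A)"
 by (simp add: mat_mult_left vec_eq_iff scaleR_conv_of_real[where 'a=complex] mult_ac)

lemma finite_positive_lower_bound:
 assumes "finite A" "!!t. t \<in> A ==> 0 < t" shows "\<exists>e>0. \<forall>t\<in>A. e \<le> (t :: real)"
proof -
 have "0 < Min (insert 1 A)" using assms by simp
 moreover have "\<forall>t\<in>A. Min (insert 1 A) \<le> t" using assms by simp
 ultimately show ?thesis by blast
qed

lemma Unn_mat: "cmod c = 1 ==> Unn (mat c)"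
 using Unn_blk_diag[of "mat c" "mat c"] by (simp add: unitary_mat blk_mat)

lemma holomorphic_compose_differentiable:
 fixes f :: "'a::real_normed_vector => complex"
 assumes "f differentiable at a" "(h has_field_derivative D) (at (f a))" shows "(%u. h (f u)) differentiable at a"
 using assms has_derivative_compose unfolding differentiable_def has_field_derivative_def by blast

context reduction begin

lemma star_matpow:
 fixes A :: "'n bmat"
 assumes "Inn**A\<^sup>H**Inn = A" shows "Inn**(matpow A m)\<^sup>H**Inn = matpow A m"
proof -
 have e: "matpow (Inn**A\<^sup>H**Inn) m = Inn**matpow (A\<^sup>H) m**Inn" by (rule matpow_conj) simp_all
 show ?thesis unfolding ctrans_matpow e[symmetric] assms ..
qed

lemma star_metric: "Inn**(g**Inn**g\<^sup>H**Inn)\<^sup>H**Inn = g**Inn**g\<^sup>H**Inn"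
 by (simp add: ctrans_mult mm_assoc)

text \<open>With \<gamma> = dg g^(-1) and its pseudo-adjoint \<gamma>', dJ = \<gamma> J + J
  \<gamma>'. Both terms have the same real trace against J^(m-1), and the resulting factor 2m
  cancels the normalisation of \<Phi>_m.\<close>

lemma Phi_has_derivative:
 fixes F :: "'a::real_normed_vector => 'n bmat"
 assumes F: "(F has_derivative F') (at a)" and gi: "gi**F a = mat 1" and m: "1 \<le> m"
 shows "((%u. Phi m (F u)) has_derivative (%Z. - Re (trace (matpow (F a**Inn**(F a)\<^sup>H**Inn) m**(F' Z**gi))))) (at a)"
proof -
 define J where "J u = F u**Inn**(F u)\<^sup>H**Inn" for u
 define J' where "J' Z = (F' Z**gi)**J a + J a**(Inn**(F' Z**gi)\<^sup>H**Inn)" for Z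
 have "(J has_derivative (%Z. (F a**Inn**(F a)\<^sup>H)**0 + ((F a**Inn)**(F' Z)\<^sup>H + (F a**0 + F' Z**Inn)**(F a)\<^sup>H)**Inn)) (at a)"
  unfolding J_def by (intro matrix_mult_has_derivative ctrans_has_derivative has_derivative_const F)
 moreover have "(F a**Inn**(F a)\<^sup>H)**0 + ((F a**Inn)**(F' Z)\<^sup>H + (F a**0 + F' Z**Inn)**(F a)\<^sup>H)**Inn = J' Z" for Z
 proof -
  have gF: "(F a)\<^sup>H**gi\<^sup>H = mat 1" using arg_cong[OF gi, of ctrans] by (simp add: ctrans_mult)
  have "J' Z = F' Z**(gi**F a)**Inn**(F a)\<^sup>H**Inn + F a**Inn**((F a)\<^sup>H**(Inn**Inn)**gi\<^sup>H)**(F' Z)\<^sup>H**Inn"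
   unfolding J'_def J_def by (simp only: ctrans_mult mm_assoc)
  then show ?thesis by (simp add: gi gF matrix_add_rdistrib add.commute)
 qed
 ultimately have J: "(J has_derivative J') (at a)" by simp
 obtain D where D: "((%u. matpow (J u) m) has_derivative D) (at a)"
  "!!B Z. B**J a = J a**B ==> trace (B**D Z) = of_nat m * trace (B**matpow (J a) (m - 1)**J' Z)"
  using matpow_has_derivative[OF J] by blast
 have star: "Inn**(matpow (J a) m)\<^sup>H**Inn = matpow (J a) m" unfolding J_def by (rule star_matpow star_metric)+
 have "trace (D Z) = of_nat m * trace (matpow (J a) (m - 1)**J' Z)" for Z using D(2)[of "mat 1" Z] by simp
 moreover have "Re (trace (matpow (J a) (m - 1)**J' Z)) = 2 * Re (trace (matpow (J a) m**(F' Z**gi)))" for Z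
 proof -
  let ?g = "F' Z**gi"
  have Jm: "matpow (J a) (m - 1)**J a = matpow (J a) m" "J a**matpow (J a) (m - 1) = matpow (J a) m"
  proof -
   obtain k where "m = Suc k" using m by (cases m) auto
   then show "matpow (J a) (m - 1)**J a = matpow (J a) m" by (simp add: matpow_Suc_right)
   show "J a**matpow (J a) (m - 1) = matpow (J a) m" unfolding \<open>m = Suc k\<close> by (simp add: matpow_def)
  qed
  have "trace (matpow (J a) (m - 1)**J' Z) = trace (matpow (J a) (m - 1)**?g**J a) + trace (matpow (J a) (m - 1)**J a**(Inn**?g\<^sup>H**Inn))"
   unfolding J'_def by (simp add: matrix_add_ldistrib trace_add mm_assoc)
  also have "trace (matpow (J a) (m - 1)**?g**J a) = trace (matpow (J a) m**?g)"
   by (subst trace_mul_sym) (simp only: mm_assoc Jm)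
  finally show ?thesis unfolding Jm using Re_trace_star[OF star, of ?g] by simp
 qed
 ultimately have tr: "Re (trace (D Z)) = real m * (2 * Re (trace (matpow (J a) m**(F' Z**gi))))" for Z
  by simp
 have "bounded_linear (%M :: 'n bmat. - (1 / (2 * real m)) * Re (trace M))"
  by (rule bounded_linear_const_mult) (simp add: linear_conv_bounded_linear[symmetric] linearI trace_add trace_scaleR)
 from bounded_linear.has_derivative[OF this D(1)]
 have "((%u. Phi m (F u)) has_derivative (%Z. - (1 / (2 * real m)) * Re (trace (D Z)))) (at a)"
  unfolding Phi_def J_def .
 moreover have "- (1 / (2 * real m)) * Re (trace (D Z)) = - Re (trace (matpow (J a) m**(F' Z**gi)))" for Z
  using m unfolding tr by simp
 ultimately show ?thesis unfolding J_def by simp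
qed

text \<open>
 \<open>cK\<^sub>t\<close> is a curve in \<open>SU(n,n)\<close> that commutes with \<open>gIg\<^sup>HI\<close>, so left multiplication by it keeps
 \<open>b\<^sub>L\<close>, \<open>b\<^sub>R\<close> and all \<open>\<Phi>\<^sub>k\<close>.  Cayley transforms replace exponentials.
\<close>

lemma exists_flow:
 fixes S :: "'n rvec \<times> 'n rvec => 'n bmat"
 assumes U: "open U" and S: "S differentiable_on U" and co: "!!u. u \<in> U ==> coords \<alpha> vh \<sigma> x y (S u) (fst u) (snd u)" and a: "a \<in> U"
 obtains N and F :: "real \<times> ('n rvec \<times> 'n rvec) => 'n bmat"
  where "open N" "(0, a) \<in> N" "F differentiable_on N"
   "!!w. w \<in> N ==> snd w \<in> U" "!!w. w \<in> N ==> F w \<in> C" "!!w. w \<in> N ==> \<exists>q p. coords \<alpha> vh \<sigma> x y (F w) q p"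
   "!!w. w \<in> N ==> wF (F w) = wF (S (snd w))" "!!w. w \<in> N ==> nF (F w) = nF (S (snd w))"
   "!!w k. w \<in> N ==> Phi k (F w) = Phi k (S (snd w))" "!!w. w \<in> N ==> fst w = 0 ==> F w = S (snd w)"
   "!!F'. (F has_derivative F') (at (0, a)) ==>
    \<exists>c'. F' (1, 0) = (mat c' + (1 / 2) *\<^sub>R (mat \<i>**matpow (S a**Inn**(S a)\<^sup>H**Inn) m))**S a"
proof -
 define J where "J u = S u**Inn**(S u)\<^sup>H**Inn" for u
 \<comment> \<open>The velocity of the Cayley curve at t = 0 is 2iA, so the factor 1/4 makes it
   (i/2) J^m.\<close>
 define A where "A u = (1 / 4) *\<^sub>R matpow (J u) m" for u
 define D P where "D w = mat 1 - fst w *\<^sub>R (mat \<i>**A (snd w))" and "P w = mat 1 + fst w *\<^sub>R (mat \<i>**A (snd w))" for w :: "real \<times> ('n rvec \<times> 'n rvec)"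
 define K where "K w = matrix_inv (D w)**P w" for w
 let ?N = "CARD('n + 'n)"
 have nz: "of_nat ?N ~= (0 :: complex)"
  unfolding of_nat_eq_0_iff by (rule zero_less_card_finite[THEN less_imp_neq, symmetric])
 \<comment> \<open>A root of 1/det K of order 2n, taken with the principal logarithm, which is
   differentiable where Re det K > 0. It is a phase because K is pseudo-unitary.\<close>
 define c where "c w = exp (- Ln (det (K w)) / of_nat ?N)" for w
 define L where "L w = mat (c w)**K w" for w
 define F where "F w = L w**S (snd w)" for w
 have SC: "S u \<in> C" if "u \<in> U" for u using coords_in_C co that by blast
 have U': "open ((UNIV :: real set) \<times> U)" using U by (intro open_Times) auto
 have fd: "fst differentiable at w" "snd differentiable at w" for w :: "real \<times> ('n rvec \<times> 'n rvec)"
  unfolding differentiable_def using bounded_linear_imp_has_derivative bounded_linear_fst bounded_linear_snd by blast+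
 have Sd: "(%w. S (snd w)) differentiable at w" if "w \<in> UNIV \<times> U" for w :: "real \<times> ('n rvec \<times> 'n rvec)"
 proof -
  have "S differentiable at (snd w)" using differentiable_on_openD[OF S U] that by auto
  then show ?thesis using fd(2)[of w] has_derivative_compose unfolding differentiable_def by blast
 qed
 have Ad: "(%w. A (snd w)) differentiable at w" if "w \<in> UNIV \<times> U" for w :: "real \<times> ('n rvec \<times> 'n rvec)"
  unfolding A_def J_def by (intro differentiable_scaleR differentiable_const matpow_differentiable matrix_mult_differentiable ctrans_differentiable Sd that)
 have DPd: "D differentiable at w" "P differentiable at w" if "w \<in> UNIV \<times> U" for w
  unfolding D_def[abs_def] P_def[abs_def]
  by (intro differentiable_diff differentiable_add differentiable_const differentiable_scaleR fd matrix_mult_differentiable Ad that)+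
 define W0 where "W0 = {w \<in> UNIV \<times> U. det (D w) ~= 0}"
 have "continuous_on (UNIV \<times> U) (%w. det (D w))"
  by (intro continuous_at_imp_continuous_on ballI differentiable_imp_continuous_within det_differentiable DPd)
 from continuous_open_preimage[OF this U' open_Compl[OF closed_singleton[of 0]]]
 have W0: "open W0" by (simp add: W0_def vimage_def Int_def)
 have Kd: "K differentiable at w" if "w \<in> W0" for w
  unfolding K_def[abs_def] by (intro matrix_mult_differentiable matrix_inv_differentiable[OF _ W0] DPd) (use that in \<open>auto simp: W0_def\<close>)
 define W1 where "W1 = {w \<in> W0. 0 < Re (det (K w))}"
 have "continuous_on W0 (%w. det (K w))"
  by (intro continuous_at_imp_continuous_on ballI differentiable_imp_continuous_within det_differentiable Kd)
 from continuous_open_preimage[OF this W0 open_halfspace_Re_gt[of 0]]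
 have W1: "open W1" by (simp add: W1_def vimage_def Int_def)
 have W1D: "w \<in> W0" "snd w \<in> U" "det (D w) ~= 0" "det (K w) \<notin> \<real>\<^sub>\<le>\<^sub>0" "det (K w) ~= 0" if "w \<in> W1" for w
  using that by (auto simp: W1_def W0_def complex_nonpos_Reals_iff)
 have cd: "c differentiable at w" if "w \<in> W1" for w
 proof -
  have "(%w. Ln (det (K w))) differentiable at w"
   by (rule holomorphic_compose_differentiable[OF det_differentiable[OF Kd[OF W1D(1)[OF that]]] has_field_derivative_Ln[OF W1D(4)[OF that]]])
  then have "(%w. - Ln (det (K w)) / of_nat ?N) differentiable at w"
   by (intro differentiable_divide differentiable_minus differentiable_const nz)
  then show ?thesis unfolding c_def[abs_def] by (rule holomorphic_compose_differentiable[OF _ DERIV_exp])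
 qed
 have matd: "(%w. mat (c w) :: 'n bmat) differentiable at w" if "w \<in> W1" for w
 proof (rule matrix_differentiableI)
  show "(%w. (mat (c w) :: 'n bmat)$i$j) differentiable at w" for i j
   using cd[OF that] by (cases "i = j") (simp_all add: mat_def)
 qed
 have Fd: "F differentiable at w" if "w \<in> W1" for w
  unfolding F_def[abs_def] L_def[abs_def] using W1D[OF that]
  by (intro matrix_mult_differentiable matd[OF that] Kd Sd) (auto simp: mem_Times_iff)
 have star: "Inn**(A u)\<^sup>H**Inn = A u" for u
  using star_matpow[OF star_metric[of "S u"], of m] by (simp add: A_def J_def ctrans_scaleR matrix_scaleR_left matrix_scaleR_right)
 have JA: "J u**A u = A u**J u" for u
  using matpow_commute[of "J u" "J u" m] by (simp add: A_def matrix_scaleR_left matrix_scaleR_right)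
 have LU: "Unn (L w)" "det (L w) = 1" "L w**J (snd w) = J (snd w)**L w" if w: "w \<in> W1" for w
 proof -
  have e: "D w = mat 1 - mat (\<i> * of_real (fst w))**A (snd w)" "P w = mat 1 + mat (\<i> * of_real (fst w))**A (snd w)"
   by (simp_all add: D_def P_def mat_i_scaleR)
  note cay = cayley_transform[OF star e(1) W1D(3)[OF w] e(2), folded K_def]
  have "cmod (det (K w)) = 1" by (rule Unn_norm_det[OF cay(1)])
  then have "Re (Ln (det (K w))) = 0" using W1D(5)[OF w] by simp
  then have "cmod (c w) = 1" by (simp add: c_def norm_exp_eq_Re)
  then show "Unn (L w)" unfolding L_def by (intro Unn_mult Unn_mat cay)
  have "c w ^ ?N = exp (of_nat ?N * (- Ln (det (K w)) / of_nat ?N))" unfolding c_def by (rule exp_of_nat_mult[symmetric])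
  also have "... = inverse (det (K w))" using W1D(5)[OF w] by (simp add: exp_minus)
  finally show "det (L w) = 1" using W1D(5)[OF w] by (simp only: L_def det_mul det_mat left_inverse not_False_eq_True)
  show "L w**J (snd w) = J (snd w)**L w"
   using cay(2)[OF JA] unfolding L_def by (simp only: mm_assoc mat_mult_commute[of "J (snd w)"]) (simp only: mm_assoc[symmetric])
 qed
 have z: "D (0, u) = mat 1" "P (0, u) = mat 1" for u by (simp_all add: D_def P_def)
 have "matrix_inv (mat 1) = (mat 1 :: 'n bmat)" by (rule matrix_inv_eqI) simp
 then have K0: "K (0, u) = mat 1" for u by (simp add: K_def z)
 have c0: "c (0, u) = 1" for u by (simp add: c_def K0)
 have F0: "F (0, u) = S u" for u by (simp add: F_def L_def K0 c0)
 have aW: "(0, a) \<in> W1" using a by (simp add: W1_def W0_def z K0)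
 have q: "fst a \<in> region \<alpha>" using co[OF a] by (simp add: coords_iff)
 obtain \<rho> z where b: "base_frame \<rho> z" using exists_base_frame[OF q] by blast
 obtain R0 r0 k1 k2 where g0: "stab R0" "unitary r0" "unitary k1" "unitary k2" "S a = blk R0 0 0 r0**sectionN \<rho> z (fst a) (snd a)**blk k1 0 0 k2"
  using section_gauge[OF co[OF a] b] by blast
 define m0 where "m0 = (\<chi> i. x^2 * (exp (fst a$i))^2)"
 have x2: "0 < x^2" using x_pos by simp
 \<comment> \<open>This matrix governs both regularity and q. At t = 0 its spectrum
   \<open>m0\<close> is simple, positive and strictly gapped, and all three properties survive when
   the eigenvalues move by less than e/2.\<close>
 define M where "M w = blk21 (F w)**(blk21 (F w))\<^sup>H" for w
 have M0: "M (0, a) = r0**dmat (cvec m0)**r0\<^sup>H"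
  unfolding M_def F0 m0_def by (rule gauge_blocks(5)[OF b q g0])
 have m0r: "m0$j < \<alpha>^2 * m0$i" if "i < j" for i j
 proof -
  have "x^2 * (exp (fst a$j))^2 < x^2 * (\<alpha>^2 * (exp (fst a$i))^2)" using region_exp[OF q that] x2 by (rule mult_strict_left_mono)
  then show ?thesis by (simp add: m0_def mult_ac)
 qed
 have m0p: "0 < m0$i" for i using x2 by (simp add: m0_def)
 have m0d: "m0$j < m0$i" if "i < j" for i j
 proof -
  have "\<alpha>^2 * m0$i < m0$i" using m0p[of i] alpha2 by simp
  then show ?thesis using m0r[OF that] by linarith
 qed
 have "\<exists>e>0. \<forall>t\<in>range (($) m0) \<union> (%(i, j). \<alpha>^2 * m0$i - m0$j) ` {(i, j). i < j}. e \<le> t"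
  by (rule finite_positive_lower_bound) (use m0p m0r in auto)
 then obtain e where e0: "0 < e" "\<forall>t\<in>range (($) m0) \<union> (%(i, j). \<alpha>^2 * m0$i - m0$j) ` {(i, j). i < j}. e \<le> t" by blast
 have e: "0 < e" "e \<le> m0$i" "i < j ==> e \<le> \<alpha>\<^sup>2 * m0$i - m0$j" for i j
  using e0 by (blast, blast, auto dest!: bspec[of _ _ "\<alpha>^2 * m0$i - m0$j"])
 have Md: "M differentiable at (0, a)"
  unfolding M_def[abs_def] by (intro matrix_mult_differentiable ctrans_differentiable blocks_differentiable Fd aW)
 have Mh: "(M w)\<^sup>H = M w" for w by (simp add: M_def ctrans_mult)
 have "0 < e / 2" using e by simp
 from simple_spectrum_persists[OF Md Mh M0 g0(2) m0d this]
 obtain V where V: "open V" "(0, a) \<in> V" and sp: "!!w. w \<in> V ==> \<exists>r m. unitary r & M w = r**dmat (cvec m)**r\<^sup>H &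
   (\<forall>i j. i < j --> m$j < m$i) & (\<forall>i. \<bar>m$i - m0$i\<bar> < e / 2)"
  unfolding eventually_nhds by blast
 define N where "N = W1 \<inter> V"
 have N: "open N" "(0, a) \<in> N" using W1 V aW by (auto simp: N_def)
 have props: "snd w \<in> U" "F w \<in> C" "\<exists>q p. coords \<alpha> vh \<sigma> x y (F w) q p" "wF (F w) = wF (S (snd w))"
  "nF (F w) = nF (S (snd w))" "Phi l (F w) = Phi l (S (snd w))" "fst w = 0 ==> F w = S (snd w)" if "w \<in> N" for w l
 proof -
  have w: "w \<in> W1" "w \<in> V" using that by (auto simp: N_def)
  note wD = W1D[OF w(1)]
  obtain r m where r: "unitary r" "M w = r**dmat (cvec m)**r\<^sup>H" and md: "!!i j. i < j ==> m$j < m$i"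
   and me: "!!i. \<bar>m$i - m0$i\<bar> < e / 2" using sp[OF w(2)] by blast
  have mr: "m$j < \<alpha>^2 * m$i" if "i < j" for i j
  proof -
   have "m0$i - e / 2 \<le> m$i" using me[of i] by linarith
   then have "\<alpha>^2 * (m0$i - e / 2) \<le> \<alpha>\<^sup>2 * m$i" by (intro mult_left_mono) auto
   moreover have "\<alpha>^2 * (e / 2) \<le> e / 2" using alpha2 e(1) by (intro mult_left_le_one_le) auto
   ultimately show ?thesis using me[of j] e(3)[OF that] unfolding right_diff_distrib by linarith
  qed
  note Sf = constrained_factors[OF SC[OF wD(2)]]
  define kk where "kk = L w**k_L (S (snd w))"
  have Uk: "Unn kk" unfolding kk_def using Sf(5) LU(1)[OF w(1)] by (intro Unn_mult) (auto simp: SUnn_iff)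
  have Fk: "F w = kk**bR (wF (S (snd w)))" unfolding F_def kk_def using Sf(7) by (simp add: mm_assoc[symmetric])
  have "blk21 (F w) = x *\<^sub>R blk21 kk"
   unfolding Fk by (rule blk_cases[of kk]) (simp add: bR_def blk_mult smat_eq matrix_scaleR_right)
  then have "M w = x^2 *\<^sub>R (blk21 kk**(blk21 kk)\<^sup>H)"
   by (simp add: M_def ctrans_scaleR matrix_scaleR_left matrix_scaleR_right power2_eq_square)
  then have "blk21 kk**(blk21 kk)\<^sup>H = (1 / x^2) *\<^sub>R (r**dmat (cvec m)**r\<^sup>H)" using x2 r(2) by simp
  also have "... = r**dmat (cvec (\<chi> i. m$i / x^2))**r\<^sup>H"
  proof -
   have "dmat (cvec (\<chi> i. m$i / x^2)) = (1 / x^2) *\<^sub>R dmat (cvec m)"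
    by (simp add: vec_eq_iff scaleR_conv_of_real[where 'a=complex])
   then show ?thesis by (simp add: matrix_scaleR_left matrix_scaleR_right)
  qed
  finally have reg: "regular kk"
  proof (rule regularI_spectrum[OF Uk r(1)])
   show "(\<chi> i. m$i / x^2)$j < (\<chi> i. m$i / x^2)$i" if "i < j" for i j using md[OF that] x2 by (simp add: divide_strict_right_mono)
   have "0 < m$i" for i using me[of i] e(1) e(2)[of i] by linarith
   then show "0 < (\<chi> i. m$i / x^2)$i" for i using x2 by simp
  qed
  note fl = commuting_flow_constrained[OF SC[OF wD(2)] LU(1,2)[OF w(1)] _ reg[unfolded kk_def], folded F_def]
  have JJ: "L w**(S (snd w)**Inn**(S (snd w))\<^sup>H**Inn) = S (snd w)**Inn**(S (snd w))\<^sup>H**Inn**L w"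
   using LU(3)[OF w(1)] by (simp add: J_def)
  show "\<exists>q p. coords \<alpha> vh \<sigma> x y (F w) q p" by (rule coordsI_spectrum[OF fl(1)[OF JJ] r(1) r(2)[unfolded M_def] md mr])
  show "F w = S (snd w)" if "fst w = 0" using F0[of "snd w"] that by (metis prod.collapse)
  show "snd w \<in> U" "F w \<in> C" "wF (F w) = wF (S (snd w))" "nF (F w) = nF (S (snd w))" "Phi l (F w) = Phi l (S (snd w))"
   by (rule wD(2) fl[OF JJ])+
 qed
 have FN: "F differentiable_on N" using Fd by (intro differentiable_at_imp_differentiable_on) (simp add: N_def)
 have der: "\<exists>c'. F' (1, 0) = (mat c' + (1 / 2) *\<^sub>R (mat \<i>**matpow (S a**Inn**(S a)\<^sup>H**Inn) m))**S a"
  if F': "(F has_derivative F') (at (0, a))" for F'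
 proof -
  let ?T = "{t. (t, a) \<in> W1}"
  have "continuous_on UNIV (%t :: real. (t, a))" by (intro continuous_intros)
  from open_vimage[OF W1 this] have T: "open ?T" "0 \<in> ?T" using aW by (simp_all add: vimage_def)
  have pair: "((%t. (t, a)) has_derivative (%h. (h, 0))) (at (0 :: real))" by (auto intro!: derivative_eq_intros)
  have cd0: "(%t. mat (c (t, a)) :: 'n bmat) differentiable at 0"
   using matd[OF aW] has_derivative_compose[OF pair] unfolding differentiable_def by blast
  then obtain c' where c': "((%t. mat (c (t, a)) :: 'n bmat) has_derivative c') (at 0)" unfolding differentiable_def by blast
  \<comment> \<open>The derivative of a scalar matrix is scalar; \<open>undefined\<close> is merely
    some index at which the scalar is read off.\<close>
  have off: "c' h$i$j = (if i = j then c' h$undefined$undefined else 0)" for h i j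
  proof -
   have n: "((%t. (mat (c (t, a)) :: 'n bmat)$i$j) has_derivative (%h. c' h$i$j)) (at 0)" for i j
    by (intro bounded_linear.has_derivative[OF bounded_linear_vec_nth] c')
   show ?thesis
   proof (cases "i = j")
    case True
    have "(%h. c' h$i$i) = (%h. c' h$undefined$undefined)"
     by (rule has_derivative_unique[OF n[of i i]]) (use n[of undefined undefined] in \<open>simp add: mat_def\<close>)
    then show ?thesis using True by metis
   next
    case False
    then have "((%t. 0 :: complex) has_derivative (%h. c' h$i$j)) (at (0 :: real))" using n[of i j] by (simp add: mat_def)
    from has_derivative_unique[OF this has_derivative_const] show ?thesis using False by metis
   qed
  qed
  have "c' 1$i$j = mat (c' 1$undefined$undefined)$i$j" for i j unfolding mat_def vec_lambda_beta by (rule off)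
  then have cm: "c' 1 = mat (c' 1$undefined$undefined)" unfolding vec_eq_iff by blast
  have F1: "((%t. F (t, a)) has_derivative (%h. F' (h, 0))) (at 0)" by (rule has_derivative_compose[OF pair F'])
  have sc: "((%t. t *\<^sub>R (mat \<i>**A a)) has_derivative (%h. h *\<^sub>R (mat \<i>**A a))) (at (0 :: real))" by (auto intro!: derivative_eq_intros)
  \<comment> \<open>The curve is multiplied by 1 - itA before differentiating, so that no derivative
    of an inverse is needed.\<close>
  have l: "((%t. (mat 1 - t *\<^sub>R (mat \<i>**A a))**F (t, a)) has_derivative
    (%h. (mat 1 - 0 *\<^sub>R (mat \<i>**A a))**F' (h, 0) + (0 - h *\<^sub>R (mat \<i>**A a))**F (0, a))) (at 0)"
   by (intro matrix_mult_has_derivative has_derivative_diff has_derivative_const sc F1)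
  have r: "((%t. mat (c (t, a))**(mat 1 + t *\<^sub>R (mat \<i>**A a))**S a) has_derivative
    (%h. (mat (c (0, a))**(mat 1 + 0 *\<^sub>R (mat \<i>**A a)))**0 + (mat (c (0, a))**(0 + h *\<^sub>R (mat \<i>**A a)) + c' h**(mat 1 + 0 *\<^sub>R (mat \<i>**A a)))**S a)) (at 0)"
   by (intro matrix_mult_has_derivative has_derivative_add has_derivative_const sc c')
  have "(mat 1 - t *\<^sub>R (mat \<i>**A a))**F (t, a) = mat (c (t, a))**(mat 1 + t *\<^sub>R (mat \<i>**A a))**S a" if "t \<in> ?T" for t
  proof -
   have i: "D (t, a)**matrix_inv (D (t, a)) = mat 1" using matrix_inv_works(1)[OF W1D(3)] that by blast
   have "D (t, a)**F (t, a) = mat (c (t, a))**(D (t, a)**matrix_inv (D (t, a)))**P (t, a)**S a"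
    unfolding F_def L_def K_def by (simp only: mm_assoc mat_mult_commute[of "D (t, a)"] snd_conv)
   then have "D (t, a)**F (t, a) = mat (c (t, a))**P (t, a)**S a" unfolding i by simp
   then show ?thesis by (simp add: D_def P_def)
  qed
  from fun_cong[OF has_derivative_unique_open[OF T this l r], of 1]
  have "F' (1, 0) - (mat \<i>**A a)**S a = ((mat \<i>**A a) + c' 1)**S a" by (simp add: F0 c0 matrix_uminus_left)
  then have "F' (1, 0) = c' 1**S a + ((mat \<i>**A a)**S a + (mat \<i>**A a)**S a)"
   by (simp only: diff_eq_eq matrix_add_rdistrib) (simp only: ac_simps)
  then have "F' (1, 0) = (c' 1 + 2 *\<^sub>R (mat \<i>**A a))**S a"
   by (simp only: matrix_add_rdistrib scaleR_2)
  moreover have "2 *\<^sub>R (mat \<i>**A a) = (1 / 2) *\<^sub>R (mat \<i>**matpow (S a**Inn**(S a)\<^sup>H**Inn) m)"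
   by (simp add: A_def J_def matrix_scaleR_right)
  ultimately show ?thesis using cm by metis
 qed
 show ?thesis by (rule that[of N F, OF N FN]) (rule props der; assumption)+
qed

end

subsection \<open>Involution\<close>

context reduction begin

text \<open>X is the velocity of the flow in the coordinates (q, p). The pull-back along the flow,
  on the time direction and a direction Y, is computed twice: in coordinates it is the form on X and
  Y, and through the factors b_L and b_R, constant in time, it is d\<Phi>_m(Y). Since each \<Phi>_k
  is constant along the flow, d\<Phi>_k(X) = 0.\<close>

lemma exists_hamiltonian_direction:
 fixes S :: "'n rvec \<times> 'n rvec => 'n bmat"
 assumes U: "open U" and S: "S differentiable_on U" and co: "!!u. u \<in> U ==> coords \<alpha> vh \<sigma> x y (S u) (fst u) (snd u)" and a: "a \<in> U"
  and m: "1 \<le> m"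
 shows "\<exists>X. (\<forall>Y. pull_symp S a X Y = frechet_derivative (%u. Phi m (S u)) (at a) Y) &
  (\<forall>k\<ge>1. frechet_derivative (%u. Phi k (S u)) (at a) X = 0)"
proof -
 obtain N F where N: "open N" "(0 :: real, a) \<in> N" and FN: "F differentiable_on N"
  and F: "!!w. w \<in> N ==> snd w \<in> U" "!!w. w \<in> N ==> F w \<in> C" "!!w. w \<in> N ==> \<exists>q p. coords \<alpha> vh \<sigma> x y (F w) q p"
   "!!w. w \<in> N ==> wF (F w) = wF (S (snd w))" "!!w. w \<in> N ==> nF (F w) = nF (S (snd w))"
   "!!w k. w \<in> N ==> Phi k (F w) = Phi k (S (snd w))" "!!w. w \<in> N ==> fst w = 0 ==> F w = S (snd w)"
  and dt: "!!F'. (F has_derivative F') (at (0, a)) ==>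
   \<exists>c'. F' (1, 0) = (mat c' + (1 / 2) *\<^sub>R (mat \<i>**matpow (S a**Inn**(S a)\<^sup>H**Inn) m))**S a"
  by (rule exists_flow[OF U S co a, where m = m], assumption, rule that)
 obtain V Q P0 where V: "open V" "(0, a) \<in> V" "V \<subseteq> N" and QP: "Q differentiable_on V" "P0 differentiable_on V"
  and c0: "!!w. w \<in> V ==> coords \<alpha> vh \<sigma> x y (F w) (Q w) (P0 w)"
  using differentiable_coords[OF N FN F(3)] by blast
 have F0: "F (0, u) = S u" if "(0, u) \<in> N" for u using F(7)[OF that] by simp
 have phase: "Q (0, u) = fst u" "exp_i (P0 (0, u)) = exp_i (snd u)" if u: "(0, u) \<in> V" for u
 proof -
  have uN: "(0, u) \<in> N" using u V(3) by blast
  have c2: "coords \<alpha> vh \<sigma> x y (F (0, u)) (fst u) (snd u)" using co[OF F(1)[OF uN]] F0[OF uN] by simp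
  have "(F (0, u), F (0, u)) \<in> G" using equiv_gauge F(2)[OF uN] by (auto simp: equiv_def refl_on_def)
  then have e: "Q (0, u) = fst u" "!!i. \<exists>k::int. snd u$i - P0 (0, u)$i = 2 * pi * of_int k"
   using coords_gauge_iff[OF c0[OF u] c2] by auto
  have "exp (\<i> * complex_of_real (P0 (0, u)$i)) = exp (\<i> * complex_of_real (snd u$i))" for i
   unfolding exp_i_eq_iff by (rule e(2))
  then show "Q (0, u) = fst u" "exp_i (P0 (0, u)) = exp_i (snd u)" using e(1) by (simp_all add: exp_i_def)
 qed
 \<comment> \<open>The lifted p may differ from that of the section by multiples of 2\<pi>; a
   constant shift makes them agree at (0, a).\<close>
 define P where "P w = P0 w + (snd a - P0 (0, a))" for w
 have Pe: "exp_i (P w) = exp_i (P0 w)" for w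
 proof -
  have "exp (\<i> * complex_of_real (P w$i)) = exp (\<i> * complex_of_real (P0 w$i))" for i
  proof -
   have "exp (\<i> * complex_of_real (snd a$i)) = exp (\<i> * complex_of_real (P0 (0, a)$i))"
    using arg_cong[OF phase(2)[OF V(2)], of "%M. M$i$i"] by (simp add: exp_i_def)
   then show ?thesis by (simp add: P_def distrib_left right_diff_distrib exp_add exp_diff)
  qed
  then show ?thesis by (simp add: exp_i_def)
 qed
 have c: "coords \<alpha> vh \<sigma> x y (F w) (Q w) (P w)" if "w \<in> V" for w using coords_cong[OF c0[OF that] Pe] .
 have P0a: "P (0, a) = snd a" by (simp add: P_def)
 have Qa: "Q (0, a) = fst a" using phase(1)[OF V(2)] .
 have Qd: "Q differentiable at w" and Pd: "P differentiable at w" if "w \<in> V" for w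
 proof -
  show "Q differentiable at w" using differentiable_on_openD[OF QP(1) V(1) that] .
  show "P differentiable at w" unfolding P_def[abs_def]
   by (intro differentiable_add differentiable_const differentiable_on_openD[OF QP(2) V(1) that])
 qed
 obtain Q' P' where Q': "(Q has_derivative Q') (at (0, a))" and P': "(P has_derivative P') (at (0, a))"
  using Qd[OF V(2)] Pd[OF V(2)] unfolding differentiable_def by blast
 have FV: "F differentiable_on V" using FN V(3) by (rule differentiable_on_subset)
 define X where "X = (Q' (1, 0), P' (1, 0))"
 have pair: "((%u. (0 :: real, u)) has_derivative (%h. (0, h))) (at a)" by (auto intro!: derivative_eq_intros)
 have "continuous_on UNIV (%u :: 'n rvec \<times> 'n rvec. (0 :: real, u))" by (intro continuous_intros)
 from open_vimage[OF V(1) this] have T: "open {u. (0, u) \<in> V}" "a \<in> {u. (0, u) \<in> V}" using V(2) by (simp_all add: vimage_def)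
 have QY: "Q' (0, Y) = fst Y" for Y
 proof -
  have "(%h. Q' (0, h)) = fst"
   by (rule has_derivative_unique_open[OF T _ has_derivative_compose[OF pair Q'] bounded_linear_imp_has_derivative[OF bounded_linear_fst]])
    (simp add: phase)
  then show ?thesis by metis
 qed
 have PY: "P' (0, Y) = snd Y" for Y
 proof -
  have "(%h. exp_i (P (0, a))**(mat \<i>**dmat (cvec (P' (0, h))))) = (%h. exp_i (snd a)**(mat \<i>**dmat (cvec (snd h))))"
   by (rule has_derivative_unique_open[OF T _ exp_i_has_derivative[OF has_derivative_compose[OF pair P']]
      exp_i_has_derivative[OF bounded_linear_imp_has_derivative[OF bounded_linear_snd]]])
    (simp add: phase Pe)
  then have e: "exp_i (snd a)**(mat \<i>**dmat (cvec (P' (0, Y)))) = exp_i (snd a)**(mat \<i>**dmat (cvec (snd Y)))"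
   unfolding P0a by metis
  have "P' (0, Y)$i = snd Y$i" for i
   using arg_cong[OF e, of "%M. M$i$i"] by (simp add: exp_i_def dmat_mult_left mat_mult_left)
  then show ?thesis by (simp add: vec_eq_iff)
 qed
 have symp: "pull_symp S a X Y = 2 * (\<Sum>i\<in>UNIV. snd X$i * fst Y$i - snd Y$i * fst X$i)" for X Y
  by (rule pull_symp_coords[OF U a S bounded_linear_imp_has_derivative[OF bounded_linear_fst] bounded_linear_imp_has_derivative[OF bounded_linear_snd] co])
 have "pull_symp F (0, a) (1, 0) (0, Y) = 2 * (\<Sum>i\<in>UNIV. P' (1, 0)$i * Q' (0, Y)$i - P' (0, Y)$i * Q' (1, 0)$i)" for Y
  by (rule pull_symp_coords[OF V(1,2) FV Q' P' c])
 then have sF: "pull_symp F (0, a) (1, 0) (0, Y) = pull_symp S a X Y" for Y unfolding symp by (simp add: X_def QY PY)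
 have Sd: "S differentiable at u" if "u \<in> U" for u using differentiable_on_openD[OF S U that] .
 have SC: "S u \<in> C" if "u \<in> U" for u using coords_in_C[OF co[OF that]] .
 define ph where "ph k = frechet_derivative (%u. Phi k (S u)) (at a)" for k
 have phd: "((%u. Phi k (S u)) has_derivative ph k) (at a)" if "1 \<le> k" for k
 proof -
  obtain S' where "(S has_derivative S') (at a)" using Sd[OF a] unfolding differentiable_def by blast
  from Phi_has_derivative[OF this invC(2)[OF SC[OF a]] that]
  have "(%u. Phi k (S u)) differentiable at a" unfolding differentiable_def by blast
  then show ?thesis unfolding ph_def by (simp add: frechet_derivative_works)
 qed
 have sndd: "(snd has_derivative snd) (at w)" for w :: "real \<times> ('n rvec \<times> 'n rvec)"
  by (rule bounded_linear_imp_has_derivative[OF bounded_linear_snd])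
 have phX: "ph k X = 0" if k: "1 \<le> k" for k
 proof -
  have "continuous_on V (%w. (Q w, P w))"
   using Qd Pd differentiable_imp_continuous_within by (intro continuous_on_Pair continuous_at_imp_continuous_on) blast+
  from continuous_open_preimage[OF this V(1) U] have W: "open {w \<in> V. (Q w, P w) \<in> U}" by (simp add: vimage_def Int_def)
  have aW: "(0, a) \<in> {w \<in> V. (Q w, P w) \<in> U}" using V(2) a by (simp add: Qa P0a)
  have eq: "Phi k (S (Q w, P w)) = Phi k (S (snd w))" if w: "w \<in> {w \<in> V. (Q w, P w) \<in> U}" for w
  proof -
   have "coords \<alpha> vh \<sigma> x y (S (Q w, P w)) (Q w) (P w)" using co[of "(Q w, P w)"] w by simp
   then have "(F w, S (Q w, P w)) \<in> G" using coords_gauge_iff[OF c] w by (metis (no_types, lifting) diff_self mem_Collect_eq mult_zero_right of_int_0)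
   then show ?thesis using Phi_gauge_rel F(6)[of w] w V(3) by (metis (no_types, lifting) mem_Collect_eq subsetD)
  qed
  have pr: "((%w. (Q w, P w)) has_derivative (%h. (Q' h, P' h))) (at (0, a))" by (intro has_derivative_Pair Q' P')
  have "((%u. Phi k (S u)) has_derivative ph k) (at (Q (0, a), P (0, a)))" "((%u. Phi k (S u)) has_derivative ph k) (at (snd (0 :: real, a)))"
   using phd[OF k] by (simp_all add: Qa P0a)
  from has_derivative_unique_open[OF W aW eq has_derivative_compose[OF pr this(1)] has_derivative_compose[OF sndd this(2)]]
  have "(%h. ph k (Q' h, P' h)) = (%h. ph k (snd h))" .
  from fun_cong[OF this, of "(1, 0)"] have "ph k X = ph k 0" by (simp add: X_def)
  then show ?thesis using linear_0[OF has_derivative_linear[OF phd[OF k]]] by simp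
 qed
 have "pull_symp F (0, a) (1, 0) (0, Y) = ph m Y" for Y
 proof -
  obtain F' where F': "(F has_derivative F') (at (0, a))" using differentiable_on_openD[OF FN N] unfolding differentiable_def by blast
  obtain w' n' where w': "((%u. wF (S u)) has_derivative w') (at a)" and n': "((%u. nF (S u)) has_derivative n') (at a)"
   using factor_maps_differentiable[OF Sd[OF a]] unfolding differentiable_def by blast
  have "((%w. wF (S (snd w))) has_derivative (%h. w' (snd h))) (at (0 :: real, a))" "((%w. nF (S (snd w))) has_derivative (%h. n' (snd h))) (at (0 :: real, a))"
   using has_derivative_compose[OF sndd, of "%u. wF (S u)" w' "(0, a)"] has_derivative_compose[OF sndd, of "%u. nF (S u)" n' "(0, a)"] w' n' by simp_all
  from has_derivative_transform_within_open[OF this(1) N] has_derivative_transform_within_open[OF this(2) N]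
  have wn: "((%w. wF (F w)) has_derivative (%h. w' (snd h))) (at (0, a))" "((%w. nF (F w)) has_derivative (%h. n' (snd h))) (at (0, a))"
   using F(4,5) by simp_all
  have z: "w' 0 = 0" "n' 0 = 0" using linear_0[OF has_derivative_linear] w' n' by blast+
  note ps = pull_symp_constrained[OF N F(2) F' wn]
  define g gi where "g = S a" and "gi = invC (S a)"
  have Fg: "F (0, a) = g" using F0[OF N(2)] by (simp add: g_def)
  have gg: "g**gi = mat 1" "gi**g = mat 1" using invC[OF SC[OF a]] by (simp_all add: g_def gi_def)
  define lam bet gam where "lam h = blk 0 ((1 / y^2) *\<^sub>R n' (snd h)) 0 0" and "bet h = blk 0 ((1 / x) *\<^sub>R w' (snd h)) 0 0"
   and "gam h = F' h**gi" for h
  have inv: "invC g = gi" by (simp add: g_def gi_def)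
  note ps = ps[unfolded Fg, unfolded inv, folded lam_def bet_def gam_def]
  define J where "J = g**Inn**g\<^sup>H**Inn"
  have star: "Inn**(matpow J m)\<^sup>H**Inn = matpow J m" unfolding J_def by (rule star_matpow star_metric)+
  obtain c' where c': "F' (1, 0) = (mat c' + (1 / 2) *\<^sub>R (mat \<i>**matpow J m))**g" using dt[OF F'] unfolding J_def g_def by blast
  have g1: "gam (1, 0) = mat c' + (1 / 2) *\<^sub>R (mat \<i>**matpow J m)"
   unfolding gam_def c' by (simp add: mm_assoc[symmetric] gg)
  let ?E = "matpow (gi**J**g) m"
  have JE: "gi**matpow J m**g = ?E" using matpow_conj[OF gg(2,1)] by simp
  have e1: "gi**gam (1, 0)**g = mat c' + (1 / 2) *\<^sub>R (mat \<i>**?E)"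
  proof -
   have "gi**(mat b**M)**g = mat b**(gi**M**g)" for b M by (simp only: mm_assoc mat_mult_commute[of gi])
   from this[of c' "mat 1"] this[of \<i> "matpow J m"] show ?thesis
    unfolding g1 JE[symmetric] by (simp add: mm_ring gg)
  qed
  have star2: "Inn**?E\<^sup>H**Inn = ?E"
  proof (rule star_matpow)
   have "gi**J**g = (gi**g)**Inn**g\<^sup>H**Inn**g" unfolding J_def by (simp only: mm_assoc)
   then have "gi**J**g = Inn**g\<^sup>H**Inn**g" by (simp add: gg)
   then show "Inn**(gi**J**g)\<^sup>H**Inn = gi**J**g"
    by (simp add: ctrans_mult) (simp add: mm_assoc[symmetric])
  qed
  \<comment> \<open>The scalar part of the velocity is orthogonal to strictly upper blocks, and the
    factor i turns the imaginary part of the trace into the real part.\<close>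
  have half: "pairing (blk 0 B 0 0) (mat c' + (1 / 2) *\<^sub>R (mat \<i>**M)) = (1 / 2) * Re (trace (M**blk 0 B 0 0))" for B M
  proof -
   have "trace (blk 0 B 0 0**mat c') = 0" by (simp add: mat_eq_blk[of c'] blk_mult trace_blk trace_zero)
   moreover have "trace (blk 0 B 0 0**(mat \<i>**M)) = \<i> * trace (M**blk 0 B 0 0)"
   proof -
    have "trace (blk 0 B 0 0**(mat \<i>**M)) = trace (mat \<i>**(M**blk 0 B 0 0))" by (subst trace_mul_sym) (simp only: mm_assoc)
    also have "... = \<i> * trace (M**blk 0 B 0 0)" by (simp add: mat_mult_left trace_def sum_distrib_left)
    finally show ?thesis .
   qed
   ultimately show ?thesis by (simp add: pairing_def matrix_add_ldistrib matrix_scaleR_right trace_add trace_scaleR)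
  qed
  have a1: "pairing (lam (0, Y)) (gam (1, 0)) = (1 / 2) * Re (trace (matpow J m**lam (0, Y)))"
   unfolding g1 lam_def by (rule half)
  have a2: "pairing (bet (0, Y)) (gi**gam (1, 0)**g) = (1 / 2) * Re (trace (?E**bet (0, Y)))"
   unfolding e1 bet_def by (rule half)
  have l0: "lam (1, 0) = 0" "bet (1, 0) = 0" by (simp_all add: lam_def bet_def z blk_zero)
  have ps1: "pull_symp F (0, a) (1, 0) (0, Y) = pairing_wedge lam gam (1, 0) (0, Y) + pairing_wedge bet (%Z. gi**gam Z**g) (1, 0) (0, Y)"
   by (rule ps(1))
  have "pull_symp F (0, a) (1, 0) (0, Y) = - (1 / 2) * Re (trace (matpow J m**lam (0, Y))) - (1 / 2) * Re (trace (?E**bet (0, Y)))"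
   unfolding ps1 pairing_wedge_def l0 a1 a2 by (simp add: pairing_def trace_zero)
  \<comment> \<open>dg g^(-1) is the b_R part plus a Lie algebra part, and likewise the b_L part
    plus another. J^m is orthogonal to the Lie algebra, so the two halves above are equal and add up
    to the full derivative of \<Phi>_m.\<close>
  moreover have "Re (trace (matpow J m**gam (0, Y))) = Re (trace (?E**bet (0, Y)))"
  proof -
   have "matpow J m**gam (0, Y) = matpow J m**(gam (0, Y) - g**bet (0, Y)**gi) + matpow J m**g**bet (0, Y)**gi"
    by (simp add: mm_ring)
   moreover have "trace (matpow J m**g**bet (0, Y)**gi) = trace (?E**bet (0, Y))"
    unfolding JE[symmetric] by (subst trace_mul_sym) (simp only: mm_assoc)
   ultimately show ?thesis using Re_trace_unnL[OF star ps(2)] by (simp add: trace_add)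
  qed
  moreover have "Re (trace (matpow J m**gam (0, Y))) = Re (trace (matpow J m**lam (0, Y)))"
  proof -
   let ?h = "gi**gam (0, Y)**g - gi**lam (0, Y)**g"
   have "trace (?E**?h) = trace (gi**(matpow J m**(g**?h)))" unfolding JE[symmetric] by (simp only: mm_assoc)
   also have "... = trace (matpow J m**(g**?h**gi))" by (subst trace_mul_sym) (simp only: mm_assoc)
   also have "g**?h**gi = (g**gi)**gam (0, Y)**(g**gi) - (g**gi)**lam (0, Y)**(g**gi)"
    by (simp add: matrix_diff_ldistrib matrix_diff_rdistrib mm_assoc)
   finally have "trace (?E**?h) = trace (matpow J m**gam (0, Y)) - trace (matpow J m**lam (0, Y))"
    by (simp add: gg matrix_diff_ldistrib trace_sub)
   moreover have "Re (trace (?E**?h)) = 0" by (rule Re_trace_unnL[OF star2 ps(3)])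
   ultimately show ?thesis by (simp only: minus_complex.simps right_minus_eq)
  qed
  moreover have "ph m Y = - Re (trace (matpow J m**gam (0, Y)))"
  proof -
   have d1: "((%w. Phi m (F w)) has_derivative (%h. - Re (trace (matpow J m**gam h)))) (at (0, a))"
    using Phi_has_derivative[OF F' _ m, of gi] gg(2) unfolding Fg J_def gam_def by simp
   have d2: "((%w. Phi m (S (snd w))) has_derivative (%h. ph m (snd h))) (at (0 :: real, a))"
    using has_derivative_compose[OF sndd, of "%u. Phi m (S u)" "ph m" "(0, a)"] phd[OF m] by simp
   from has_derivative_unique_open[OF N F(6) d1 d2] show ?thesis by (metis snd_conv)
  qed
  ultimately show ?thesis by simp
 qed
 then show ?thesis using sF phX unfolding ph_def by (intro exI[of _ X]) simp
qed

text \<open>Twice dp wedge dq is non-degenerate, so the direction found before is the vector that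
  \<open>THE\<close> selects. The bracket is then the differential of one Hamiltonian on the vector
  of another, which is zero.\<close>

lemma involution:
 fixes S :: "'n rvec \<times> 'n rvec => 'n bmat"
 assumes U: "open U" and S: "S differentiable_on U" and co: "!!u. u \<in> U ==> coords \<alpha> vh \<sigma> x y (S u) (fst u) (snd u)" and a: "a \<in> U"
  and m: "1 \<le> m" "1 \<le> m'"
 shows "poisson_bracket (pull_symp S) (%u. Phi m (S u)) (%u. Phi m' (S u)) a = 0"
proof -
 have symp: "pull_symp S a X Y = 2 * (\<Sum>i\<in>UNIV. snd X$i * fst Y$i - snd Y$i * fst X$i)" for X Y
  by (rule pull_symp_coords[OF U a S bounded_linear_imp_has_derivative[OF bounded_linear_fst] bounded_linear_imp_has_derivative[OF bounded_linear_snd] co])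
 have nondeg: "X = X'" if e: "!!Y. pull_symp S a X Y = pull_symp S a X' Y" for X X'
 proof -
  have "fst X$k = fst X'$k" "snd X$k = snd X'$k" for k
   using e[of "(0, axis k 1)"] e[of "(axis k 1, 0)"]
   by (simp_all add: symp axis_def if_distrib[of "%t. t * _"] if_distrib[of "%t. _ * t"] sum_negf cong: if_cong)
  then show ?thesis by (simp add: prod_eq_iff vec_eq_iff)
 qed
 let ?d = "%k. frechet_derivative (%u. Phi k (S u)) (at a)"
 have ham: "\<exists>X. hamiltonian_vector (pull_symp S a) (?d k) = X & (\<forall>Y. pull_symp S a X Y = ?d k Y) & (\<forall>l\<ge>1. ?d l X = 0)" if k: "1 \<le> k" for k
 proof -
  have "\<exists>X. (\<forall>Y. pull_symp S a X Y = ?d k Y) & (\<forall>l\<ge>1. ?d l X = 0)"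
   by (rule exists_hamiltonian_direction[OF U S co a k])
  then obtain X where X: "\<forall>Y. pull_symp S a X Y = ?d k Y" "\<forall>l\<ge>1. ?d l X = 0" by (elim exE conjE)
  have "hamiltonian_vector (pull_symp S a) (?d k) = X"
   unfolding hamiltonian_vector_def
  proof (rule the_equality)
   show "X' = X" if "\<forall>Y. pull_symp S a X' Y = ?d k Y" for X' using that X(1) by (intro nondeg) metis
  qed (rule X(1))
  then show ?thesis using X by (intro exI[of _ X] conjI)
 qed
 from ham[OF m(1)] ham[OF m(2)] show ?thesis
  unfolding poisson_bracket_def using m(1) by (elim exE conjE) (simp only:)
qed

end

no_notation ctrans ("(_\<^sup>H)" [1000] 999)

theorem mainTheorem1:
  fixes x y \<alpha> :: real
    and vh :: "('n::{finite,linorder}) cvec"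
    and \<sigma> :: "'n cmat"
  assumes "0 < x" and "0 < y"
    and "\<alpha> \<notin> {0, 1, -1}" and "\<alpha>\<^sup>2 < 1"
    and "\<sigma> \<in> B_n" and "det \<sigma> = 1" and "\<sigma> ** \<sigma>\<^sup>\<dagger> = smat (\<alpha>\<^sup>2) + outer vh"
  shows
    \<comment> \<open>the gauge action is an action on the constrained set\<close>
    "equiv (constrained \<sigma> x y) (gauge_rel \<sigma> x y) \<and>
    \<comment> \<open>(1) normal form\<close>
    (\<forall>g \<in> constrained \<sigma> x y. \<exists>\<rho> \<Delta> T. normal_data \<sigma> \<rho> \<Delta> T \<and>
        (g, normal_form x y \<rho> \<Delta> T) \<in> gauge_rel \<sigma> x y \<and>
        Sinh \<Delta> ** \<rho>\<^sup>\<dagger> ** \<sigma> ** \<sigma>\<^sup>\<dagger> ** \<rho> ** Sinh \<Delta>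
          = \<alpha>\<^sup>2 *\<^sub>R (Sinh \<Delta> ** Sinh \<Delta>) + outer (Sinh \<Delta> *v (\<rho>\<^sup>\<dagger> *v vh))) \<and>
    (\<forall>\<rho> \<Delta> T. normal_data \<sigma> \<rho> \<Delta> T \<and> normal_form x y \<rho> \<Delta> T \<in> constrained \<sigma> x y \<longrightarrow>
      (\<exists>m R w v. (\<forall>i. cmod (m $ i) = 1) \<and> unitary R \<and> R\<^sup>\<dagger> ** \<sigma> ** \<sigma>\<^sup>\<dagger> ** R = \<sigma> ** \<sigma>\<^sup>\<dagger> \<and>
        rephased vh w \<and> (\<forall>i. 0 \<le> v $ i) \<and>
        (let \<rho>' = R ** \<rho> ** dmat m; T' = (dmat m)\<^sup>\<dagger> ** T ** dmat m in
          normal_data \<sigma> \<rho>' \<Delta> T' \<and>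
          (normal_form x y \<rho> \<Delta> T, normal_form x y \<rho>' \<Delta> T') \<in> gauge_rel \<sigma> x y \<and>
          cvec v = Sinh \<Delta> *v (\<rho>'\<^sup>\<dagger> *v w)))) \<and>
    (\<forall>\<rho> \<Delta> T w v. normal_data \<sigma> \<rho> \<Delta> T \<and> rephased vh w \<and> (\<forall>i. 0 \<le> v $ i) \<and>
        cvec v = Sinh \<Delta> *v (\<rho>\<^sup>\<dagger> *v w) \<longrightarrow>
      (let S = (\<chi> i. sinh (\<Delta> $ i)); q = (\<chi> i. ln (S $ i)) in
        (\<forall>k. (v $ k)\<^sup>2 =
            inverse (\<Prod>j\<in>UNIV - {k}. \<alpha>\<^sup>2 * (S $ j)\<^sup>2 - \<alpha>\<^sup>2 * (S $ k)\<^sup>2) *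
            (\<Prod>i\<in>UNIV. (S $ i)\<^sup>2 - \<alpha>\<^sup>2 * (S $ k)\<^sup>2)) \<and>
        (\<forall>i j. i < j \<longrightarrow> q $ i \<ge> q $ j + gap \<alpha>) \<and>
        (q \<in> region \<alpha> \<longrightarrow> orthogonal_matrix (T_tilde \<alpha> S v) \<and>
          (\<exists>p. T = exp_i p ** map_matrix complex_of_real (T_tilde \<alpha> S v))))) \<and>
    \<comment> \<open>(2) \<open>(q, p)\<close>, with \<open>p\<close> modulo \<open>2\<pi>\<close>, are coordinates on the reduced space\<close>
    (\<forall>g \<rho> \<Delta> T. normal_data \<sigma> \<rho> \<Delta> T \<and> (g, normal_form x y \<rho> \<Delta> T) \<in> gauge_rel \<sigma> x y \<and>
        (\<chi> i. ln (sinh (\<Delta> $ i))) \<in> region \<alpha> \<longrightarrow>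
      (\<exists>p. coords \<alpha> vh \<sigma> x y g (\<chi> i. ln (sinh (\<Delta> $ i))) p)) \<and>
    (\<forall>g h q p q' p'. coords \<alpha> vh \<sigma> x y g q p \<and> coords \<alpha> vh \<sigma> x y h q' p' \<longrightarrow>
      ((g, h) \<in> gauge_rel \<sigma> x y \<longleftrightarrow> q = q' \<and> (\<forall>i. \<exists>k::int. p' $ i - p $ i = 2 * pi * of_int k))) \<and>
    (\<forall>q p. q \<in> region \<alpha> \<longrightarrow> (\<exists>U S. (q, p) \<in> U \<and> local_section \<alpha> vh \<sigma> x y U S)) \<and>
    (\<forall>(F :: 'a::euclidean_space \<Rightarrow> 'n bmat) U a. open U \<and> a \<in> U \<and> F differentiable_on U \<and>
        (\<forall>u\<in>U. \<exists>q p. coords \<alpha> vh \<sigma> x y (F u) q p) \<longrightarrow>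
      (\<exists>V Q P. open V \<and> a \<in> V \<and> V \<subseteq> U \<and> Q differentiable_on V \<and> P differentiable_on V \<and>
        (\<forall>u\<in>V. coords \<alpha> vh \<sigma> x y (F u) (Q u) (P u)))) \<and>
    \<comment> \<open>(2) the induced form in these coordinates, along any map into the constrained set\<close>
    (\<forall>(F :: 'a \<Rightarrow> 'n bmat) U Q P. open U \<and> F differentiable_on U \<and>
        Q differentiable_on U \<and> P differentiable_on U \<and>
        (\<forall>u\<in>U. coords \<alpha> vh \<sigma> x y (F u) (Q u) (P u)) \<longrightarrow>
      (\<forall>a\<in>U. \<forall>X Y.
        (let dp = (\<lambda>i. frechet_derivative (\<lambda>u. P u $ i) (at a));
             dq = (\<lambda>i. frechet_derivative (\<lambda>u. Q u $ i) (at a));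
             dS = (\<lambda>i. frechet_derivative (\<lambda>u. exp (Q u $ i)) (at a)) in
          pull_symp F a X Y
            = 2 * (\<Sum>i\<in>UNIV. wedge (dp i) (\<lambda>Z. inverse (exp (Q a $ i)) * dS i Z) X Y) \<and>
          pull_symp F a X Y = 2 * (\<Sum>i\<in>UNIV. wedge (dp i) (dq i) X Y)))) \<and>
    (\<forall>U S. local_section \<alpha> vh \<sigma> x y U S \<longrightarrow>
      (\<forall>a\<in>U. \<forall>X Y. pull_symp S a X Y
         = 2 * (\<Sum>i\<in>UNIV. wedge (\<lambda>Z. snd Z $ i) (\<lambda>Z. fst Z $ i) X Y))) \<and>
    \<comment> \<open>(3) descent, involution, and the first Hamiltonian\<close>
    (\<forall>m\<ge>1. \<exists>\<phi>. \<forall>c \<in> reduced_space \<sigma> x y. \<forall>g\<in>c. Phi m g = \<phi> c) \<and>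
    (\<forall>U S. local_section \<alpha> vh \<sigma> x y U S \<longrightarrow>
      (\<forall>a\<in>U. \<forall>m\<ge>1. \<forall>m'\<ge>1.
        poisson_bracket (pull_symp S) (\<lambda>u. Phi m (S u)) (\<lambda>u. Phi m' (S u)) a = 0)) \<and>
    0 < gap \<alpha> \<and>
    (\<forall>q :: 'n rvec. q \<in> region \<alpha> \<longrightarrow> (\<forall>i k. i \<noteq> k \<longrightarrow>
      0 < 1 - (\<alpha> - inverse \<alpha>)\<^sup>2 / (4 * (sinh (q $ i - q $ k))\<^sup>2))) \<and>
    (\<forall>g q p. coords \<alpha> vh \<sigma> x y g q p \<longrightarrow>
      Phi 1 g = 1 / 2 * (1 / x\<^sup>2 + y\<^sup>2) * (\<Sum>i\<in>UNIV. exp (- 2 * q $ i))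
        - (\<Sum>i\<in>UNIV. cos (p $ i) *
            sqrt (1 + (1 + y\<^sup>2 / x\<^sup>2) * exp (- 2 * q $ i) + y\<^sup>2 / x\<^sup>2 * exp (- 4 * q $ i)) *
            (\<Prod>k\<in>UNIV - {i}. sqrt (1 - (\<alpha> - inverse \<alpha>)\<^sup>2 / (4 * (sinh (q $ i - q $ k))\<^sup>2)))))"
proof -
 interpret reduction x y \<alpha> vh \<sigma>
  by unfold_locales (use assms in auto)
 have normal: "\<exists>\<rho> Delta T. normal_data \<sigma> \<rho> Delta T & (g, NF \<rho> Delta T) \<in> G &
   Sinh Delta**\<rho>\<^sup>\<dagger>**\<sigma>**\<sigma>\<^sup>\<dagger>**\<rho>**Sinh Delta
    = \<alpha>^2 *\<^sub>R (Sinh Delta**Sinh Delta) + outer (Sinh Delta *v (\<rho>\<^sup>\<dagger> *v vh))" if g: "g \<in> C" for g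
 proof -
  obtain \<rho> Delta T where nd: "normal_data \<sigma> \<rho> Delta T" "(g, NF \<rho> Delta T) \<in> G" using exists_normal_form[OF g] by blast
  have "unitary \<rho>" using nd by (simp add: normal_data_def)
  from sinh_sigma_outer[OF this, of Delta] nd show ?thesis by blast
 qed
 have data: "(let S = (\<chi> i. sinh (Delta$i)); q = (\<chi> i. ln (S$i)) in
   (\<forall>k. (v$k)^2 =
     inverse (\<Prod>j\<in>UNIV - {k}. \<alpha>^2 * (S$j)^2 - \<alpha>\<^sup>2 * (S$k)^2) *
     (\<Prod>i\<in>UNIV. (S$i)^2 - \<alpha>\<^sup>2 * (S$k)^2)) &
   (\<forall>i j. i < j --> q$i \<ge> q$j + gap \<alpha>) &
   (q \<in> region \<alpha> --> orthogonal_matrix (T_tilde \<alpha> S v) &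
    (\<exists>p. T = exp_i p**map_matrix complex_of_real (T_tilde \<alpha> S v))))"
  if nd: "normal_data \<sigma> \<rho> Delta T" and w: "rephased vh w" and v: "\<forall>i. 0 \<le> v$i" "cvec v = Sinh Delta *v (\<rho>\<^sup>\<dagger> *v w)"
  for \<rho> Delta T w v
 proof -
  have D: "Delta \<in> chamber" and T: "unitary T" using nd by (auto simp: normal_data_def)
  note M = normal_data_outer[OF nd w v(2)]
  show ?thesis
   using secular_chamber[OF D secular_normal_data[OF T M]] region_weak[OF D T M] normal_data_coords(1,2)[OF nd w _ v(2)] v(1)
   by (simp add: Let_def)
 qed
 have local: "open U & S differentiable_on U & (\<forall>u\<in>U. coords \<alpha> vh \<sigma> x y (S u) (fst u) (snd u))"
  if "local_section \<alpha> vh \<sigma> x y U S" for U S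
  using that by (auto simp: local_section_def)
 have symp: "(let dp = (%i. frechet_derivative (%u. P u$i) (at a));
      dq = (%i. frechet_derivative (%u. Q u$i) (at a));
      dS = (%i. frechet_derivative (%u. exp (Q u$i)) (at a)) in
    pull_symp F a X Y
     = 2 * (\<Sum>i\<in>UNIV. wedge (dp i) (%Z. inverse (exp (Q a$i)) * dS i Z) X Y) &
    pull_symp F a X Y = 2 * (\<Sum>i\<in>UNIV. wedge (dp i) (dq i) X Y))"
  if *: "open U" "F differentiable_on U" "Q differentiable_on U" "P differentiable_on U"
   "\<forall>u\<in>U. coords \<alpha> vh \<sigma> x y (F u) (Q u) (P u)" "a \<in> U"
  for F :: "'a => 'n bmat" and U Q P a X Y
 proof -
  obtain Q' P' where D: "(Q has_derivative Q') (at a)" "(P has_derivative P') (at a)"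
   using differentiable_on_openD[OF *(3,1,6)] differentiable_on_openD[OF *(4,1,6)] unfolding differentiable_def by blast
  have n: "((%u. Q u$i) has_derivative (%Z. Q' Z$i)) (at a)" "((%u. P u$i) has_derivative (%Z. P' Z$i)) (at a)" for i
   by (rule bounded_linear.has_derivative[OF bounded_linear_vec_nth] D)+
  have "((%u. exp (Q u$i)) has_derivative (%Z. exp (Q a$i) * Q' Z$i)) (at a)" for i
   using has_derivative_exp[OF n(1)[of i]] by (simp add: mult.commute)
  note f = frechet_derivative_at[OF n(1), symmetric] frechet_derivative_at[OF n(2), symmetric] frechet_derivative_at[OF this, symmetric]
  have "pull_symp F a X Y = 2 * (\<Sum>i\<in>UNIV. P' X$i * Q' Y$i - P' Y$i * Q' X$i)"
   by (rule pull_symp_coords[OF *(1,6,2) D]) (use *(5) in blast)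
  \<comment> \<open>\<Sigma>_i^(-1) d\<Sigma>_i = dq_i, so the two expressions for the form
    coincide.\<close>
  moreover have e: "inverse (exp t) * (exp t * s) = s" for s t :: real by (simp add: mult.assoc[symmetric])
  ultimately show ?thesis by (simp add: f wedge_def e)
 qed
 have symp_section: "pull_symp S a X Y = 2 * (\<Sum>i\<in>UNIV. wedge (%Z. snd Z$i) (%Z. fst Z$i) X Y)"
  if S: "local_section \<alpha> vh \<sigma> x y U S" and a: "a \<in> U" for U S a X Y
 proof -
  note l = local[OF S]
  have "pull_symp S a X Y = 2 * (\<Sum>i\<in>UNIV. snd X$i * fst Y$i - snd Y$i * fst X$i)"
   by (rule pull_symp_coords[OF _ a _ bounded_linear_imp_has_derivative[OF bounded_linear_fst] bounded_linear_imp_has_derivative[OF bounded_linear_snd]])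
    (use l in auto)
  then show ?thesis by (simp add: wedge_def)
 qed
 have inv: "poisson_bracket (pull_symp S) (%u. Phi m (S u)) (%u. Phi m' (S u)) a = 0"
  if "local_section \<alpha> vh \<sigma> x y U S" "a \<in> U" "1 \<le> m" "1 \<le> m'" for U S a m m'
  using involution[of U S a m m'] local[OF that(1)] that by blast
 have coordinates: "\<exists>p. coords \<alpha> vh \<sigma> x y g (\<chi> i. ln (sinh (Delta$i))) p"
  if "normal_data \<sigma> \<rho> Delta T" "(g, NF \<rho> Delta T) \<in> G" "(\<chi> i. ln (sinh (Delta$i))) \<in> region \<alpha>" for g \<rho> Delta T
  using exists_coords that by blast
 show ?thesis
  by (intro conjI; ((intro allI impI ballI)?, (elim conjE)?, rule equiv_gauge normal normal_form_rephase data coordinates coords_gauge_iff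
    exists_local_section differentiable_coords symp symp_section Phi_descends inv gap_pos gap_factor_pos(2) Phi_one_coords; (assumption | blast)?))
qed

end
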